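(* Let $k$ be a field of characteristic zero. The functor $$\widetilde{\mathcal C}:\ \mathrm{Mor}(\mathrm{DGA}_k)\to\mathrm{Com}(k),\qquad(S\xrightarrow{f}A)\mapsto\mathrm{cone}(f_\natural:S_\natural\to A_\natural)$$ has a total left derived functor $\boldsymbol L\widetilde{\mathcal C}:\mathrm{Ho}(\mathrm{Mor}(\mathrm{DGA}_k))\to\mathscr D(k)$ which is given by $$\boldsymbol L\widetilde{\mathcal C}(S\backslash A)=\mathrm{cone}[(QS)_\natural\to Q(QS\backslash A)_\natural],$$ where $QS\to S$ is a cofibrant resolution of $S$ in $\mathrm{DGA}_k$ and $Q(QS\backslash A)$ is a cofibrant resolution of the composite $QS\to S\to A$ in $\mathrm{DGA}_{QS}$.
   Context: All DG objects have differentials of degree $-1$. $\mathrm{DGA}_k$ is the category of unital associative $\mathbb Z$-graded DG $k$-algebras, with the model structure whose weak equivalences are the quasi-isomorphisms, whose fibrations are the degreewise surjective maps, and whose cofibrations are the maps with the left lifting property with respect to acyclic fibrations. For a DG algebra $S$, $\mathrm{DGA}_S$ is the category of DG algebra maps $S\to A$ and DG algebra maps under $S$, with the model structure inherited from $\mathrm{DGA}_k$. $\mathrm{Mor}(\mathrm{DGA}_k)$ is the category of all morphisms of $\mathrm{DGA}_k$ and commutative squares, with the model structure in which $(\alpha,\beta):(A\to B)\to(A'\to B')$ is a weak equivalence (fibration) iff $\alpha$ and $\beta$ are, and a cofibration iff both $\alpha$ and the induced map $B\coprod_AA'\to B'$ are cofibrations. For a DG algebra $A$, $A_\natural:=A/[A,A]$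 is the quotient complex by the span of graded commutators. $\mathrm{Com}(k)$ is the category of unbounded complexes of $k$-vector spaces with weak equivalences the quasi-isomorphisms and fibrations the epimorphisms; its homotopy category is the derived category $\mathscr D(k)$. "cone" is the mapping cone. A cofibrant resolution is an acyclic fibration from a cofibrant object. A total left derived functor of $F:\mathcal A\to\mathcal B$ is a functor $\boldsymbol LF:\mathrm{Ho}(\mathcal A)\to\mathrm{Ho}(\mathcal B)$ with a natural transformation $t:\boldsymbol LF\circ\gamma\to\gamma\circ F$ ($\gamma$ the localization functors) such that any $s:G\circ\gamma\to\gamma\circ F$ factors uniquely as $t\circ(s'\gamma)$ for some $s':G\to\boldsymbol LF$. *)

theory Defs
  imports "HOL-Algebra.Module" "HOL-Algebra.AbelCoset" "HOL-Library.Equipollence"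
begin

section \<open>Categories, functors, natural transformations\<close>

record ('o, 'm) category =
  Ob :: "'o set"
  Ar :: "'m set"
  Dom :: "'m \<Rightarrow> 'o"
  Cod :: "'m \<Rightarrow> 'o"
  Idt :: "'o \<Rightarrow> 'm"
  Cmp :: "'m \<Rightarrow> 'm \<Rightarrow> 'm"  \<comment> \<open>\<open>Cmp C g f\<close> is "g after f"\<close>

record ('o, 'l) arrow =
  src :: 'o
  lab :: 'l
  tgt :: 'o

definition Hom :: "('o, 'm, 'z) category_scheme \<Rightarrow> 'o \<Rightarrow> 'o \<Rightarrow> 'm set" where
  "Hom C X Y = {f \<in> Ar C. Dom C f = X \<and> Cod C f = Y}"

definition is_isomorphism :: "('o, 'm, 'z) category_scheme \<Rightarrow> 'm \<Rightarrow> bool" where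
  "is_isomorphism C f \<longleftrightarrow> f \<in> Ar C \<and>
     (\<exists>g \<in> Hom C (Cod C f) (Dom C f).
        Cmp C g f = Idt C (Dom C f) \<and> Cmp C f g = Idt C (Cod C f))"

definition initial_object :: "('o, 'm, 'z) category_scheme \<Rightarrow> 'o \<Rightarrow> bool" where
  "initial_object C I \<longleftrightarrow> I \<in> Ob C \<and> (\<forall>X \<in> Ob C. \<exists>!f. f \<in> Hom C I X)"

record ('o1, 'm1, 'o2, 'm2) func =
  FOb :: "'o1 \<Rightarrow> 'o2"
  FAr :: "'m1 \<Rightarrow> 'm2"

definition is_functor ::
  "('o1, 'm1, 'y) category_scheme \<Rightarrow> ('o2, 'm2, 'z) category_scheme \<Rightarrow>
     ('o1, 'm1, 'o2, 'm2) func \<Rightarrow> bool" where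
  "is_functor C D F \<longleftrightarrow>
     (\<forall>X \<in> Ob C. FOb F X \<in> Ob D \<and> FAr F (Idt C X) = Idt D (FOb F X)) \<and>
     (\<forall>f \<in> Ar C. FAr F f \<in> Hom D (FOb F (Dom C f)) (FOb F (Cod C f))) \<and>
     (\<forall>f \<in> Ar C. \<forall>g \<in> Ar C. Cod C f = Dom C g \<longrightarrow>
        FAr F (Cmp C g f) = Cmp D (FAr F g) (FAr F f))"

definition func_comp ::
  "('o2, 'm2, 'o3, 'm3) func \<Rightarrow> ('o1, 'm1, 'o2, 'm2) func \<Rightarrow> ('o1, 'm1, 'o3, 'm3) func" where
  "func_comp G F = \<lparr>FOb = FOb G \<circ> FOb F, FAr = FAr G \<circ> FAr F\<rparr>"

text \<open>Components are \<open>undefined\<close> outside the objects, so that two natural transformations are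
  equal as HOL functions iff their components agree.\<close>

definition nat_trans ::
  "('o1, 'm1, 'y) category_scheme \<Rightarrow> ('o2, 'm2, 'z) category_scheme \<Rightarrow>
     ('o1, 'm1, 'o2, 'm2) func \<Rightarrow> ('o1, 'm1, 'o2, 'm2) func \<Rightarrow> ('o1 \<Rightarrow> 'm2) \<Rightarrow> bool" where
  "nat_trans C D F G t \<longleftrightarrow>
     is_functor C D F \<and> is_functor C D G \<and> t \<in> extensional (Ob C) \<and>
     (\<forall>X \<in> Ob C. t X \<in> Hom D (FOb F X) (FOb G X)) \<and>
     (\<forall>f \<in> Ar C. Cmp D (t (Cod C f)) (FAr F f) = Cmp D (FAr G f) (t (Dom C f)))"


section \<open>Weak equivalences, homotopy categories, total left derived functors\<close>

record ('o, 'm) relcat = "('o, 'm) category" +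
  weq :: "'m set"

record ('o, 'm) model = "('o, 'm) relcat" +
  fib :: "'m set"
  cof :: "'m set"

definition cofibrant :: "('o, 'm, 'z) model_scheme \<Rightarrow> 'o \<Rightarrow> bool" where
  "cofibrant M X \<longleftrightarrow> (\<exists>I. initial_object M I \<and> (\<exists>i \<in> Hom M I X. i \<in> cof M))"

definition cofibrant_resolution :: "('o, 'm, 'z) model_scheme \<Rightarrow> 'o \<Rightarrow> 'm \<Rightarrow> bool" where
  "cofibrant_resolution M X p \<longleftrightarrow>
     p \<in> Ar M \<and> Cod M p = X \<and> p \<in> weq M \<and> p \<in> fib M \<and> cofibrant M (Dom M p)"

definition has_llp :: "('o, 'm, 'z) category_scheme \<Rightarrow> 'm \<Rightarrow> 'm set \<Rightarrow> bool" where
  "has_llp C i P \<longleftrightarrow>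
     (\<forall>p \<in> P. \<forall>u \<in> Hom C (Dom C i) (Dom C p). \<forall>v \<in> Hom C (Cod C i) (Cod C p).
        Cmp C p u = Cmp C v i \<longrightarrow>
        (\<exists>h \<in> Hom C (Cod C i) (Dom C p). Cmp C h i = u \<and> Cmp C p h = v))"

text \<open>The homotopy category is the localization at the weak equivalences, in the construction of
  Gabriel and Zisman: it has the same objects, and its arrows are the finite zigzags, whose
  backward steps are weak equivalences, modulo the congruence generated by the relations below.
  Zigzags are lists read in diagrammatic order.\<close>

datatype 'm step = Fwd 'm | Bwd 'm

fun zigzag :: "('o, 'm, 'z) relcat_scheme \<Rightarrow> 'o \<Rightarrow> 'm step list \<Rightarrow> 'o \<Rightarrow> bool" where
  "zigzag C X [] Y \<longleftrightarrow> X \<in> Ob C \<and> X = Y"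
| "zigzag C X (Fwd f # p) Y \<longleftrightarrow> f \<in> Ar C \<and> Dom C f = X \<and> zigzag C (Cod C f) p Y"
| "zigzag C X (Bwd w # p) Y \<longleftrightarrow>
     w \<in> Ar C \<and> w \<in> weq C \<and> Cod C w = X \<and> zigzag C (Dom C w) p Y"

inductive zz_eq ::
  "('o, 'm, 'z) relcat_scheme \<Rightarrow> 'o \<Rightarrow> 'm step list \<Rightarrow> 'm step list \<Rightarrow> 'o \<Rightarrow> bool" for C where
  refl: "zigzag C X p Y \<Longrightarrow> zz_eq C X p p Y"
| sym: "zz_eq C X p q Y \<Longrightarrow> zz_eq C X q p Y"
| trans: "zz_eq C X p q Y \<Longrightarrow> zz_eq C X q r Y \<Longrightarrow> zz_eq C X p r Y"
| append: "zz_eq C X p p' Y \<Longrightarrow> zz_eq C Y q q' Z \<Longrightarrow> zz_eq C X (p @ q) (p' @ q') Z"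
| ident: "X \<in> Ob C \<Longrightarrow> zz_eq C X [Fwd (Idt C X)] [] X"
| comp: "f \<in> Ar C \<Longrightarrow> g \<in> Ar C \<Longrightarrow> Cod C f = Dom C g \<Longrightarrow>
    zz_eq C (Dom C f) [Fwd f, Fwd g] [Fwd (Cmp C g f)] (Cod C g)"
| inv_right: "w \<in> Ar C \<Longrightarrow> w \<in> weq C \<Longrightarrow> zz_eq C (Dom C w) [Fwd w, Bwd w] [] (Dom C w)"
| inv_left: "w \<in> Ar C \<Longrightarrow> w \<in> weq C \<Longrightarrow> zz_eq C (Cod C w) [Bwd w, Fwd w] [] (Cod C w)"

definition zz_class ::
  "('o, 'm, 'z) relcat_scheme \<Rightarrow> 'o \<Rightarrow> 'm step list \<Rightarrow> 'o \<Rightarrow> 'm step list set" where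
  "zz_class C X p Y = {q. zz_eq C X p q Y}"

definition zz_arrow ::
  "('o, 'm, 'z) relcat_scheme \<Rightarrow> 'o \<Rightarrow> 'm step list \<Rightarrow> 'o \<Rightarrow> ('o, 'm step list set) arrow" where
  "zz_arrow C X p Y = \<lparr>src = X, lab = zz_class C X p Y, tgt = Y\<rparr>"

definition Ho ::
  "('o, 'm, 'z) relcat_scheme \<Rightarrow> ('o, ('o, 'm step list set) arrow) category" where
  "Ho C = \<lparr>
     Ob = Ob C,
     Ar = {zz_arrow C X p Y | X p Y. zigzag C X p Y},
     Dom = src,
     Cod = tgt,
     Idt = (\<lambda>X. zz_arrow C X [] X),
     Cmp = (\<lambda>v u. \<lparr>src = src u,
                   lab = (\<Union>p \<in> lab u. \<Union>q \<in> lab v. zz_class C (src u) (p @ q) (tgt v)),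
                   tgt = tgt v\<rparr>)\<rparr>"

definition loc ::
  "('o, 'm, 'z) relcat_scheme \<Rightarrow> ('o, 'm, 'o, ('o, 'm step list set) arrow) func" where
  "loc C = \<lparr>FOb = (\<lambda>X. X), FAr = (\<lambda>f. zz_arrow C (Dom C f) [Fwd f] (Cod C f))\<rparr>"

definition total_left_derived ::
  "('o1, 'm1, 'y) relcat_scheme \<Rightarrow> ('o2, 'm2, 'z) relcat_scheme \<Rightarrow> ('o1, 'm1, 'o2, 'm2) func \<Rightarrow>
   ('o1, ('o1, 'm1 step list set) arrow, 'o2, ('o2, 'm2 step list set) arrow) func \<Rightarrow>
   ('o1 \<Rightarrow> ('o2, 'm2 step list set) arrow) \<Rightarrow> bool" where
  "total_left_derived C D F LF t \<longleftrightarrow>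
     is_functor C D F \<and>
     is_functor (Ho C) (Ho D) LF \<and>
     nat_trans C (Ho D) (func_comp LF (loc C)) (func_comp (loc D) F) t \<and>
     (\<forall>G s. is_functor (Ho C) (Ho D) G \<and>
            nat_trans C (Ho D) (func_comp G (loc C)) (func_comp (loc D) F) s \<longrightarrow>
        (\<exists>!s'. nat_trans (Ho C) (Ho D) G LF s' \<and>
               (\<forall>X \<in> Ob C. s X = Cmp (Ho D) (t X) (s' (FOb (loc C) X)))))"


section \<open>Under categories and arrow categories\<close>

definition under_model ::
  "('o, 'm, 'z) model_scheme \<Rightarrow> 'o \<Rightarrow> ('m, ('m, 'm) arrow) model" where
  "under_model M S = (let
      obs = {i \<in> Ar M. Dom M i = S};
      ars = {u. src u \<in> obs \<and> tgt u \<in> obs \<and>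
                lab u \<in> Hom M (Cod M (src u)) (Cod M (tgt u)) \<and>
                Cmp M (lab u) (src u) = tgt u}
    in \<lparr>
     Ob = obs,
     Ar = ars,
     Dom = src,
     Cod = tgt,
     Idt = (\<lambda>i. \<lparr>src = i, lab = Idt M (Cod M i), tgt = i\<rparr>),
     Cmp = (\<lambda>v u. \<lparr>src = src u, lab = Cmp M (lab v) (lab u), tgt = tgt v\<rparr>),
     weq = {u \<in> ars. lab u \<in> weq M},
     fib = {u \<in> ars. lab u \<in> fib M},
     cof = {u \<in> ars. lab u \<in> cof M}\<rparr>)"

text \<open>Only the weak equivalences of an arrow category are recorded: its homotopy category and
  total derived functors do not depend on fibrations and cofibrations.\<close>

definition Mor :: "('o, 'm, 'z) relcat_scheme \<Rightarrow> ('m, ('m, 'm \<times> 'm) arrow) relcat" where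
  "Mor C = (let
      ars = {u. src u \<in> Ar C \<and> tgt u \<in> Ar C \<and>
                fst (lab u) \<in> Hom C (Dom C (src u)) (Dom C (tgt u)) \<and>
                snd (lab u) \<in> Hom C (Cod C (src u)) (Cod C (tgt u)) \<and>
                Cmp C (tgt u) (fst (lab u)) = Cmp C (snd (lab u)) (src u)}
    in \<lparr>
     Ob = Ar C,
     Ar = ars,
     Dom = src,
     Cod = tgt,
     Idt = (\<lambda>f. \<lparr>src = f, lab = (Idt C (Dom C f), Idt C (Cod C f)), tgt = f\<rparr>),
     Cmp = (\<lambda>v u. \<lparr>src = src u,
                   lab = (Cmp C (fst (lab v)) (fst (lab u)), Cmp C (snd (lab v)) (snd (lab u))),
                   tgt = tgt v\<rparr>),
     weq = {u \<in> ars. fst (lab u) \<in> weq C \<and> snd (lab u) \<in> weq C}\<rparr>)"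


section \<open>Linear algebra over the ground field\<close>

definition linear_map ::
  "'k ring \<Rightarrow> ('k, 'a) module \<Rightarrow> ('k, 'b) module \<Rightarrow> ('a \<Rightarrow> 'b) \<Rightarrow> bool" where
  "linear_map K M N f \<longleftrightarrow>
     f \<in> carrier M \<rightarrow> carrier N \<and>
     (\<forall>x \<in> carrier M. \<forall>y \<in> carrier M. f (x \<oplus>\<^bsub>M\<^esub> y) = f x \<oplus>\<^bsub>N\<^esub> f y) \<and>
     (\<forall>c \<in> carrier K. \<forall>x \<in> carrier M. f (c \<odot>\<^bsub>M\<^esub> x) = c \<odot>\<^bsub>N\<^esub> f x)"

text \<open>The fields \<open>mult\<close> and \<open>one\<close> are part of the library record but have no meaning for
  modules.\<close>

definition quot_mod :: "('k, 'a) module \<Rightarrow> 'a set \<Rightarrow> ('k, 'a set) module" where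
  "quot_mod M H = \<lparr>
     carrier = a_rcosets\<^bsub>M\<^esub> H,
     mult = undefined,
     one = undefined,
     zero = H,
     add = (\<lambda>X Y. X <+>\<^bsub>M\<^esub> Y),
     smult = (\<lambda>c X. \<Union>x \<in> X. H +>\<^bsub>M\<^esub> (c \<odot>\<^bsub>M\<^esub> x))\<rparr>"

definition quot_map ::
  "('k, 'a) module \<Rightarrow> 'a set \<Rightarrow> ('k, 'b) module \<Rightarrow> 'b set \<Rightarrow> ('a \<Rightarrow> 'b) \<Rightarrow> 'a set \<Rightarrow> 'b set" where
  "quot_map M H N J f = (\<lambda>X \<in> a_rcosets\<^bsub>M\<^esub> H. \<Union>x \<in> X. J +>\<^bsub>N\<^esub> f x)"

definition sign :: "'k ring \<Rightarrow> int \<Rightarrow> 'k" where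
  "sign K n = (if even n then \<one>\<^bsub>K\<^esub> else \<ominus>\<^bsub>K\<^esub> \<one>\<^bsub>K\<^esub>)"


section \<open>Complexes\<close>

record ('k, 'a) chain_complex =
  piece :: "int \<Rightarrow> ('k, 'a) module"
  bdry :: "int \<Rightarrow> 'a \<Rightarrow> 'a"  \<comment> \<open>\<open>bdry X n\<close> maps degree \<open>n\<close> to degree \<open>n - 1\<close>\<close>

abbreviation elts :: "('k, 'a, 'z) chain_complex_scheme \<Rightarrow> int \<Rightarrow> 'a set" where
  "elts X n \<equiv> carrier (piece X n)"

definition is_complex :: "'k ring \<Rightarrow> ('k, 'a, 'z) chain_complex_scheme \<Rightarrow> bool" where
  "is_complex K X \<longleftrightarrow> (\<forall>n.
     module K (piece X n) \<and>
     linear_map K (piece X n) (piece X (n - 1)) (bdry X n) \<and>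
     (\<forall>x \<in> elts X n. bdry X (n - 1) (bdry X n x) = \<zero>\<^bsub>piece X (n - 1 - 1)\<^esub>))"

text \<open>Maps are \<open>undefined\<close> outside their domain, so that equality of arrows is equality of maps.\<close>

definition chain_map ::
  "'k ring \<Rightarrow> ('k, 'a, 'y) chain_complex_scheme \<Rightarrow> ('k, 'b, 'z) chain_complex_scheme \<Rightarrow>
     (int \<Rightarrow> 'a \<Rightarrow> 'b) \<Rightarrow> bool" where
  "chain_map K X Y f \<longleftrightarrow> (\<forall>n.
     f n \<in> extensional (elts X n) \<and>
     linear_map K (piece X n) (piece Y n) (f n) \<and>
     (\<forall>x \<in> elts X n. f (n - 1) (bdry X n x) = bdry Y n (f n x)))"

definition cycles :: "('k, 'a, 'z) chain_complex_scheme \<Rightarrow> int \<Rightarrow> ('k, 'a) module" where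
  "cycles X n =
     (piece X n)\<lparr>carrier := {x \<in> elts X n. bdry X n x = \<zero>\<^bsub>piece X (n - 1)\<^esub>}\<rparr>"

definition boundaries :: "('k, 'a, 'z) chain_complex_scheme \<Rightarrow> int \<Rightarrow> 'a set" where
  "boundaries X n = bdry X (n + 1) ` elts X (n + 1)"

definition homology :: "('k, 'a, 'z) chain_complex_scheme \<Rightarrow> int \<Rightarrow> ('k, 'a set) module" where
  "homology X n = quot_mod (cycles X n) (boundaries X n)"

definition homology_map ::
  "('k, 'a, 'y) chain_complex_scheme \<Rightarrow> ('k, 'b, 'z) chain_complex_scheme \<Rightarrow>
     (int \<Rightarrow> 'a \<Rightarrow> 'b) \<Rightarrow> int \<Rightarrow> 'a set \<Rightarrow> 'b set" where
  "homology_map X Y f n =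
     quot_map (cycles X n) (boundaries X n) (cycles Y n) (boundaries Y n) (f n)"

definition quasi_iso ::
  "('k, 'a, 'y) chain_complex_scheme \<Rightarrow> ('k, 'b, 'z) chain_complex_scheme \<Rightarrow>
     (int \<Rightarrow> 'a \<Rightarrow> 'b) \<Rightarrow> bool" where
  "quasi_iso X Y f \<longleftrightarrow>
     (\<forall>n. bij_betw (homology_map X Y f n) (carrier (homology X n)) (carrier (homology Y n)))"

text \<open>\<open>cone(f : X \<rightarrow> Y)\<close> is \<open>X\<^sub>n\<^sub>-\<^sub>1 \<oplus> Y\<^sub>n\<close> in degree \<open>n\<close>, with differential
  \<open>(x, y) \<mapsto> (- d x, f x + d y)\<close>.\<close>

definition cone ::
  "('k, 'a) chain_complex \<Rightarrow> ('k, 'b) chain_complex \<Rightarrow> (int \<Rightarrow> 'a \<Rightarrow> 'b) \<Rightarrow>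
     ('k, 'a \<times> 'b) chain_complex" where
  "cone X Y f = \<lparr>
     piece = (\<lambda>n. \<lparr>
       carrier = elts X (n - 1) \<times> elts Y n,
       mult = undefined,
       one = undefined,
       zero = (\<zero>\<^bsub>piece X (n - 1)\<^esub>, \<zero>\<^bsub>piece Y n\<^esub>),
       add = (\<lambda>z w. (fst z \<oplus>\<^bsub>piece X (n - 1)\<^esub> fst w, snd z \<oplus>\<^bsub>piece Y n\<^esub> snd w)),
       smult = (\<lambda>c z. (c \<odot>\<^bsub>piece X (n - 1)\<^esub> fst z, c \<odot>\<^bsub>piece Y n\<^esub> snd z))\<rparr>),
     bdry = (\<lambda>n z.
       (\<ominus>\<^bsub>piece X (n - 1 - 1)\<^esub> bdry X (n - 1) (fst z),
        f (n - 1) (fst z) \<oplus>\<^bsub>piece Y (n - 1)\<^esub> bdry Y n (snd z)))\<rparr>"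

definition graded_category ::
  "('k, 'a, 'z) chain_complex_scheme set \<Rightarrow>
   (('k, 'a, 'z) chain_complex_scheme \<Rightarrow> ('k, 'a, 'z) chain_complex_scheme \<Rightarrow>
     (int \<Rightarrow> 'a \<Rightarrow> 'a) \<Rightarrow> bool) \<Rightarrow>
   (('k, 'a, 'z) chain_complex_scheme,
    (('k, 'a, 'z) chain_complex_scheme, int \<Rightarrow> 'a \<Rightarrow> 'a) arrow) category" where
  "graded_category obs is_map = \<lparr>
     Ob = obs,
     Ar = {u. src u \<in> obs \<and> tgt u \<in> obs \<and> is_map (src u) (tgt u) (lab u)},
     Dom = src,
     Cod = tgt,
     Idt = (\<lambda>X. \<lparr>src = X, lab = (\<lambda>n. \<lambda>x \<in> elts X n. x), tgt = X\<rparr>),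
     Cmp = (\<lambda>v u. \<lparr>src = src u,
                   lab = (\<lambda>n. compose (elts (src u) n) (lab v n) (lab u n)),
                   tgt = tgt v\<rparr>)\<rparr>"

type_synonym ('k, 'a) complex_arrow =
  "(('k, 'a) chain_complex, int \<Rightarrow> 'a \<Rightarrow> 'a) arrow"

text \<open>Complexes all of whose elements lie in the type \<open>'a\<close>.\<close>

definition Com :: "'k ring \<Rightarrow> (('k, 'a) chain_complex, ('k, 'a) complex_arrow) relcat" where
  "Com K = (let C = graded_category {X. is_complex K X} (chain_map K)
    in category.extend C (relcat.fields {u \<in> Ar C. quasi_iso (src u) (tgt u) (lab u)}))"


section \<open>DG algebras\<close>

text \<open>A graded algebra is the family of its homogeneous components; \<open>gmult A i j\<close> multiplies
  elements of degrees \<open>i\<close> and \<open>j\<close>.\<close>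

record ('k, 'a) dga = "('k, 'a) chain_complex" +
  gmult :: "int \<Rightarrow> int \<Rightarrow> 'a \<Rightarrow> 'a \<Rightarrow> 'a"
  gone :: 'a

definition is_dga :: "'k ring \<Rightarrow> ('k, 'a) dga \<Rightarrow> bool" where
  "is_dga K A \<longleftrightarrow>
     is_complex K A \<and>
     (\<forall>i j. \<forall>a \<in> elts A i. linear_map K (piece A j) (piece A (i + j)) (\<lambda>b. gmult A i j a b)) \<and>
     (\<forall>i j. \<forall>b \<in> elts A j. linear_map K (piece A i) (piece A (i + j)) (\<lambda>a. gmult A i j a b)) \<and>
     (\<forall>i j l. \<forall>a \<in> elts A i. \<forall>b \<in> elts A j. \<forall>c \<in> elts A l.
        gmult A (i + j) l (gmult A i j a b) c = gmult A i (j + l) a (gmult A j l b c)) \<and>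
     gone A \<in> elts A 0 \<and>
     (\<forall>i. \<forall>a \<in> elts A i. gmult A 0 i (gone A) a = a \<and> gmult A i 0 a (gone A) = a) \<and>
     (\<forall>i j. \<forall>a \<in> elts A i. \<forall>b \<in> elts A j.
        bdry A (i + j) (gmult A i j a b) =
          gmult A (i - 1) j (bdry A i a) b
            \<oplus>\<^bsub>piece A (i + j - 1)\<^esub>
          sign K i \<odot>\<^bsub>piece A (i + j - 1)\<^esub> gmult A i (j - 1) a (bdry A j b))"

definition dga_map :: "'k ring \<Rightarrow> ('k, 'a) dga \<Rightarrow> ('k, 'a) dga \<Rightarrow> (int \<Rightarrow> 'a \<Rightarrow> 'a) \<Rightarrow> bool" where
  "dga_map K A B f \<longleftrightarrow>
     chain_map K A B f \<and>
     (\<forall>i j. \<forall>a \<in> elts A i. \<forall>b \<in> elts A j.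
        f (i + j) (gmult A i j a b) = gmult B i j (f i a) (f j b)) \<and>
     f 0 (gone A) = gone B"

type_synonym ('k, 'a) dga_arrow = "(('k, 'a) dga, int \<Rightarrow> 'a \<Rightarrow> 'a) arrow"

text \<open>DG algebras all of whose elements lie in the type \<open>'a\<close>, which plays the role of the
  universe. It has to be infinite and at least as large as the ground field for free DG algebras
  to exist in it.\<close>

definition DGA :: "'k ring \<Rightarrow> (('k, 'a) dga, ('k, 'a) dga_arrow) model" where
  "DGA K = (let
      C = graded_category {A. is_dga K A} (dga_map K);
      W = {u \<in> Ar C. quasi_iso (src u) (tgt u) (lab u)};
      F = {u \<in> Ar C. \<forall>n. lab u n ` elts (src u) n = elts (tgt u) n}
    in relcat.extend (category.extend C (relcat.fields W))
         (model.fields F {i \<in> Ar C. has_llp C i (W \<inter> F)}))"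


section \<open>The cone functor\<close>

text \<open>Degree \<open>n\<close> part of the span \<open>[A, A]\<close> of the graded commutators.\<close>

definition commutators :: "'k ring \<Rightarrow> ('k, 'a) dga \<Rightarrow> int \<Rightarrow> 'a set" where
  "commutators K A n =
     \<Inter>{H. submodule H K (piece A n) \<and>
         (\<forall>i j. \<forall>a \<in> elts A i. \<forall>b \<in> elts A j. i + j = n \<longrightarrow>
            gmult A i j a b \<ominus>\<^bsub>piece A n\<^esub> sign K (i * j) \<odot>\<^bsub>piece A n\<^esub> gmult A j i b a \<in> H)}"

text \<open>The quotient complex \<open>A/[A, A]\<close>, written \<open>A\<close> with a natural sign as subscript.\<close>

definition natural :: "'k ring \<Rightarrow> ('k, 'a) dga \<Rightarrow> ('k, 'a set) chain_complex" where
  "natural K A = \<lparr>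
     piece = (\<lambda>n. quot_mod (piece A n) (commutators K A n)),
     bdry = (\<lambda>n. quot_map (piece A n) (commutators K A n)
                          (piece A (n - 1)) (commutators K A (n - 1)) (bdry A n))\<rparr>"

definition natural_map :: "'k ring \<Rightarrow> ('k, 'a) dga_arrow \<Rightarrow> int \<Rightarrow> 'a set \<Rightarrow> 'a set" where
  "natural_map K f n =
     quot_map (piece (src f) n) (commutators K (src f) n)
              (piece (tgt f) n) (commutators K (tgt f) n) (lab f n)"

definition natural_cone ::
  "'k ring \<Rightarrow> ('k, 'a) dga_arrow \<Rightarrow> ('k, 'a set \<times> 'a set) chain_complex" where
  "natural_cone K f = cone (natural K (src f)) (natural K (tgt f)) (natural_map K f)"

definition cone_functor ::
  "'k ring \<Rightarrow>
   (('k, 'a) dga_arrow, (('k, 'a) dga_arrow, ('k, 'a) dga_arrow \<times> ('k, 'a) dga_arrow) arrow,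
    ('k, 'a set \<times> 'a set) chain_complex, ('k, 'a set \<times> 'a set) complex_arrow) func" where
  "cone_functor K = \<lparr>
     FOb = natural_cone K,
     FAr = (\<lambda>u. \<lparr>
       src = natural_cone K (src u),
       lab = (\<lambda>n. \<lambda>z \<in> elts (natural_cone K (src u)) n.
                (natural_map K (fst (lab u)) (n - 1) (fst z),
                 natural_map K (snd (lab u)) n (snd z))),
       tgt = natural_cone K (tgt u)\<rparr>)\<rparr>"

end

theory Submission
  imports Defs "HOL-Library.Nat_Bijection"
begin

text \<open>
  Everything rests on one homotopical fact: a quasi-isomorphism \<open>w : A \<rightarrow> B\<close> between cofibrant DG
  algebras induces a quasi-isomorphism \<open>A/[A,A] \<rightarrow> B/[B,B]\<close> (\<open>natural_quasi_iso\<close>). The quotient by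
  commutators is not exact, so this does not follow by linear algebra; it holds because the quotient
  turns multiplicative homotopies into chain homotopies. In characteristic zero the polynomial paths
  \<open>B[t, dt]\<close> form a DG algebra whose evaluation at \<open>t = 0\<close> is an acyclic fibration, since the
  integral from zero to \<open>t\<close> is a contracting homotopy for the paths that vanish at zero. If \<open>B\<close> is
  cofibrant, then lifting the identity of \<open>B\<close> through the path fibration \<open>A \<times>\<^bsub>B\<^esub> B[t, dt] \<rightarrow> B\<close>,
  which is acyclic because \<open>w\<close> is a quasi-isomorphism, yields \<open>g : B \<rightarrow> A\<close> and a path \<open>H : B \<rightarrow> B[t,
  dt]\<close> from \<open>w g\<close> to the identity (\<open>right_homotopy_inverse\<close>). Integrating the \<open>dt\<close> part of \<open>H\<close> over
  the unit interval is a chain homotopy, and it sends commutators to commutators, because the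
  integral of a graded commutator of polynomials is a linear combination of commutators of their
  coefficients (\<open>homotopy_commutators\<close>). So \<open>w\<close> has a right inverse on the homology of the
  commutator quotients. The map \<open>g\<close> is again a quasi-isomorphism of cofibrant algebras, and the same
  argument applied to \<open>g\<close> makes that right inverse two-sided.

  Cofibrant objects of the arrow category are cofibrations between cofibrant algebras, so both
  components of a weak equivalence between them are covered by this fact, and the five lemma for
  cones shows that the cone functor inverts it in the derived category. A functor with this property
  has a total left derived functor, obtained by applying it to cofibrant replacements
  (\<open>total_left_derived\<close>). That replacements are functorial up to homotopy is proved without cylinder
  or path objects: if two maps into a cofibrant object agree after composition with an acyclic
  fibration \<open>p\<close>, they factor through a cofibrant resolution of the kernel pair of \<open>p\<close>, whose two
  projections have a common section and therefore become equal after localization (\<open>lifts_agree\<close>).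
  The value at any other cofibrant replacement is compared through the derived functor itself, which
  inverts weak equivalences (\<open>derived_value\<close>). Resolving first \<open>S\<close> by \<open>QS\<close> and then the composite
  \<open>QS \<rightarrow> S \<rightarrow> A\<close> in the category under \<open>QS\<close> is such a replacement, since a cofibrant object under \<open>QS\<close>
  is a cofibration with source \<open>QS\<close> (\<open>under_cofibrant_cof\<close>).

  From the model structure, the argument takes what \<open>resolution_model\<close> lists: cofibrations are
  characterized by lifting, weak equivalences can be composed and cancelled, and there are
  factorizations into a cofibration and an acyclic fibration, kernel pairs of acyclic fibrations,
  and an initial object. For the factorizations, all cells are adjoined at once: the middle algebra
  consists of terms over the source and formal generators, modulo the laws of a DG algebra, where
  every cycle that has to be bounded comes with a generator bounding it (\<open>free_extension\<close>). Coded
  back into the universe \<open>'a\<close>, which is infinite and at least as large as the field, these terms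
  stay inside the given category.
\<close>

section \<open>Categories and localization\<close>

locale category_laws =
  fixes C :: "('o, 'm, 'z) category_scheme"
  assumes Dom_Ob: "f \<in> Ar C \<Longrightarrow> Dom C f \<in> Ob C"
    and Cod_Ob: "f \<in> Ar C \<Longrightarrow> Cod C f \<in> Ob C"
    and Idt_Hom: "X \<in> Ob C \<Longrightarrow> Idt C X \<in> Hom C X X"
    and Cmp_Hom: "f \<in> Hom C X Y \<Longrightarrow> g \<in> Hom C Y Z \<Longrightarrow> Cmp C g f \<in> Hom C X Z"
    and Idt_left: "f \<in> Hom C X Y \<Longrightarrow> Cmp C (Idt C Y) f = f"
    and Idt_right: "f \<in> Hom C X Y \<Longrightarrow> Cmp C f (Idt C X) = f"
    and Cmp_assoc: "f \<in> Hom C W X \<Longrightarrow> g \<in> Hom C X Y \<Longrightarrow> h \<in> Hom C Y Z \<Longrightarrow>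
      Cmp C (Cmp C h g) f = Cmp C h (Cmp C g f)"

lemma HomI: "f \<in> Ar C \<Longrightarrow> f \<in> Hom C (Dom C f) (Cod C f)"
  by (simp add: Hom_def)

lemma HomD: "f \<in> Hom C X Y \<Longrightarrow> f \<in> Ar C \<and> Dom C f = X \<and> Cod C f = Y"
  by (simp add: Hom_def)

lemma (in category_laws) Hom_Ob: "f \<in> Hom C X Y \<Longrightarrow> X \<in> Ob C \<and> Y \<in> Ob C"
  using Dom_Ob Cod_Ob by (auto simp: Hom_def)

definition inverse_arrow :: "('o, 'm, 'z) category_scheme \<Rightarrow> 'm \<Rightarrow> 'm" where
  "inverse_arrow C f = (SOME g. g \<in> Hom C (Cod C f) (Dom C f) \<and>
     Cmp C g f = Idt C (Dom C f) \<and> Cmp C f g = Idt C (Cod C f))"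

lemma inverse_arrow:
  assumes "is_isomorphism C f" "f \<in> Hom C X Y"
  shows "inverse_arrow C f \<in> Hom C Y X" "Cmp C (inverse_arrow C f) f = Idt C X"
    "Cmp C f (inverse_arrow C f) = Idt C Y"
proof -
  have *: "\<exists>g. g \<in> Hom C (Cod C f) (Dom C f) \<and>
     Cmp C g f = Idt C (Dom C f) \<and> Cmp C f g = Idt C (Cod C f)"
    using assms(1) unfolding is_isomorphism_def by blast
  show "inverse_arrow C f \<in> Hom C Y X" "Cmp C (inverse_arrow C f) f = Idt C X"
    "Cmp C f (inverse_arrow C f) = Idt C Y"
    using someI_ex[OF *] assms(2) unfolding inverse_arrow_def[symmetric] by (auto simp: Hom_def)
qed

lemma isomorphismI:
  assumes "f \<in> Hom C X Y" "g \<in> Hom C Y X" "Cmp C g f = Idt C X" "Cmp C f g = Idt C Y"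
  shows "is_isomorphism C f"
  using assms unfolding is_isomorphism_def by (auto simp: Hom_def)

lemma (in category_laws) iso_cancel_left:
  assumes "is_isomorphism C f" "f \<in> Hom C X Y" "u \<in> Hom C W X" "v \<in> Hom C W X"
    "Cmp C f u = Cmp C f v"
  shows "u = v"
proof -
  note i = inverse_arrow[OF assms(1,2)]
  have "u = Cmp C (Cmp C (inverse_arrow C f) f) u"
    using i Idt_left[OF assms(3)] by simp
  also have "\<dots> = Cmp C (Cmp C (inverse_arrow C f) f) v"
    using Cmp_assoc[OF assms(3,2) i(1)] Cmp_assoc[OF assms(4,2) i(1)] assms(5) by simp
  also have "\<dots> = v" using i Idt_left[OF assms(4)] by simp
  finally show ?thesis .
qed

lemma (in category_laws) iso_cancel_right:
  assumes "is_isomorphism C f" "f \<in> Hom C X Y" "u \<in> Hom C Y Z" "v \<in> Hom C Y Z"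
    "Cmp C u f = Cmp C v f"
  shows "u = v"
proof -
  note i = inverse_arrow[OF assms(1,2)]
  have "u = Cmp C u (Cmp C f (inverse_arrow C f))"
    using i Idt_right[OF assms(3)] by simp
  also have "\<dots> = Cmp C v (Cmp C f (inverse_arrow C f))"
    using Cmp_assoc[OF i(1) assms(2,3)] Cmp_assoc[OF i(1) assms(2,4)] assms(5) by simp
  also have "\<dots> = v" using i Idt_right[OF assms(4)] by simp
  finally show ?thesis .
qed

lemma (in category_laws) iso_inverse:
  assumes "is_isomorphism C f" "f \<in> Hom C X Y"
  shows "is_isomorphism C (inverse_arrow C f)"
  using isomorphismI[of "inverse_arrow C f" C Y X f] inverse_arrow[OF assms] assms(2) by blast

lemma (in category_laws) iso_Cmp:
  assumes "is_isomorphism C f" "f \<in> Hom C X Y" "is_isomorphism C g" "g \<in> Hom C Y Z"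
  shows "is_isomorphism C (Cmp C g f)"
proof (rule isomorphismI)
  let ?f = "inverse_arrow C f" and ?g = "inverse_arrow C g"
  note f = inverse_arrow[OF assms(1,2)] and g = inverse_arrow[OF assms(3,4)]
  show "Cmp C g f \<in> Hom C X Z" "Cmp C ?f ?g \<in> Hom C Z X"
    using assms f g Cmp_Hom by blast+
  have "Cmp C (Cmp C ?f ?g) (Cmp C g f) = Cmp C ?f (Cmp C (Cmp C ?g g) f)"
    using Cmp_assoc[OF assms(2,4) g(1)] Cmp_assoc[OF Cmp_Hom[OF assms(2,4)] g(1) f(1)] by simp
  then show "Cmp C (Cmp C ?f ?g) (Cmp C g f) = Idt C X"
    using f g assms Idt_left by simp
  have "Cmp C (Cmp C g f) (Cmp C ?f ?g) = Cmp C g (Cmp C (Cmp C f ?f) ?g)"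
    using Cmp_assoc[OF g(1) f(1) assms(2)] Cmp_assoc[OF Cmp_Hom[OF g(1) f(1)] assms(2,4)] by simp
  then show "Cmp C (Cmp C g f) (Cmp C ?f ?g) = Idt C Z"
    using f g assms Idt_left by simp
qed

lemma functor_Hom: "is_functor C D F \<Longrightarrow> f \<in> Hom C X Y \<Longrightarrow> FAr F f \<in> Hom D (FOb F X) (FOb F Y)"
  unfolding is_functor_def Hom_def by blast

lemma functor_Cmp: "is_functor C D F \<Longrightarrow> f \<in> Hom C X Y \<Longrightarrow> g \<in> Hom C Y Z \<Longrightarrow>
    FAr F (Cmp C g f) = Cmp D (FAr F g) (FAr F f)"
  unfolding is_functor_def Hom_def by simp

lemma functor_Idt: "is_functor C D F \<Longrightarrow> X \<in> Ob C \<Longrightarrow> FAr F (Idt C X) = Idt D (FOb F X)"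
  unfolding is_functor_def by blast

lemma functor_Ob: "is_functor C D F \<Longrightarrow> X \<in> Ob C \<Longrightarrow> FOb F X \<in> Ob D"
  unfolding is_functor_def by blast

lemma functor_iso:
  assumes "category_laws C" "is_functor C D F" "is_isomorphism C f"
  shows "is_isomorphism D (FAr F f)"
proof -
  interpret category_laws C by fact
  define X Y where "X = Dom C f" "Y = Cod C f"
  have f: "f \<in> Hom C X Y" using assms(3) by (simp add: is_isomorphism_def X_Y_def Hom_def)
  note i = inverse_arrow[OF assms(3) f]
  show ?thesis
  proof (rule isomorphismI)
    show "FAr F f \<in> Hom D (FOb F X) (FOb F Y)"
      "FAr F (inverse_arrow C f) \<in> Hom D (FOb F Y) (FOb F X)"
      using functor_Hom[OF assms(2)] f i(1) by auto
    show "Cmp D (FAr F (inverse_arrow C f)) (FAr F f) = Idt D (FOb F X)"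
      "Cmp D (FAr F f) (FAr F (inverse_arrow C f)) = Idt D (FOb F Y)"
      using functor_Cmp[OF assms(2) f i(1)] functor_Cmp[OF assms(2) i(1) f] i(2,3)
        functor_Idt[OF assms(2)] Hom_Ob[OF f] by auto
  qed
qed

lemma functor_compose:
  assumes "is_functor C D F" "is_functor D E G"
  shows "is_functor C E (func_comp G F)"
  using assms unfolding is_functor_def func_comp_def Hom_def by simp

locale rel_category = category_laws C for C :: "('o, 'm, 'z) relcat_scheme"
begin

lemma zigzag_Ob: "zigzag C X p Y \<Longrightarrow> X \<in> Ob C \<and> Y \<in> Ob C"
proof (induction p arbitrary: X)
  case (Cons a p)
  then show ?case by (cases a) (auto simp: Dom_Ob Cod_Ob)
qed simp

lemma zigzag_append: "zigzag C X p Y \<Longrightarrow> zigzag C Y q Z \<Longrightarrow> zigzag C X (p @ q) Z"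
proof (induction p arbitrary: X)
  case (Cons a p)
  then show ?case by (cases a) auto
qed simp

lemma zz_eq_zigzag: "zz_eq C X p q Y \<Longrightarrow> zigzag C X p Y \<and> zigzag C X q Y"
proof (induction rule: zz_eq.induct)
  case (ident X)
  then show ?case using Idt_Hom[of X] by (auto simp: Hom_def)
next
  case (comp f g)
  then show ?case using Cmp_Hom[of f "Dom C f" "Cod C f" g "Cod C g"] Cod_Ob
    by (auto simp: Hom_def)
qed (auto simp: zigzag_append Dom_Ob Cod_Ob)

lemma zz_class_eq: "zz_eq C X p q Y \<Longrightarrow> zz_class C X p Y = zz_class C X q Y"
  unfolding zz_class_def by (blast intro: zz_eq.sym zz_eq.trans)

lemma zz_arrow_eq: "zz_eq C X p q Y \<Longrightarrow> zz_arrow C X p Y = zz_arrow C X q Y"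
  unfolding zz_arrow_def by (simp add: zz_class_eq)

lemma zz_self: "zigzag C X p Y \<Longrightarrow> p \<in> zz_class C X p Y"
  by (simp add: zz_class_def zz_eq.refl)

lemma Ho_simps [simp]: "Ob (Ho C) = Ob C" "Dom (Ho C) = src" "Cod (Ho C) = tgt"
  "Idt (Ho C) X = zz_arrow C X [] X"
  by (simp_all add: Ho_def)

lemma Ho_Hom: "Hom (Ho C) X Y = {zz_arrow C X p Y | p. zigzag C X p Y}"
  by (auto simp: Hom_def Ho_def zz_arrow_def)

lemma Ho_Cmp:
  assumes "zigzag C X p Y" "zigzag C Y q Z"
  shows "Cmp (Ho C) (zz_arrow C Y q Z) (zz_arrow C X p Y) = zz_arrow C X (p @ q) Z"
proof -
  have "zz_class C X (p' @ q') Z = zz_class C X (p @ q) Z"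
    if "p' \<in> zz_class C X p Y" "q' \<in> zz_class C Y q Z" for p' q'
    using that zz_eq.append[of C X p p' Y q q' Z] zz_class_eq unfolding zz_class_def by blast
  moreover have "p \<in> zz_class C X p Y" "q \<in> zz_class C Y q Z"
    using assms zz_self by auto
  ultimately have "(\<Union>p'\<in>zz_class C X p Y. \<Union>q'\<in>zz_class C Y q Z. zz_class C X (p' @ q') Z)
    = zz_class C X (p @ q) Z" by blast
  then show ?thesis by (simp add: Ho_def zz_arrow_def)
qed

lemma Ho_category: "category_laws (Ho C)"
proof
  fix f assume "f \<in> Ar (Ho C)"
  then show "Dom (Ho C) f \<in> Ob (Ho C)" "Cod (Ho C) f \<in> Ob (Ho C)"
    using zigzag_Ob by (auto simp: Ho_def zz_arrow_def)
next
  fix X assume "X \<in> Ob (Ho C)"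
  then show "Idt (Ho C) X \<in> Hom (Ho C) X X" by (auto simp: Ho_Hom)
next
  fix f g X Y Z assume "f \<in> Hom (Ho C) X Y" "g \<in> Hom (Ho C) Y Z"
  then show "Cmp (Ho C) g f \<in> Hom (Ho C) X Z"
    by (auto simp: Ho_Hom Ho_Cmp intro: zigzag_append)
next
  fix f X Y assume "f \<in> Hom (Ho C) X Y"
  then show "Cmp (Ho C) (Idt (Ho C) Y) f = f" "Cmp (Ho C) f (Idt (Ho C) X) = f"
    using zigzag_Ob by (auto simp: Ho_Hom Ho_Cmp)
next
  fix f g h W X Y Z
  assume "f \<in> Hom (Ho C) W X" "g \<in> Hom (Ho C) X Y" "h \<in> Hom (Ho C) Y Z"
  then show "Cmp (Ho C) (Cmp (Ho C) h g) f = Cmp (Ho C) h (Cmp (Ho C) g f)"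
    by (auto simp: Ho_Hom Ho_Cmp zigzag_append)
qed

lemma loc_functor: "is_functor C (Ho C) (loc C)"
  unfolding is_functor_def
proof (intro conjI ballI impI)
  fix X assume "X \<in> Ob C"
  then show "FOb (loc C) X \<in> Ob (Ho C)" "FAr (loc C) (Idt C X) = Idt (Ho C) (FOb (loc C) X)"
    using Idt_Hom[of X] zz_arrow_eq[OF zz_eq.ident[of X]] by (auto simp: loc_def Hom_def)
next
  fix f assume "f \<in> Ar C"
  then show "FAr (loc C) f \<in> Hom (Ho C) (FOb (loc C) (Dom C f)) (FOb (loc C) (Cod C f))"
    by (auto simp: loc_def Ho_Hom Cod_Ob)
next
  fix f g assume *: "f \<in> Ar C" "g \<in> Ar C" "Cod C f = Dom C g"
  then have "Cmp C g f \<in> Hom C (Dom C f) (Cod C g)" using Cmp_Hom by (auto simp: Hom_def)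
  then show "FAr (loc C) (Cmp C g f) = Cmp (Ho C) (FAr (loc C) g) (FAr (loc C) f)"
    using * zz_arrow_eq[OF zz_eq.comp[OF *]] Ho_Cmp[of "Dom C f" "[Fwd f]" "Dom C g" "[Fwd g]" "Cod C g"]
    by (auto simp: loc_def Hom_def Dom_Ob Cod_Ob)
qed

lemma FOb_loc [simp]: "FOb (loc C) X = X"
  by (simp add: loc_def)

definition formal_inverse :: "'m \<Rightarrow> ('o, 'm step list set) arrow" where
  "formal_inverse w = zz_arrow C (Cod C w) [Bwd w] (Dom C w)"

lemma formal_inverse:
  assumes "w \<in> weq C" "w \<in> Hom C X Y"
  shows "formal_inverse w \<in> Hom (Ho C) Y X"
    "Cmp (Ho C) (formal_inverse w) (FAr (loc C) w) = Idt (Ho C) X"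
    "Cmp (Ho C) (FAr (loc C) w) (formal_inverse w) = Idt (Ho C) Y"
  using assms zz_arrow_eq[OF zz_eq.inv_right[of w]] zz_arrow_eq[OF zz_eq.inv_left[of w]]
    Ho_Cmp[of "Dom C w" "[Fwd w]" "Cod C w" "[Bwd w]" "Dom C w"]
    Ho_Cmp[of "Cod C w" "[Bwd w]" "Dom C w" "[Fwd w]" "Cod C w"]
  unfolding formal_inverse_def Ho_Hom by (auto simp: Hom_def Dom_Ob Cod_Ob loc_def)

lemma loc_iso:
  assumes "w \<in> weq C" "w \<in> Ar C"
  shows "is_isomorphism (Ho C) (FAr (loc C) w)"
  using isomorphismI[of "FAr (loc C) w" "Ho C" "Dom C w" "Cod C w" "formal_inverse w"]
    formal_inverse[OF assms(1) HomI[OF assms(2)]] functor_Hom[OF loc_functor HomI[OF assms(2)]]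
  by simp

text \<open>Every arrow of the localization is a composite of images of arrows and of formal inverses.\<close>

lemma Ho_induct [consumes 1, case_names ident forward backward]:
  assumes "u \<in> Hom (Ho C) X Y"
    and ident: "\<And>X. X \<in> Ob C \<Longrightarrow> P X X (Idt (Ho C) X)"
    and forward: "\<And>f u X Y Z. f \<in> Hom C X Y \<Longrightarrow> u \<in> Hom (Ho C) Y Z \<Longrightarrow> P Y Z u \<Longrightarrow>
      P X Z (Cmp (Ho C) u (FAr (loc C) f))"
    and backward: "\<And>w u X Y Z. w \<in> Hom C X Y \<Longrightarrow> w \<in> weq C \<Longrightarrow> u \<in> Hom (Ho C) X Z \<Longrightarrow> P X Z u \<Longrightarrow>
      P Y Z (Cmp (Ho C) u (formal_inverse w))"
  shows "P X Y u"
proof -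
  obtain p where p: "zigzag C X p Y" "u = zz_arrow C X p Y" using assms(1) by (auto simp: Ho_Hom)
  have "zigzag C X p Y \<Longrightarrow> P X Y (zz_arrow C X p Y)"
  proof (induction p arbitrary: X)
    case Nil
    then have "X \<in> Ob C" "X = Y" by auto
    then show ?case using ident[of X] by simp
  next
    case (Cons a p)
    show ?case
    proof (cases a)
      case (Fwd f)
      with Cons have f: "f \<in> Hom C X (Cod C f)" and z: "zigzag C (Cod C f) p Y"
        by (auto simp: Hom_def)
      have "P X Y (Cmp (Ho C) (zz_arrow C (Cod C f) p Y) (FAr (loc C) f))"
        by (rule forward[OF f]) (use z Cons.IH in \<open>auto simp: Ho_Hom\<close>)
      then show ?thesis
        using Ho_Cmp[of X "[Fwd f]" "Cod C f" p Y] f z Fwd zigzag_Ob[OF z]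
        by (auto simp: Hom_def loc_def)
    next
      case (Bwd w)
      with Cons have w: "w \<in> Hom C (Dom C w) X" "w \<in> weq C" and z: "zigzag C (Dom C w) p Y"
        by (auto simp: Hom_def)
      have "P X Y (Cmp (Ho C) (zz_arrow C (Dom C w) p Y) (formal_inverse w))"
        by (rule backward[OF w]) (use z Cons.IH in \<open>auto simp: Ho_Hom\<close>)
      then show ?thesis
        using Ho_Cmp[of X "[Bwd w]" "Dom C w" p Y] w z Bwd zigzag_Ob[OF z]
        by (auto simp: Hom_def formal_inverse_def)
    qed
  qed
  with p show ?thesis by simp
qed

text \<open>Naturality over the localization only has to be checked on the arrows of \<open>C\<close>: a square remains
  commutative when two parallel sides are replaced by their inverses.\<close>

lemma nat_trans_HoI:
  assumes E: "category_laws E" and G: "is_functor (Ho C) E G" and H: "is_functor (Ho C) E H"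
    and s: "s \<in> extensional (Ob C)" "\<And>X. X \<in> Ob C \<Longrightarrow> s X \<in> Hom E (FOb G X) (FOb H X)"
    and nat: "\<And>f X Y. f \<in> Hom C X Y \<Longrightarrow>
      Cmp E (s Y) (FAr G (FAr (loc C) f)) = Cmp E (FAr H (FAr (loc C) f)) (s X)"
  shows "nat_trans (Ho C) E G H s"
proof -
  interpret E: category_laws E by fact
  interpret Ho: category_laws "Ho C" by (rule Ho_category)
  have *: "Cmp E (s Y) (FAr G u) = Cmp E (FAr H u) (s X)" if "u \<in> Hom (Ho C) X Y" for u X Y
    using that
  proof (induction rule: Ho_induct)
    case (ident X)
    then show ?case
      using functor_Idt[OF G, of X] functor_Idt[OF H, of X] s(2)[of X]
        E.Idt_left[of "s X"] E.Idt_right[of "s X"] by simp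
  next
    case (forward f u X Y Z)
    note f = functor_Hom[OF loc_functor forward(1), unfolded FOb_loc]
    note ob = Hom_Ob[OF forward(1)] Ho.Hom_Ob[OF forward(2)]
    note Gf = functor_Hom[OF G f] and Gu = functor_Hom[OF G forward(2)]
      and Hf = functor_Hom[OF H f] and Hu = functor_Hom[OF H forward(2)]
    have "Cmp E (s Z) (FAr G (Cmp (Ho C) u (FAr (loc C) f)))
        = Cmp E (Cmp E (s Z) (FAr G u)) (FAr G (FAr (loc C) f))"
      using functor_Cmp[OF G f forward(2)] E.Cmp_assoc[OF Gf Gu s(2)[of Z]] ob by simp
    also have "\<dots> = Cmp E (FAr H u) (Cmp E (s Y) (FAr G (FAr (loc C) f)))"
      using forward(3) E.Cmp_assoc[OF Gf s(2)[of Y] Hu] ob by simp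
    also have "\<dots> = Cmp E (Cmp E (FAr H u) (FAr H (FAr (loc C) f))) (s X)"
      using nat[OF forward(1)] E.Cmp_assoc[OF s(2)[of X] Hf Hu] ob by simp
    also have "\<dots> = Cmp E (FAr H (Cmp (Ho C) u (FAr (loc C) f))) (s X)"
      using functor_Cmp[OF H f forward(2)] by simp
    finally show ?case .
  next
    case (backward w u X Y Z)
    note f = functor_Hom[OF loc_functor backward(1), unfolded FOb_loc]
    note i = formal_inverse[OF backward(2,1)]
    note ob = Hom_Ob[OF backward(1)] Ho.Hom_Ob[OF backward(3)]
    note Gi = functor_Hom[OF G i(1)] and Hi = functor_Hom[OF H i(1)]
      and Gu = functor_Hom[OF G backward(3)] and Hu = functor_Hom[OF H backward(3)]
      and Gf = functor_Hom[OF G f] and Hf = functor_Hom[OF H f]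
    have sX: "s X \<in> Hom E (FOb G X) (FOb H X)" and sY: "s Y \<in> Hom E (FOb G Y) (FOb H Y)"
      and sZ: "s Z \<in> Hom E (FOb G Z) (FOb H Z)" using s(2) ob by auto
    have G1: "Cmp E (FAr G (FAr (loc C) w)) (FAr G (formal_inverse w)) = Idt E (FOb G Y)"
      using functor_Cmp[OF G i(1) f] functor_Idt[OF G, of Y] i(3) ob by simp
    have H1: "Cmp E (FAr H (formal_inverse w)) (FAr H (FAr (loc C) w)) = Idt E (FOb H X)"
      using functor_Cmp[OF H f i(1)] functor_Idt[OF H, of X] i(2) ob by simp
    have "Cmp E (s X) (FAr G (formal_inverse w)) =
        Cmp E (Cmp E (Cmp E (FAr H (formal_inverse w)) (FAr H (FAr (loc C) w))) (s X))
          (FAr G (formal_inverse w))"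
      using H1 E.Idt_left[OF sX] by simp
    also have "\<dots> = Cmp E (FAr H (formal_inverse w))
        (Cmp E (Cmp E (s Y) (FAr G (FAr (loc C) w))) (FAr G (formal_inverse w)))"
      using nat[OF backward(1)] E.Cmp_assoc[OF sX Hf Hi]
        E.Cmp_assoc[OF Gi E.Cmp_Hom[OF sX Hf] Hi] by simp
    also have "\<dots> = Cmp E (FAr H (formal_inverse w)) (s Y)"
      using E.Cmp_assoc[OF Gi Gf sY] G1 E.Idt_right[OF sY] by simp
    finally have sq: "Cmp E (s X) (FAr G (formal_inverse w)) = Cmp E (FAr H (formal_inverse w)) (s Y)" .
    have "Cmp E (s Z) (FAr G (Cmp (Ho C) u (formal_inverse w)))
        = Cmp E (Cmp E (s Z) (FAr G u)) (FAr G (formal_inverse w))"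
      using functor_Cmp[OF G i(1) backward(3)] E.Cmp_assoc[OF Gi Gu sZ] by simp
    also have "\<dots> = Cmp E (FAr H u) (Cmp E (s X) (FAr G (formal_inverse w)))"
      using backward(4) E.Cmp_assoc[OF Gi sX Hu] by simp
    also have "\<dots> = Cmp E (Cmp E (FAr H u) (FAr H (formal_inverse w))) (s Y)"
      using sq E.Cmp_assoc[OF sY Hi Hu] by simp
    also have "\<dots> = Cmp E (FAr H (Cmp (Ho C) u (formal_inverse w))) (s Y)"
      using functor_Cmp[OF H i(1) backward(3)] by simp
    finally show ?case .
  qed
  show ?thesis
    unfolding nat_trans_def using G H s * HomI[of _ "Ho C"] by auto
qed

end

text \<open>The universal property of the localization: a functor that inverts the weak equivalences
  extends to it.\<close>

locale inverting_functor = rel_category C + E: category_laws E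
  for C :: "('o, 'm, 'z) relcat_scheme" and E :: "('p, 'n, 'y) category_scheme" +
  fixes \<Phi> :: "('o, 'm, 'p, 'n) func"
  assumes \<Phi>: "is_functor C E \<Phi>"
    and inverts: "w \<in> weq C \<Longrightarrow> w \<in> Ar C \<Longrightarrow> is_isomorphism E (FAr \<Phi> w)"
begin

fun zz_map :: "'o \<Rightarrow> 'm step list \<Rightarrow> 'n" where
  "zz_map X [] = Idt E (FOb \<Phi> X)"
| "zz_map X (Fwd f # p) = Cmp E (zz_map (Cod C f) p) (FAr \<Phi> f)"
| "zz_map X (Bwd w # p) = Cmp E (zz_map (Dom C w) p) (inverse_arrow E (FAr \<Phi> w))"

lemma inverse_Hom:
  assumes "w \<in> weq C" "w \<in> Ar C"
  shows "inverse_arrow E (FAr \<Phi> w) \<in> Hom E (FOb \<Phi> (Cod C w)) (FOb \<Phi> (Dom C w))"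
  using inverse_arrow(1)[OF inverts[OF assms] functor_Hom[OF \<Phi> HomI[OF assms(2)]]] .

lemma zz_map_Hom: "zigzag C X p Y \<Longrightarrow> zz_map X p \<in> Hom E (FOb \<Phi> X) (FOb \<Phi> Y)"
proof (induction X p rule: zz_map.induct)
  case (1 X)
  then show ?case using E.Idt_Hom functor_Ob[OF \<Phi>] by auto
next
  case (2 X f p)
  then show ?case using E.Cmp_Hom functor_Hom[OF \<Phi> HomI[of f]] by auto
next
  case (3 X w p)
  then show ?case using E.Cmp_Hom[OF inverse_Hom[of w]] by auto
qed

lemma zz_map_append: "zigzag C X p Y \<Longrightarrow> zigzag C Y q Z \<Longrightarrow>
    zz_map X (p @ q) = Cmp E (zz_map Y q) (zz_map X p)"
proof (induction X p rule: zz_map.induct)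
  case (1 X)
  then show ?case using E.Idt_right[OF zz_map_Hom] by auto
next
  case (2 X f p)
  then have z: "zigzag C (Cod C f) p Y" and f: "f \<in> Hom C X (Cod C f)" by (auto simp: Hom_def)
  show ?case
    using 2 z E.Cmp_assoc[OF functor_Hom[OF \<Phi> f] zz_map_Hom[OF z] zz_map_Hom[OF 2(3)]] by simp
next
  case (3 X w p)
  then have z: "zigzag C (Dom C w) p Y" and w: "w \<in> weq C" "w \<in> Ar C" by (auto simp: Hom_def)
  show ?case
    using 3 z E.Cmp_assoc[OF inverse_Hom[OF w] zz_map_Hom[OF z] zz_map_Hom[OF 3(3)]] by simp
qed

lemma zz_map_eq: "zz_eq C X p q Y \<Longrightarrow> zz_map X p = zz_map X q"
proof (induction rule: zz_eq.induct)
  case (append X p p' Y q q' Z)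
  then show ?case
    using zz_map_append[of X p Y q Z] zz_map_append[of X p' Y q' Z]
      zz_eq_zigzag[OF append(1)] zz_eq_zigzag[OF append(2)] by simp
next
  case (ident X)
  note h = functor_Ob[OF \<Phi> ident]
  show ?case
    using Idt_Hom[OF ident] functor_Idt[OF \<Phi> ident] E.Idt_left[OF E.Idt_Hom[OF h]]
    by (auto simp: Hom_def)
next
  case (comp f g)
  then have f: "f \<in> Hom C (Dom C f) (Dom C g)" and g: "g \<in> Hom C (Dom C g) (Cod C g)"
    by (auto simp: Hom_def)
  note gf = Cmp_Hom[OF f g]
  show ?case
    using functor_Cmp[OF \<Phi> f g] E.Idt_left[OF functor_Hom[OF \<Phi> g]]
      E.Idt_left[OF functor_Hom[OF \<Phi> gf]] gf functor_Cmp[OF \<Phi> f g] by (auto simp: Hom_def)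
next
  case (inv_right w)
  note i = inverse_arrow[OF inverts[OF inv_right(2,1)] functor_Hom[OF \<Phi> HomI[OF inv_right(1)]]]
  show ?case using i E.Idt_left[OF i(1)] by simp
next
  case (inv_left w)
  note i = inverse_arrow[OF inverts[OF inv_left(2,1)] functor_Hom[OF \<Phi> HomI[OF inv_left(1)]]]
  show ?case using i E.Idt_left[OF functor_Hom[OF \<Phi> HomI[OF inv_left(1)]]] by simp
qed auto

definition ext :: "('o, ('o, 'm step list set) arrow, 'p, 'n) func" where
  "ext = \<lparr>FOb = FOb \<Phi>, FAr = (\<lambda>u. zz_map (src u) (SOME p. p \<in> lab u))\<rparr>"

lemma FOb_ext [simp]: "FOb ext X = FOb \<Phi> X" by (simp add: ext_def)

lemma ext_zz_arrow:
  assumes "zigzag C X p Y" shows "FAr ext (zz_arrow C X p Y) = zz_map X p"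
proof -
  have "(SOME q. q \<in> zz_class C X p Y) \<in> zz_class C X p Y"
    using someI[of "\<lambda>q. q \<in> zz_class C X p Y" p] zz_self[OF assms] .
  then show ?thesis
    using zz_map_eq unfolding ext_def zz_arrow_def zz_class_def by fastforce
qed

lemma ext_functor: "is_functor (Ho C) E ext"
  unfolding is_functor_def
proof (intro conjI ballI impI)
  fix X assume "X \<in> Ob (Ho C)"
  then show "FOb ext X \<in> Ob E" "FAr ext (Idt (Ho C) X) = Idt E (FOb ext X)"
    using functor_Ob[OF \<Phi>] ext_zz_arrow[of X "[]" X] by auto
next
  fix u assume "u \<in> Ar (Ho C)"
  then obtain p where "u = zz_arrow C (src u) p (tgt u)" "zigzag C (src u) p (tgt u)"
    using HomI[of u "Ho C"] by (auto simp: Ho_Hom)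
  then show "FAr ext u \<in> Hom E (FOb ext (Dom (Ho C) u)) (FOb ext (Cod (Ho C) u))"
    using ext_zz_arrow[of "src u" p "tgt u"] zz_map_Hom[of "src u" p "tgt u"] by simp
next
  fix u v assume "u \<in> Ar (Ho C)" "v \<in> Ar (Ho C)" and uv: "Cod (Ho C) u = Dom (Ho C) v"
  then obtain p q where "u = zz_arrow C (src u) p (tgt u)" "zigzag C (src u) p (tgt u)"
     "v = zz_arrow C (src v) q (tgt v)" "zigzag C (src v) q (tgt v)"
    using HomI[of u "Ho C"] HomI[of v "Ho C"] by (auto simp: Ho_Hom)
  then show "FAr ext (Cmp (Ho C) v u) = Cmp E (FAr ext v) (FAr ext u)"
    using uv ext_zz_arrow[of "src u" p "tgt u"] ext_zz_arrow[of "tgt u" q "tgt v"]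
      ext_zz_arrow[of "src u" "p @ q" "tgt v"] Ho_Cmp[of "src u" p "tgt u" q "tgt v"]
      zz_map_append[of "src u" p "tgt u" q "tgt v"] zigzag_append[of "src u" p "tgt u" q "tgt v"]
    by simp
qed

lemma ext_loc: "f \<in> Hom C X Y \<Longrightarrow> FAr ext (FAr (loc C) f) = FAr \<Phi> f"
  using ext_zz_arrow[of X "[Fwd f]" Y] E.Idt_left[OF functor_Hom[OF \<Phi>, of f X Y]] Cod_Ob[of f]
  by (auto simp: Hom_def loc_def)

end

section \<open>Left derived functors from cofibrant replacements\<close>

text \<open>The class \<open>cofs\<close> plays the role of the cofibrant objects and \<open>tf\<close> that of the acyclic
  fibrations.\<close>

locale left_derivable = C: rel_category C + D: rel_category D
  for C :: "('o1, 'm1, 'y) relcat_scheme" and D :: "('o2, 'm2, 'z) relcat_scheme" +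
  fixes F :: "('o1, 'm1, 'o2, 'm2) func" and cofs :: "'o1 set" and tf :: "'m1 set"
  assumes F: "is_functor C D F"
    and cofs_Ob: "cofs \<subseteq> Ob C"
    and tf_weq: "tf \<subseteq> weq C"
    and weq_Cmp: "f \<in> Hom C X Y \<Longrightarrow> g \<in> Hom C Y Z \<Longrightarrow> f \<in> weq C \<Longrightarrow> g \<in> weq C \<Longrightarrow> Cmp C g f \<in> weq C"
    and weq_cancel: "f \<in> Hom C X Y \<Longrightarrow> g \<in> Hom C Y Z \<Longrightarrow> g \<in> weq C \<Longrightarrow> Cmp C g f \<in> weq C \<Longrightarrow> f \<in> weq C"
    and resolve: "X \<in> Ob C \<Longrightarrow> \<exists>Y\<in>cofs. \<exists>q\<in>Hom C Y X. q \<in> tf"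
    and lift: "X \<in> cofs \<Longrightarrow> p \<in> tf \<Longrightarrow> p \<in> Hom C E B \<Longrightarrow> v \<in> Hom C X B \<Longrightarrow>
      \<exists>h\<in>Hom C X E. Cmp C p h = v"
    and kernel_pair: "p \<in> tf \<Longrightarrow> p \<in> Hom C E B \<Longrightarrow>
      \<exists>P a b. a \<in> Hom C P E \<and> b \<in> Hom C P E \<and> a \<in> weq C \<and> b \<in> weq C \<and>
        (\<forall>Z. \<forall>u\<in>Hom C Z E. \<forall>v\<in>Hom C Z E. Cmp C p u = Cmp C p v \<longrightarrow>
          (\<exists>h\<in>Hom C Z P. Cmp C a h = u \<and> Cmp C b h = v))"
    and F_weq: "w \<in> Hom C X Y \<Longrightarrow> w \<in> weq C \<Longrightarrow> X \<in> cofs \<Longrightarrow> Y \<in> cofs \<Longrightarrow> FAr F w \<in> weq D"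
begin

abbreviation LF where "LF f \<equiv> FAr (loc D) (FAr F f)"

interpretation Ho: category_laws "Ho D" by (rule D.Ho_category)
interpretation HoC: category_laws "Ho C" by (rule C.Ho_category)

lemma locF: "is_functor C (Ho D) (func_comp (loc D) F)"
  using functor_compose[OF F D.loc_functor] .

lemma LF_Hom: "f \<in> Hom C X Y \<Longrightarrow> LF f \<in> Hom (Ho D) (FOb F X) (FOb F Y)"
  using functor_Hom[OF locF, of f X Y] by (simp add: func_comp_def)

lemma LF_Cmp: "f \<in> Hom C X Y \<Longrightarrow> g \<in> Hom C Y Z \<Longrightarrow> LF (Cmp C g f) = Cmp (Ho D) (LF g) (LF f)"
  using functor_Cmp[OF locF, of f X Y g Z] by (simp add: func_comp_def)

lemma LF_Idt: "X \<in> Ob C \<Longrightarrow> LF (Idt C X) = Idt (Ho D) (FOb F X)"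
  using functor_Idt[OF locF, of X] by (simp add: func_comp_def)

lemma LF_iso: "w \<in> Hom C X Y \<Longrightarrow> w \<in> weq C \<Longrightarrow> X \<in> cofs \<Longrightarrow> Y \<in> cofs \<Longrightarrow> is_isomorphism (Ho D) (LF w)"
  using D.loc_iso[OF F_weq] HomD[OF functor_Hom[OF F]] by blast

text \<open>Resolve the kernel pair of \<open>p\<close> by a cofibrant object \<open>P\<close>. The diagonal lifts to a common
  section of the two projections \<open>P \<rightarrow> Y\<close>, which \<open>F\<close> inverts up to weak equivalence; so the two
  projections have the same image in the homotopy category, and hence so have any two maps that
  factor through them.\<close>

lemma lifts_agree:
  assumes "X \<in> cofs" "Y \<in> cofs" "p \<in> tf" and p: "p \<in> Hom C Y B"
    and u: "u \<in> Hom C X Y" and v: "v \<in> Hom C X Y" and eq: "Cmp C p u = Cmp C p v"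
  shows "LF u = LF v"
proof -
  obtain P a b where a: "a \<in> Hom C P Y" "a \<in> weq C" and b: "b \<in> Hom C P Y" "b \<in> weq C"
    and univ: "\<And>Z u v. u \<in> Hom C Z Y \<Longrightarrow> v \<in> Hom C Z Y \<Longrightarrow> Cmp C p u = Cmp C p v \<Longrightarrow>
          \<exists>h\<in>Hom C Z P. Cmp C a h = u \<and> Cmp C b h = v"
    using kernel_pair[OF assms(3) p] by blast
  obtain Q r where Q: "Q \<in> cofs" and r: "r \<in> Hom C Q P" "r \<in> tf"
    using resolve C.Hom_Ob[OF a(1)] by blast
  have through: "\<exists>h\<in>Hom C Z Q. Cmp C (Cmp C a r) h = u' \<and> Cmp C (Cmp C b r) h = v'"
    if Z: "Z \<in> cofs" and u': "u' \<in> Hom C Z Y" and v': "v' \<in> Hom C Z Y"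
      and eq': "Cmp C p u' = Cmp C p v'" for Z u' v'
  proof -
    obtain k where k: "k \<in> Hom C Z P" "Cmp C a k = u'" "Cmp C b k = v'"
      using univ[OF u' v' eq'] by blast
    obtain h where "h \<in> Hom C Z Q" "Cmp C r h = k" using lift[OF Z r(2,1) k(1)] by blast
    then show ?thesis
      using k C.Cmp_assoc[OF _ r(1) a(1)] C.Cmp_assoc[OF _ r(1) b(1)] by metis
  qed
  define a' where "a' = Cmp C a r"
  define b' where "b' = Cmp C b r"
  have a': "a' \<in> Hom C Q Y" "a' \<in> weq C" and b': "b' \<in> Hom C Q Y" "b' \<in> weq C"
    using a b r tf_weq C.Cmp_Hom weq_Cmp unfolding a'_def b'_def by blast+
  have id: "Idt C Y \<in> Hom C Y Y" using C.Idt_Hom C.Hom_Ob[OF p] by blast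
  obtain d where d: "d \<in> Hom C Y Q" "Cmp C a' d = Idt C Y" "Cmp C b' d = Idt C Y"
    using through[OF assms(2) id id] unfolding a'_def b'_def by blast
  have iso: "is_isomorphism (Ho D) (LF a')" "is_isomorphism (Ho D) (LF b')"
    using LF_iso a' b' Q assms(2) by blast+
  have "Cmp (Ho D) (LF a') (LF d) = Idt (Ho D) (FOb F Y)"
    "Cmp (Ho D) (LF b') (LF d) = Idt (Ho D) (FOb F Y)"
    using LF_Cmp[OF d(1) a'(1)] LF_Cmp[OF d(1) b'(1)] d LF_Idt C.Hom_Ob[OF p] by simp_all
  note sec = this
  have "is_isomorphism (Ho D) (LF d)"
  proof -
    note i = inverse_arrow[OF iso(1) LF_Hom[OF a'(1)]]
    have "LF d = inverse_arrow (Ho D) (LF a')"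
      using Ho.iso_cancel_left[OF iso(1) LF_Hom[OF a'(1)] LF_Hom[OF d(1)] i(1)] sec(1) i(3) by simp
    then show ?thesis using Ho.iso_inverse[OF iso(1) LF_Hom[OF a'(1)]] by simp
  qed
  then have "LF a' = LF b'"
    using Ho.iso_cancel_right[OF _ LF_Hom[OF d(1)] LF_Hom[OF a'(1)] LF_Hom[OF b'(1)]] sec by simp
  moreover obtain h where "h \<in> Hom C X Q" "Cmp C a' h = u" "Cmp C b' h = v"
    using through[OF assms(1) u v eq] unfolding a'_def b'_def by blast
  ultimately show ?thesis using LF_Cmp a' b' by metis
qed

definition Q :: "'o1 \<Rightarrow> 'o1" where
  "Q X = (SOME Y. Y \<in> cofs \<and> (\<exists>q\<in>Hom C Y X. q \<in> tf))"

definition q :: "'o1 \<Rightarrow> 'm1" where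
  "q X = (SOME q. q \<in> Hom C (Q X) X \<and> q \<in> tf)"

lemma Q: assumes "X \<in> Ob C" shows "Q X \<in> cofs" "q X \<in> Hom C (Q X) X" "q X \<in> tf" "q X \<in> weq C"
proof -
  have "\<exists>Y. Y \<in> cofs \<and> (\<exists>q\<in>Hom C Y X. q \<in> tf)" using resolve[OF assms] by blast
  from someI_ex[OF this] have *: "Q X \<in> cofs" "\<exists>q. q \<in> Hom C (Q X) X \<and> q \<in> tf"
    unfolding Q_def[symmetric] by blast+
  from someI_ex[OF *(2)] *(1) show "Q X \<in> cofs" "q X \<in> Hom C (Q X) X" "q X \<in> tf" "q X \<in> weq C"
    unfolding q_def[symmetric] using tf_weq by auto
qed

definition Qar :: "'m1 \<Rightarrow> 'm1" where
  "Qar f = (SOME h. h \<in> Hom C (Q (Dom C f)) (Q (Cod C f)) \<and>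
     Cmp C (q (Cod C f)) h = Cmp C f (q (Dom C f)))"

lemma Qar:
  assumes f: "f \<in> Hom C X Y"
  shows "Qar f \<in> Hom C (Q X) (Q Y)" "Cmp C (q Y) (Qar f) = Cmp C f (q X)"
proof -
  note ob = C.Hom_Ob[OF f]
  have "\<exists>h. h \<in> Hom C (Q X) (Q Y) \<and> Cmp C (q Y) h = Cmp C f (q X)"
    using lift[OF Q(1)[of X] Q(3,2)[of Y] C.Cmp_Hom[OF Q(2)[of X] f]] ob by blast
  from someI_ex[OF this] show "Qar f \<in> Hom C (Q X) (Q Y)" "Cmp C (q Y) (Qar f) = Cmp C f (q X)"
    using f unfolding Qar_def by (auto simp: Hom_def)
qed

text \<open>Any two lifts of a map to replacements agree after localization, which makes \<open>replaced\<close> a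
  functor although its values are arbitrary choices.\<close>

lemma LF_Qar_unique:
  assumes f: "f \<in> Hom C X Y" and h: "h \<in> Hom C (Q X) (Q Y)" "Cmp C (q Y) h = Cmp C f (q X)"
  shows "LF h = LF (Qar f)"
  using lifts_agree[OF Q(1) Q(1) Q(3,2) h(1) Qar(1)[OF f]] C.Hom_Ob[OF f] h(2) Qar(2)[OF f] by simp

definition replaced :: "('o1, 'm1, 'o2, ('o2, 'm2 step list set) arrow) func" where
  "replaced = \<lparr>FOb = (\<lambda>X. FOb F (Q X)), FAr = (\<lambda>f. LF (Qar f))\<rparr>"

lemma replaced_functor: "is_functor C (Ho D) replaced"
  unfolding is_functor_def
proof (intro conjI ballI impI)
  fix X assume X: "X \<in> Ob C"
  have QX: "Q X \<in> Ob C" using Q(1)[OF X] cofs_Ob by blast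
  show "FOb replaced X \<in> Ob (Ho D)" using functor_Ob[OF F QX] by (simp add: replaced_def)
  have "LF (Idt C (Q X)) = LF (Qar (Idt C X))"
    by (rule LF_Qar_unique[OF C.Idt_Hom[OF X] C.Idt_Hom[OF QX]])
       (simp add: C.Idt_left[OF Q(2)[OF X]] C.Idt_right[OF Q(2)[OF X]])
  then show "FAr replaced (Idt C X) = Idt (Ho D) (FOb replaced X)"
    using LF_Idt[OF QX] by (simp add: replaced_def)
next
  fix f assume "f \<in> Ar C"
  from LF_Hom[OF Qar(1)[OF HomI[OF this]]]
  show "FAr replaced f \<in> Hom (Ho D) (FOb replaced (Dom C f)) (FOb replaced (Cod C f))"
    by (simp add: replaced_def)
next
  fix f g assume "f \<in> Ar C" "g \<in> Ar C" "Cod C f = Dom C g"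
  then have f: "f \<in> Hom C (Dom C f) (Dom C g)" and g: "g \<in> Hom C (Dom C g) (Cod C g)"
    by (simp_all add: Hom_def)
  note qf = Qar[OF f] and qg = Qar[OF g]
  have D: "Dom C f \<in> Ob C" "Dom C g \<in> Ob C" "Cod C g \<in> Ob C"
    using C.Hom_Ob[OF f] C.Hom_Ob[OF g] by auto
  have "LF (Cmp C (Qar g) (Qar f)) = LF (Qar (Cmp C g f))"
  proof (rule LF_Qar_unique[OF C.Cmp_Hom[OF f g] C.Cmp_Hom[OF qf(1) qg(1)]])
    have "Cmp C (q (Cod C g)) (Cmp C (Qar g) (Qar f)) = Cmp C (Cmp C g (q (Dom C g))) (Qar f)"
      using C.Cmp_assoc[OF qf(1) qg(1) Q(2)[OF D(3)]] qg(2) by simp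
    also have "\<dots> = Cmp C g (Cmp C f (q (Dom C f)))"
      using C.Cmp_assoc[OF qf(1) Q(2)[OF D(2)] g] qf(2) by simp
    finally show "Cmp C (q (Cod C g)) (Cmp C (Qar g) (Qar f)) = Cmp C (Cmp C g f) (q (Dom C f))"
      using C.Cmp_assoc[OF Q(2)[OF D(1)] f g] by simp
  qed
  then show "FAr replaced (Cmp C g f) = Cmp (Ho D) (FAr replaced g) (FAr replaced f)"
    using LF_Cmp[OF qf(1) qg(1)] by (simp add: replaced_def)
qed

lemma replaced_inverts:
  assumes "w \<in> weq C" "w \<in> Ar C" shows "is_isomorphism (Ho D) (FAr replaced w)"
proof -
  note w = HomI[OF assms(2)]
  note X = C.Hom_Ob[OF w]
  have "Cmp C (q (Cod C w)) (Qar w) \<in> weq C"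
    using weq_Cmp[OF Q(2) w Q(4) assms(1)] X Qar(2)[OF w] by simp
  then have "Qar w \<in> weq C" using weq_cancel[OF Qar(1)[OF w] Q(2,4)] X by blast
  then show ?thesis using LF_iso[OF Qar(1)[OF w] _ Q(1) Q(1)] X by (simp add: replaced_def)
qed

text \<open>By two-out-of-three, a lift of a weak equivalence is a weak equivalence between objects of
  \<open>cofs\<close>; so the replaced functor descends to the homotopy category.\<close>

sublocale R: inverting_functor C "Ho D" replaced
  by unfold_locales (use D.Ho_category replaced_functor replaced_inverts in
    \<open>auto intro: category_laws.Dom_Ob category_laws.Cod_Ob category_laws.Idt_Hom category_laws.Cmp_Hom
      category_laws.Idt_left category_laws.Idt_right category_laws.Cmp_assoc\<close>)

definition derived :: "('o1, ('o1, 'm1 step list set) arrow, 'o2, ('o2, 'm2 step list set) arrow) func"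
  where "derived = R.ext"

definition comparison :: "'o1 \<Rightarrow> ('o2, 'm2 step list set) arrow" where
  "comparison = (\<lambda>X\<in>Ob C. LF (q X))"

lemma FOb_derived [simp]: "FOb derived X = FOb F (Q X)"
  unfolding derived_def R.FOb_ext by (simp add: replaced_def)

lemma derived_functor: "is_functor (Ho C) (Ho D) derived"
  unfolding derived_def by (rule R.ext_functor)

lemma derived_loc: "f \<in> Hom C X Y \<Longrightarrow> FAr derived (FAr (loc C) f) = LF (Qar f)"
  unfolding derived_def by (simp only: R.ext_loc) (simp add: replaced_def)

lemma comparison_Hom: "X \<in> Ob C \<Longrightarrow> comparison X \<in> Hom (Ho D) (FOb F (Q X)) (FOb F X)"
  using LF_Hom[OF Q(2)] by (simp add: comparison_def)

lemma comparison_iso: "X \<in> cofs \<Longrightarrow> is_isomorphism (Ho D) (comparison X)"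
  using LF_iso[OF Q(2,4) Q(1)] cofs_Ob by (auto simp: comparison_def)

lemma derived_compose: "is_functor C (Ho D) (func_comp derived (loc C))"
  using functor_compose[OF C.loc_functor derived_functor] .

lemma comparison_natural:
  assumes f: "f \<in> Hom C X Y"
  shows "Cmp (Ho D) (comparison Y) (LF (Qar f)) = Cmp (Ho D) (LF f) (comparison X)"
  using LF_Cmp[OF Qar(1)[OF f] Q(2)] LF_Cmp[OF Q(2) f] Qar(2)[OF f] C.Hom_Ob[OF f]
  by (simp add: comparison_def)

lemma comparison_nat_trans:
  "nat_trans C (Ho D) (func_comp derived (loc C)) (func_comp (loc D) F) comparison"
  unfolding nat_trans_def
proof (intro conjI ballI derived_compose locF)
  show "comparison \<in> extensional (Ob C)" by (simp add: comparison_def)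
next
  fix X assume "X \<in> Ob C"
  from comparison_Hom[OF this]
  show "comparison X \<in> Hom (Ho D) (FOb (func_comp derived (loc C)) X) (FOb (func_comp (loc D) F) X)"
    by (simp add: func_comp_def)
next
  fix f assume "f \<in> Ar C"
  note f = HomI[OF this]
  show "Cmp (Ho D) (comparison (Cod C f)) (FAr (func_comp derived (loc C)) f) =
         Cmp (Ho D) (FAr (func_comp (loc D) F) f) (comparison (Dom C f))"
    using comparison_natural[OF f] derived_loc[OF f] by (simp add: func_comp_def)
qed

text \<open>A transformation \<open>s\<close> from \<open>G\<close> is forced on replacements, where the comparison is invertible,
  and is then transported to \<open>X\<close> along the isomorphism \<open>G (q X)\<close>: its factorization at \<open>X\<close> has to be
  \<open>s (Q X)\<close> after the inverse of \<open>G (q X)\<close>.\<close>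

theorem total_left_derived: "total_left_derived C D F derived comparison"
  unfolding total_left_derived_def
proof (intro conjI F derived_functor comparison_nat_trans allI impI)
  fix G s
  assume "is_functor (Ho C) (Ho D) G \<and>
    nat_trans C (Ho D) (func_comp G (loc C)) (func_comp (loc D) F) s"
  then have G: "is_functor (Ho C) (Ho D) G"
    and s: "nat_trans C (Ho D) (func_comp G (loc C)) (func_comp (loc D) F) s" by auto
  have s_Hom: "s X \<in> Hom (Ho D) (FOb G X) (FOb F X)" if "X \<in> Ob C" for X
    using s that unfolding nat_trans_def by (simp add: func_comp_def)
  define g where "g = (\<lambda>f. FAr G (FAr (loc C) f))"
  have g_Hom: "g f \<in> Hom (Ho D) (FOb G X) (FOb G Y)" if "f \<in> Hom C X Y" for f X Y
    using functor_Hom[OF functor_compose[OF C.loc_functor G] that] by (simp add: func_comp_def g_def)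
  have g_Cmp: "g (Cmp C k f) = Cmp (Ho D) (g k) (g f)" if "f \<in> Hom C X Y" "k \<in> Hom C Y Z" for f k X Y Z
    using functor_Cmp[OF functor_compose[OF C.loc_functor G] that] by (simp add: func_comp_def g_def)
  have g_iso: "is_isomorphism (Ho D) (g w)" if "w \<in> weq C" "w \<in> Hom C X Y" for w X Y
    using functor_iso[OF C.Ho_category G C.loc_iso] that unfolding g_def Hom_def by blast
  have s_nat: "Cmp (Ho D) (s Y) (g f) = Cmp (Ho D) (LF f) (s X)" if "f \<in> Hom C X Y" for f X Y
    using s HomD[OF that] unfolding nat_trans_def by (auto simp: func_comp_def g_def)
  define i where "i X = inverse_arrow (Ho D) (g (q X))" for X
  have i: "i X \<in> Hom (Ho D) (FOb G X) (FOb G (Q X))"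
     "Cmp (Ho D) (i X) (g (q X)) = Idt (Ho D) (FOb G (Q X))"
     "Cmp (Ho D) (g (q X)) (i X) = Idt (Ho D) (FOb G X)" if "X \<in> Ob C" for X
    using inverse_arrow[OF g_iso[OF Q(4,2)] g_Hom[OF Q(2)]] that unfolding i_def by auto
  define s' where "s' = (\<lambda>X\<in>Ob C. Cmp (Ho D) (s (Q X)) (i X))"
  have QOb: "Q X \<in> Ob C" if "X \<in> Ob C" for X using Q(1)[OF that] cofs_Ob by blast
  have s'_Hom: "s' X \<in> Hom (Ho D) (FOb G X) (FOb derived X)" if "X \<in> Ob C" for X
    using Ho.Cmp_Hom[OF i(1)[OF that] s_Hom[OF QOb[OF that]]] that by (simp add: s'_def)
  show "\<exists>!s'. nat_trans (Ho C) (Ho D) G derived s' \<and>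
         (\<forall>X\<in>Ob C. s X = Cmp (Ho D) (comparison X) (s' (FOb (loc C) X)))"
  proof (rule ex1I[of _ s'], rule conjI)
    show "nat_trans (Ho C) (Ho D) G derived s'"
    proof (rule C.nat_trans_HoI[OF D.Ho_category G derived_functor])
      show "s' \<in> extensional (Ob C)" by (simp add: s'_def)
      fix f X Y assume f: "f \<in> Hom C X Y"
      then have X: "X \<in> Ob C" and Y: "Y \<in> Ob C" using C.Hom_Ob by auto
      note qX = Q(2)[OF X] and qY = Q(2)[OF Y] and qf = Qar[OF f]
      have sq: "Cmp (Ho D) (i Y) (g f) = Cmp (Ho D) (g (Qar f)) (i X)"
      proof (rule Ho.iso_cancel_left[OF g_iso[OF Q(4)[OF Y] qY] g_Hom[OF qY]])
        show "Cmp (Ho D) (i Y) (g f) \<in> Hom (Ho D) (FOb G X) (FOb G (Q Y))"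
          "Cmp (Ho D) (g (Qar f)) (i X) \<in> Hom (Ho D) (FOb G X) (FOb G (Q Y))"
          using Ho.Cmp_Hom g_Hom[OF f] g_Hom[OF qf(1)] i(1) X Y by blast+
        have "Cmp (Ho D) (g (q Y)) (Cmp (Ho D) (i Y) (g f)) = g f"
          using Ho.Cmp_assoc[OF g_Hom[OF f] i(1)[OF Y] g_Hom[OF qY]] i(3)[OF Y]
            Ho.Idt_left[OF g_Hom[OF f]] by simp
        also have "\<dots> = Cmp (Ho D) (Cmp (Ho D) (g f) (g (q X))) (i X)"
          using Ho.Cmp_assoc[OF i(1)[OF X] g_Hom[OF qX] g_Hom[OF f]] i(3)[OF X]
            Ho.Idt_right[OF g_Hom[OF f]] by simp
        also have "\<dots> = Cmp (Ho D) (Cmp (Ho D) (g (q Y)) (g (Qar f))) (i X)"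
          using g_Cmp[OF qX f] g_Cmp[OF qf(1) qY] qf(2) by simp
        also have "\<dots> = Cmp (Ho D) (g (q Y)) (Cmp (Ho D) (g (Qar f)) (i X))"
          using Ho.Cmp_assoc[OF i(1)[OF X] g_Hom[OF qf(1)] g_Hom[OF qY]] .
        finally show "Cmp (Ho D) (g (q Y)) (Cmp (Ho D) (i Y) (g f)) =
          Cmp (Ho D) (g (q Y)) (Cmp (Ho D) (g (Qar f)) (i X))" .
      qed
      have "Cmp (Ho D) (s' Y) (g f) = Cmp (Ho D) (s (Q Y)) (Cmp (Ho D) (g (Qar f)) (i X))"
        using Ho.Cmp_assoc[OF g_Hom[OF f] i(1)[OF Y] s_Hom[OF QOb[OF Y]]] sq Y by (simp add: s'_def)
      also have "\<dots> = Cmp (Ho D) (Cmp (Ho D) (LF (Qar f)) (s (Q X))) (i X)"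
        using Ho.Cmp_assoc[OF i(1)[OF X] g_Hom[OF qf(1)] s_Hom[OF QOb[OF Y]]] s_nat[OF qf(1)] by simp
      also have "\<dots> = Cmp (Ho D) (LF (Qar f)) (s' X)"
        using Ho.Cmp_assoc[OF i(1)[OF X] s_Hom[OF QOb[OF X]] LF_Hom[OF qf(1)]] X by (simp add: s'_def)
      finally show "Cmp (Ho D) (s' Y) (FAr G (FAr (loc C) f)) =
          Cmp (Ho D) (FAr derived (FAr (loc C) f)) (s' X)"
        by (simp add: derived_loc[OF f] g_def)
    qed (use s'_Hom in auto)
    show "\<forall>X\<in>Ob C. s X = Cmp (Ho D) (comparison X) (s' (FOb (loc C) X))"
    proof
      fix X assume X: "X \<in> Ob C"
      note qX = Q(2)[OF X]
      have "Cmp (Ho D) (comparison X) (s' X) = Cmp (Ho D) (Cmp (Ho D) (LF (q X)) (s (Q X))) (i X)"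
        using Ho.Cmp_assoc[OF i(1)[OF X] s_Hom[OF QOb[OF X]] LF_Hom[OF qX]] X
        by (simp add: comparison_def s'_def)
      also have "\<dots> = Cmp (Ho D) (s X) (Cmp (Ho D) (g (q X)) (i X))"
        using s_nat[OF qX] Ho.Cmp_assoc[OF i(1)[OF X] g_Hom[OF qX] s_Hom[OF X]] by simp
      also have "\<dots> = s X" using i(3)[OF X] Ho.Idt_right[OF s_Hom[OF X]] by simp
      finally show "s X = Cmp (Ho D) (comparison X) (s' (FOb (loc C) X))" by simp
    qed
  next
    fix r
    assume "nat_trans (Ho C) (Ho D) G derived r \<and>
      (\<forall>X\<in>Ob C. s X = Cmp (Ho D) (comparison X) (r (FOb (loc C) X)))"
    then have r: "nat_trans (Ho C) (Ho D) G derived r"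
      and sr: "\<And>X. X \<in> Ob C \<Longrightarrow> s X = Cmp (Ho D) (comparison X) (r X)" by auto
    have r_Hom: "r X \<in> Hom (Ho D) (FOb G X) (FOb F (Q X))" if "X \<in> Ob C" for X
      using r that unfolding nat_trans_def by auto
    have r_nat: "Cmp (Ho D) (r Y) (g f) = Cmp (Ho D) (LF (Qar f)) (r X)" if "f \<in> Hom C X Y" for f X Y
      using r HomD[OF functor_Hom[OF C.loc_functor that]] derived_loc[OF that]
      unfolding nat_trans_def g_def by auto
    have s'_r: "s' X = r X" if X: "X \<in> Ob C" for X
    proof -
      note qX = Q(2)[OF X]
      have "s' X = Cmp (Ho D) (Cmp (Ho D) (comparison (Q X)) (r (Q X))) (i X)"
        using sr[OF QOb[OF X]] X by (simp add: s'_def)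
      also have "comparison (Q X) = LF (Qar (q X))"
        \<comment> \<open>both \<open>q (Q X)\<close> and the lift of \<open>q X\<close> become equal after composition with \<open>q X\<close>\<close>
        using lifts_agree[OF Q(1) Q(1) Q(3,2) Q(2) Qar(1)[OF qX]] Qar(2)[OF qX] QOb[OF X] X
        by (simp add: comparison_def)
      also have "Cmp (Ho D) (Cmp (Ho D) (LF (Qar (q X))) (r (Q X))) (i X) = r X"
        using r_nat[OF qX] Ho.Cmp_assoc[OF i(1)[OF X] g_Hom[OF qX] r_Hom[OF X]] i(3)[OF X]
          Ho.Idt_right[OF r_Hom[OF X]] by simp
      finally show ?thesis .
    qed
    show "r = s'"
      using r s'_r unfolding nat_trans_def by (intro extensionalityI[of _ "Ob C"]) (auto simp: s'_def)
  qed
qed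

text \<open>The derived functor inverts the weak equivalence \<open>r\<close>, and the comparison is invertible at the
  object \<open>Y\<close> of \<open>cofs\<close>; so \<open>F Y\<close> computes the value at \<open>X\<close>.\<close>

lemma derived_value:
  assumes Y: "Y \<in> cofs" and r: "r \<in> Hom C Y X" "r \<in> weq C"
  shows "\<exists>\<phi>\<in>Hom (Ho D) (FOb derived X) (FOb F Y). is_isomorphism (Ho D) \<phi> \<and>
     Cmp (Ho D) \<phi> (FAr derived (FAr (loc C) r)) = comparison Y"
proof -
  define d where "d = FAr derived (FAr (loc C) r)"
  have Ob: "X \<in> Ob C" "Y \<in> Ob C" using C.Hom_Ob[OF r(1)] by auto
  have d: "d \<in> Hom (Ho D) (FOb derived Y) (FOb derived X)"
    using functor_Hom[OF derived_functor functor_Hom[OF C.loc_functor r(1)]] by (simp add: d_def)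
  have iso: "is_isomorphism (Ho D) d"
    using functor_iso[OF C.Ho_category derived_functor C.loc_iso[OF r(2)]] HomD[OF r(1)]
    by (simp add: d_def)
  note i = inverse_arrow[OF iso d] and c = comparison_Hom[OF Ob(2), folded FOb_derived]
  let ?\<phi> = "Cmp (Ho D) (comparison Y) (inverse_arrow (Ho D) d)"
  have "Cmp (Ho D) ?\<phi> d = comparison Y"
    using Ho.Cmp_assoc[OF d i(1) c] i(2) Ho.Idt_right[OF c] by simp
  moreover have "?\<phi> \<in> Hom (Ho D) (FOb derived X) (FOb F Y)" using Ho.Cmp_Hom[OF i(1) c] .
  moreover have "is_isomorphism (Ho D) ?\<phi>"
    using Ho.iso_Cmp[OF Ho.iso_inverse[OF iso d] i(1) comparison_iso[OF Y] c] .
  ultimately show ?thesis unfolding d_def by blast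
qed

end

section \<open>Cofibrant objects of an arrow category\<close>

lemma Mor_simps [simp]: "Ob (Mor C) = Ar C" "Dom (Mor C) = src" "Cod (Mor C) = tgt"
  "Idt (Mor C) = (\<lambda>f. \<lparr>src = f, lab = (Idt C (Dom C f), Idt C (Cod C f)), tgt = f\<rparr>)"
  "Cmp (Mor C) = (\<lambda>v u. \<lparr>src = src u,
     lab = (Cmp C (fst (lab v)) (fst (lab u)), Cmp C (snd (lab v)) (snd (lab u))), tgt = tgt v\<rparr>)"
  by (simp_all add: Mor_def Let_def)

definition square :: "'m \<Rightarrow> 'm \<Rightarrow> 'm \<Rightarrow> 'm \<Rightarrow> ('m, 'm \<times> 'm) arrow" where
  "square f a b g = \<lparr>src = f, lab = (a, b), tgt = g\<rparr>"

lemma square_simps [simp]: "src (square f a b g) = f" "tgt (square f a b g) = g"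
  "lab (square f a b g) = (a, b)" "square f a b g = square f' a' b' g' \<longleftrightarrow> f = f' \<and> a = a' \<and> b = b' \<and> g = g'"
  by (auto simp: square_def)

lemma Cmp_square [simp]:
  "Cmp (Mor C) (square g c d h) (square f a b g) = square f (Cmp C c a) (Cmp C d b) h"
  by (simp add: square_def)

lemma Mor_Hom: "u \<in> Hom (Mor C) f g \<longleftrightarrow> f \<in> Ar C \<and> g \<in> Ar C \<and>
   (\<exists>a b. u = square f a b g \<and> a \<in> Hom C (Dom C f) (Dom C g) \<and> b \<in> Hom C (Cod C f) (Cod C g) \<and>
     Cmp C g a = Cmp C b f)"
  by (cases u) (auto simp: Hom_def Mor_def Let_def square_def)

lemma square_Hom: "square f a b g \<in> Hom (Mor C) f g \<longleftrightarrow> f \<in> Ar C \<and> g \<in> Ar C \<and>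
   a \<in> Hom C (Dom C f) (Dom C g) \<and> b \<in> Hom C (Cod C f) (Cod C g) \<and> Cmp C g a = Cmp C b f"
  by (auto simp: Mor_Hom)

lemma Mor_weq: "square f a b g \<in> Hom (Mor C) f g \<Longrightarrow>
   square f a b g \<in> weq (Mor C) \<longleftrightarrow> a \<in> weq C \<and> b \<in> weq C"
  by (auto simp: Mor_def Let_def Hom_def)

lemma (in rel_category) Mor_category: "rel_category (Mor C)"
proof
  fix f assume "f \<in> Ar (Mor C)"
  then show "Dom (Mor C) f \<in> Ob (Mor C)" "Cod (Mor C) f \<in> Ob (Mor C)"
    by (auto simp: Mor_def Let_def)
next
  fix f assume "f \<in> Ob (Mor C)"
  then have f: "f \<in> Hom C (Dom C f) (Cod C f)" by (simp add: HomI)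
  then show "Idt (Mor C) f \<in> Hom (Mor C) f f"
    using Idt_left[OF f] Idt_right[OF f] Hom_Ob[OF f] Idt_Hom
    unfolding square_def[symmetric] Mor_simps square_Hom by (auto simp: Hom_def)
next
  fix u v f g h assume "u \<in> Hom (Mor C) f g" "v \<in> Hom (Mor C) g h"
  then obtain a b c d where *: "u = square f a b g" "v = square g c d h" "f \<in> Ar C" "g \<in> Ar C" "h \<in> Ar C"
    "a \<in> Hom C (Dom C f) (Dom C g)" "b \<in> Hom C (Cod C f) (Cod C g)"
    "c \<in> Hom C (Dom C g) (Dom C h)" "d \<in> Hom C (Cod C g) (Cod C h)"
    "Cmp C g a = Cmp C b f" "Cmp C h c = Cmp C d g" by (auto simp: Mor_Hom)
  note f = HomI[OF *(3)] and g = HomI[OF *(4)] and h = HomI[OF *(5)]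
  have "Cmp C h (Cmp C c a) = Cmp C (Cmp C d b) f"
    using Cmp_assoc[OF *(6,8) h] Cmp_assoc[OF *(6) g *(9)] Cmp_assoc[OF f *(7,9)] *(10,11) by simp
  then show "Cmp (Mor C) v u \<in> Hom (Mor C) f h"
    unfolding *(1,2) Cmp_square square_Hom using * Cmp_Hom by blast
next
  fix u f g assume "u \<in> Hom (Mor C) f g"
  then obtain a b where *: "u = square f a b g" "f \<in> Ar C" "g \<in> Ar C"
    "a \<in> Hom C (Dom C f) (Dom C g)" "b \<in> Hom C (Cod C f) (Cod C g)" by (auto simp: Mor_Hom)
  show "Cmp (Mor C) (Idt (Mor C) g) u = u" "Cmp (Mor C) u (Idt (Mor C) f) = u"
    using Idt_left[OF *(4)] Idt_left[OF *(5)] Idt_right[OF *(4)] Idt_right[OF *(5)]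
    unfolding *(1) by (simp_all add: square_def)
next
  fix u v w e f g h
  assume "u \<in> Hom (Mor C) e f" "v \<in> Hom (Mor C) f g" "w \<in> Hom (Mor C) g h"
  then obtain a b c d p r where *: "u = square e a b f" "v = square f c d g" "w = square g p r h"
    "a \<in> Hom C (Dom C e) (Dom C f)" "b \<in> Hom C (Cod C e) (Cod C f)"
    "c \<in> Hom C (Dom C f) (Dom C g)" "d \<in> Hom C (Cod C f) (Cod C g)"
    "p \<in> Hom C (Dom C g) (Dom C h)" "r \<in> Hom C (Cod C g) (Cod C h)" unfolding Mor_Hom by blast
  show "Cmp (Mor C) (Cmp (Mor C) w v) u = Cmp (Mor C) w (Cmp (Mor C) v u)"
    unfolding *(1-3) Cmp_square using Cmp_assoc[OF *(4,6,8)] Cmp_assoc[OF *(5,7,9)] by simp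
qed

text \<open>The part of a model structure from which functors on the arrow category can be derived.\<close>

locale resolution_model = rel_category M for M :: "('o, 'm, 'z) model_scheme" +
  assumes weq_Ar: "weq M \<subseteq> Ar M"
    and cof_iff: "i \<in> cof M \<longleftrightarrow> i \<in> Ar M \<and> has_llp M i (weq M \<inter> fib M)"
    and weq_Cmp: "f \<in> Hom M X Y \<Longrightarrow> g \<in> Hom M Y Z \<Longrightarrow> f \<in> weq M \<Longrightarrow> g \<in> weq M \<Longrightarrow> Cmp M g f \<in> weq M"
    and weq_cancel: "f \<in> Hom M X Y \<Longrightarrow> g \<in> Hom M Y Z \<Longrightarrow> g \<in> weq M \<Longrightarrow> Cmp M g f \<in> weq M \<Longrightarrow> f \<in> weq M"
    and factor: "f \<in> Hom M X Y \<Longrightarrow> \<exists>Z. \<exists>i\<in>Hom M X Z. \<exists>p\<in>Hom M Z Y.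
      i \<in> cof M \<and> p \<in> weq M \<and> p \<in> fib M \<and> Cmp M p i = f"
    and kernel_pair: "p \<in> Hom M E B \<Longrightarrow> p \<in> weq M \<Longrightarrow> p \<in> fib M \<Longrightarrow>
      \<exists>P. \<exists>a\<in>Hom M P E. \<exists>b\<in>Hom M P E. a \<in> weq M \<and> b \<in> weq M \<and> Cmp M p a = Cmp M p b \<and>
        (\<forall>Z. \<forall>u\<in>Hom M Z E. \<forall>v\<in>Hom M Z E. Cmp M p u = Cmp M p v \<longrightarrow>
          (\<exists>!h. h \<in> Hom M Z P \<and> Cmp M a h = u \<and> Cmp M b h = v))"
    and initial: "\<exists>I. initial_object M I"
begin

abbreviation TF where "TF \<equiv> weq M \<inter> fib M"

lemma cof_lift:
  assumes "i \<in> cof M" "i \<in> Hom M A X" "p \<in> TF" "p \<in> Hom M E B" "u \<in> Hom M A E" "v \<in> Hom M X B"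
    "Cmp M p u = Cmp M v i"
  shows "\<exists>h\<in>Hom M X E. Cmp M h i = u \<and> Cmp M p h = v"
  using assms cof_iff unfolding has_llp_def by (auto simp: Hom_def)

lemma cofI:
  assumes i: "i \<in> Hom M A X"
    and "\<And>p E B u v. p \<in> TF \<Longrightarrow> p \<in> Hom M E B \<Longrightarrow> u \<in> Hom M A E \<Longrightarrow> v \<in> Hom M X B \<Longrightarrow>
      Cmp M p u = Cmp M v i \<Longrightarrow> \<exists>h\<in>Hom M X E. Cmp M h i = u \<and> Cmp M p h = v"
  shows "i \<in> cof M"
  unfolding cof_iff has_llp_def using assms weq_Ar by (auto simp: Hom_def)

lemma cof_Cmp:
  assumes i: "i \<in> Hom M A X" "i \<in> cof M" and j: "j \<in> Hom M X Y" "j \<in> cof M"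
  shows "Cmp M j i \<in> cof M"
proof (rule cofI[OF Cmp_Hom[OF i(1) j(1)]])
  fix p E B u v
  assume p: "p \<in> TF" "p \<in> Hom M E B" and u: "u \<in> Hom M A E" and v: "v \<in> Hom M Y B"
    and eq: "Cmp M p u = Cmp M v (Cmp M j i)"
  obtain h where h: "h \<in> Hom M X E" "Cmp M h i = u" "Cmp M p h = Cmp M v j"
    using cof_lift[OF i(2,1) p u Cmp_Hom[OF j(1) v]] eq Cmp_assoc[OF i(1) j(1) v] by auto
  obtain k where k: "k \<in> Hom M Y E" "Cmp M k j = h" "Cmp M p k = v"
    using cof_lift[OF j(2,1) p h(1) v h(3)] by auto
  show "\<exists>h\<in>Hom M Y E. Cmp M h (Cmp M j i) = u \<and> Cmp M p h = v"
    using k h Cmp_assoc[OF i(1) j(1) k(1)] by auto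
qed

lemma cofibrant_cod: "cofibrant M A \<Longrightarrow> i \<in> Hom M A X \<Longrightarrow> i \<in> cof M \<Longrightarrow> cofibrant M X"
  unfolding cofibrant_def using cof_Cmp Cmp_Hom by blast

lemma cofibrant_lift:
  assumes X: "cofibrant M X" and p: "p \<in> TF" "p \<in> Hom M E B" and v: "v \<in> Hom M X B"
  shows "\<exists>h\<in>Hom M X E. Cmp M p h = v"
proof -
  obtain I i where I: "initial_object M I" and i: "i \<in> Hom M I X" "i \<in> cof M"
    using X unfolding cofibrant_def by blast
  obtain u where u: "u \<in> Hom M I E" using I Hom_Ob[OF p(2)] unfolding initial_object_def by blast
  have "Cmp M p u = Cmp M v i"
    using I Hom_Ob[OF p(2)] Cmp_Hom[OF u p(2)] Cmp_Hom[OF i(1) v]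
    unfolding initial_object_def by blast
  then show ?thesis using cof_lift[OF i(2,1) p u v] by blast
qed

lemma resolution_exists: "X \<in> Ob M \<Longrightarrow> \<exists>p. cofibrant_resolution M X p"
proof -
  assume X: "X \<in> Ob M"
  obtain I where I: "initial_object M I" using initial by blast
  obtain j where j: "j \<in> Hom M I X" using I X unfolding initial_object_def by blast
  obtain Z i p where *: "i \<in> Hom M I Z" "p \<in> Hom M Z X" "i \<in> cof M" "p \<in> weq M" "p \<in> fib M"
    using factor[OF j] by blast
  then have "cofibrant M Z" unfolding cofibrant_def using I by blast
  then have "cofibrant_resolution M X p"
    using * HomD[OF *(2)] by (simp add: cofibrant_resolution_def)
  then show ?thesis ..
qed

text \<open>The cofibrant objects of the arrow category: for a square out of the initial arrow, the
  condition on sources says that \<open>A\<close> is cofibrant, and the condition on the pushout that \<open>A \<rightarrow> B\<close> is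
  a cofibration.\<close>

definition Mor_cofs :: "'m set" where
  "Mor_cofs = {i \<in> cof M. i \<in> Ar M \<and> cofibrant M (Dom M i)}"

definition Mor_tf :: "('m, 'm \<times> 'm) arrow set" where
  "Mor_tf = {u \<in> Ar (Mor M). fst (lab u) \<in> TF \<and> snd (lab u) \<in> TF}"

lemma Mor_resolve:
  assumes f: "f \<in> Ar M" shows "\<exists>i\<in>Mor_cofs. \<exists>u\<in>Hom (Mor M) i f. u \<in> Mor_tf"
proof -
  obtain p where p: "cofibrant_resolution M (Dom M f) p"
    using resolution_exists Dom_Ob[OF f] by blast
  then have p': "p \<in> Hom M (Dom M p) (Dom M f)" "p \<in> TF" "cofibrant M (Dom M p)"
    by (auto simp: cofibrant_resolution_def Hom_def)
  obtain Z i r where "i \<in> Hom M (Dom M p) Z" "r \<in> Hom M Z (Cod M f)" "i \<in> cof M" "r \<in> TF"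
    "Cmp M r i = Cmp M f p"
    using factor[OF Cmp_Hom[OF p'(1) HomI[OF f]]] by blast
  then have "square i p r f \<in> Hom (Mor M) i f" "square i p r f \<in> Mor_tf" "i \<in> Mor_cofs"
    using f p' by (auto simp: square_Hom Mor_tf_def Mor_cofs_def Hom_def Mor_def Let_def)
  then show ?thesis by blast
qed

text \<open>Lift on the sources first; the lift on the targets then extends the lift already chosen.\<close>

lemma Mor_lift:
  assumes i: "i \<in> Mor_cofs" and p: "p \<in> Mor_tf" "p \<in> Hom (Mor M) e b" and v: "v \<in> Hom (Mor M) i b"
  shows "\<exists>h\<in>Hom (Mor M) i e. Cmp (Mor M) p h = v"
proof -
  obtain p1 p2 where pp: "p = square e p1 p2 b" "e \<in> Ar M" "b \<in> Ar M" "p1 \<in> Hom M (Dom M e) (Dom M b)"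
    "p2 \<in> Hom M (Cod M e) (Cod M b)" "Cmp M b p1 = Cmp M p2 e" using p(2) by (auto simp: Mor_Hom)
  have tf: "p1 \<in> TF" "p2 \<in> TF" using p(1) by (auto simp: Mor_tf_def pp(1))
  obtain v1 v2 where vv: "v = square i v1 v2 b" "i \<in> Ar M" "v1 \<in> Hom M (Dom M i) (Dom M b)"
    "v2 \<in> Hom M (Cod M i) (Cod M b)" "Cmp M b v1 = Cmp M v2 i" using v by (auto simp: Mor_Hom)
  obtain h1 where h1: "h1 \<in> Hom M (Dom M i) (Dom M e)" "Cmp M p1 h1 = v1"
    using cofibrant_lift[OF _ tf(1) pp(4) vv(3)] i by (auto simp: Mor_cofs_def)
  note e = HomI[OF pp(2)] and b = HomI[OF pp(3)]
  have "Cmp M p2 (Cmp M e h1) = Cmp M v2 i"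
    using Cmp_assoc[OF h1(1) e pp(5)] Cmp_assoc[OF h1(1) pp(4) b] pp(6) h1(2) vv(5) by simp
  then obtain h2 where "h2 \<in> Hom M (Cod M i) (Cod M e)" "Cmp M h2 i = Cmp M e h1" "Cmp M p2 h2 = v2"
    using cof_lift[OF _ HomI[OF vv(2)] tf(2) pp(5) Cmp_Hom[OF h1(1) e] vv(4)] i
    by (auto simp: Mor_cofs_def)
  then have "square i h1 h2 e \<in> Hom (Mor M) i e" "Cmp (Mor M) p (square i h1 h2 e) = v"
    unfolding square_Hom pp(1) vv(1) Cmp_square using h1 pp(2) vv(2) by auto
  then show ?thesis by blast
qed

text \<open>Kernel pairs are formed on sources and targets separately. The uniqueness in their universal
  property makes the induced squares commute.\<close>

lemma Mor_kernel_pair: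
  assumes p: "p \<in> Mor_tf" "p \<in> Hom (Mor M) e b"
  shows "\<exists>P x y. x \<in> Hom (Mor M) P e \<and> y \<in> Hom (Mor M) P e \<and> x \<in> weq (Mor M) \<and> y \<in> weq (Mor M) \<and>
        (\<forall>Z. \<forall>u\<in>Hom (Mor M) Z e. \<forall>v\<in>Hom (Mor M) Z e. Cmp (Mor M) p u = Cmp (Mor M) p v \<longrightarrow>
          (\<exists>h\<in>Hom (Mor M) Z P. Cmp (Mor M) x h = u \<and> Cmp (Mor M) y h = v))"
proof -
  obtain p1 p2 where pp: "p = square e p1 p2 b" "e \<in> Ar M" "b \<in> Ar M" "p1 \<in> Hom M (Dom M e) (Dom M b)"
    "p2 \<in> Hom M (Cod M e) (Cod M b)" "Cmp M b p1 = Cmp M p2 e" using p(2) by (auto simp: Mor_Hom)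
  have tf: "p1 \<in> weq M" "p1 \<in> fib M" "p2 \<in> weq M" "p2 \<in> fib M"
    using p(1) by (auto simp: Mor_tf_def pp(1))
  note e = HomI[OF pp(2)] and b = HomI[OF pp(3)]
  obtain P1 x1 y1 where 1: "x1 \<in> Hom M P1 (Dom M e)" "y1 \<in> Hom M P1 (Dom M e)" "x1 \<in> weq M" "y1 \<in> weq M"
    "Cmp M p1 x1 = Cmp M p1 y1"
    and u1: "\<And>Z u v. u\<in>Hom M Z (Dom M e) \<Longrightarrow> v\<in>Hom M Z (Dom M e) \<Longrightarrow> Cmp M p1 u = Cmp M p1 v \<Longrightarrow>
          (\<exists>!h. h \<in> Hom M Z P1 \<and> Cmp M x1 h = u \<and> Cmp M y1 h = v)"
    using kernel_pair[OF pp(4) tf(1,2)] by blast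
  obtain P2 x2 y2 where 2: "x2 \<in> Hom M P2 (Cod M e)" "y2 \<in> Hom M P2 (Cod M e)" "x2 \<in> weq M" "y2 \<in> weq M"
    "Cmp M p2 x2 = Cmp M p2 y2"
    and u2: "\<And>Z u v. u\<in>Hom M Z (Cod M e) \<Longrightarrow> v\<in>Hom M Z (Cod M e) \<Longrightarrow> Cmp M p2 u = Cmp M p2 v \<Longrightarrow>
          (\<exists>!h. h \<in> Hom M Z P2 \<and> Cmp M x2 h = u \<and> Cmp M y2 h = v)"
    using kernel_pair[OF pp(5) tf(3,4)] by blast
  have "Cmp M p2 (Cmp M e x1) = Cmp M p2 (Cmp M e y1)"
    using Cmp_assoc[OF 1(1) e pp(5)] Cmp_assoc[OF 1(1) pp(4) b]
      Cmp_assoc[OF 1(2) e pp(5)] Cmp_assoc[OF 1(2) pp(4) b] pp(6) 1(5) by simp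
  from u2[OF Cmp_Hom[OF 1(1) e] Cmp_Hom[OF 1(2) e] this]
  obtain P where P: "P \<in> Hom M P1 P2" "Cmp M x2 P = Cmp M e x1" "Cmp M y2 P = Cmp M e y1" by blast
  then have D: "P \<in> Ar M" "Dom M P = P1" "Cod M P = P2" by (auto simp: Hom_def)
  have xy: "square P x1 x2 e \<in> Hom (Mor M) P e" "square P y1 y2 e \<in> Hom (Mor M) P e"
    unfolding square_Hom D using 1 2 D P pp(2) by auto
  moreover have "square P x1 x2 e \<in> weq (Mor M)" "square P y1 y2 e \<in> weq (Mor M)"
    unfolding Mor_weq[OF xy(1)] Mor_weq[OF xy(2)] using 1 2 by auto
  moreover have "\<exists>h\<in>Hom (Mor M) z P. Cmp (Mor M) (square P x1 x2 e) h = u \<and> Cmp (Mor M) (square P y1 y2 e) h = v"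
    if u: "u \<in> Hom (Mor M) z e" and v: "v \<in> Hom (Mor M) z e" and eq: "Cmp (Mor M) p u = Cmp (Mor M) p v" for z u v
  proof -
    obtain a a' where uu: "u = square z a a' e" "z \<in> Ar M" "a \<in> Hom M (Dom M z) (Dom M e)"
      "a' \<in> Hom M (Cod M z) (Cod M e)" "Cmp M e a = Cmp M a' z" using u by (auto simp: Mor_Hom)
    obtain c c' where vv: "v = square z c c' e" "c \<in> Hom M (Dom M z) (Dom M e)"
      "c' \<in> Hom M (Cod M z) (Cod M e)" "Cmp M e c = Cmp M c' z" using v by (auto simp: Mor_Hom)
    have eqs: "Cmp M p1 a = Cmp M p1 c" "Cmp M p2 a' = Cmp M p2 c'"
      using eq unfolding uu(1) vv(1) pp(1) Cmp_square by auto
    obtain h where h: "h \<in> Hom M (Dom M z) P1" "Cmp M x1 h = a" "Cmp M y1 h = c"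
      using u1[OF uu(3) vv(2) eqs(1)] by blast
    obtain h' where h': "h' \<in> Hom M (Cod M z) P2" "Cmp M x2 h' = a'" "Cmp M y2 h' = c'"
      using u2[OF uu(4) vv(3) eqs(2)] by blast
    note z = HomI[OF uu(2)]
    have Pz: "Cmp M P h \<in> Hom M (Dom M z) P2" "Cmp M h' z \<in> Hom M (Dom M z) P2"
      using Cmp_Hom[OF h(1) P(1)] Cmp_Hom[OF z h'(1)] .
    have "Cmp M x2 (Cmp M P h) = Cmp M e a" "Cmp M y2 (Cmp M P h) = Cmp M e c"
      "Cmp M x2 (Cmp M h' z) = Cmp M e a" "Cmp M y2 (Cmp M h' z) = Cmp M e c"
      using Cmp_assoc[OF h(1) P(1) 2(1)] Cmp_assoc[OF h(1) P(1) 2(2)] P h h' uu vv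
        Cmp_assoc[OF h(1) 1(1) e] Cmp_assoc[OF h(1) 1(2) e]
        Cmp_assoc[OF z h'(1) 2(1)] Cmp_assoc[OF z h'(1) 2(2)] by simp_all
    moreover have "Cmp M p2 (Cmp M e a) = Cmp M p2 (Cmp M e c)"
      using Cmp_assoc[OF uu(3) e pp(5)] Cmp_assoc[OF vv(2) e pp(5)] eqs(1)
        Cmp_assoc[OF uu(3) pp(4) b] Cmp_assoc[OF vv(2) pp(4) b] pp(6) by simp
    ultimately have "Cmp M P h = Cmp M h' z"
      using u2[OF Cmp_Hom[OF uu(3) e] Cmp_Hom[OF vv(2) e]] Pz by blast
    then have "square z h h' P \<in> Hom (Mor M) z P"
      unfolding square_Hom D using h h' D uu(2) by auto
    then show ?thesis using h h' unfolding uu(1) vv(1) by (intro bexI[of _ "square z h h' P"]) simp_all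
  qed
  ultimately show ?thesis by blast
qed

lemma Mor_left_derivable:
  assumes D: "rel_category D" and F: "is_functor (Mor M) D F"
    and weq: "\<And>w i j. w \<in> Hom (Mor M) i j \<Longrightarrow> w \<in> weq (Mor M) \<Longrightarrow> i \<in> Mor_cofs \<Longrightarrow> j \<in> Mor_cofs \<Longrightarrow>
      FAr F w \<in> weq D"
  shows "left_derivable (Mor M) D F Mor_cofs Mor_tf"
proof -
  interpret D: rel_category D by fact
  interpret MM: rel_category "Mor M" by (rule Mor_category)
  show ?thesis
  proof
    show "Mor_cofs \<subseteq> Ob (Mor M)" by (auto simp: Mor_cofs_def)
    show "Mor_tf \<subseteq> weq (Mor M)" by (auto simp: Mor_tf_def Mor_def Let_def)
  next
    fix u v f g h
    assume *: "u \<in> Hom (Mor M) f g" "v \<in> Hom (Mor M) g h" "u \<in> weq (Mor M)" "v \<in> weq (Mor M)"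
    then obtain a b c d where s: "u = square f a b g" "v = square g c d h"
      "a \<in> Hom M (Dom M f) (Dom M g)" "b \<in> Hom M (Cod M f) (Cod M g)"
      "c \<in> Hom M (Dom M g) (Dom M h)" "d \<in> Hom M (Cod M g) (Cod M h)" by (auto simp: Mor_Hom)
    show "Cmp (Mor M) v u \<in> weq (Mor M)"
      using * MM.Cmp_Hom[OF *(1,2)] s(3-) weq_Cmp
      unfolding s(1,2) Cmp_square by (auto simp: Mor_weq)
  next
    fix u v f g h
    assume *: "u \<in> Hom (Mor M) f g" "v \<in> Hom (Mor M) g h" "v \<in> weq (Mor M)" "Cmp (Mor M) v u \<in> weq (Mor M)"
    then obtain a b c d where s: "u = square f a b g" "v = square g c d h"
      "a \<in> Hom M (Dom M f) (Dom M g)" "b \<in> Hom M (Cod M f) (Cod M g)"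
      "c \<in> Hom M (Dom M g) (Dom M h)" "d \<in> Hom M (Cod M g) (Cod M h)" by (auto simp: Mor_Hom)
    show "u \<in> weq (Mor M)"
      using * MM.Cmp_Hom[OF *(1,2)] s(3-) weq_cancel[OF s(3,5)] weq_cancel[OF s(4,6)]
      unfolding s(1,2) Cmp_square by (auto simp: Mor_weq)
  qed (use F weq Mor_resolve Mor_lift Mor_kernel_pair in auto)
qed

lemma under_Hom: "u \<in> Hom (under_model M S) i j \<longleftrightarrow> i \<in> Ar M \<and> j \<in> Ar M \<and> Dom M i = S \<and> Dom M j = S \<and>
   (\<exists>a\<in>Hom M (Cod M i) (Cod M j). u = \<lparr>src = i, lab = a, tgt = j\<rparr> \<and> Cmp M a i = j)"
  by (cases u) (auto simp: under_model_def Let_def Hom_def)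

lemma under_simps [simp]: "Ob (under_model M S) = {i \<in> Ar M. Dom M i = S}"
  "Dom (under_model M S) = src" "Cod (under_model M S) = tgt"
  by (simp_all add: under_model_def Let_def)

lemma under_weq: "u \<in> weq (under_model M S) \<longleftrightarrow> u \<in> Ar (under_model M S) \<and> lab u \<in> weq M"
  "u \<in> fib (under_model M S) \<longleftrightarrow> u \<in> Ar (under_model M S) \<and> lab u \<in> fib M"
  "u \<in> cof (under_model M S) \<longleftrightarrow> u \<in> Ar (under_model M S) \<and> lab u \<in> cof M"
  by (auto simp: under_model_def Let_def)

lemma under_initial:
  assumes S: "S \<in> Ob M" shows "initial_object (under_model M S) (Idt M S)"
proof -
  have I: "Idt M S \<in> Ar M" "Dom M (Idt M S) = S" "Cod M (Idt M S) = S"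
    using Idt_Hom[OF S] by (auto simp: Hom_def)
  show ?thesis
    unfolding initial_object_def
  proof (intro conjI ballI)
    show "Idt M S \<in> Ob (under_model M S)" using I by simp
    fix j assume "j \<in> Ob (under_model M S)"
    then have j: "j \<in> Hom M S (Cod M j)" and D: "j \<in> Ar M" "Dom M j = S" by (auto simp: Hom_def)
    show "\<exists>!f. f \<in> Hom (under_model M S) (Idt M S) j"
    proof (rule ex1I[of _ "\<lparr>src = Idt M S, lab = j, tgt = j\<rparr>"])
      show "\<lparr>src = Idt M S, lab = j, tgt = j\<rparr> \<in> Hom (under_model M S) (Idt M S) j"
        unfolding under_Hom I using I j D Idt_right[OF j] by auto
      fix f assume "f \<in> Hom (under_model M S) (Idt M S) j"
      then obtain a where "a \<in> Hom M S (Cod M j)" "f = \<lparr>src = Idt M S, lab = a, tgt = j\<rparr>"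
        "Cmp M a (Idt M S) = j" unfolding under_Hom I by blast
      then show "f = \<lparr>src = Idt M S, lab = j, tgt = j\<rparr>" using Idt_right by auto
    qed
  qed
qed

lemma under_cofibrant:
  assumes i: "i \<in> Hom M S X" "i \<in> cof M" shows "cofibrant (under_model M S) i"
proof -
  have S: "S \<in> Ob M" using Hom_Ob[OF i(1)] by blast
  have I: "Idt M S \<in> Ar M" "Dom M (Idt M S) = S" "Cod M (Idt M S) = S"
    using Idt_Hom[OF S] by (auto simp: Hom_def)
  have "\<lparr>src = Idt M S, lab = i, tgt = i\<rparr> \<in> Hom (under_model M S) (Idt M S) i"
    unfolding under_Hom I using I i Idt_right[OF i(1)] by (auto simp: Hom_def)
  moreover from this have "\<lparr>src = Idt M S, lab = i, tgt = i\<rparr> \<in> cof (under_model M S)"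
    unfolding under_weq using i(2) by (auto simp: Hom_def)
  ultimately show ?thesis unfolding cofibrant_def using under_initial[OF S] by blast
qed

text \<open>Cofibrancy under \<open>S\<close> may be witnessed by any initial object \<open>i\<close>, not only by the identity of
  \<open>S\<close>. An initial \<open>i\<close> is an isomorphism in \<open>M\<close>, and a cofibration remains one after composition with
  it.\<close>

lemma under_cofibrant_cof:
  assumes j: "cofibrant (under_model M S) j" shows "j \<in> cof M" "j \<in> Ar M" "Dom M j = S"
proof -
  obtain i u where i: "initial_object (under_model M S) i" and u: "u \<in> Hom (under_model M S) i j"
    "u \<in> cof (under_model M S)" using j unfolding cofibrant_def by blast
  obtain a where a: "a \<in> Hom M (Cod M i) (Cod M j)" "u = \<lparr>src = i, lab = a, tgt = j\<rparr>" "Cmp M a i = j"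
    and D: "i \<in> Ar M" "j \<in> Ar M" "Dom M i = S" "Dom M j = S" using u(1) by (auto simp: under_Hom)
  have acof: "a \<in> cof M" using u(2) by (simp add: under_weq a(2))
  have S: "S \<in> Ob M" using Dom_Ob[OF D(1)] D by simp
  have I: "Idt M S \<in> Ar M" "Dom M (Idt M S) = S" "Cod M (Idt M S) = S"
    using Idt_Hom[OF S] by (auto simp: Hom_def)
  have iH: "i \<in> Hom M S (Cod M i)" and jH: "j \<in> Hom M S (Cod M j)" using D by (auto simp: Hom_def)
  \<comment> \<open>the inverse of \<open>i\<close> is the map under \<open>S\<close> from \<open>i\<close> to the identity\<close>
  obtain r where r: "r \<in> Hom M (Cod M i) S" "Cmp M r i = Idt M S"
  proof -
    have "\<exists>v. v \<in> Hom (under_model M S) i (Idt M S)"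
      using i I unfolding initial_object_def by auto
    then show ?thesis using that I by (auto simp: under_Hom)
  qed
  have ir: "Cmp M i r = Idt M (Cod M i)"
  proof -
    have c: "Cod M i \<in> Ob M" using Cod_Ob[OF D(1)] .
    have "Cmp M (Cmp M i r) i = i" using Cmp_assoc[OF iH r(1) iH] r(2) Idt_right[OF iH] by simp
    then have "\<lparr>src = i, lab = Cmp M i r, tgt = i\<rparr> \<in> Hom (under_model M S) i i"
      unfolding under_Hom using D Cmp_Hom[OF r(1) iH] by auto
    moreover have "\<lparr>src = i, lab = Idt M (Cod M i), tgt = i\<rparr> \<in> Hom (under_model M S) i i"
      unfolding under_Hom using D Idt_Hom[OF c] Idt_left[OF iH] by auto
    ultimately have "\<lparr>src = i, lab = Cmp M i r, tgt = i\<rparr> = \<lparr>src = i, lab = Idt M (Cod M i), tgt = i\<rparr>"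
      using i D unfolding initial_object_def by blast
    then show ?thesis by simp
  qed
  show "j \<in> cof M"
  proof (rule cofI[OF jH])
    fix p E B u v
    assume p: "p \<in> TF" "p \<in> Hom M E B" and u: "u \<in> Hom M S E" and v: "v \<in> Hom M (Cod M j) B"
      and eq: "Cmp M p u = Cmp M v j"
    have "Cmp M p (Cmp M u r) = Cmp M (Cmp M v (Cmp M a i)) r"
      using Cmp_assoc[OF r(1) u p(2)] eq a(3) by simp
    also have "\<dots> = Cmp M v (Cmp M a (Cmp M i r))"
      using Cmp_assoc[OF r(1) Cmp_Hom[OF iH a(1)] v] Cmp_assoc[OF r(1) iH a(1)] by simp
    also have "\<dots> = Cmp M v a" using ir Idt_right[OF a(1)] by simp
    finally obtain h where h: "h \<in> Hom M (Cod M j) E" "Cmp M h a = Cmp M u r" "Cmp M p h = v"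
      using cof_lift[OF acof a(1) p Cmp_Hom[OF r(1) u] v] by blast
    then have "Cmp M h j = u"
      using Cmp_assoc[OF iH a(1) h(1)] Cmp_assoc[OF iH r(1) u] a(3) r(2) Idt_right[OF u] by simp
    with h show "\<exists>h\<in>Hom M (Cod M j) E. Cmp M h j = u \<and> Cmp M p h = v" by blast
  qed
qed (use j in \<open>auto simp: cofibrant_def under_Hom\<close>)

text \<open>A resolution \<open>p\<close> of the source together with a resolution \<open>q\<close> of the composite under its
  domain is a weak equivalence in the arrow category from an object of \<open>Mor_cofs\<close>.\<close>

theorem derived_on_arrows:
  assumes D: "rel_category D" and F: "is_functor (Mor M) D F"
    and weq: "\<And>w i j. w \<in> Hom (Mor M) i j \<Longrightarrow> w \<in> weq (Mor M) \<Longrightarrow> i \<in> Mor_cofs \<Longrightarrow> j \<in> Mor_cofs \<Longrightarrow>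
      FAr F w \<in> weq D"
  shows "\<exists>LC t. total_left_derived (Mor M) D F LC t \<and>
    (\<forall>f \<in> Ar M.
      (\<exists>p. cofibrant_resolution M (Dom M f) p) \<and>
      (\<forall>p. cofibrant_resolution M (Dom M f) p \<longrightarrow>
        (\<exists>q. cofibrant_resolution (under_model M (Dom M p)) (Cmp M f p) q) \<and>
        (\<forall>q. cofibrant_resolution (under_model M (Dom M p)) (Cmp M f p) q \<longrightarrow>
          (\<exists>\<phi> \<in> Hom (Ho D) (FOb LC f) (FOb F (src q)).
            is_isomorphism (Ho D) \<phi> \<and>
            Cmp (Ho D) \<phi>
              (FAr LC (FAr (loc (Mor M)) \<lparr>src = src q, lab = (p, lab q), tgt = f\<rparr>))
              = t (src q)))))"
proof -
  have "left_derivable (Mor M) D F Mor_cofs Mor_tf"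
    by (rule Mor_left_derivable[OF D F]) (use weq in blast)
  then interpret L: left_derivable "Mor M" D F Mor_cofs Mor_tf .
  show ?thesis
  proof (rule exI[of _ L.derived], rule exI[of _ L.comparison], intro conjI ballI allI impI)
    show "total_left_derived (Mor M) D F L.derived L.comparison" by (rule L.total_left_derived)
  next
    fix f assume "f \<in> Ar M"
    then show "\<exists>p. cofibrant_resolution M (Dom M f) p" using resolution_exists Dom_Ob by blast
  next
    fix f p assume f: "f \<in> Ar M" and p: "cofibrant_resolution M (Dom M f) p"
    have pH: "p \<in> Hom M (Dom M p) (Dom M f)" using p by (auto simp: cofibrant_resolution_def Hom_def)
    note fp = Cmp_Hom[OF pH HomI[OF f]]
    obtain Z i r where i: "i \<in> Hom M (Dom M p) Z" "r \<in> Hom M Z (Cod M f)" "i \<in> cof M" "r \<in> weq M" "r \<in> fib M"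
      "Cmp M r i = Cmp M f p" using factor[OF fp] by blast
    have "\<lparr>src = i, lab = r, tgt = Cmp M f p\<rparr> \<in> Hom (under_model M (Dom M p)) i (Cmp M f p)"
      unfolding under_Hom using i fp by (auto simp: Hom_def)
    then have "cofibrant_resolution (under_model M (Dom M p)) (Cmp M f p) \<lparr>src = i, lab = r, tgt = Cmp M f p\<rparr>"
      using under_cofibrant[OF i(1,3)] i(4,5) unfolding cofibrant_resolution_def under_weq
      by (auto simp: Hom_def)
    then show "\<exists>q. cofibrant_resolution (under_model M (Dom M p)) (Cmp M f p) q" by blast
  next
    fix f p q assume f: "f \<in> Ar M" and p: "cofibrant_resolution M (Dom M f) p"
      and q: "cofibrant_resolution (under_model M (Dom M p)) (Cmp M f p) q"
    have pH: "p \<in> Hom M (Dom M p) (Dom M f)" "p \<in> weq M" "cofibrant M (Dom M p)"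
      using p by (auto simp: cofibrant_resolution_def Hom_def)
    note fp = Cmp_Hom[OF pH(1) HomI[OF f]]
    have qc: "cofibrant (under_model M (Dom M p)) (src q)" and qw: "lab q \<in> weq M"
      and qH: "q \<in> Hom (under_model M (Dom M p)) (src q) (Cmp M f p)"
      using q by (auto simp: cofibrant_resolution_def Hom_def under_weq)
    obtain a where a: "a \<in> Hom M (Cod M (src q)) (Cod M (Cmp M f p))"
      "q = \<lparr>src = src q, lab = a, tgt = Cmp M f p\<rparr>" "Cmp M a (src q) = Cmp M f p"
      using qH unfolding under_Hom by blast
    have "lab q = a" using a(2) by (cases q) simp
    moreover note i = under_cofibrant_cof[OF qc]
    ultimately have sq: "square (src q) p (lab q) f \<in> Hom (Mor M) (src q) f"
      unfolding square_Hom using a(1,3) pH(1) f HomD[OF fp] by auto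
    have s1: "src q \<in> Mor_cofs" using i pH by (simp add: Mor_cofs_def)
    show "\<exists>\<phi> \<in> Hom (Ho D) (FOb L.derived f) (FOb F (src q)). is_isomorphism (Ho D) \<phi> \<and>
        Cmp (Ho D) \<phi> (FAr L.derived (FAr (loc (Mor M)) \<lparr>src = src q, lab = (p, lab q), tgt = f\<rparr>))
          = L.comparison (src q)"
      using L.derived_value[OF s1 sq Mor_weq[OF sq, THEN iffD2, OF conjI[OF pH(2) qw]]]
      by (simp add: square_def)
  qed
qed

end

section \<open>Quotient modules\<close>

context abelian_group begin

lemma neg_zero [simp]: "\<ominus> \<zero> = \<zero>"
  using minus_equality[of \<zero> \<zero>] by simp

lemma minus_zero [simp]: "x \<in> carrier G \<Longrightarrow> x \<ominus> \<zero> = x"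
  by (simp add: minus_eq)

lemma minus_self [simp]: "x \<in> carrier G \<Longrightarrow> x \<ominus> x = \<zero>"
  by (simp add: minus_eq r_neg)

text \<open>Sorting a sum may leave up to two other summands between a pair of opposite ones; these rules
  let the simplifier cancel the pair nevertheless.\<close>

lemma cancel2: "x \<in> carrier G \<Longrightarrow> y \<in> carrier G \<Longrightarrow> x \<oplus> (y \<oplus> \<ominus> x) = y"
  by (simp add: a_lcomm[of x y] r_neg)

lemma cancel3: "x \<in> carrier G \<Longrightarrow> y \<in> carrier G \<Longrightarrow> z \<in> carrier G \<Longrightarrow>
    x \<oplus> (y \<oplus> (\<ominus> x \<oplus> z)) = y \<oplus> z"
  by (simp add: a_lcomm[of x y] r_neg2)

lemma cancel4: "x \<in> carrier G \<Longrightarrow> y \<in> carrier G \<Longrightarrow> z \<in> carrier G \<Longrightarrow>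
    x \<oplus> (y \<oplus> (z \<oplus> \<ominus> x)) = y \<oplus> z"
  using cancel2[of x "y \<oplus> z"] by (simp add: a_assoc)

lemma cancel5: "x \<in> carrier G \<Longrightarrow> y \<in> carrier G \<Longrightarrow> z \<in> carrier G \<Longrightarrow> w \<in> carrier G \<Longrightarrow>
    x \<oplus> (y \<oplus> (z \<oplus> (\<ominus> x \<oplus> w))) = y \<oplus> (z \<oplus> w)"
  using cancel3[of x "y \<oplus> z" w] by (simp add: a_assoc)

lemmas abel = minus_eq minus_add minus_minus r_neg l_neg r_neg1 r_neg2 cancel2 cancel3 cancel4 cancel5 a_ac

end

locale quotient = module K M + submodule H K M
  for K :: "'k ring" and M :: "('k, 'a) module" (structure) and H
begin

lemma abelian_sub: "abelian_subgroup H M"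
  using abelian_subgroupI2[OF M.a_comm_group subgroup_axioms] .

interpretation A: abelian_subgroup H M by (rule abelian_sub)

lemma H_sub: "x \<in> H \<Longrightarrow> x \<in> carrier M" using A.a_subset by blast
lemma H_zero: "\<zero>\<^bsub>M\<^esub> \<in> H" by (rule A.zero_closed)
lemma H_add: "x \<in> H \<Longrightarrow> y \<in> H \<Longrightarrow> x \<oplus>\<^bsub>M\<^esub> y \<in> H" by (rule A.a_closed)
lemma H_neg: "x \<in> H \<Longrightarrow> \<ominus>\<^bsub>M\<^esub> x \<in> H" by (rule A.a_inv_closed)

lemma coset_eq:
  assumes "x \<in> carrier M" "y \<in> carrier M"
  shows "H +>\<^bsub>M\<^esub> x = H +>\<^bsub>M\<^esub> y \<longleftrightarrow> x \<ominus>\<^bsub>M\<^esub> y \<in> H"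
proof -
  have "H +>\<^bsub>M\<^esub> x = H +>\<^bsub>M\<^esub> y \<longleftrightarrow> x \<in> H +>\<^bsub>M\<^esub> y"
    using assms M.a_repr_independence[OF _ assms(2) subgroup_axioms] A.a_rcos_self[OF assms(1)] by blast
  then show ?thesis using A.a_rcos_module[of y x] assms
    by (simp add: M.minus_eq)
qed

lemma coset_zero: "H +>\<^bsub>M\<^esub> \<zero>\<^bsub>M\<^esub> = H"
  using H_sub by (intro M.a_coset_add_zero) auto

lemma mem_coset: "x \<in> carrier M \<Longrightarrow> y \<in> H +>\<^bsub>M\<^esub> x \<longleftrightarrow> y \<in> carrier M \<and> y \<ominus>\<^bsub>M\<^esub> x \<in> H"
  using A.a_rcos_module[of x y] M.a_r_coset_subset_G[of H x] A.a_subset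
  by (auto simp: M.minus_eq)

lemma carrier_quot: "carrier (quot_mod M H) = (\<lambda>x. H +>\<^bsub>M\<^esub> x) ` carrier M"
  by (auto simp: quot_mod_def A_RCOSETS_def')

lemma quot_zero: "\<zero>\<^bsub>quot_mod M H\<^esub> = H +>\<^bsub>M\<^esub> \<zero>\<^bsub>M\<^esub>"
  by (simp add: quot_mod_def coset_zero)

lemma quot_add: "x \<in> carrier M \<Longrightarrow> y \<in> carrier M \<Longrightarrow>
   (H +>\<^bsub>M\<^esub> x) \<oplus>\<^bsub>quot_mod M H\<^esub> (H +>\<^bsub>M\<^esub> y) = H +>\<^bsub>M\<^esub> (x \<oplus>\<^bsub>M\<^esub> y)"
  by (simp add: quot_mod_def A.a_rcos_sum)

lemma quot_smult:
  assumes c: "c \<in> carrier K" and x: "x \<in> carrier M"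
  shows "c \<odot>\<^bsub>quot_mod M H\<^esub> (H +>\<^bsub>M\<^esub> x) = H +>\<^bsub>M\<^esub> (c \<odot>\<^bsub>M\<^esub> x)"
proof -
  have "H +>\<^bsub>M\<^esub> (c \<odot>\<^bsub>M\<^esub> y) = H +>\<^bsub>M\<^esub> (c \<odot>\<^bsub>M\<^esub> x)" if "y \<in> H +>\<^bsub>M\<^esub> x" for y
  proof -
    have y: "y \<in> carrier M" "y \<ominus>\<^bsub>M\<^esub> x \<in> H" using that mem_coset[OF x] by auto
    have "c \<odot>\<^bsub>M\<^esub> y \<ominus>\<^bsub>M\<^esub> c \<odot>\<^bsub>M\<^esub> x = c \<odot>\<^bsub>M\<^esub> (y \<ominus>\<^bsub>M\<^esub> x)"
      using c x y by (simp add: M.minus_eq smult_r_distr smult_r_minus)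
    then show ?thesis using c x y by (subst coset_eq) auto
  qed
  note const = this
  have "H +>\<^bsub>M\<^esub> x \<noteq> {}" using A.a_rcos_self[OF x] by blast
  from SUP_eq_const[OF this const]
  have "(\<Union>y\<in>H +>\<^bsub>M\<^esub> x. H +>\<^bsub>M\<^esub> (c \<odot>\<^bsub>M\<^esub> y)) = H +>\<^bsub>M\<^esub> (c \<odot>\<^bsub>M\<^esub> x)" .
  then show ?thesis by (simp add: quot_mod_def)
qed

lemma quot_module: "module K (quot_mod M H)"
proof (rule moduleI[OF R.is_cring])
  show "abelian_group (quot_mod M H)"
  proof (rule abelian_groupI)
    fix X assume "X \<in> carrier (quot_mod M H)"
    then obtain x where x: "x \<in> carrier M" "X = H +>\<^bsub>M\<^esub> x" by (auto simp: carrier_quot)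
    then have "(H +>\<^bsub>M\<^esub> (\<ominus>\<^bsub>M\<^esub> x)) \<oplus>\<^bsub>quot_mod M H\<^esub> X = \<zero>\<^bsub>quot_mod M H\<^esub>"
      by (simp add: quot_add quot_zero M.l_neg)
    then show "\<exists>Y\<in>carrier (quot_mod M H). Y \<oplus>\<^bsub>quot_mod M H\<^esub> X = \<zero>\<^bsub>quot_mod M H\<^esub>"
      using x by (auto simp: carrier_quot)
  qed (auto simp: carrier_quot quot_add quot_zero M.a_ac)
qed (auto simp: carrier_quot quot_add quot_smult smult_l_distr smult_r_distr smult_assoc1)

end

lemma quot_map_coset:
  assumes "quotient K M H" "quotient K N J" and f: "linear_map K M N f" "\<And>x. x \<in> H \<Longrightarrow> f x \<in> J"
    and x: "x \<in> carrier M"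
  shows "quot_map M H N J f (H +>\<^bsub>M\<^esub> x) = J +>\<^bsub>N\<^esub> f x"
proof -
  interpret M: quotient K M H by fact
  interpret N: quotient K N J by fact
  interpret A: abelian_subgroup H M by (rule M.abelian_sub)
  have fc: "y \<in> carrier M \<Longrightarrow> f y \<in> carrier N" for y using f(1) by (auto simp: linear_map_def)
  have "J +>\<^bsub>N\<^esub> f y = J +>\<^bsub>N\<^esub> f x" if "y \<in> H +>\<^bsub>M\<^esub> x" for y
  proof -
    have y: "y \<in> carrier M" "y \<ominus>\<^bsub>M\<^esub> x \<in> H" using that M.mem_coset[OF x] by auto
    have "f y = f ((y \<ominus>\<^bsub>M\<^esub> x) \<oplus>\<^bsub>M\<^esub> x)" using x y by (simp add: M.minus_eq M.M.a_assoc M.M.l_neg)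
    also have "\<dots> = f (y \<ominus>\<^bsub>M\<^esub> x) \<oplus>\<^bsub>N\<^esub> f x" using f(1) x y by (simp add: linear_map_def)
    finally have "f y \<ominus>\<^bsub>N\<^esub> f x = f (y \<ominus>\<^bsub>M\<^esub> x)"
      using fc x y by (simp add: N.minus_eq N.M.a_assoc N.M.r_neg)
    then show ?thesis using f(2) y x fc by (subst N.coset_eq) auto
  qed
  note const = this
  have "H +>\<^bsub>M\<^esub> x \<noteq> {}" using A.a_rcos_self[OF x] by blast
  from SUP_eq_const[OF this const]
  have "(\<Union>y\<in>H +>\<^bsub>M\<^esub> x. J +>\<^bsub>N\<^esub> f y) = J +>\<^bsub>N\<^esub> f x" .
  moreover have "H +>\<^bsub>M\<^esub> x \<in> a_rcosets\<^bsub>M\<^esub> H" using x by (auto simp: A_RCOSETS_def')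
  ultimately show ?thesis by (simp add: quot_map_def)
qed

section \<open>Complexes\<close>

locale cplx =
  fixes K :: "'k ring" and X :: "('k, 'a, 'z) chain_complex_scheme"
  assumes is_complex: "is_complex K X"

sublocale cplx \<subseteq> P: module K "piece X n" for n
  using is_complex by (simp add: is_complex_def)

context cplx begin

lemma bdry_closed [simp]: "x \<in> elts X n \<Longrightarrow> m = n - 1 \<Longrightarrow> bdry X n x \<in> elts X m"
  using is_complex by (auto simp: is_complex_def linear_map_def)

lemma bdry_add: "x \<in> elts X n \<Longrightarrow> y \<in> elts X n \<Longrightarrow>
   bdry X n (x \<oplus>\<^bsub>piece X n\<^esub> y) = bdry X n x \<oplus>\<^bsub>piece X (n - 1)\<^esub> bdry X n y"
  using is_complex by (auto simp: is_complex_def linear_map_def)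

lemma bdry_smult: "c \<in> carrier K \<Longrightarrow> x \<in> elts X n \<Longrightarrow>
   bdry X n (c \<odot>\<^bsub>piece X n\<^esub> x) = c \<odot>\<^bsub>piece X (n - 1)\<^esub> bdry X n x"
  using is_complex by (auto simp: is_complex_def linear_map_def)

lemma bdry_bdry: "x \<in> elts X n \<Longrightarrow> m = n - 1 \<Longrightarrow> l = n - 2 \<Longrightarrow>
   bdry X m (bdry X n x) = \<zero>\<^bsub>piece X l\<^esub>"
  using is_complex by (auto simp: is_complex_def diff_diff_eq)

lemma bdry_zero [simp]: "bdry X n \<zero>\<^bsub>piece X n\<^esub> = \<zero>\<^bsub>piece X (n - 1)\<^esub>"
  using bdry_smult[of "\<zero>\<^bsub>K\<^esub>" "\<zero>\<^bsub>piece X n\<^esub>" n] by simp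

lemma bdry_neg: "x \<in> elts X n \<Longrightarrow> bdry X n (\<ominus>\<^bsub>piece X n\<^esub> x) = \<ominus>\<^bsub>piece X (n - 1)\<^esub> bdry X n x"
  using bdry_smult[of "\<ominus>\<^bsub>K\<^esub> \<one>\<^bsub>K\<^esub>" x n] by (simp add: P.smult_l_minus)

lemma bdry_minus: "x \<in> elts X n \<Longrightarrow> y \<in> elts X n \<Longrightarrow>
   bdry X n (x \<ominus>\<^bsub>piece X n\<^esub> y) = bdry X n x \<ominus>\<^bsub>piece X (n - 1)\<^esub> bdry X n y"
  by (simp add: P.minus_eq bdry_add bdry_neg)

lemma boundaries_iff: "x \<in> boundaries X n \<longleftrightarrow> (\<exists>y\<in>elts X (n + 1). x = bdry X (n + 1) y)"
  by (auto simp: boundaries_def)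

lemma boundaries_closed: "x \<in> boundaries X n \<Longrightarrow> x \<in> elts X n"
  using bdry_closed[of _ "n + 1" n] by (auto simp: boundaries_iff)

lemma boundaries_cycle: "x \<in> boundaries X n \<Longrightarrow> bdry X n x = \<zero>\<^bsub>piece X (n - 1)\<^esub>"
  using bdry_bdry[of _ "n + 1" n "n - 1"] by (auto simp: boundaries_iff)

lemma boundaries_zero: "\<zero>\<^bsub>piece X n\<^esub> \<in> boundaries X n"
  using bdry_zero[of "n + 1"] unfolding boundaries_iff
  by (intro bexI[of _ "\<zero>\<^bsub>piece X (n + 1)\<^esub>"]) auto

lemma boundaries_add: "x \<in> boundaries X n \<Longrightarrow> y \<in> boundaries X n \<Longrightarrow> x \<oplus>\<^bsub>piece X n\<^esub> y \<in> boundaries X n"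
  using bdry_add[of _ "n + 1"] unfolding boundaries_iff by (metis P.add.m_closed add_diff_cancel_right')

lemma boundaries_smult: "c \<in> carrier K \<Longrightarrow> x \<in> boundaries X n \<Longrightarrow> c \<odot>\<^bsub>piece X n\<^esub> x \<in> boundaries X n"
  using bdry_smult[of c _ "n + 1"] unfolding boundaries_iff by (metis P.smult_closed add_diff_cancel_right')

lemma boundaries_neg: "x \<in> boundaries X n \<Longrightarrow> \<ominus>\<^bsub>piece X n\<^esub> x \<in> boundaries X n"
  using boundaries_smult[of "\<ominus>\<^bsub>K\<^esub> \<one>\<^bsub>K\<^esub>" x n] boundaries_closed[of x n] by (simp add: P.smult_l_minus)

lemma boundaries_minus: "x \<in> boundaries X n \<Longrightarrow> y \<in> boundaries X n \<Longrightarrow> x \<ominus>\<^bsub>piece X n\<^esub> y \<in> boundaries X n"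
  by (simp add: P.minus_eq boundaries_add boundaries_neg)

lemma boundariesI: "y \<in> elts X m \<Longrightarrow> m = n + 1 \<Longrightarrow> bdry X m y \<in> boundaries X n"
  by (auto simp: boundaries_iff)

abbreviation cycle :: "int \<Rightarrow> 'a \<Rightarrow> bool" where
  "cycle n x \<equiv> x \<in> elts X n \<and> bdry X n x = \<zero>\<^bsub>piece X (n - 1)\<^esub>"

lemma cycles_module: "module K (cycles X n)"
proof -
  have "submodule {x \<in> elts X n. bdry X n x = \<zero>\<^bsub>piece X (n - 1)\<^esub>} K (piece X n)"
    by (rule P.submoduleI) (auto simp: bdry_add bdry_smult bdry_neg)
  from submodule.submodule_is_module[OF this P.module_axioms] show ?thesis
    by (simp add: cycles_def)
qed

lemma cycles_simps [simp]: "carrier (cycles X n) = {x. cycle n x}"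
  "x \<oplus>\<^bsub>cycles X n\<^esub> y = x \<oplus>\<^bsub>piece X n\<^esub> y" "\<zero>\<^bsub>cycles X n\<^esub> = \<zero>\<^bsub>piece X n\<^esub>"
  "c \<odot>\<^bsub>cycles X n\<^esub> x = c \<odot>\<^bsub>piece X n\<^esub> x"
  by (simp_all add: cycles_def)

lemma cycles_neg: assumes "cycle n x" shows "\<ominus>\<^bsub>cycles X n\<^esub> x = \<ominus>\<^bsub>piece X n\<^esub> x"
proof -
  interpret Z: module K "cycles X n" by (rule cycles_module)
  have "\<ominus>\<^bsub>cycles X n\<^esub> x = (\<ominus>\<^bsub>K\<^esub> \<one>\<^bsub>K\<^esub>) \<odot>\<^bsub>cycles X n\<^esub> x"
    using assms Z.smult_l_minus[of "\<one>\<^bsub>K\<^esub>" x] by simp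
  then show ?thesis using assms by (simp add: P.smult_l_minus)
qed

lemma homology_quotient: "quotient K (cycles X n) (boundaries X n)"
proof -
  interpret Z: module K "cycles X n" by (rule cycles_module)
  have "submodule (boundaries X n) K (cycles X n)"
    by (rule Z.submoduleI)
       (auto simp: boundaries_cycle boundaries_closed boundaries_zero boundaries_add boundaries_smult
          cycles_neg boundaries_neg)
  then show ?thesis by (simp add: quotient_def cycles_module)
qed

end

text \<open>Chain maps without the convention on values outside the domain, so that composites and
  restrictions of formulas need no adjustment.\<close>

definition complex_hom ::
  "'k ring \<Rightarrow> ('k, 'a, 'y) chain_complex_scheme \<Rightarrow> ('k, 'b, 'z) chain_complex_scheme \<Rightarrow>
     (int \<Rightarrow> 'a \<Rightarrow> 'b) \<Rightarrow> bool" where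
  "complex_hom K X Y f \<longleftrightarrow> (\<forall>n. linear_map K (piece X n) (piece Y n) (f n) \<and>
     (\<forall>x \<in> elts X n. f (n - 1) (bdry X n x) = bdry Y n (f n x)))"

lemma chain_map_iff: "chain_map K X Y f \<longleftrightarrow> complex_hom K X Y f \<and> (\<forall>n. f n \<in> extensional (elts X n))"
  by (auto simp: chain_map_def complex_hom_def)

locale cplx_hom = X: cplx K X + Y: cplx K Y for K :: "'k ring"
  and X :: "('k, 'a, 'y) chain_complex_scheme" and Y :: "('k, 'b, 'z) chain_complex_scheme" +
  fixes f :: "int \<Rightarrow> 'a \<Rightarrow> 'b"
  assumes hom: "complex_hom K X Y f"
begin

lemma hom_closed [simp]: "x \<in> elts X n \<Longrightarrow> f n x \<in> elts Y n"
  using hom by (auto simp: complex_hom_def linear_map_def)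

lemma hom_linear: "linear_map K (piece X n) (piece Y n) (f n)"
  using hom by (auto simp: complex_hom_def)

lemma hom_add: "x \<in> elts X n \<Longrightarrow> y \<in> elts X n \<Longrightarrow>
   f n (x \<oplus>\<^bsub>piece X n\<^esub> y) = f n x \<oplus>\<^bsub>piece Y n\<^esub> f n y"
  using hom by (auto simp: complex_hom_def linear_map_def)

lemma hom_smult: "c \<in> carrier K \<Longrightarrow> x \<in> elts X n \<Longrightarrow>
   f n (c \<odot>\<^bsub>piece X n\<^esub> x) = c \<odot>\<^bsub>piece Y n\<^esub> f n x"
  using hom by (auto simp: complex_hom_def linear_map_def)

lemma hom_bdry: "x \<in> elts X n \<Longrightarrow> m = n - 1 \<Longrightarrow> f m (bdry X n x) = bdry Y n (f n x)"
  using hom by (auto simp: complex_hom_def)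

lemma hom_zero [simp]: "f n \<zero>\<^bsub>piece X n\<^esub> = \<zero>\<^bsub>piece Y n\<^esub>"
  using hom_smult[of "\<zero>\<^bsub>K\<^esub>" "\<zero>\<^bsub>piece X n\<^esub>" n] by simp

lemma hom_neg: "x \<in> elts X n \<Longrightarrow> f n (\<ominus>\<^bsub>piece X n\<^esub> x) = \<ominus>\<^bsub>piece Y n\<^esub> f n x"
  using hom_smult[of "\<ominus>\<^bsub>K\<^esub> \<one>\<^bsub>K\<^esub>" x n] by (simp add: X.P.smult_l_minus Y.P.smult_l_minus)

lemma hom_minus: "x \<in> elts X n \<Longrightarrow> y \<in> elts X n \<Longrightarrow>
   f n (x \<ominus>\<^bsub>piece X n\<^esub> y) = f n x \<ominus>\<^bsub>piece Y n\<^esub> f n y"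
  by (simp add: X.P.minus_eq Y.P.minus_eq hom_add hom_neg)

lemma hom_cycle: "X.cycle n x \<Longrightarrow> Y.cycle n (f n x)"
  using hom_bdry[of x n "n - 1"] by auto

lemma hom_boundaries: "x \<in> boundaries X n \<Longrightarrow> f n x \<in> boundaries Y n"
  using hom_bdry[of _ "n + 1" n] Y.boundariesI[of _ "n + 1" n] by (auto simp: X.boundaries_iff)

lemma homology_map_coset:
  assumes "X.cycle n x"
  shows "homology_map X Y f n (boundaries X n +>\<^bsub>cycles X n\<^esub> x) = boundaries Y n +>\<^bsub>cycles Y n\<^esub> f n x"
  unfolding homology_map_def
proof (rule quot_map_coset[OF X.homology_quotient Y.homology_quotient])
  show "linear_map K (cycles X n) (cycles Y n) (f n)"
    using hom_cycle[of _ n] by (auto simp: linear_map_def hom_add hom_smult)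
qed (use assms hom_boundaries in auto)

text \<open>Injectivity and surjectivity on homology, in terms of cycles and boundaries: the form suited
  to diagram chases.\<close>

lemma quasi_iso_iff:
  "quasi_iso X Y f \<longleftrightarrow>
     (\<forall>n x. X.cycle n x \<longrightarrow> f n x \<in> boundaries Y n \<longrightarrow> x \<in> boundaries X n) \<and>
     (\<forall>n y. Y.cycle n y \<longrightarrow> (\<exists>x. X.cycle n x \<and> f n x \<ominus>\<^bsub>piece Y n\<^esub> y \<in> boundaries Y n))"
proof -
  have "bij_betw (homology_map X Y f n) (carrier (homology X n)) (carrier (homology Y n)) \<longleftrightarrow>
     (\<forall>x. X.cycle n x \<longrightarrow> f n x \<in> boundaries Y n \<longrightarrow> x \<in> boundaries X n) \<and>
     (\<forall>y. Y.cycle n y \<longrightarrow> (\<exists>x. X.cycle n x \<and> f n x \<ominus>\<^bsub>piece Y n\<^esub> y \<in> boundaries Y n))"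
    (is "?b \<longleftrightarrow> ?i \<and> ?s") for n
  proof -
    interpret HX: quotient K "cycles X n" "boundaries X n" by (rule X.homology_quotient)
    interpret HY: quotient K "cycles Y n" "boundaries Y n" by (rule Y.homology_quotient)
    let ?h = "homology_map X Y f n"
    let ?cX = "\<lambda>x. boundaries X n +>\<^bsub>cycles X n\<^esub> x" and ?cY = "\<lambda>x. boundaries Y n +>\<^bsub>cycles Y n\<^esub> x"
    note h = homology_map_coset
    have cX: "carrier (homology X n) = ?cX ` {x. X.cycle n x}"
      and cY: "carrier (homology Y n) = ?cY ` {y. Y.cycle n y}"
      by (simp_all add: homology_def HX.carrier_quot HY.carrier_quot)
    have eqX: "?cX x = ?cX x' \<longleftrightarrow> x \<ominus>\<^bsub>piece X n\<^esub> x' \<in> boundaries X n" if "X.cycle n x" "X.cycle n x'" for x x'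
      using HX.coset_eq[of x x'] that X.cycles_neg[of x' n] by (simp add: X.P.minus_eq a_minus_def)
    have eqY: "?cY y = ?cY y' \<longleftrightarrow> y \<ominus>\<^bsub>piece Y n\<^esub> y' \<in> boundaries Y n" if "Y.cycle n y" "Y.cycle n y'" for y y'
      using HY.coset_eq[of y y'] that Y.cycles_neg[of y' n] by (simp add: Y.P.minus_eq a_minus_def)
    have hX: "?h (?cX x) = ?cY (f n x)" if "X.cycle n x" for x using h that by blast
    have fc: "Y.cycle n (f n x)" if "X.cycle n x" for x using hom_cycle that by blast
    have diff: "X.cycle n (x \<ominus>\<^bsub>piece X n\<^esub> x')" if "X.cycle n x" "X.cycle n x'" for x x'
      using that X.bdry_minus[of x n x'] by simp
    have zero: "X.cycle n \<zero>\<^bsub>piece X n\<^esub>" by simp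
    have into: "?h ` carrier (homology X n) \<subseteq> carrier (homology Y n)"
      unfolding cX cY using hX fc by blast
    have inj: "inj_on ?h (carrier (homology X n)) \<longleftrightarrow> ?i"
    proof
      assume inj: "inj_on ?h (carrier (homology X n))"
      show ?i
      proof (intro allI impI)
        fix x assume x: "X.cycle n x" and b: "f n x \<in> boundaries Y n"
        have "?cY (f n x) = ?cY (f n \<zero>\<^bsub>piece X n\<^esub>)"
          using eqY[OF fc[OF x] fc[OF zero]] b x by simp
        then have "?h (?cX x) = ?h (?cX \<zero>\<^bsub>piece X n\<^esub>)" using hX[OF x] hX[OF zero] by (simp only:)
        then have "?cX x = ?cX \<zero>\<^bsub>piece X n\<^esub>" using inj x zero unfolding inj_on_def cX by blast
        then show "x \<in> boundaries X n" using eqX[OF x zero] x by simp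
      qed
    next
      assume i: ?i
      show "inj_on ?h (carrier (homology X n))"
      proof (rule inj_onI)
        fix U V assume "U \<in> carrier (homology X n)" "V \<in> carrier (homology X n)" and eq: "?h U = ?h V"
        then obtain x x' where x: "X.cycle n x" "U = ?cX x" and x': "X.cycle n x'" "V = ?cX x'"
          unfolding cX by blast
        have "?cY (f n x) = ?cY (f n x')" using eq hX[OF x(1)] hX[OF x'(1)] x x' by (simp only:)
        then have "f n (x \<ominus>\<^bsub>piece X n\<^esub> x') \<in> boundaries Y n"
          using eqY[OF fc[OF x(1)] fc[OF x'(1)]] x x' by (simp add: hom_minus)
        then show "U = V" using i diff[OF x(1) x'(1)] eqX[OF x(1) x'(1)] x x' by (simp only:)
      qed
    qed
    have surj: "carrier (homology Y n) \<subseteq> ?h ` carrier (homology X n) \<longleftrightarrow> ?s"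
    proof
      assume s: "carrier (homology Y n) \<subseteq> ?h ` carrier (homology X n)"
      show ?s
      proof (intro allI impI)
        fix y assume y: "Y.cycle n y"
        then obtain x where x: "X.cycle n x" "?cY y = ?h (?cX x)" using s unfolding cX cY by blast
        then have "?cY (f n x) = ?cY y" using hX[OF x(1)] by (simp only:)
        then show "\<exists>x. X.cycle n x \<and> f n x \<ominus>\<^bsub>piece Y n\<^esub> y \<in> boundaries Y n"
          using eqY[OF fc[OF x(1)] y] x(1) by blast
      qed
    next
      assume s: ?s
      show "carrier (homology Y n) \<subseteq> ?h ` carrier (homology X n)"
      proof
        fix V assume "V \<in> carrier (homology Y n)"
        then obtain y where y: "Y.cycle n y" "V = ?cY y" unfolding cY by blast
        obtain x where x: "X.cycle n x" "f n x \<ominus>\<^bsub>piece Y n\<^esub> y \<in> boundaries Y n" using s y(1) by blast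
        have "?cY (f n x) = ?cY y" using eqY[OF fc[OF x(1)] y(1)] x(2) by blast
        then have "?h (?cX x) = V" using hX[OF x(1)] y(2) by (simp only:)
        then show "V \<in> ?h ` carrier (homology X n)" unfolding cX using x(1) by blast
      qed
    qed
    have "?b \<longleftrightarrow> inj_on ?h (carrier (homology X n)) \<and> carrier (homology Y n) \<subseteq> ?h ` carrier (homology X n)"
      unfolding bij_betw_def using into by blast
    then show ?thesis unfolding inj surj .
  qed
  then show ?thesis unfolding quasi_iso_def by blast
qed

lemma quasi_iso_inj:
  "quasi_iso X Y f \<Longrightarrow> X.cycle n x \<Longrightarrow> f n x \<in> boundaries Y n \<Longrightarrow> x \<in> boundaries X n"
  unfolding quasi_iso_iff by blast

lemma quasi_iso_surj:
  "quasi_iso X Y f \<Longrightarrow> Y.cycle n y \<Longrightarrow> \<exists>x. X.cycle n x \<and> f n x \<ominus>\<^bsub>piece Y n\<^esub> y \<in> boundaries Y n"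
  unfolding quasi_iso_iff by blast

lemma quasi_isoI:
  assumes "\<And>n x. X.cycle n x \<Longrightarrow> f n x \<in> boundaries Y n \<Longrightarrow> x \<in> boundaries X n"
    and "\<And>n y. Y.cycle n y \<Longrightarrow> \<exists>x. X.cycle n x \<and> f n x \<ominus>\<^bsub>piece Y n\<^esub> y \<in> boundaries Y n"
  shows "quasi_iso X Y f"
  unfolding quasi_iso_iff using assms by blast

end

lemma complex_hom_comp:
  assumes "cplx_hom K X Y f" "cplx_hom K Y Z g"
  shows "cplx_hom K X Z (\<lambda>n x. g n (f n x))"
proof -
  interpret f: cplx_hom K X Y f by fact
  interpret g: cplx_hom K Y Z g by fact
  show ?thesis
    by unfold_locales
       (auto simp: complex_hom_def linear_map_def f.hom_add g.hom_add f.hom_smult g.hom_smult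
          f.hom_bdry g.hom_bdry)
qed

lemma quasi_iso_cong:
  assumes "cplx_hom K X Y f" "cplx_hom K X Y g" "\<And>n x. x \<in> elts X n \<Longrightarrow> f n x = g n x"
  shows "quasi_iso X Y f \<longleftrightarrow> quasi_iso X Y g"
proof -
  have "homology_map X Y f n = homology_map X Y g n" for n
  proof -
    interpret cplx_hom K X Y f by fact
    interpret quotient K "cycles X n" "boundaries X n" by (rule X.homology_quotient)
    have "f n x = g n x" if "U \<in> a_rcosets\<^bsub>cycles X n\<^esub> boundaries X n" "x \<in> U" for U x
      using that mem_coset assms(3) by (auto simp: A_RCOSETS_def')
    then show ?thesis
      unfolding homology_map_def quot_map_def by (intro restrict_ext SUP_cong) simp_all
  qed
  then show ?thesis by (simp add: quasi_iso_def)
qed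

lemma (in cplx) boundaries_diff_iff:
  assumes "x \<in> elts X n" "y \<in> elts X n" "x \<ominus>\<^bsub>piece X n\<^esub> y \<in> boundaries X n"
  shows "x \<in> boundaries X n \<longleftrightarrow> y \<in> boundaries X n"
proof
  assume "x \<in> boundaries X n"
  from boundaries_minus[OF this assms(3)] show "y \<in> boundaries X n"
    using assms by (simp add: P.abel)
next
  assume "y \<in> boundaries X n"
  from boundaries_add[OF this assms(3)] show "x \<in> boundaries X n"
    using assms by (simp add: P.abel)
qed

lemma (in cplx) boundaries_trans:
  assumes "x \<in> elts X n" "y \<in> elts X n" "z \<in> elts X n"
    "x \<ominus>\<^bsub>piece X n\<^esub> y \<in> boundaries X n" "y \<ominus>\<^bsub>piece X n\<^esub> z \<in> boundaries X n"
  shows "x \<ominus>\<^bsub>piece X n\<^esub> z \<in> boundaries X n"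
  using boundaries_add[OF assms(4,5)] assms by (simp add: P.abel)

lemma (in cplx) boundaries_sym:
  assumes "x \<in> elts X n" "y \<in> elts X n" "x \<ominus>\<^bsub>piece X n\<^esub> y \<in> boundaries X n"
  shows "y \<ominus>\<^bsub>piece X n\<^esub> x \<in> boundaries X n"
  using boundaries_neg[OF assms(3)] assms by (simp add: P.abel)

lemma quasi_iso_comp:
  assumes "cplx_hom K X Y f" "cplx_hom K Y Z g" "quasi_iso X Y f" "quasi_iso Y Z g"
  shows "quasi_iso X Z (\<lambda>n x. g n (f n x))"
proof -
  interpret f: cplx_hom K X Y f by fact
  interpret g: cplx_hom K Y Z g by fact
  interpret gf: cplx_hom K X Z "\<lambda>n x. g n (f n x)" using complex_hom_comp[OF assms(1,2)] .
  show ?thesis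
  proof (rule gf.quasi_isoI)
    fix n x assume "f.X.cycle n x" "g n (f n x) \<in> boundaries Z n"
    then show "x \<in> boundaries X n"
      using f.quasi_iso_inj[OF assms(3)] g.quasi_iso_inj[OF assms(4) f.hom_cycle] by blast
  next
    fix n z assume z: "g.Y.cycle n z"
    obtain y where y: "f.Y.cycle n y" "g n y \<ominus>\<^bsub>piece Z n\<^esub> z \<in> boundaries Z n" using g.quasi_iso_surj[OF assms(4) z] by blast
    obtain x where x: "f.X.cycle n x" "f n x \<ominus>\<^bsub>piece Y n\<^esub> y \<in> boundaries Y n" using f.quasi_iso_surj[OF assms(3) y(1)] by blast
    have "g n (f n x) \<ominus>\<^bsub>piece Z n\<^esub> g n y \<in> boundaries Z n"
      using g.hom_boundaries[OF x(2)] x y by (simp add: g.hom_minus)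
    then have "g n (f n x) \<ominus>\<^bsub>piece Z n\<^esub> z \<in> boundaries Z n"
      using g.Y.boundaries_trans[of "g n (f n x)" n "g n y" z] x y z by simp
    then show "\<exists>x. f.X.cycle n x \<and> g n (f n x) \<ominus>\<^bsub>piece Z n\<^esub> z \<in> boundaries Z n" using x by blast
  qed
qed

text \<open>Both injectivity and surjectivity of \<open>f\<close> on homology can be tested after applying \<open>g\<close>.\<close>

lemma quasi_iso_cancel:
  assumes "cplx_hom K X Y f" "cplx_hom K Y Z g" "quasi_iso Y Z g"
    "quasi_iso X Z (\<lambda>n x. g n (f n x))"
  shows "quasi_iso X Y f"
proof -
  interpret f: cplx_hom K X Y f by fact
  interpret g: cplx_hom K Y Z g by fact
  interpret gf: cplx_hom K X Z "\<lambda>n x. g n (f n x)" using complex_hom_comp[OF assms(1,2)] .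
  show ?thesis
  proof (rule f.quasi_isoI)
    fix n x assume "f.X.cycle n x" "f n x \<in> boundaries Y n"
    then show "x \<in> boundaries X n" using gf.quasi_iso_inj[OF assms(4)] g.hom_boundaries by blast
  next
    fix n y assume y: "f.Y.cycle n y"
    obtain x where x: "f.X.cycle n x" "g n (f n x) \<ominus>\<^bsub>piece Z n\<^esub> g n y \<in> boundaries Z n"
      using gf.quasi_iso_surj[OF assms(4) g.hom_cycle[OF y]] by blast
    then have "g n (f n x \<ominus>\<^bsub>piece Y n\<^esub> y) \<in> boundaries Z n" using y by (simp add: g.hom_minus)
    moreover have "f.Y.cycle n (f n x \<ominus>\<^bsub>piece Y n\<^esub> y)"
      using x y f.hom_cycle[of x n] f.Y.bdry_minus[of "f n x" n y] by simp
    ultimately show "\<exists>x. f.X.cycle n x \<and> f n x \<ominus>\<^bsub>piece Y n\<^esub> y \<in> boundaries Y n"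
      using g.quasi_iso_inj[OF assms(3)] x(1) by blast
  qed
qed

text \<open>Agreement on homology, as it results from a chain homotopy.\<close>

definition homologous ::
  "('k, 'a, 'y) chain_complex_scheme \<Rightarrow> ('k, 'b, 'z) chain_complex_scheme \<Rightarrow>
     (int \<Rightarrow> 'a \<Rightarrow> 'b) \<Rightarrow> (int \<Rightarrow> 'a \<Rightarrow> 'b) \<Rightarrow> bool" where
  "homologous X Y f g \<longleftrightarrow> (\<forall>n. \<forall>x\<in>elts X n. bdry X n x = \<zero>\<^bsub>piece X (n - 1)\<^esub> \<longrightarrow>
     f n x \<ominus>\<^bsub>piece Y n\<^esub> g n x \<in> boundaries Y n)"

lemma (in cplx_hom) quasi_iso_homologous:
  assumes "cplx_hom K X Y g" "quasi_iso X Y f" "homologous X Y f g"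
  shows "quasi_iso X Y g"
proof -
  interpret g: cplx_hom K X Y g by fact
  have d: "f n x \<ominus>\<^bsub>piece Y n\<^esub> g n x \<in> boundaries Y n" if "X.cycle n x" for n x
    using assms(3) that by (simp add: homologous_def)
  show ?thesis
  proof (rule g.quasi_isoI)
    fix n x assume x: "X.cycle n x" and "g n x \<in> boundaries Y n"
    then have "f n x \<in> boundaries Y n"
      using Y.boundaries_diff_iff[of "f n x" n "g n x"] d[OF x] by simp
    then show "x \<in> boundaries X n" using quasi_iso_inj[OF assms(2) x] by blast
  next
    fix n y assume y: "Y.cycle n y"
    obtain x where x: "X.cycle n x" "f n x \<ominus>\<^bsub>piece Y n\<^esub> y \<in> boundaries Y n"
      using quasi_iso_surj[OF assms(2) y] by blast
    have "g n x \<ominus>\<^bsub>piece Y n\<^esub> f n x \<in> boundaries Y n"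
      using Y.boundaries_sym[of "f n x" n "g n x"] d[OF x(1)] x(1) by simp
    then have "g n x \<ominus>\<^bsub>piece Y n\<^esub> y \<in> boundaries Y n"
      using Y.boundaries_trans[of "g n x" n "f n x" y] x y by simp
    then show "\<exists>x. X.cycle n x \<and> g n x \<ominus>\<^bsub>piece Y n\<^esub> y \<in> boundaries Y n" using x(1) by blast
  qed
qed

text \<open>On homology \<open>f g\<close> and \<open>g h\<close> are identities, so \<open>g\<close> is invertible with inverse \<open>f\<close>.\<close>

lemma quasi_iso_from_inverses:
  assumes "cplx_hom K X Y f" "cplx_hom K Y X g" "cplx_hom K X Y h"
    and fg: "homologous Y Y (\<lambda>n y. f n (g n y)) (\<lambda>n y. y)"
    and gh: "homologous X X (\<lambda>n x. g n (h n x)) (\<lambda>n x. x)"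
  shows "quasi_iso X Y f"
proof -
  interpret f: cplx_hom K X Y f by fact
  interpret g: cplx_hom K Y X g by fact
  interpret h: cplx_hom K X Y h by fact
  show ?thesis
  proof (rule f.quasi_isoI)
    fix n x assume x: "f.X.cycle n x" and b: "f n x \<in> boundaries Y n"
    define y where "y = h n x"
    have y: "f.Y.cycle n y" using h.hom_cycle[OF x] by (simp add: y_def)
    have gy: "g n y \<ominus>\<^bsub>piece X n\<^esub> x \<in> boundaries X n" using gh x by (simp add: homologous_def y_def)
    have "f n (g n y) \<ominus>\<^bsub>piece Y n\<^esub> f n x \<in> boundaries Y n"
      using f.hom_boundaries[OF gy] x y by (simp add: f.hom_minus)
    then have "f n (g n y) \<in> boundaries Y n"
      using f.Y.boundaries_diff_iff[of "f n (g n y)" n "f n x"] b x y by simp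
    then have "y \<in> boundaries Y n"
      using f.Y.boundaries_diff_iff[of "f n (g n y)" n y] fg y by (simp add: homologous_def)
    then have "g n y \<in> boundaries X n" by (rule g.hom_boundaries)
    then show "x \<in> boundaries X n"
      using f.X.boundaries_diff_iff[of "g n y" n x] gy x y by simp
  next
    fix n y assume y: "f.Y.cycle n y"
    then show "\<exists>x. f.X.cycle n x \<and> f n x \<ominus>\<^bsub>piece Y n\<^esub> y \<in> boundaries Y n"
      using fg g.hom_cycle[OF y] unfolding homologous_def by blast
  qed
qed

section \<open>Mapping cones\<close>

lemma cone_simps [simp]:
  "elts (cone X Y f) n = elts X (n - 1) \<times> elts Y n"
  "(x, y) \<oplus>\<^bsub>piece (cone X Y f) n\<^esub> (x', y') = (x \<oplus>\<^bsub>piece X (n - 1)\<^esub> x', y \<oplus>\<^bsub>piece Y n\<^esub> y')"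
  "\<zero>\<^bsub>piece (cone X Y f) n\<^esub> = (\<zero>\<^bsub>piece X (n - 1)\<^esub>, \<zero>\<^bsub>piece Y n\<^esub>)"
  "c \<odot>\<^bsub>piece (cone X Y f) n\<^esub> (x, y) = (c \<odot>\<^bsub>piece X (n - 1)\<^esub> x, c \<odot>\<^bsub>piece Y n\<^esub> y)"
  "bdry (cone X Y f) n (x, y) = (\<ominus>\<^bsub>piece X (n - 1 - 1)\<^esub> bdry X (n - 1) x,
      f (n - 1) x \<oplus>\<^bsub>piece Y (n - 1)\<^esub> bdry Y n y)"
  by (simp_all add: cone_def)

lemma cone_is_complex:
  fixes X :: "('k, 'a) chain_complex" and Y :: "('k, 'b) chain_complex"
  assumes "cplx_hom K X Y f"
  shows "cplx K (cone X Y f)"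
proof -
  interpret cplx_hom K X Y f by fact
  show ?thesis
    unfolding cplx_def is_complex_def
  proof (intro allI conjI ballI)
    fix n
    show "module K (piece (cone X Y f) n)"
    proof (rule moduleI[OF X.P.R.is_cring])
      show "abelian_group (piece (cone X Y f) n)"
      proof (rule abelian_groupI)
        fix z assume "z \<in> elts (cone X Y f) n"
        then obtain x y where *: "z = (x, y)" "x \<in> elts X (n - 1)" "y \<in> elts Y n" by auto
        then show "\<exists>w\<in>elts (cone X Y f) n. w \<oplus>\<^bsub>piece (cone X Y f) n\<^esub> z = \<zero>\<^bsub>piece (cone X Y f) n\<^esub>"
          by (intro bexI[of _ "(\<ominus>\<^bsub>piece X (n - 1)\<^esub> x, \<ominus>\<^bsub>piece Y n\<^esub> y)"])
             (auto simp: X.P.l_neg Y.P.l_neg)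
      qed (auto simp: X.P.a_ac Y.P.a_ac)
    qed (auto simp: X.P.smult_l_distr Y.P.smult_l_distr X.P.smult_r_distr Y.P.smult_r_distr
         X.P.smult_assoc1 Y.P.smult_assoc1)
    show "linear_map K (piece (cone X Y f) n) (piece (cone X Y f) (n - 1)) (bdry (cone X Y f) n)"
      unfolding linear_map_def
      by (auto simp: X.bdry_add Y.bdry_add hom_add X.P.minus_add Y.P.a_ac X.bdry_smult Y.bdry_smult
          hom_smult X.P.smult_r_minus Y.P.smult_r_distr X.P.a_comm)
    fix z assume "z \<in> elts (cone X Y f) n"
    then obtain x y where *: "z = (x, y)" "x \<in> elts X (n - 1)" "y \<in> elts Y n" by auto
    have "f (n - 1 - 1) (\<ominus>\<^bsub>piece X (n - 1 - 1)\<^esub> bdry X (n - 1) x) \<oplus>\<^bsub>piece Y (n - 1 - 1)\<^esub>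
        bdry Y (n - 1) (f (n - 1) x \<oplus>\<^bsub>piece Y (n - 1)\<^esub> bdry Y n y) = \<zero>\<^bsub>piece Y (n - 1 - 1)\<^esub>"
      using *(2,3) hom_bdry[of x "n - 1" "n - 1 - 1"] Y.bdry_bdry[of y n "n - 1" "n - 1 - 1"]
      by (simp add: hom_neg Y.bdry_add Y.P.l_neg)
    then show "bdry (cone X Y f) (n - 1) (bdry (cone X Y f) n z) = \<zero>\<^bsub>piece (cone X Y f) (n - 1 - 1)\<^esub>"
      using * X.bdry_neg[of "bdry X (n - 1) x" "n - 1 - 1"]
        X.bdry_bdry[of x "n - 1" "n - 1 - 1" "n - 1 - 1 - 1"]
      by simp
  qed
qed

lemma cone_minus:
  fixes X :: "('k, 'a) chain_complex" and Y :: "('k, 'b) chain_complex"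
  assumes "cplx_hom K X Y f" "x \<in> elts X (n - 1)" "x' \<in> elts X (n - 1)" "y \<in> elts Y n" "y' \<in> elts Y n"
  shows "(x, y) \<ominus>\<^bsub>piece (cone X Y f) n\<^esub> (x', y') = (x \<ominus>\<^bsub>piece X (n - 1)\<^esub> x', y \<ominus>\<^bsub>piece Y n\<^esub> y')"
proof -
  interpret cplx_hom K X Y f by fact
  interpret C: cplx K "cone X Y f" by (rule cone_is_complex) fact
  have "\<ominus>\<^bsub>piece (cone X Y f) n\<^esub> (x', y') = (\<ominus>\<^bsub>piece X (n - 1)\<^esub> x', \<ominus>\<^bsub>piece Y n\<^esub> y')"
    by (rule C.P.minus_equality) (use assms in \<open>auto simp: X.P.l_neg Y.P.l_neg\<close>)
  then show ?thesis by (simp add: C.P.minus_eq X.P.minus_eq Y.P.minus_eq)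
qed

locale cone_square =
  f: cplx_hom K X Y f + f': cplx_hom K X' Y' f' + a: cplx_hom K X X' a + b: cplx_hom K Y Y' b
  for K :: "'k ring" and X :: "('k, 'a) chain_complex" and Y :: "('k, 'b) chain_complex"
    and X' :: "('k, 'c) chain_complex" and Y' :: "('k, 'd) chain_complex" and f f' a b +
  assumes commutes: "x \<in> elts X n \<Longrightarrow> f' n (a n x) = b n (f n x)"
begin

definition cmap :: "int \<Rightarrow> 'a \<times> 'b \<Rightarrow> 'c \<times> 'd" where
  "cmap = (\<lambda>n z. (a (n - 1) (fst z), b n (snd z)))"

lemma cmap_simp [simp]: "cmap n (x, y) = (a (n - 1) x, b n y)"
  by (simp add: cmap_def)

lemma cmap_hom: "cplx_hom K (cone X Y f) (cone X' Y' f') cmap"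
proof -
  interpret C: cplx K "cone X Y f" by (rule cone_is_complex) (rule f.cplx_hom_axioms)
  interpret C': cplx K "cone X' Y' f'" by (rule cone_is_complex) (rule f'.cplx_hom_axioms)
  show ?thesis
    by unfold_locales
       (auto simp: complex_hom_def linear_map_def a.hom_add b.hom_add a.hom_smult b.hom_smult
          a.hom_neg a.hom_bdry b.hom_bdry commutes)
qed

text \<open>The five lemma for the long exact sequences of the two cones, as a chase in terms of cycles
  and boundaries. Injectivity: bound the source component, correct the bounding element by a cycle
  so that its image becomes prescribed up to a boundary, and then bound what is left in the target.
  Surjectivity: lift the source component up to a boundary, use injectivity of \<open>b\<close> to complete it to
  a cycle of the cone, and correct by a cycle of the target.\<close>

lemma cmap_quasi_iso:
  assumes "quasi_iso X X' a" "quasi_iso Y Y' b"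
  shows "quasi_iso (cone X Y f) (cone X' Y' f') cmap"
proof -
  interpret C: cplx_hom K "cone X Y f" "cone X' Y' f'" cmap by (rule cmap_hom)
  note qa = a.quasi_iso_inj[OF assms(1)] a.quasi_iso_surj[OF assms(1)]
  note qb = b.quasi_iso_inj[OF assms(2)] b.quasi_iso_surj[OF assms(2)]
  note simps = f.X.P.abel f.Y.P.abel f'.X.P.abel f'.Y.P.abel
  show ?thesis
  proof (rule C.quasi_isoI)
    fix n z assume z: "C.X.cycle n z" and bz: "cmap n z \<in> boundaries (cone X' Y' f') n"
    obtain x y where xy: "z = (x, y)" "x \<in> elts X (n - 1)" "y \<in> elts Y n" using z by auto
    have "\<ominus>\<^bsub>piece X (n - 1 - 1)\<^esub> bdry X (n - 1) x = \<zero>\<^bsub>piece X (n - 1 - 1)\<^esub>"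
      and cyc: "f (n - 1) x \<oplus>\<^bsub>piece Y (n - 1)\<^esub> bdry Y n y = \<zero>\<^bsub>piece Y (n - 1)\<^esub>" using z xy(1) by auto
    then have dx: "bdry X (n - 1) x = \<zero>\<^bsub>piece X (n - 1 - 1)\<^esub>"
      using xy(2) f.X.P.minus_minus[of "bdry X (n - 1) x" "n - 1 - 1"] by simp
    obtain w where "w \<in> elts (cone X' Y' f') (n + 1)" and w: "cmap n z = bdry (cone X' Y' f') (n + 1) w"
      using bz unfolding C.Y.boundaries_iff by blast
    then obtain x' y' where xy': "w = (x', y')" "x' \<in> elts X' n" "y' \<in> elts Y' (n + 1)" by auto
    have w1: "a (n - 1) x = \<ominus>\<^bsub>piece X' (n - 1)\<^esub> bdry X' n x'"
      and w2: "b n y = f' n x' \<oplus>\<^bsub>piece Y' n\<^esub> bdry Y' (n + 1) y'"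
      using w xy xy' by auto
    have "a (n - 1) x \<in> boundaries X' (n - 1)"
      unfolding w1 using f'.X.boundaries_neg[OF f'.X.boundariesI[OF xy'(2), of "n - 1"]] by simp
    then have "x \<in> boundaries X (n - 1)" using qa(1)[of x "n - 1"] xy(2) dx by blast
    then obtain u where u: "u \<in> elts X n" "x = bdry X n u" unfolding f.X.boundaries_iff by auto
    define v where "v = \<ominus>\<^bsub>piece X' n\<^esub> (a n u \<oplus>\<^bsub>piece X' n\<^esub> x')"
    have au: "bdry X' n (a n u) = \<ominus>\<^bsub>piece X' (n - 1)\<^esub> bdry X' n x'"
      using w1 u a.hom_bdry[of u n "n - 1"] by simp
    then have v: "f'.X.cycle n v"
      using u xy' by (simp add: v_def f'.X.bdry_neg f'.X.bdry_add f'.X.P.l_neg)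
    obtain u' where u': "f.X.cycle n u'" "a n u' \<ominus>\<^bsub>piece X' n\<^esub> v \<in> boundaries X' n" using qa(2)[OF v] by blast
    obtain t where t: "t \<in> elts X' (n + 1)" "a n u' \<ominus>\<^bsub>piece X' n\<^esub> v = bdry X' (n + 1) t"
      using u'(2) unfolding f'.X.boundaries_iff by blast
    define r where "r = u \<oplus>\<^bsub>piece X n\<^esub> u'"
    have r: "r \<in> elts X n" "bdry X n r = x" using u u' by (auto simp: r_def f.X.bdry_add)
    have "a n r = \<ominus>\<^bsub>piece X' n\<^esub> x' \<oplus>\<^bsub>piece X' n\<^esub> (a n u' \<ominus>\<^bsub>piece X' n\<^esub> v)"
      using u u' xy' by (simp add: r_def v_def a.hom_add simps)
    then have ar: "a n r = \<ominus>\<^bsub>piece X' n\<^esub> x' \<oplus>\<^bsub>piece X' n\<^esub> bdry X' (n + 1) t" using t(2) by simp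
    have bt: "bdry X' (n + 1) t \<in> elts X' n" using f'.X.bdry_closed[OF t(1), of n] by simp
    have by': "bdry Y' (n + 1) y' \<in> elts Y' n" using f'.Y.bdry_closed[OF xy'(3), of n] by simp
    have fr: "b n (f n r) = \<ominus>\<^bsub>piece Y' n\<^esub> f' n x' \<oplus>\<^bsub>piece Y' n\<^esub> bdry Y' (n + 1) (f' (n + 1) t)"
      using commutes[OF r(1)] ar xy' t bt f'.hom_bdry[OF t(1), of n] by (simp add: f'.hom_add f'.hom_neg)
    define s where "s = y \<oplus>\<^bsub>piece Y n\<^esub> f n r"
    have sc: "f.Y.cycle n s"
      using r xy cyc f.hom_bdry[OF r(1), of "n - 1"] by (simp add: s_def f.Y.bdry_add f.Y.P.a_comm)
    have "b n s = bdry Y' (n + 1) y' \<oplus>\<^bsub>piece Y' n\<^esub> bdry Y' (n + 1) (f' (n + 1) t)"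
    proof -
      have "bdry Y' (n + 1) (f' (n + 1) t) \<in> elts Y' n"
        using f'.Y.bdry_closed[of "f' (n + 1) t" "n + 1" n] t(1) by simp
      then show ?thesis using w2 fr by' r xy xy' by (simp add: s_def b.hom_add simps)
    qed
    also have "\<dots> \<in> boundaries Y' n"
      using f'.Y.boundariesI[of _ "n + 1" n] xy' t by (intro f'.Y.boundaries_add) auto
    finally have "s \<in> boundaries Y n" using qb(1)[OF sc] by blast
    then obtain q where q: "q \<in> elts Y (n + 1)" "s = bdry Y (n + 1) q" unfolding f.Y.boundaries_iff by blast
    have "z = bdry (cone X Y f) (n + 1) (\<ominus>\<^bsub>piece X n\<^esub> r, q)"
    proof -
      have "y = \<ominus>\<^bsub>piece Y n\<^esub> f n r \<oplus>\<^bsub>piece Y n\<^esub> s" using r xy by (simp add: s_def simps)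
      then show ?thesis using xy r q by (simp add: f.X.bdry_neg f.hom_neg)
    qed
    moreover have "(\<ominus>\<^bsub>piece X n\<^esub> r, q) \<in> elts (cone X Y f) (n + 1)" using r q by simp
    ultimately show "z \<in> boundaries (cone X Y f) n" unfolding C.X.boundaries_iff by blast
  next
    fix n z assume z: "C.Y.cycle n z"
    obtain x' y' where xy: "z = (x', y')" "x' \<in> elts X' (n - 1)" "y' \<in> elts Y' n" using z by auto
    have "\<ominus>\<^bsub>piece X' (n - 1 - 1)\<^esub> bdry X' (n - 1) x' = \<zero>\<^bsub>piece X' (n - 1 - 1)\<^esub>"
      and cyc: "f' (n - 1) x' \<oplus>\<^bsub>piece Y' (n - 1)\<^esub> bdry Y' n y' = \<zero>\<^bsub>piece Y' (n - 1)\<^esub>" using z xy(1) by auto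
    then have dx: "bdry X' (n - 1) x' = \<zero>\<^bsub>piece X' (n - 1 - 1)\<^esub>"
      using xy(2) f'.X.P.minus_minus[of "bdry X' (n - 1) x'" "n - 1 - 1"] by simp
    obtain x where x: "f.X.cycle (n - 1) x" "a (n - 1) x \<ominus>\<^bsub>piece X' (n - 1)\<^esub> x' \<in> boundaries X' (n - 1)"
      using qa(2)[of x' "n - 1"] xy(2) dx by blast
    then obtain u where u: "u \<in> elts X' n" "a (n - 1) x \<ominus>\<^bsub>piece X' (n - 1)\<^esub> x' = bdry X' n u"
      unfolding f'.X.boundaries_iff by auto
    have ax: "a (n - 1) x = x' \<oplus>\<^bsub>piece X' (n - 1)\<^esub> bdry X' n u"
      using u(2)[symmetric] x xy by (simp add: simps)
    have fx': "f' (n - 1) x' = \<ominus>\<^bsub>piece Y' (n - 1)\<^esub> bdry Y' n y'"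
      using cyc xy f'.Y.P.minus_equality[OF cyc] by simp
    have bf: "b (n - 1) (f (n - 1) x) = bdry Y' n (f' n u \<ominus>\<^bsub>piece Y' n\<^esub> y')"
      using commutes[of x "n - 1"] x ax xy u fx' f'.hom_bdry[OF u(1), of "n - 1"]
      by (simp add: f'.hom_add f'.Y.bdry_add f'.Y.bdry_neg simps)
    then have "b (n - 1) (f (n - 1) x) \<in> boundaries Y' (n - 1)"
      using f'.Y.boundariesI[of "f' n u \<ominus>\<^bsub>piece Y' n\<^esub> y'" n "n - 1"] u xy by simp
    then have "f (n - 1) x \<in> boundaries Y (n - 1)" using qb(1)[OF f.hom_cycle[OF x(1)]] by blast
    then obtain y0 where y0: "y0 \<in> elts Y n" "f (n - 1) x = bdry Y n y0" unfolding f.Y.boundaries_iff by auto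
    define y where "y = \<ominus>\<^bsub>piece Y n\<^esub> y0"
    have y: "y \<in> elts Y n" "f (n - 1) x \<oplus>\<^bsub>piece Y (n - 1)\<^esub> bdry Y n y = \<zero>\<^bsub>piece Y (n - 1)\<^esub>"
      using y0 by (auto simp: y_def f.Y.bdry_neg f.Y.P.r_neg)
    define v where "v = b n y \<ominus>\<^bsub>piece Y' n\<^esub> y' \<oplus>\<^bsub>piece Y' n\<^esub> f' n u"
    have "bdry Y' n (b n y) = \<ominus>\<^bsub>piece Y' (n - 1)\<^esub> b (n - 1) (f (n - 1) x)"
      using y0 b.hom_bdry[of y0 n "n - 1"] by (simp add: y_def b.hom_neg f'.Y.bdry_neg)
    then have v: "f'.Y.cycle n v"
      using bf y u xy by (simp add: v_def f'.Y.bdry_add f'.Y.bdry_minus simps)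
    obtain y1 where y1: "f.Y.cycle n y1" "b n y1 \<ominus>\<^bsub>piece Y' n\<^esub> v \<in> boundaries Y' n" using qb(2)[OF v] by blast
    obtain t where t: "t \<in> elts Y' (n + 1)" "b n y1 \<ominus>\<^bsub>piece Y' n\<^esub> v = bdry Y' (n + 1) t"
      using y1(2) unfolding f'.Y.boundaries_iff by blast
    have bt: "bdry Y' (n + 1) t \<in> elts Y' n" using f'.Y.bdry_closed[OF t(1), of n] by simp
    define w where "w = (x, y \<ominus>\<^bsub>piece Y n\<^esub> y1)"
    have wc: "C.X.cycle n w" using x y y1 by (simp add: w_def f.Y.bdry_minus)
    have "b n (y \<ominus>\<^bsub>piece Y n\<^esub> y1) \<ominus>\<^bsub>piece Y' n\<^esub> y' = \<ominus>\<^bsub>piece Y' n\<^esub> f' n u \<ominus>\<^bsub>piece Y' n\<^esub> (b n y1 \<ominus>\<^bsub>piece Y' n\<^esub> v)"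
      using y y1 u xy by (simp add: v_def b.hom_add b.hom_neg simps)
    then have 2: "b n (y \<ominus>\<^bsub>piece Y n\<^esub> y1) \<ominus>\<^bsub>piece Y' n\<^esub> y' =
        f' n (\<ominus>\<^bsub>piece X' n\<^esub> u) \<oplus>\<^bsub>piece Y' n\<^esub> bdry Y' (n + 1) (\<ominus>\<^bsub>piece Y' (n + 1)\<^esub> t)"
      using t u bt by (simp add: f'.hom_neg f'.Y.bdry_neg f'.Y.P.minus_eq)
    have "cmap n w \<ominus>\<^bsub>piece (cone X' Y' f') n\<^esub> z =
        bdry (cone X' Y' f') (n + 1) (\<ominus>\<^bsub>piece X' n\<^esub> u, \<ominus>\<^bsub>piece Y' (n + 1)\<^esub> t)"
      using cone_minus[OF f'.cplx_hom_axioms, of "a (n - 1) x" n x' "b n (y \<ominus>\<^bsub>piece Y n\<^esub> y1)" y'] 2 u x y y1 xy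
      by (simp add: w_def f'.X.bdry_neg)
    moreover have "(\<ominus>\<^bsub>piece X' n\<^esub> u, \<ominus>\<^bsub>piece Y' (n + 1)\<^esub> t) \<in> elts (cone X' Y' f') (n + 1)"
      using u t by simp
    ultimately have "cmap n w \<ominus>\<^bsub>piece (cone X' Y' f') n\<^esub> z \<in> boundaries (cone X' Y' f') n"
      unfolding C.Y.boundaries_iff by blast
    with wc show "\<exists>w. C.X.cycle n w \<and> cmap n w \<ominus>\<^bsub>piece (cone X' Y' f') n\<^esub> z \<in> boundaries (cone X' Y' f') n"
      by blast
  qed
qed

end

section \<open>Categories of graded objects\<close>

text \<open>Complexes and DG algebras form categories for the same reason; \<open>C\<close> carries the classes of maps
  of a relative or a model category in addition.\<close>

lemma graded_category_laws:
  fixes C :: "(('k, 'a, 'z) chain_complex_scheme,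
    (('k, 'a, 'z) chain_complex_scheme, int \<Rightarrow> 'a \<Rightarrow> 'a) arrow, 'y) category_scheme"
  assumes C: "category.truncate C = graded_category obs is_map"
    and id: "\<And>X. X \<in> obs \<Longrightarrow> is_map X X (\<lambda>n. \<lambda>x\<in>elts X n. x)"
    and comp: "\<And>X Y Z f g. X \<in> obs \<Longrightarrow> Y \<in> obs \<Longrightarrow> Z \<in> obs \<Longrightarrow> is_map X Y f \<Longrightarrow> is_map Y Z g \<Longrightarrow>
       is_map X Z (\<lambda>n. compose (elts X n) (g n) (f n))"
    and closed: "\<And>X Y f n. X \<in> obs \<Longrightarrow> Y \<in> obs \<Longrightarrow> is_map X Y f \<Longrightarrow> f n \<in> extensional (elts X n) \<inter> (elts X n \<rightarrow> elts Y n)"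
  shows "category_laws C"
proof -
  have simps: "Ob C = obs" "Ar C = {u. src u \<in> obs \<and> tgt u \<in> obs \<and> is_map (src u) (tgt u) (lab u)}"
    "Dom C = src" "Cod C = tgt" "Idt C = (\<lambda>X. \<lparr>src = X, lab = (\<lambda>n. \<lambda>x \<in> elts X n. x), tgt = X\<rparr>)"
    "Cmp C = (\<lambda>v u. \<lparr>src = src u, lab = (\<lambda>n. compose (elts (src u) n) (lab v n) (lab u n)), tgt = tgt v\<rparr>)"
    using C by (auto simp: graded_category_def category.truncate_def)
  have ext: "f n x = undefined" if "X \<in> obs" "Y \<in> obs" "is_map X Y f" "x \<notin> elts X n" for X Y f n x
    using closed[OF that(1-3), of n] that(4) by (auto simp: extensional_def)
  have into: "f n x \<in> elts Y n" if "X \<in> obs" "Y \<in> obs" "is_map X Y f" "x \<in> elts X n" for X Y f n x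
    using closed[OF that(1-3), of n] that(4) by auto
  show ?thesis
  proof
    fix f X Y assume "f \<in> Hom C X Y"
    then have f: "X \<in> obs" "Y \<in> obs" "is_map X Y (lab f)" "src f = X" "tgt f = Y" by (auto simp: Hom_def simps)
    have e: "(\<lambda>n. compose (elts X n) (\<lambda>x\<in>elts Y n. x) (lab f n)) = lab f"
      "(\<lambda>n. compose (elts X n) (lab f n) (\<lambda>x\<in>elts X n. x)) = lab f"
      by (auto simp: fun_eq_iff compose_def ext[OF f(1-3)] into[OF f(1-3)])
    show "Cmp C (Idt C Y) f = f" "Cmp C f (Idt C X) = f"
      using f(4,5) e by (simp_all add: simps)
  next
    fix f g h W X Y Z assume "f \<in> Hom C W X" "g \<in> Hom C X Y" "h \<in> Hom C Y Z"
    then have f: "W \<in> obs" "X \<in> obs" "is_map W X (lab f)" "src f = W" and g: "src g = X" and h: "src h = Y"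
       "tgt f = X" "tgt g = Y"
      by (auto simp: Hom_def simps)
    show "Cmp C (Cmp C h g) f = Cmp C h (Cmp C g f)"
      by (auto simp: simps compose_def fun_eq_iff f(4) g h into[OF f(1-3)])
  qed (auto simp: Hom_def simps id intro: comp)
qed

lemma complex_hom_id: "is_complex K X \<Longrightarrow> complex_hom K X X (\<lambda>n x. x)"
  by (auto simp: complex_hom_def linear_map_def)

lemma complex_hom_restrict:
  assumes "is_complex K X"
  shows "complex_hom K X Y (\<lambda>n. restrict (f n) (elts X n)) \<longleftrightarrow> complex_hom K X Y f"
proof -
  interpret cplx K X by (simp add: cplx_def assms)
  show ?thesis by (simp add: complex_hom_def linear_map_def Pi_iff)
qed

lemma Com_simps:
  "Ob (Com K) = {X. is_complex K X}"
  "u \<in> Ar (Com K) \<longleftrightarrow> is_complex K (src u) \<and> is_complex K (tgt u) \<and> chain_map K (src u) (tgt u) (lab u)"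
  "Dom (Com K) = src" "Cod (Com K) = tgt"
  "Idt (Com K) = (\<lambda>X. \<lparr>src = X, lab = (\<lambda>n. \<lambda>x \<in> elts X n. x), tgt = X\<rparr>)"
  "Cmp (Com K) = (\<lambda>v u. \<lparr>src = src u, lab = (\<lambda>n. compose (elts (src u) n) (lab v n) (lab u n)), tgt = tgt v\<rparr>)"
  "weq (Com K) = {u \<in> Ar (Com K). quasi_iso (src u) (tgt u) (lab u)}"
  by (auto simp: Com_def Let_def graded_category_def category.extend_def relcat.fields_def)

lemma Com_category: "rel_category (Com K)"
  unfolding rel_category_def
proof (rule graded_category_laws[where obs = "{X. is_complex K X}" and is_map = "chain_map K"])
  show "category.truncate (Com K) = graded_category {X. is_complex K X} (chain_map K)"
    by (simp add: Com_def Let_def graded_category_def category.extend_def relcat.fields_def category.truncate_def)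
next
  fix X :: "('a, 'b) chain_complex" assume "X \<in> {X. is_complex K X}"
  then show "chain_map K X X (\<lambda>n. \<lambda>x\<in>elts X n. x)"
    using complex_hom_id[of K X] complex_hom_restrict[of K X X "\<lambda>n x. x"] by (auto simp: chain_map_iff)
next
  fix X Y Z :: "('a, 'b) chain_complex" and f g
  assume "X \<in> {X. is_complex K X}" "Y \<in> {X. is_complex K X}" "Z \<in> {X. is_complex K X}"
     "chain_map K X Y f" "chain_map K Y Z g"
  then have "cplx_hom K X Z (\<lambda>n x. g n (f n x))"
    using complex_hom_comp[of K X Y f Z g]
    by (auto simp: cplx_hom_def cplx_def cplx_hom_axioms_def chain_map_iff)
  then show "chain_map K X Z (\<lambda>n. compose (elts X n) (g n) (f n))"
    using complex_hom_restrict[of K X Z "\<lambda>n x. g n (f n x)"]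
    by (auto simp: chain_map_iff compose_def cplx_hom_def cplx_def cplx_hom_axioms_def)
qed (auto simp: chain_map_def linear_map_def)

section \<open>Graded algebras\<close>

definition graded_algebra :: "'k ring \<Rightarrow> ('k, 'a) dga \<Rightarrow> bool" where
  "graded_algebra K A \<longleftrightarrow> (\<forall>n. module K (piece A n)) \<and>
     (\<forall>i j. \<forall>a \<in> elts A i. linear_map K (piece A j) (piece A (i + j)) (\<lambda>b. gmult A i j a b)) \<and>
     (\<forall>i j. \<forall>b \<in> elts A j. linear_map K (piece A i) (piece A (i + j)) (\<lambda>a. gmult A i j a b)) \<and>
     (\<forall>i j l. \<forall>a \<in> elts A i. \<forall>b \<in> elts A j. \<forall>c \<in> elts A l.
        gmult A (i + j) l (gmult A i j a b) c = gmult A i (j + l) a (gmult A j l b c)) \<and>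
     gone A \<in> elts A 0 \<and>
     (\<forall>i. \<forall>a \<in> elts A i. gmult A 0 i (gone A) a = a \<and> gmult A i 0 a (gone A) = a)"

lemma graded_algebraI:
  assumes "\<And>n. module K (piece A n)"
    and "\<And>i j a b. a \<in> elts A i \<Longrightarrow> b \<in> elts A j \<Longrightarrow> gmult A i j a b \<in> elts A (i + j)"
    and "\<And>i j a b c. a \<in> elts A i \<Longrightarrow> b \<in> elts A j \<Longrightarrow> c \<in> elts A j \<Longrightarrow>
       gmult A i j a (b \<oplus>\<^bsub>piece A j\<^esub> c) = gmult A i j a b \<oplus>\<^bsub>piece A (i + j)\<^esub> gmult A i j a c"
    and "\<And>i j a b c. a \<in> elts A i \<Longrightarrow> b \<in> elts A i \<Longrightarrow> c \<in> elts A j \<Longrightarrow>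
       gmult A i j (a \<oplus>\<^bsub>piece A i\<^esub> b) c = gmult A i j a c \<oplus>\<^bsub>piece A (i + j)\<^esub> gmult A i j b c"
    and "\<And>i j a b c. c \<in> carrier K \<Longrightarrow> a \<in> elts A i \<Longrightarrow> b \<in> elts A j \<Longrightarrow>
       gmult A i j a (c \<odot>\<^bsub>piece A j\<^esub> b) = c \<odot>\<^bsub>piece A (i + j)\<^esub> gmult A i j a b"
    and "\<And>i j a b c. c \<in> carrier K \<Longrightarrow> a \<in> elts A i \<Longrightarrow> b \<in> elts A j \<Longrightarrow>
       gmult A i j (c \<odot>\<^bsub>piece A i\<^esub> a) b = c \<odot>\<^bsub>piece A (i + j)\<^esub> gmult A i j a b"
    and "\<And>i j l a b c. a \<in> elts A i \<Longrightarrow> b \<in> elts A j \<Longrightarrow> c \<in> elts A l \<Longrightarrow>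
        gmult A (i + j) l (gmult A i j a b) c = gmult A i (j + l) a (gmult A j l b c)"
    and "gone A \<in> elts A 0"
    and "\<And>i a. a \<in> elts A i \<Longrightarrow> gmult A 0 i (gone A) a = a"
    and "\<And>i a. a \<in> elts A i \<Longrightarrow> gmult A i 0 a (gone A) = a"
  shows "graded_algebra K A"
  using assms unfolding graded_algebra_def linear_map_def by (auto simp: Pi_def)

locale galg =
  fixes K :: "'k ring" and A :: "('k, 'a) dga"
  assumes graded_algebra: "graded_algebra K A"

sublocale galg \<subseteq> P: module K "piece A n" for n
  using graded_algebra by (simp add: graded_algebra_def)

context galg begin

lemma mult_closed [simp]:
  "a \<in> elts A i \<Longrightarrow> b \<in> elts A j \<Longrightarrow> i + j = n \<Longrightarrow> gmult A i j a b \<in> elts A n"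
  using graded_algebra by (auto simp: graded_algebra_def linear_map_def Pi_iff)

lemma mult_add_right: "a \<in> elts A i \<Longrightarrow> b \<in> elts A j \<Longrightarrow> c \<in> elts A j \<Longrightarrow>
    gmult A i j a (b \<oplus>\<^bsub>piece A j\<^esub> c) = gmult A i j a b \<oplus>\<^bsub>piece A (i + j)\<^esub> gmult A i j a c"
  using graded_algebra by (auto simp: graded_algebra_def linear_map_def)

lemma mult_add_left: "a \<in> elts A i \<Longrightarrow> b \<in> elts A i \<Longrightarrow> c \<in> elts A j \<Longrightarrow>
    gmult A i j (a \<oplus>\<^bsub>piece A i\<^esub> b) c = gmult A i j a c \<oplus>\<^bsub>piece A (i + j)\<^esub> gmult A i j b c"
  using graded_algebra by (auto simp: graded_algebra_def linear_map_def)

lemma mult_smult_right: "c \<in> carrier K \<Longrightarrow> a \<in> elts A i \<Longrightarrow> b \<in> elts A j \<Longrightarrow>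
    gmult A i j a (c \<odot>\<^bsub>piece A j\<^esub> b) = c \<odot>\<^bsub>piece A (i + j)\<^esub> gmult A i j a b"
  using graded_algebra by (auto simp: graded_algebra_def linear_map_def)

lemma mult_smult_left: "c \<in> carrier K \<Longrightarrow> a \<in> elts A i \<Longrightarrow> b \<in> elts A j \<Longrightarrow>
    gmult A i j (c \<odot>\<^bsub>piece A i\<^esub> a) b = c \<odot>\<^bsub>piece A (i + j)\<^esub> gmult A i j a b"
  using graded_algebra by (auto simp: graded_algebra_def linear_map_def)

lemma mult_assoc: "a \<in> elts A i \<Longrightarrow> b \<in> elts A j \<Longrightarrow> c \<in> elts A l \<Longrightarrow> m = i + j \<Longrightarrow> n = j + l \<Longrightarrow>
    gmult A m l (gmult A i j a b) c = gmult A i n a (gmult A j l b c)"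
  using graded_algebra by (auto simp: graded_algebra_def)

lemma one_closed [simp]: "gone A \<in> elts A 0"
  using graded_algebra by (auto simp: graded_algebra_def)

lemma one_mult [simp]: "a \<in> elts A i \<Longrightarrow> gmult A 0 i (gone A) a = a"
  and mult_one [simp]: "a \<in> elts A i \<Longrightarrow> gmult A i 0 a (gone A) = a"
  using graded_algebra by (auto simp: graded_algebra_def)

lemma mult_zero_right [simp]: "a \<in> elts A i \<Longrightarrow> gmult A i j a \<zero>\<^bsub>piece A j\<^esub> = \<zero>\<^bsub>piece A (i + j)\<^esub>"
  using mult_smult_right[of "\<zero>\<^bsub>K\<^esub>" a i "\<zero>\<^bsub>piece A j\<^esub>" j] by simp

lemma mult_zero_left [simp]: "b \<in> elts A j \<Longrightarrow> gmult A i j \<zero>\<^bsub>piece A i\<^esub> b = \<zero>\<^bsub>piece A (i + j)\<^esub>"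
  using mult_smult_left[of "\<zero>\<^bsub>K\<^esub>" "\<zero>\<^bsub>piece A i\<^esub>" i b j] by simp

lemma mult_neg_right: "a \<in> elts A i \<Longrightarrow> b \<in> elts A j \<Longrightarrow>
    gmult A i j a (\<ominus>\<^bsub>piece A j\<^esub> b) = \<ominus>\<^bsub>piece A (i + j)\<^esub> gmult A i j a b"
  using mult_smult_right[of "\<ominus>\<^bsub>K\<^esub> \<one>\<^bsub>K\<^esub>" a i b j] by (simp add: P.smult_l_minus)

lemma mult_neg_left: "a \<in> elts A i \<Longrightarrow> b \<in> elts A j \<Longrightarrow>
    gmult A i j (\<ominus>\<^bsub>piece A i\<^esub> a) b = \<ominus>\<^bsub>piece A (i + j)\<^esub> gmult A i j a b"
  using mult_smult_left[of "\<ominus>\<^bsub>K\<^esub> \<one>\<^bsub>K\<^esub>" a i b j] by (simp add: P.smult_l_minus)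

lemma sign_closed [simp]: "sign K n \<in> carrier K"
  by (simp add: sign_def)

lemma sign_smult: "x \<in> elts A n \<Longrightarrow> sign K m \<odot>\<^bsub>piece A n\<^esub> x = (if even m then x else \<ominus>\<^bsub>piece A n\<^esub> x)"
  by (simp add: sign_def P.smult_l_minus)

end

lemma is_dga_iff: "is_dga K A \<longleftrightarrow> graded_algebra K A \<and> is_complex K A \<and>
   (\<forall>i j. \<forall>a \<in> elts A i. \<forall>b \<in> elts A j.
        bdry A (i + j) (gmult A i j a b) =
          gmult A (i - 1) j (bdry A i a) b
            \<oplus>\<^bsub>piece A (i + j - 1)\<^esub>
          sign K i \<odot>\<^bsub>piece A (i + j - 1)\<^esub> gmult A i (j - 1) a (bdry A j b))"
  unfolding is_dga_def graded_algebra_def is_complex_def by blast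

locale dgalg =
  fixes K :: "'k ring" and A :: "('k, 'a) dga"
  assumes is_dga: "is_dga K A"

sublocale dgalg \<subseteq> galg K A
  using is_dga by unfold_locales (simp add: is_dga_iff)

sublocale dgalg \<subseteq> cplx K A
  using is_dga by unfold_locales (simp add: is_dga_iff)

context dgalg begin

lemma leibniz: "a \<in> elts A i \<Longrightarrow> b \<in> elts A j \<Longrightarrow> n = i + j \<Longrightarrow>
   bdry A n (gmult A i j a b) = gmult A (i - 1) j (bdry A i a) b
      \<oplus>\<^bsub>piece A (n - 1)\<^esub> sign K i \<odot>\<^bsub>piece A (n - 1)\<^esub> gmult A i (j - 1) a (bdry A j b)"
  using is_dga by (auto simp: is_dga_def)

lemma bdry_one: "bdry A 0 (gone A) = \<zero>\<^bsub>piece A (- 1)\<^esub>"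
proof -
  have d: "bdry A 0 (gone A) \<in> elts A (- 1)" by simp
  have "bdry A 0 (gone A) = bdry A 0 (gone A) \<oplus>\<^bsub>piece A (- 1)\<^esub> bdry A 0 (gone A)"
    using leibniz[of "gone A" 0 "gone A" 0 0] d by (simp add: sign_def)
  then show ?thesis using d P.add.r_cancel_one[of "bdry A 0 (gone A)" "- 1" "bdry A 0 (gone A)"] by simp
qed

end

text \<open>Maps of DG algebras without the convention on values outside the domain.\<close>

definition dga_hom :: "'k ring \<Rightarrow> ('k, 'a) dga \<Rightarrow> ('k, 'b) dga \<Rightarrow> (int \<Rightarrow> 'a \<Rightarrow> 'b) \<Rightarrow> bool" where
  "dga_hom K A B f \<longleftrightarrow> complex_hom K A B f \<and>
     (\<forall>i j. \<forall>a \<in> elts A i. \<forall>b \<in> elts A j. f (i + j) (gmult A i j a b) = gmult B i j (f i a) (f j b)) \<and>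
     f 0 (gone A) = gone B"

lemma dga_map_iff: "dga_map K A B f \<longleftrightarrow> dga_hom K A B f \<and> (\<forall>n. f n \<in> extensional (elts A n))"
  by (auto simp: dga_map_def dga_hom_def chain_map_iff)

locale dgalg_hom = A: dgalg K A + B: dgalg K B
  for K :: "'k ring" and A :: "('k, 'a) dga" and B :: "('k, 'b) dga" +
  fixes f :: "int \<Rightarrow> 'a \<Rightarrow> 'b"
  assumes dga_hom: "dga_hom K A B f"

sublocale dgalg_hom \<subseteq> cplx_hom K A B f
  using dga_hom by unfold_locales (simp add: dga_hom_def)

context dgalg_hom begin

lemma hom_mult: "a \<in> elts A i \<Longrightarrow> b \<in> elts A j \<Longrightarrow> n = i + j \<Longrightarrow>
    f n (gmult A i j a b) = gmult B i j (f i a) (f j b)"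
  using dga_hom by (auto simp: dga_hom_def)

lemma hom_one [simp]: "f 0 (gone A) = gone B"
  using dga_hom by (auto simp: dga_hom_def)

end

lemma dga_hom_restrict:
  assumes "is_dga K A"
  shows "dga_hom K A B (\<lambda>n. restrict (f n) (elts A n)) \<longleftrightarrow> dga_hom K A B f"
proof -
  interpret dgalg K A by (simp add: dgalg_def assms)
  show ?thesis using complex_hom_restrict[OF is_complex, of B f] by (auto simp: dga_hom_def)
qed

lemma dga_hom_comp:
  assumes "dgalg_hom K A B f" "dgalg_hom K B C g"
  shows "dgalg_hom K A C (\<lambda>n x. g n (f n x))"
proof -
  interpret f: dgalg_hom K A B f by fact
  interpret g: dgalg_hom K B C g by fact
  interpret gf: cplx_hom K A C "\<lambda>n x. g n (f n x)"
    using complex_hom_comp[OF f.cplx_hom_axioms g.cplx_hom_axioms] .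
  show ?thesis by unfold_locales (use gf.hom in \<open>auto simp: dga_hom_def f.hom_mult g.hom_mult\<close>)
qed

lemma dga_hom_id: "is_dga K A \<Longrightarrow> dga_hom K A A (\<lambda>n x. x)"
  by (auto simp: dga_hom_def is_dga_def complex_hom_id)

lemma DGA_simps:
  "Ob (DGA K) = {A. is_dga K A}"
  "u \<in> Ar (DGA K) \<longleftrightarrow> is_dga K (src u) \<and> is_dga K (tgt u) \<and> dga_map K (src u) (tgt u) (lab u)"
  "Dom (DGA K) = src" "Cod (DGA K) = tgt"
  "Idt (DGA K) = (\<lambda>X. \<lparr>src = X, lab = (\<lambda>n. \<lambda>x \<in> elts X n. x), tgt = X\<rparr>)"
  "Cmp (DGA K) = (\<lambda>v u. \<lparr>src = src u, lab = (\<lambda>n. compose (elts (src u) n) (lab v n) (lab u n)), tgt = tgt v\<rparr>)"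
  "weq (DGA K) = {u \<in> Ar (DGA K). quasi_iso (src u) (tgt u) (lab u)}"
  "fib (DGA K) = {u \<in> Ar (DGA K). \<forall>n. lab u n ` elts (src u) n = elts (tgt u) n}"
  by (auto simp: DGA_def Let_def graded_category_def category.extend_def relcat.extend_def
      relcat.fields_def model.fields_def)

lemma DGA_category: "rel_category (DGA K)"
  unfolding rel_category_def
proof (rule graded_category_laws[where obs = "{A. is_dga K A}" and is_map = "dga_map K"])
  show "category.truncate (DGA K) = graded_category {A. is_dga K A} (dga_map K)"
    by (simp add: DGA_def Let_def graded_category_def category.extend_def relcat.fields_def
        relcat.extend_def model.fields_def category.truncate_def)
next
  fix A :: "('a, 'b) dga" assume "A \<in> {A. is_dga K A}"
  then show "dga_map K A A (\<lambda>n. \<lambda>x\<in>elts A n. x)"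
    using dga_hom_id[of K A] dga_hom_restrict[of K A A "\<lambda>n x. x"] by (auto simp: dga_map_iff)
next
  fix A B C :: "('a, 'b) dga" and f g
  assume "A \<in> {A. is_dga K A}" "B \<in> {A. is_dga K A}" "C \<in> {A. is_dga K A}"
     "dga_map K A B f" "dga_map K B C g"
  then have "dgalg_hom K A C (\<lambda>n x. g n (f n x))"
    using dga_hom_comp[of K A B f C g]
    by (auto simp: dgalg_hom_def dgalg_def dgalg_hom_axioms_def dga_map_iff)
  then show "dga_map K A C (\<lambda>n. compose (elts A n) (g n) (f n))"
    using dga_hom_restrict[of K A C "\<lambda>n x. g n (f n x)"]
    by (auto simp: dga_map_iff compose_def dgalg_hom_def dgalg_def dgalg_hom_axioms_def)
qed (auto simp: dga_map_def chain_map_def linear_map_def)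

section \<open>The commutator quotient\<close>

context galg begin

lemma commutators_submodule: "submodule (commutators K A n) K (piece A n)"
proof (rule P.submoduleI)
  let ?F = "{H. submodule H K (piece A n) \<and>
         (\<forall>i j. \<forall>a \<in> elts A i. \<forall>b \<in> elts A j. i + j = n \<longrightarrow>
            gmult A i j a b \<ominus>\<^bsub>piece A n\<^esub> sign K (i * j) \<odot>\<^bsub>piece A n\<^esub> gmult A j i b a \<in> H)}"
  have "elts A n \<in> ?F" using P.carrier_is_submodule[of n] by (auto simp: add.commute)
  then show "commutators K A n \<subseteq> elts A n" unfolding commutators_def by blast
  have H: "submodule H K (piece A n)" if "H \<in> ?F" for H using that by simp
  show "\<zero>\<^bsub>piece A n\<^esub> \<in> commutators K A n"
    unfolding commutators_def using submodule.axioms(1)[OF H] subgroup.one_closed by fastforce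
  show "\<ominus>\<^bsub>piece A n\<^esub> a \<in> commutators K A n" if "a \<in> commutators K A n" for a
    using that P.submoduleE(3)[OF H] unfolding commutators_def by blast
  show "a \<oplus>\<^bsub>piece A n\<^esub> b \<in> commutators K A n" if "a \<in> commutators K A n" "b \<in> commutators K A n" for a b
    using that P.submoduleE(5)[OF H] unfolding commutators_def by blast
  show "c \<odot>\<^bsub>piece A n\<^esub> b \<in> commutators K A n" if "c \<in> carrier K" "b \<in> commutators K A n" for c b
    using that P.submoduleE(4)[OF H] unfolding commutators_def by blast
qed

lemma commutators_quotient: "quotient K (piece A n) (commutators K A n)"
  by (simp add: quotient_def commutators_submodule P.module_axioms)

lemma commutator_mem: "a \<in> elts A i \<Longrightarrow> b \<in> elts A j \<Longrightarrow> i + j = n \<Longrightarrow> s = sign K (i * j) \<Longrightarrow>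
    gmult A i j a b \<ominus>\<^bsub>piece A n\<^esub> s \<odot>\<^bsub>piece A n\<^esub> gmult A j i b a \<in> commutators K A n"
  unfolding commutators_def by blast

lemma commutators_least:
  assumes "submodule H K (piece A n)"
    and "\<And>i j a b. a \<in> elts A i \<Longrightarrow> b \<in> elts A j \<Longrightarrow> i + j = n \<Longrightarrow>
       gmult A i j a b \<ominus>\<^bsub>piece A n\<^esub> sign K (i * j) \<odot>\<^bsub>piece A n\<^esub> gmult A j i b a \<in> H"
  shows "commutators K A n \<subseteq> H"
  unfolding commutators_def using assms by blast

sublocale C: quotient K "piece A n" "commutators K A n" for n
  by (rule commutators_quotient)

end

text \<open>The preimage of the submodule \<open>J\<close> is a submodule, so it contains the span of commutators as soon
  as it contains the generators.\<close>

lemma commutators_image: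
  assumes "galg K A" "quotient K N J" and f: "linear_map K (piece A n) N f"
    and gen: "\<And>i j a b. a \<in> elts A i \<Longrightarrow> b \<in> elts A j \<Longrightarrow> i + j = n \<Longrightarrow>
       f (gmult A i j a b \<ominus>\<^bsub>piece A n\<^esub> sign K (i * j) \<odot>\<^bsub>piece A n\<^esub> gmult A j i b a) \<in> J"
    and x: "x \<in> commutators K A n"
  shows "f x \<in> J"
proof -
  interpret galg K A by fact
  interpret N: quotient K N J by fact
  let ?H = "{x \<in> elts A n. f x \<in> J}"
  have fc: "y \<in> elts A n \<Longrightarrow> f y \<in> carrier N" for y using f by (auto simp: linear_map_def)
  have fneg: "f (\<ominus>\<^bsub>piece A n\<^esub> y) = \<ominus>\<^bsub>N\<^esub> f y" and fzero: "f \<zero>\<^bsub>piece A n\<^esub> = \<zero>\<^bsub>N\<^esub>" if "y \<in> elts A n" for y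
  proof -
    have s: "f (c \<odot>\<^bsub>piece A n\<^esub> y) = c \<odot>\<^bsub>N\<^esub> f y" if "c \<in> carrier K" "y \<in> elts A n" for c y
      using f that by (auto simp: linear_map_def)
    from s[of "\<ominus>\<^bsub>K\<^esub> \<one>\<^bsub>K\<^esub>" y] s[of "\<zero>\<^bsub>K\<^esub>" y] that
    show "f (\<ominus>\<^bsub>piece A n\<^esub> y) = \<ominus>\<^bsub>N\<^esub> f y" "f \<zero>\<^bsub>piece A n\<^esub> = \<zero>\<^bsub>N\<^esub>"
      by (auto simp: P.smult_l_minus N.smult_l_minus fc)
  qed
  have "submodule ?H K (piece A n)"
    using f fneg fzero[OF P.zero_closed] N.H_zero N.H_add N.H_neg N.smult_closed
    by (intro P.submoduleI) (auto simp: linear_map_def)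
  moreover have "gmult A i j a b \<ominus>\<^bsub>piece A n\<^esub> sign K (i * j) \<odot>\<^bsub>piece A n\<^esub> gmult A j i b a \<in> ?H"
    if "a \<in> elts A i" "b \<in> elts A j" "i + j = n" for i j a b
    using gen[OF that] that by (simp add: add.commute)
  ultimately show ?thesis using commutators_least[of ?H n] x by blast
qed

lemma (in dgalg) bdry_commutators:
  assumes "x \<in> commutators K A n" shows "bdry A n x \<in> commutators K A (n - 1)"
proof (rule commutators_image[OF galg_axioms commutators_quotient _ _ assms])
  show "linear_map K (piece A n) (piece A (n - 1)) (bdry A n)"
    using is_complex by (simp add: is_complex_def)
  fix i j a b assume ab: "a \<in> elts A i" "b \<in> elts A j" "i + j = n"
  have "gmult A (i - 1) j (bdry A i a) b \<ominus>\<^bsub>piece A (n - 1)\<^esub>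
      sign K ((i - 1) * j) \<odot>\<^bsub>piece A (n - 1)\<^esub> gmult A j (i - 1) b (bdry A i a) \<in> commutators K A (n - 1)"
    using ab by (intro commutator_mem) auto
  moreover have "sign K i \<odot>\<^bsub>piece A (n - 1)\<^esub> (gmult A i (j - 1) a (bdry A j b) \<ominus>\<^bsub>piece A (n - 1)\<^esub>
      sign K (i * (j - 1)) \<odot>\<^bsub>piece A (n - 1)\<^esub> gmult A (j - 1) i (bdry A j b) a) \<in> commutators K A (n - 1)"
    using ab by (intro C.smult_closed commutator_mem) auto
  moreover have "bdry A n (gmult A i j a b \<ominus>\<^bsub>piece A n\<^esub> sign K (i * j) \<odot>\<^bsub>piece A n\<^esub> gmult A j i b a) =
     (gmult A (i - 1) j (bdry A i a) b \<ominus>\<^bsub>piece A (n - 1)\<^esub>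
      sign K ((i - 1) * j) \<odot>\<^bsub>piece A (n - 1)\<^esub> gmult A j (i - 1) b (bdry A i a)) \<oplus>\<^bsub>piece A (n - 1)\<^esub>
     sign K i \<odot>\<^bsub>piece A (n - 1)\<^esub> (gmult A i (j - 1) a (bdry A j b) \<ominus>\<^bsub>piece A (n - 1)\<^esub>
      sign K (i * (j - 1)) \<odot>\<^bsub>piece A (n - 1)\<^esub> gmult A (j - 1) i (bdry A j b) a)"
    using ab
    by (cases "even i"; cases "even j")
       (simp_all add: bdry_minus bdry_neg bdry_add leibniz[of _ _ _ _ n] sign_smult P.abel)
  ultimately show "bdry A n (gmult A i j a b \<ominus>\<^bsub>piece A n\<^esub> sign K (i * j) \<odot>\<^bsub>piece A n\<^esub> gmult A j i b a)
      \<in> commutators K A (n - 1)" by (simp add: C.H_add)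
qed

context dgalg begin

abbreviation cls :: "int \<Rightarrow> 'a \<Rightarrow> 'a set" where
  "cls n a \<equiv> commutators K A n +>\<^bsub>piece A n\<^esub> a"

lemma natural_elts: "elts (natural K A) n = cls n ` elts A n"
  by (simp add: natural_def C.carrier_quot)

lemma natural_simps [simp]:
  "\<zero>\<^bsub>piece (natural K A) n\<^esub> = cls n \<zero>\<^bsub>piece A n\<^esub>"
  "a \<in> elts A n \<Longrightarrow> b \<in> elts A n \<Longrightarrow> cls n a \<oplus>\<^bsub>piece (natural K A) n\<^esub> cls n b = cls n (a \<oplus>\<^bsub>piece A n\<^esub> b)"
  "c \<in> carrier K \<Longrightarrow> a \<in> elts A n \<Longrightarrow> c \<odot>\<^bsub>piece (natural K A) n\<^esub> cls n a = cls n (c \<odot>\<^bsub>piece A n\<^esub> a)"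
  by (simp_all add: natural_def C.quot_zero C.quot_add C.quot_smult)

lemma natural_bdry [simp]:
  "a \<in> elts A n \<Longrightarrow> bdry (natural K A) n (cls n a) = cls (n - 1) (bdry A n a)"
  unfolding natural_def chain_complex.simps
  by (rule quot_map_coset[OF commutators_quotient commutators_quotient])
     (use is_complex bdry_commutators in \<open>auto simp: is_complex_def\<close>)

lemma natural_complex: "is_complex K (natural K A)"
  unfolding is_complex_def
proof (intro allI conjI ballI)
  fix n
  show "module K (piece (natural K A) n)" by (simp add: natural_def C.quot_module)
  show "linear_map K (piece (natural K A) n) (piece (natural K A) (n - 1)) (bdry (natural K A) n)"
    unfolding linear_map_def by (auto simp: natural_elts bdry_add bdry_smult)
  fix x assume "x \<in> elts (natural K A) n"
  then show "bdry (natural K A) (n - 1) (bdry (natural K A) n x) = \<zero>\<^bsub>piece (natural K A) (n - 1 - 1)\<^esub>"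
    using bdry_bdry[of _ n "n - 1" "n - 1 - 1"] by (auto simp: natural_elts)
qed

sublocale N: cplx K "natural K A"
  by unfold_locales (rule natural_complex)

lemma natural_minus: "a \<in> elts A n \<Longrightarrow> b \<in> elts A n \<Longrightarrow>
   cls n a \<ominus>\<^bsub>piece (natural K A) n\<^esub> cls n b = cls n (a \<ominus>\<^bsub>piece A n\<^esub> b)"
proof -
  assume ab: "a \<in> elts A n" "b \<in> elts A n"
  have "\<ominus>\<^bsub>piece (natural K A) n\<^esub> cls n b = cls n (\<ominus>\<^bsub>piece A n\<^esub> b)"
    by (rule N.P.minus_equality) (use ab in \<open>auto simp: natural_elts P.l_neg\<close>)
  then show ?thesis using ab by (simp add: N.P.minus_eq P.minus_eq)
qed

end

text \<open>The map on commutator quotients, for functions between algebras over different types.\<close>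

definition nmap ::
  "'k ring \<Rightarrow> ('k, 'a) dga \<Rightarrow> ('k, 'b) dga \<Rightarrow> (int \<Rightarrow> 'a \<Rightarrow> 'b) \<Rightarrow> int \<Rightarrow> 'a set \<Rightarrow> 'b set" where
  "nmap K A B f n = quot_map (piece A n) (commutators K A n) (piece B n) (commutators K B n) (f n)"

lemma natural_map_nmap: "natural_map K u = nmap K (src u) (tgt u) (lab u)"
  by (simp add: natural_map_def nmap_def fun_eq_iff)

context dgalg_hom begin

lemma hom_commutators:
  assumes "x \<in> commutators K A n" shows "f n x \<in> commutators K B n"
proof (rule commutators_image[OF A.galg_axioms B.commutators_quotient hom_linear _ assms])
  fix i j a b assume ab: "a \<in> elts A i" "b \<in> elts A j" "i + j = n"
  have "f n (gmult A i j a b \<ominus>\<^bsub>piece A n\<^esub> sign K (i * j) \<odot>\<^bsub>piece A n\<^esub> gmult A j i b a) =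
     gmult B i j (f i a) (f j b) \<ominus>\<^bsub>piece B n\<^esub> sign K (i * j) \<odot>\<^bsub>piece B n\<^esub> gmult B j i (f j b) (f i a)"
    using ab hom_mult[of a i b j n] hom_mult[of b j a i n] by (simp add: hom_minus hom_smult)
  also have "\<dots> \<in> commutators K B n" using ab by (intro B.commutator_mem) auto
  finally show "f n (gmult A i j a b \<ominus>\<^bsub>piece A n\<^esub> sign K (i * j) \<odot>\<^bsub>piece A n\<^esub> gmult A j i b a)
    \<in> commutators K B n" .
qed

lemma nmap_cls [simp]: "a \<in> elts A n \<Longrightarrow> nmap K A B f n (A.cls n a) = B.cls n (f n a)"
  unfolding nmap_def
  by (rule quot_map_coset[OF A.commutators_quotient B.commutators_quotient hom_linear hom_commutators])

lemma nmap_hom: "cplx_hom K (natural K A) (natural K B) (nmap K A B f)"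
  by unfold_locales (auto simp: complex_hom_def linear_map_def A.natural_elts B.natural_elts
      hom_add hom_smult hom_bdry)

end

lemma nmap_comp:
  assumes "dgalg_hom K A B f" "dgalg_hom K B C g" "x \<in> elts (natural K A) n"
  shows "nmap K B C g n (nmap K A B f n x) = nmap K A C (\<lambda>n x. g n (f n x)) n x"
proof -
  interpret f: dgalg_hom K A B f by fact
  interpret g: dgalg_hom K B C g by fact
  interpret gf: dgalg_hom K A C "\<lambda>n x. g n (f n x)" using dga_hom_comp[OF assms(1,2)] .
  show ?thesis using assms(3) by (auto simp: f.A.natural_elts)
qed

lemma nmap_id:
  assumes "dgalg K A" "x \<in> elts (natural K A) n"
  shows "nmap K A A (\<lambda>n x. x) n x = x"
proof -
  interpret dgalg K A by fact
  interpret i: dgalg_hom K A A "\<lambda>n x. x" by unfold_locales (simp add: dga_hom_id is_dga)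
  show ?thesis using assms(2) by (auto simp: natural_elts)
qed

text \<open>Only the values on elements of \<open>A\<close> matter: every coset consists of such elements.\<close>

lemma nmap_cong:
  assumes "dgalg K A" "\<And>n x. x \<in> elts A n \<Longrightarrow> f n x = g n x"
  shows "nmap K A B f = nmap K A B g"
proof -
  interpret dgalg K A by fact
  have "f n x = g n x" if "U \<in> a_rcosets\<^bsub>piece A n\<^esub> commutators K A n" "x \<in> U" for U x n
    using that assms(2) C.mem_coset by (auto simp: A_RCOSETS_def')
  then show ?thesis unfolding nmap_def quot_map_def by (intro ext restrict_ext SUP_cong) simp_all
qed

section \<open>The cone functor\<close>

lemma DGA_ArD:
  assumes "u \<in> Ar (DGA K)" shows "dgalg_hom K (src u) (tgt u) (lab u)"
  using assms by (auto simp: DGA_simps dga_map_iff dgalg_hom_def dgalg_def dgalg_hom_axioms_def)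

lemma natural_cone_complex: "u \<in> Ar (DGA K) \<Longrightarrow> is_complex K (natural_cone K u)"
  using cone_is_complex[OF dgalg_hom.nmap_hom[OF DGA_ArD]]
  by (simp add: natural_cone_def natural_map_nmap cplx_def)

lemma DGA_Cmp_lab:
  assumes "u \<in> Hom (DGA K) A B" "v \<in> Hom (DGA K) B C" "x \<in> elts A n"
  shows "lab (Cmp (DGA K) v u) n x = lab v n (lab u n x)"
  using assms by (auto simp: DGA_simps Hom_def compose_def)

lemma natural_map_Cmp:
  assumes "u \<in> Hom (DGA K) A B" "v \<in> Hom (DGA K) B C" "x \<in> elts (natural K A) n"
  shows "natural_map K (Cmp (DGA K) v u) n x = natural_map K v n (natural_map K u n x)"
proof -
  have u: "src u = A" "tgt u = B" "dgalg_hom K A B (lab u)" and v: "src v = B" "tgt v = C" "dgalg_hom K B C (lab v)"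
    using assms(1,2) DGA_ArD[of u K] DGA_ArD[of v K] by (auto simp: Hom_def DGA_simps(2-4))
  have A: "dgalg K A" using u(3) by (simp add: dgalg_hom_def)
  have "natural_map K (Cmp (DGA K) v u) = nmap K A C (lab (Cmp (DGA K) v u))"
    using u(1) v(2) by (simp add: natural_map_nmap DGA_simps(6))
  also have "\<dots> = nmap K A C (\<lambda>n x. lab v n (lab u n x))"
    by (rule nmap_cong[OF A DGA_Cmp_lab[OF assms(1,2)]])
  finally have "natural_map K (Cmp (DGA K) v u) = nmap K A C (\<lambda>n x. lab v n (lab u n x))" .
  then show ?thesis using nmap_comp[OF u(3) v(3) assms(3)] u v by (simp add: natural_map_nmap)
qed

lemma cone_functor_square:
  assumes "square f a b g \<in> Hom (Mor (DGA K)) f g"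
  shows "cone_square K (natural K (src f)) (natural K (tgt f)) (natural K (src g)) (natural K (tgt g))
    (natural_map K f) (natural_map K g) (natural_map K a) (natural_map K b)"
proof -
  have *: "f \<in> Ar (DGA K)" "g \<in> Ar (DGA K)" "a \<in> Hom (DGA K) (src f) (src g)" "b \<in> Hom (DGA K) (tgt f) (tgt g)"
    "Cmp (DGA K) g a = Cmp (DGA K) b f" using assms by (auto simp: square_Hom DGA_simps)
  have f: "f \<in> Hom (DGA K) (src f) (tgt f)" and g: "g \<in> Hom (DGA K) (src g) (tgt g)"
    using *(1,2) by (auto simp: Hom_def DGA_simps)
  have h: "cplx_hom K (natural K A) (natural K B) (natural_map K u)" if "u \<in> Hom (DGA K) A B" for u A B
    using dgalg_hom.nmap_hom[OF DGA_ArD[of u K]] that by (auto simp: natural_map_nmap Hom_def DGA_simps)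
  show ?thesis
    unfolding cone_square_def cone_square_axioms_def
    using h[OF f] h[OF g] h[OF *(3)] h[OF *(4)] natural_map_Cmp[OF *(3) g] natural_map_Cmp[OF f *(4)] *(5)
    by auto
qed

lemma cone_functor_Ob [simp]: "FOb (cone_functor K) = natural_cone K"
  by (simp add: cone_functor_def)

lemma cone_functor_Ar: "FAr (cone_functor K) (square f a b g) = \<lparr>src = natural_cone K f,
   lab = (\<lambda>n. restrict (cone_square.cmap (natural_map K a) (natural_map K b) n) (elts (natural_cone K f) n)),
   tgt = natural_cone K g\<rparr>"
  if "cone_square K (natural K (src f)) (natural K (tgt f)) (natural K (src g)) (natural K (tgt g))
    (natural_map K f) (natural_map K g) (natural_map K a) (natural_map K b)"
  by (simp add: cone_functor_def cone_square.cmap_def[OF that])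

lemma cone_functor: "is_functor (Mor (DGA K)) (Com K) (cone_functor K)"
  unfolding is_functor_def
proof (intro conjI ballI impI)
  fix f assume "f \<in> Ob (Mor (DGA K))"
  then have f: "f \<in> Ar (DGA K)" by simp
  show "FOb (cone_functor K) f \<in> Ob (Com K)" using natural_cone_complex[OF f] by (simp add: Com_simps)
  have id: "natural_map K (Idt (DGA K) A) n x = x" if "is_dga K A" "x \<in> elts (natural K A) n" for A n x
  proof -
    have A: "dgalg K A" using that by (simp add: dgalg_def)
    show ?thesis using nmap_id[OF A that(2)] nmap_cong[OF A, of "\<lambda>n x. x" "\<lambda>n. \<lambda>x\<in>elts A n. x" A]
      by (simp add: natural_map_nmap DGA_simps)
  qed
  then show "FAr (cone_functor K) (Idt (Mor (DGA K)) f) = Idt (Com K) (FOb (cone_functor K) f)"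
    using f by (auto simp: cone_functor_def Com_simps natural_cone_def DGA_simps(2-4) fun_eq_iff restrict_def)
next
  fix u assume "u \<in> Ar (Mor (DGA K))"
  then have "u \<in> Hom (Mor (DGA K)) (src u) (tgt u)" by (simp add: Hom_def)
  then obtain f g a b where u: "u = square f a b g" and H: "square f a b g \<in> Hom (Mor (DGA K)) f g"
    unfolding Mor_Hom square_Hom by (metis square_simps(1,2))
  interpret S: cone_square K "natural K (src f)" "natural K (tgt f)" "natural K (src g)" "natural K (tgt g)"
    "natural_map K f" "natural_map K g" "natural_map K a" "natural_map K b"
    by (rule cone_functor_square[OF H])
  have fg: "f \<in> Ar (DGA K)" "g \<in> Ar (DGA K)" using H by (auto simp: square_Hom)
  have "complex_hom K (natural_cone K f) (natural_cone K g) S.cmap"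
    using cplx_hom.hom[OF S.cmap_hom] by (simp add: natural_cone_def)
  then show "FAr (cone_functor K) u
    \<in> Hom (Com K) (FOb (cone_functor K) (Dom (Mor (DGA K)) u)) (FOb (cone_functor K) (Cod (Mor (DGA K)) u))"
    using fg natural_cone_complex[OF fg(1)] natural_cone_complex[OF fg(2)] complex_hom_restrict[of K "natural_cone K f" "natural_cone K g" S.cmap]
    by (simp add: u cone_functor_Ar[OF S.cone_square_axioms] Hom_def Com_simps chain_map_iff)
next
  fix u v assume uv: "u \<in> Ar (Mor (DGA K))" "v \<in> Ar (Mor (DGA K))" "Cod (Mor (DGA K)) u = Dom (Mor (DGA K)) v"
  then have "u \<in> Hom (Mor (DGA K)) (src u) (tgt u)" "v \<in> Hom (Mor (DGA K)) (src v) (tgt v)"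
    by (simp_all add: Hom_def)
  then obtain f g h a b c d where u: "u = square f a b g" and v: "v = square g c d h"
    and Hu: "square f a b g \<in> Hom (Mor (DGA K)) f g" and Hv: "square g c d h \<in> Hom (Mor (DGA K)) g h"
    using uv(3) unfolding Mor_Hom square_Hom by auto
  have abcd: "a \<in> Hom (DGA K) (src f) (src g)" "b \<in> Hom (DGA K) (tgt f) (tgt g)"
    "c \<in> Hom (DGA K) (src g) (src h)" "d \<in> Hom (DGA K) (tgt g) (tgt h)"
    using Hu Hv by (auto simp: square_Hom DGA_simps)
  interpret S: cone_square K "natural K (src f)" "natural K (tgt f)" "natural K (src g)" "natural K (tgt g)"
    "natural_map K f" "natural_map K g" "natural_map K a" "natural_map K b"
    by (rule cone_functor_square[OF Hu])
  have into: "(natural_map K a (n - 1) x, natural_map K b n y) \<in> elts (natural_cone K g) n"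
    if "(x, y) \<in> elts (natural_cone K f) n" for x y n
    using that by (auto simp: natural_cone_def)
  show "FAr (cone_functor K) (Cmp (Mor (DGA K)) v u) = Cmp (Com K) (FAr (cone_functor K) v) (FAr (cone_functor K) u)"
    unfolding u v Cmp_square
    using natural_map_Cmp[OF abcd(1,3)] natural_map_Cmp[OF abcd(2,4)] into
    by (auto simp: cone_functor_def Com_simps fun_eq_iff compose_def natural_cone_def)
qed

lemma cone_functor_weq:
  assumes u: "u \<in> Hom (Mor (DGA K)) f g"
    and fst: "quasi_iso (natural K (src f)) (natural K (src g)) (natural_map K (fst (lab u)))"
    and snd: "quasi_iso (natural K (tgt f)) (natural K (tgt g)) (natural_map K (snd (lab u)))"
  shows "FAr (cone_functor K) u \<in> weq (Com K)"
proof -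
  obtain a b where ab: "u = square f a b g" using u by (auto simp: Mor_Hom)
  interpret S: cone_square K "natural K (src f)" "natural K (tgt f)" "natural K (src g)" "natural K (tgt g)"
    "natural_map K f" "natural_map K g" "natural_map K a" "natural_map K b"
    using cone_functor_square u unfolding ab by blast
  interpret C: cplx_hom K "natural_cone K f" "natural_cone K g" S.cmap
    using S.cmap_hom by (simp add: natural_cone_def)
  let ?r = "\<lambda>n. restrict (S.cmap n) (elts (natural_cone K f) n)"
  have r: "cplx_hom K (natural_cone K f) (natural_cone K g) ?r"
    using complex_hom_restrict[OF C.X.is_complex, of "natural_cone K g" S.cmap] C.hom
    by unfold_locales simp
  have "quasi_iso (natural_cone K f) (natural_cone K g) S.cmap"
    using S.cmap_quasi_iso fst snd by (simp add: ab natural_cone_def)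
  then have "quasi_iso (natural_cone K f) (natural_cone K g) ?r"
    using quasi_iso_cong[OF r C.cplx_hom_axioms] by simp
  moreover have "FAr (cone_functor K) u \<in> Ar (Com K)"
    using functor_Hom[OF cone_functor u] by (simp add: Hom_def)
  ultimately show ?thesis
    by (simp add: Com_simps(7) ab cone_functor_Ar[OF S.cone_square_axioms])
qed

section \<open>Acyclic fibrations\<close>

text \<open>The right lifting property against the inclusions of spheres into disks, in terms of elements.
  It is equivalent to being a surjective quasi-isomorphism, but one step of a cell-by-cell lifting
  and the stability under base change can be read off from it.\<close>

definition acyclic_fibration ::
  "('k, 'a, 'y) chain_complex_scheme \<Rightarrow> ('k, 'b, 'z) chain_complex_scheme \<Rightarrow>
     (int \<Rightarrow> 'a \<Rightarrow> 'b) \<Rightarrow> bool" where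
  "acyclic_fibration X Y f \<longleftrightarrow> (\<forall>n. \<forall>c\<in>elts X n. \<forall>b\<in>elts Y (n + 1).
     bdry X n c = \<zero>\<^bsub>piece X (n - 1)\<^esub> \<longrightarrow> bdry Y (n + 1) b = f n c \<longrightarrow>
       (\<exists>c'\<in>elts X (n + 1). bdry X (n + 1) c' = c \<and> f (n + 1) c' = b))"

lemma acyclic_fibrationD:
  "acyclic_fibration X Y f \<Longrightarrow> c \<in> elts X n \<Longrightarrow> b \<in> elts Y (n + 1) \<Longrightarrow>
     bdry X n c = \<zero>\<^bsub>piece X (n - 1)\<^esub> \<Longrightarrow> bdry Y (n + 1) b = f n c \<Longrightarrow>
       \<exists>c'\<in>elts X (n + 1). bdry X (n + 1) c' = c \<and> f (n + 1) c' = b"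
  unfolding acyclic_fibration_def by blast

context cplx_hom begin

lemma acyclic_fibration_cycle:
  assumes af: "acyclic_fibration X Y f" and b: "Y.cycle n b"
  shows "\<exists>c. X.cycle n c \<and> f n c = b"
  using acyclic_fibrationD[OF af, of "\<zero>\<^bsub>piece X (n - 1)\<^esub>" "n - 1" b] b by auto

text \<open>For the surjectivity in one direction, bound the lift of the boundary of the given element. In
  the other direction, surjectivity on homology and on elements first give surjectivity on cycles,
  which corrects a preimage with the right boundary.\<close>

lemma acyclic_fibration_iff:
  "acyclic_fibration X Y f \<longleftrightarrow> quasi_iso X Y f \<and> (\<forall>n. f n ` elts X n = elts Y n)"
proof (intro iffI conjI allI)
  assume af: "acyclic_fibration X Y f"
  show "quasi_iso X Y f"
  proof (rule quasi_isoI)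
    fix n x assume "X.cycle n x" "f n x \<in> boundaries Y n"
    then show "x \<in> boundaries X n"
      using acyclic_fibrationD[OF af, of x n] unfolding X.boundaries_iff Y.boundaries_iff by metis
  next
    fix n y assume "Y.cycle n y"
    then show "\<exists>x. X.cycle n x \<and> f n x \<ominus>\<^bsub>piece Y n\<^esub> y \<in> boundaries Y n"
      using acyclic_fibration_cycle[OF af, of y n] Y.boundaries_zero by fastforce
  qed
  fix n
  show "f n ` elts X n = elts Y n"
  proof (intro equalityI subsetI)
    fix b assume b: "b \<in> elts Y n"
    have "Y.cycle (n - 1) (bdry Y n b)" using b Y.bdry_bdry[of b n "n - 1" "n - 1 - 1"] by simp
    then obtain c where "X.cycle (n - 1) c" "f (n - 1) c = bdry Y n b"
      using acyclic_fibration_cycle[OF af] by blast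
    then show "b \<in> f n ` elts X n"
      using acyclic_fibrationD[OF af, of c "n - 1" b] b by auto
  qed auto
next
  assume *: "quasi_iso X Y f \<and> (\<forall>n. f n ` elts X n = elts Y n)"
  then have qi: "quasi_iso X Y f" by blast
  have surj: "\<exists>c\<in>elts X n. f n c = b" if "b \<in> elts Y n" for n b
    using that * imageE[of b "f n" "elts X n"] by metis
  have cycle: "\<exists>c. X.cycle n c \<and> f n c = b" if b: "Y.cycle n b" for n b
  proof -
    obtain x where x: "X.cycle n x" "f n x \<ominus>\<^bsub>piece Y n\<^esub> b \<in> boundaries Y n"
      using quasi_iso_surj[OF qi b] by blast
    then obtain y where y: "y \<in> elts Y (n + 1)" "f n x \<ominus>\<^bsub>piece Y n\<^esub> b = bdry Y (n + 1) y"
      unfolding Y.boundaries_iff by blast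
    obtain u where u: "u \<in> elts X (n + 1)" "f (n + 1) u = y" using surj[OF y(1)] by blast
    have du: "bdry X (n + 1) u \<in> elts X n" using X.bdry_closed[OF u(1), of n] by simp
    have "f n (x \<ominus>\<^bsub>piece X n\<^esub> bdry X (n + 1) u) = f n x \<ominus>\<^bsub>piece Y n\<^esub> (f n x \<ominus>\<^bsub>piece Y n\<^esub> b)"
      using x(1) u du y(2) hom_bdry[OF u(1), of n] by (simp add: hom_minus)
    also have "\<dots> = b" using x(1) b by (simp add: Y.P.abel)
    finally have "f n (x \<ominus>\<^bsub>piece X n\<^esub> bdry X (n + 1) u) = b" .
    moreover have "X.cycle n (x \<ominus>\<^bsub>piece X n\<^esub> bdry X (n + 1) u)"
      using x(1) du X.bdry_bdry[OF u(1), of n "n - 1"] by (simp add: X.bdry_minus)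
    ultimately show ?thesis by blast
  qed
  show "acyclic_fibration X Y f"
    unfolding acyclic_fibration_def
  proof (intro allI ballI impI)
    fix n c b assume c: "c \<in> elts X n" "bdry X n c = \<zero>\<^bsub>piece X (n - 1)\<^esub>"
      and b: "b \<in> elts Y (n + 1)" "bdry Y (n + 1) b = f n c"
    have "f n c \<in> boundaries Y n" using Y.boundariesI[OF b(1), of n] b(2) by simp
    then have "c \<in> boundaries X n" using quasi_iso_inj[OF qi] c by blast
    then obtain c1 where c1: "c1 \<in> elts X (n + 1)" "c = bdry X (n + 1) c1" unfolding X.boundaries_iff by blast
    have "Y.cycle (n + 1) (b \<ominus>\<^bsub>piece Y (n + 1)\<^esub> f (n + 1) c1)"
      using b c1 c hom_bdry[OF c1(1), of n] by (simp add: Y.bdry_minus)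
    then obtain c0 where c0: "X.cycle (n + 1) c0" "f (n + 1) c0 = b \<ominus>\<^bsub>piece Y (n + 1)\<^esub> f (n + 1) c1"
      using cycle by blast
    have "bdry X (n + 1) (c1 \<oplus>\<^bsub>piece X (n + 1)\<^esub> c0) = c" using c0 c1 c by (simp add: X.bdry_add)
    moreover have "f (n + 1) (c1 \<oplus>\<^bsub>piece X (n + 1)\<^esub> c0) = b" using c0 c1 b by (simp add: hom_add Y.P.abel)
    moreover have "c1 \<oplus>\<^bsub>piece X (n + 1)\<^esub> c0 \<in> elts X (n + 1)" using c0(1) c1(1) by simp
    ultimately show "\<exists>c'\<in>elts X (n + 1). bdry X (n + 1) c' = c \<and> f (n + 1) c' = b" by blast
  qed
qed

end

section \<open>Transport, fibre products, and the ground field\<close>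

text \<open>Moving a DG algebra along injections of its homogeneous components, to realize it inside a
  given type.\<close>

definition transport :: "(int \<Rightarrow> 'a \<Rightarrow> 'b) \<Rightarrow> ('k, 'a) dga \<Rightarrow> ('k, 'b) dga" where
  "transport j X = (let i = (\<lambda>n. inv_into (elts X n) (j n)) in \<lparr>
     piece = (\<lambda>n. \<lparr>carrier = j n ` elts X n, mult = undefined, one = undefined,
        zero = j n \<zero>\<^bsub>piece X n\<^esub>,
        add = (\<lambda>x y. j n (i n x \<oplus>\<^bsub>piece X n\<^esub> i n y)),
        smult = (\<lambda>c x. j n (c \<odot>\<^bsub>piece X n\<^esub> i n x))\<rparr>),
     bdry = (\<lambda>n x. j (n - 1) (bdry X n (i n x))),
     gmult = (\<lambda>p q x y. j (p + q) (gmult X p q (i p x) (i q y))),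
     gone = j 0 (gone X)\<rparr>)"

locale transported = dgalg K X for K :: "'k ring" and X :: "('k, 'a) dga" +
  fixes j :: "int \<Rightarrow> 'a \<Rightarrow> 'b"
  assumes inj: "inj_on (j n) (elts X n)"
begin

abbreviation T where "T \<equiv> transport j X"
abbreviation unT where "unT n \<equiv> inv_into (elts X n) (j n)"

lemma unT [simp]: "x \<in> elts X n \<Longrightarrow> unT n (j n x) = x"
  using inj by simp

lemma T_simps [simp]:
  "elts T n = j n ` elts X n" "\<zero>\<^bsub>piece T n\<^esub> = j n \<zero>\<^bsub>piece X n\<^esub>"
  "x \<in> elts X n \<Longrightarrow> y \<in> elts X n \<Longrightarrow> j n x \<oplus>\<^bsub>piece T n\<^esub> j n y = j n (x \<oplus>\<^bsub>piece X n\<^esub> y)"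
  "x \<in> elts X n \<Longrightarrow> c \<odot>\<^bsub>piece T n\<^esub> j n x = j n (c \<odot>\<^bsub>piece X n\<^esub> x)"
  "x \<in> elts X n \<Longrightarrow> bdry T n (j n x) = j (n - 1) (bdry X n x)"
  "a \<in> elts X p \<Longrightarrow> b \<in> elts X q \<Longrightarrow> gmult T p q (j p a) (j q b) = j (p + q) (gmult X p q a b)"
  "gone T = j 0 (gone X)"
  by (simp_all add: transport_def Let_def)

lemma T_dga: "is_dga K T"
  unfolding is_dga_iff
proof (intro conjI)
  have mod: "module K (piece T n)" for n
  proof (rule moduleI[OF P.R.is_cring])
    show "abelian_group (piece T n)"
    proof (rule abelian_groupI)
      fix x assume "x \<in> elts T n"
      then obtain y where y: "y \<in> elts X n" "x = j n y" by auto
      then have "j n (\<ominus>\<^bsub>piece X n\<^esub> y) \<oplus>\<^bsub>piece T n\<^esub> x = \<zero>\<^bsub>piece T n\<^esub>" by (simp add: P.l_neg)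
      then show "\<exists>w\<in>elts T n. w \<oplus>\<^bsub>piece T n\<^esub> x = \<zero>\<^bsub>piece T n\<^esub>" using y by auto
    qed (auto simp: P.a_ac)
  qed (auto simp: P.smult_l_distr P.smult_r_distr P.smult_assoc1)
  show "graded_algebra K T"
    by (rule graded_algebraI)
       (auto simp: mod mult_add_left mult_add_right mult_smult_left mult_smult_right mult_assoc add.assoc)
  show "is_complex K T"
    using bdry_bdry[of _ n "n - 1" "n - 1 - 1" for n]
    by (auto simp: is_complex_def linear_map_def mod bdry_add bdry_smult)
  show "\<forall>i l. \<forall>a\<in>elts T i. \<forall>b\<in>elts T l. bdry T (i + l) (gmult T i l a b) =
      gmult T (i - 1) l (bdry T i a) b \<oplus>\<^bsub>piece T (i + l - 1)\<^esub>
      sign K i \<odot>\<^bsub>piece T (i + l - 1)\<^esub> gmult T i (l - 1) a (bdry T l b)"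
  proof (intro allI ballI)
    fix i l a b assume "a \<in> elts T i" "b \<in> elts T l"
    then obtain x y where xy: "x \<in> elts X i" "y \<in> elts X l" "a = j i x" "b = j l y" by auto
    have e: "i - 1 + l = i + l - 1" "i + (l - 1) = i + l - 1" by simp_all
    have "gmult T (i - 1) l (bdry T i a) b = j (i + l - 1) (gmult X (i - 1) l (bdry X i x) y)"
      using T_simps(6)[of "bdry X i x" "i - 1" y l] xy by (simp add: e)
    moreover have "gmult T i (l - 1) a (bdry T l b) = j (i + l - 1) (gmult X i (l - 1) x (bdry X l y))"
      using T_simps(6)[of x i "bdry X l y" "l - 1"] xy by (simp add: e)
    moreover have "gmult X (i - 1) l (bdry X i x) y \<in> elts X (i + l - 1)"
      "gmult X i (l - 1) x (bdry X l y) \<in> elts X (i + l - 1)" using xy by simp_all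
    ultimately show "bdry T (i + l) (gmult T i l a b) =
      gmult T (i - 1) l (bdry T i a) b \<oplus>\<^bsub>piece T (i + l - 1)\<^esub>
      sign K i \<odot>\<^bsub>piece T (i + l - 1)\<^esub> gmult T i (l - 1) a (bdry T l b)"
      using xy by (simp add: leibniz)
  qed
qed

lemma to_T: "dgalg_hom K X T j"
  by unfold_locales (auto simp: dga_hom_def complex_hom_def linear_map_def is_dga T_dga is_dga[unfolded is_dga_def])

lemma from_T: "dgalg_hom K T X unT"
proof -
  have 1: "unT (p + q) (gmult T p q a b) = gmult X p q (unT p a) (unT q b)"
    if "a \<in> elts T p" "b \<in> elts T q" for p q a b using that by auto
  have 2: "complex_hom K T X unT"
    by (auto simp: complex_hom_def linear_map_def)
  show ?thesis
    by unfold_locales (use 1 2 in \<open>auto simp: dga_hom_def is_dga T_dga\<close>)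
qed

lemma to_from: "y \<in> elts T n \<Longrightarrow> j n (unT n y) = y"
  by auto

end

definition fibre_product ::
  "('k, 'a) dga \<Rightarrow> ('k, 'b) dga \<Rightarrow> (int \<Rightarrow> 'a \<Rightarrow> 'c) \<Rightarrow> (int \<Rightarrow> 'b \<Rightarrow> 'c) \<Rightarrow> ('k, 'a \<times> 'b) dga" where
  "fibre_product X Y f g = \<lparr>
     piece = (\<lambda>n. \<lparr>carrier = {(x, y). x \<in> elts X n \<and> y \<in> elts Y n \<and> f n x = g n y},
        mult = undefined, one = undefined,
        zero = (\<zero>\<^bsub>piece X n\<^esub>, \<zero>\<^bsub>piece Y n\<^esub>),
        add = (\<lambda>u v. (fst u \<oplus>\<^bsub>piece X n\<^esub> fst v, snd u \<oplus>\<^bsub>piece Y n\<^esub> snd v)),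
        smult = (\<lambda>c u. (c \<odot>\<^bsub>piece X n\<^esub> fst u, c \<odot>\<^bsub>piece Y n\<^esub> snd u))\<rparr>),
     bdry = (\<lambda>n u. (bdry X n (fst u), bdry Y n (snd u))),
     gmult = (\<lambda>i j u v. (gmult X i j (fst u) (fst v), gmult Y i j (snd u) (snd v))),
     gone = (gone X, gone Y)\<rparr>"

locale cospan = f: dgalg_hom K X B f + g: dgalg_hom K Y B g
  for K :: "'k ring" and X :: "('k, 'a) dga" and Y :: "('k, 'b) dga" and B :: "('k, 'c) dga" and f g
begin

abbreviation FP where "FP \<equiv> fibre_product X Y f g"

lemma FP_simps [simp]:
  "u \<in> elts FP n \<longleftrightarrow> fst u \<in> elts X n \<and> snd u \<in> elts Y n \<and> f n (fst u) = g n (snd u)"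
  "\<zero>\<^bsub>piece FP n\<^esub> = (\<zero>\<^bsub>piece X n\<^esub>, \<zero>\<^bsub>piece Y n\<^esub>)"
  "u \<oplus>\<^bsub>piece FP n\<^esub> v = (fst u \<oplus>\<^bsub>piece X n\<^esub> fst v, snd u \<oplus>\<^bsub>piece Y n\<^esub> snd v)"
  "c \<odot>\<^bsub>piece FP n\<^esub> u = (c \<odot>\<^bsub>piece X n\<^esub> fst u, c \<odot>\<^bsub>piece Y n\<^esub> snd u)"
  "bdry FP n u = (bdry X n (fst u), bdry Y n (snd u))"
  "gmult FP i j u v = (gmult X i j (fst u) (fst v), gmult Y i j (snd u) (snd v))"
  "gone FP = (gone X, gone Y)"
  by (auto simp: fibre_product_def)

lemma FP_dga: "is_dga K FP"
  unfolding is_dga_iff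
proof (intro conjI)
  have mod: "module K (piece FP n)" for n
  proof (rule moduleI[OF f.A.P.R.is_cring])
    show "abelian_group (piece FP n)"
    proof (rule abelian_groupI)
      fix u assume "u \<in> elts FP n"
      then show "\<exists>w\<in>elts FP n. w \<oplus>\<^bsub>piece FP n\<^esub> u = \<zero>\<^bsub>piece FP n\<^esub>"
        by (intro bexI[of _ "(\<ominus>\<^bsub>piece X n\<^esub> fst u, \<ominus>\<^bsub>piece Y n\<^esub> snd u)"])
           (auto simp: f.A.P.l_neg g.A.P.l_neg f.hom_neg g.hom_neg)
    qed (auto simp: f.A.P.a_ac g.A.P.a_ac f.hom_add g.hom_add)
  qed (auto simp: f.A.P.smult_l_distr g.A.P.smult_l_distr f.A.P.smult_r_distr g.A.P.smult_r_distr
      f.A.P.smult_assoc1 g.A.P.smult_assoc1 f.hom_smult g.hom_smult)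
  show "graded_algebra K FP"
    by (rule graded_algebraI)
       (auto simp: mod f.A.mult_add_left f.A.mult_add_right f.A.mult_smult_left f.A.mult_smult_right f.A.mult_assoc
         g.A.mult_add_left g.A.mult_add_right g.A.mult_smult_left g.A.mult_smult_right g.A.mult_assoc
         f.hom_mult g.hom_mult)
  show "is_complex K FP"
    using f.A.bdry_bdry[of _ n "n - 1" "n - 1 - 1" for n] g.A.bdry_bdry[of _ n "n - 1" "n - 1 - 1" for n]
    by (auto simp: is_complex_def linear_map_def mod f.A.bdry_add f.A.bdry_smult g.A.bdry_add g.A.bdry_smult
       f.hom_bdry g.hom_bdry)
  show "\<forall>i l. \<forall>a\<in>elts FP i. \<forall>b\<in>elts FP l. bdry FP (i + l) (gmult FP i l a b) =
      gmult FP (i - 1) l (bdry FP i a) b \<oplus>\<^bsub>piece FP (i + l - 1)\<^esub>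
      sign K i \<odot>\<^bsub>piece FP (i + l - 1)\<^esub> gmult FP i (l - 1) a (bdry FP l b)"
    by (auto simp: f.A.leibniz g.A.leibniz)
qed

lemma FP_fst: "dgalg_hom K FP X (\<lambda>n. fst)" and FP_snd: "dgalg_hom K FP Y (\<lambda>n. snd)"
  by (unfold_locales; auto simp: FP_dga dga_hom_def complex_hom_def linear_map_def)+

lemma FP_fst_acyclic_fibration:
  assumes "acyclic_fibration Y B g" shows "acyclic_fibration FP X (\<lambda>n. fst)"
  unfolding acyclic_fibration_def
proof (intro allI ballI impI)
  fix n u x assume u: "u \<in> elts FP n" "bdry FP n u = \<zero>\<^bsub>piece FP (n - 1)\<^esub>"
    and x: "x \<in> elts X (n + 1)" "bdry X (n + 1) x = fst u"
  have "bdry B (n + 1) (f (n + 1) x) = g n (snd u)"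
    using u x f.hom_bdry[OF x(1), of n] by simp
  then obtain y where "y \<in> elts Y (n + 1)" "bdry Y (n + 1) y = snd u" "g (n + 1) y = f (n + 1) x"
    using acyclic_fibrationD[OF assms, of "snd u" n "f (n + 1) x"] u x by auto
  then show "\<exists>w\<in>elts FP (n + 1). bdry FP (n + 1) w = u \<and> fst w = x"
    using x by (intro bexI[of _ "(x, y)"]) auto
qed

lemma FP_universal:
  assumes "dgalg_hom K Z X u" "dgalg_hom K Z Y v" "\<And>n z. z \<in> elts Z n \<Longrightarrow> f n (u n z) = g n (v n z)"
  shows "dgalg_hom K Z FP (\<lambda>n z. (u n z, v n z))"
proof -
  interpret u: dgalg_hom K Z X u by fact
  interpret v: dgalg_hom K Z Y v by fact
  show ?thesis
    by unfold_locales
      (auto simp: FP_dga dga_hom_def complex_hom_def linear_map_def u.hom_add v.hom_add u.hom_smult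
        v.hom_smult u.hom_bdry v.hom_bdry u.hom_mult v.hom_mult assms(3))
qed

end

definition ground :: "'k ring \<Rightarrow> ('k, 'k) dga" where
  "ground K = \<lparr>
     piece = (\<lambda>n. \<lparr>carrier = (if n = 0 then carrier K else {\<zero>\<^bsub>K\<^esub>}), mult = undefined, one = undefined,
        zero = \<zero>\<^bsub>K\<^esub>, add = add K, smult = monoid.mult K\<rparr>),
     bdry = (\<lambda>n x. \<zero>\<^bsub>K\<^esub>), gmult = (\<lambda>i j. monoid.mult K), gone = \<one>\<^bsub>K\<^esub>\<rparr>"

lemma ground_simps [simp]:
  "elts (ground K) n = (if n = 0 then carrier K else {\<zero>\<^bsub>K\<^esub>})" "\<zero>\<^bsub>piece (ground K) n\<^esub> = \<zero>\<^bsub>K\<^esub>"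
  "x \<oplus>\<^bsub>piece (ground K) n\<^esub> y = x \<oplus>\<^bsub>K\<^esub> y" "c \<odot>\<^bsub>piece (ground K) n\<^esub> x = c \<otimes>\<^bsub>K\<^esub> x"
  "bdry (ground K) n x = \<zero>\<^bsub>K\<^esub>" "gmult (ground K) i l x y = x \<otimes>\<^bsub>K\<^esub> y" "gone (ground K) = \<one>\<^bsub>K\<^esub>"
  by (simp_all add: ground_def)

lemma ground_dga:
  assumes "cring K" shows "is_dga K (ground K)"
  unfolding is_dga_iff
proof (intro conjI)
  interpret cring K by fact
  have s: "sign K i \<in> carrier K" for i by (simp add: sign_def)
  have mod: "module K (piece (ground K) n)" for n
  proof (rule moduleI[OF assms])
    show "abelian_group (piece (ground K) n)"
      by (rule abelian_groupI) (auto simp: a_ac intro: bexI[of _ "\<ominus>\<^bsub>K\<^esub> x" for x] l_neg split: if_splits)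
  qed (auto simp: l_distr r_distr m_assoc split: if_splits)
  show "graded_algebra K (ground K)"
    by (rule graded_algebraI[OF mod]) (auto simp: l_distr r_distr m_ac split: if_splits)
  show "is_complex K (ground K)" by (auto simp: is_complex_def linear_map_def mod)
  show "\<forall>i l. \<forall>a\<in>elts (ground K) i. \<forall>b\<in>elts (ground K) l. bdry (ground K) (i + l) (gmult (ground K) i l a b) =
      gmult (ground K) (i - 1) l (bdry (ground K) i a) b \<oplus>\<^bsub>piece (ground K) (i + l - 1)\<^esub>
      sign K i \<odot>\<^bsub>piece (ground K) (i + l - 1)\<^esub> gmult (ground K) i (l - 1) a (bdry (ground K) l b)"
    using s by (auto split: if_splits)
qed

text \<open>The map is given by the unit of \<open>A\<close>; outside degree zero, where there is no unit, the ground
  field contains only zero.\<close>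

lemma (in dgalg) from_ground: "dgalg_hom K (ground K) A (\<lambda>n c. c \<odot>\<^bsub>piece A n\<^esub> (if n = 0 then gone A else \<zero>\<^bsub>piece A n\<^esub>))"
proof -
  have "is_dga K (ground K)" by (rule ground_dga[OF P.R.is_cring])
  moreover have "a \<odot>\<^bsub>piece A n\<^esub> (b \<odot>\<^bsub>piece A n\<^esub> x) = b \<odot>\<^bsub>piece A n\<^esub> (a \<odot>\<^bsub>piece A n\<^esub> x)"
    if "a \<in> carrier K" "b \<in> carrier K" "x \<in> elts A n" for a b x n
    using that by (simp add: P.smult_assoc1[symmetric] P.R.m_comm)
  then have "dga_hom K (ground K) A (\<lambda>n c. c \<odot>\<^bsub>piece A n\<^esub> (if n = 0 then gone A else \<zero>\<^bsub>piece A n\<^esub>))"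
    unfolding dga_hom_def complex_hom_def linear_map_def
    by (auto simp: P.smult_l_distr P.smult_assoc1 bdry_smult bdry_one mult_smult_left mult_smult_right
        split: if_splits)
  ultimately show ?thesis by unfold_locales (auto simp: is_dga)
qed

lemma (in dgalg) hom_from_ground:
  assumes "dgalg_hom K (ground K) A f" "c \<in> elts (ground K) n"
  shows "f n c = c \<odot>\<^bsub>piece A n\<^esub> (if n = 0 then gone A else \<zero>\<^bsub>piece A n\<^esub>)"
proof -
  interpret f: dgalg_hom K "ground K" A f by fact
  show ?thesis
  proof (cases "n = 0")
    case True
    then have "f 0 c = f 0 (c \<odot>\<^bsub>piece (ground K) 0\<^esub> gone (ground K))" using assms(2) by simp
    also have "\<dots> = c \<odot>\<^bsub>piece A 0\<^esub> gone A" using f.hom_smult[of c "gone (ground K)" 0] f.hom_one assms(2) True by simp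
    finally show ?thesis using True by simp
  next
    case False
    then show ?thesis using assms(2) f.hom_zero[of n] by simp
  qed
qed

section \<open>Factoring a map into a cofibration and an acyclic fibration\<close>

text \<open>Associativity of the square-zero extension of \<open>A\<close> by a shift of itself, with a shift by \<open>e\<close>.
  For \<open>e = -1\<close> it says that Leibniz's rule respects associativity; for \<open>e = 1\<close> the extension is by
  \<open>dt\<close>.\<close>

lemma (in galg) deriv_assoc:
  assumes abc: "a \<in> elts A i" "b \<in> elts A j" "c \<in> elts A l"
    and abc': "a' \<in> elts A (i + e)" "b' \<in> elts A (j + e)" "c' \<in> elts A (l + e)"
  shows "gmult A (i + j + e) l
      (gmult A (i + e) j a' b \<oplus>\<^bsub>piece A (i + j + e)\<^esub> sign K i \<odot>\<^bsub>piece A (i + j + e)\<^esub> gmult A i (j + e) a b') c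
     \<oplus>\<^bsub>piece A (i + j + l + e)\<^esub>
      sign K (i + j) \<odot>\<^bsub>piece A (i + j + l + e)\<^esub> gmult A (i + j) (l + e) (gmult A i j a b) c' =
     gmult A (i + e) (j + l) a' (gmult A j l b c) \<oplus>\<^bsub>piece A (i + j + l + e)\<^esub>
      sign K i \<odot>\<^bsub>piece A (i + j + l + e)\<^esub> gmult A i (j + l + e) a
       (gmult A (j + e) l b' c \<oplus>\<^bsub>piece A (j + l + e)\<^esub> sign K j \<odot>\<^bsub>piece A (j + l + e)\<^esub> gmult A j (l + e) b c')"
    (is "gmult A _ l (?p \<oplus>\<^bsub>_\<^esub> _ \<odot>\<^bsub>_\<^esub> ?q) c \<oplus>\<^bsub>piece A ?n\<^esub> _ \<odot>\<^bsub>_\<^esub> ?r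
      = ?x \<oplus>\<^bsub>_\<^esub> _ \<odot>\<^bsub>_\<^esub> gmult A i _ a (?v \<oplus>\<^bsub>_\<^esub> _ \<odot>\<^bsub>_\<^esub> ?w)")
proof -
  let ?y = "gmult A i (j + l + e) a ?v" and ?z = "gmult A i (j + l + e) a ?w"
  have n: "i + j + e + l = ?n" "i + (j + l + e) = ?n" by simp_all
  have pq: "?p \<in> elts A (i + j + e)" "?q \<in> elts A (i + j + e)" "?v \<in> elts A (j + l + e)" "?w \<in> elts A (j + l + e)"
    using abc abc' by simp_all
  then have xyz: "?x \<in> elts A ?n" "?y \<in> elts A ?n" "?z \<in> elts A ?n" using abc abc' by simp_all
  have p: "gmult A (i + j + e) l ?p c = ?x" and q: "gmult A (i + j + e) l ?q c = ?y" and r: "?r = ?z"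
    using mult_assoc[OF abc'(1) abc(2,3), of "i + j + e" "j + l"]
      mult_assoc[OF abc(1) abc'(2) abc(3), of "i + j + e" "j + l + e"]
      mult_assoc[OF abc(1,2) abc'(3), of "i + j" "j + l + e"] by simp_all
  have "gmult A (i + j + e) l (?p \<oplus>\<^bsub>piece A (i + j + e)\<^esub> sign K i \<odot>\<^bsub>piece A (i + j + e)\<^esub> ?q) c =
      ?x \<oplus>\<^bsub>piece A ?n\<^esub> sign K i \<odot>\<^bsub>piece A ?n\<^esub> ?y"
    using mult_add_left[of ?p "i + j + e" "sign K i \<odot>\<^bsub>piece A (i + j + e)\<^esub> ?q" c l]
      mult_smult_left[of "sign K i" ?q "i + j + e" c l] pq abc(3) unfolding n p q by simp
  moreover have "gmult A i (j + l + e) a (?v \<oplus>\<^bsub>piece A (j + l + e)\<^esub> sign K j \<odot>\<^bsub>piece A (j + l + e)\<^esub> ?w) =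
      ?y \<oplus>\<^bsub>piece A ?n\<^esub> sign K j \<odot>\<^bsub>piece A ?n\<^esub> ?z"
    using mult_add_right[of a i ?v "j + l + e" "sign K j \<odot>\<^bsub>piece A (j + l + e)\<^esub> ?w"]
      mult_smult_right[of "sign K j" a i ?w "j + l + e"] pq abc(1) unfolding n by simp
  moreover have "?x \<oplus>\<^bsub>piece A ?n\<^esub> sign K i \<odot>\<^bsub>piece A ?n\<^esub> ?y \<oplus>\<^bsub>piece A ?n\<^esub> sign K (i + j) \<odot>\<^bsub>piece A ?n\<^esub> ?z =
      ?x \<oplus>\<^bsub>piece A ?n\<^esub> sign K i \<odot>\<^bsub>piece A ?n\<^esub> (?y \<oplus>\<^bsub>piece A ?n\<^esub> sign K j \<odot>\<^bsub>piece A ?n\<^esub> ?z)"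
    using xyz by (cases "even i"; cases "even j") (simp_all add: sign_smult P.a_assoc P.minus_add)
  ultimately show ?thesis unfolding r by simp
qed

text \<open>Terms over the elements of a DG algebra (\<open>El\<close>) and formal generators: \<open>Gn b z\<close> is a generator
  with boundary \<open>z\<close> that is to be mapped to \<open>b\<close>. As \<open>z\<close> may itself contain generators, the
  infinitely many stages of attaching cells are merged into one recursive type. Scalars occur under
  an injection into \<open>'a\<close>, which keeps the terms over \<open>'a\<close> codable in \<open>'a\<close>.\<close>

datatype 'a tm = El 'a | Gn 'a "'a tm" | Zr | On | Ad "'a tm" "'a tm" | Sm 'a "'a tm"
  | Ml int int "'a tm" "'a tm"

primrec encode_tm :: "(nat \<times> 'a \<times> 'a \<Rightarrow> 'a) \<Rightarrow> 'a tm \<Rightarrow> 'a" where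
  "encode_tm J (El a) = J (0, a, a)"
| "encode_tm J (Gn b z) = J (1, b, encode_tm J z)"
| "encode_tm J Zr = J (2, undefined, undefined)"
| "encode_tm J On = J (3, undefined, undefined)"
| "encode_tm J (Ad s t) = J (4, encode_tm J s, encode_tm J t)"
| "encode_tm J (Sm c t) = J (5, c, encode_tm J t)"
| "encode_tm J (Ml i j s t) = J (6 + prod_encode (int_encode i, int_encode j), encode_tm J s, encode_tm J t)"

lemma inj_encode_tm:
  assumes "inj J" shows "inj (encode_tm J)"
proof (rule injI)
  fix s t :: "'a tm"
  have J: "J x = J y \<longleftrightarrow> x = y" for x y using assms by (simp add: inj_eq)
  show "encode_tm J s = encode_tm J t \<Longrightarrow> s = t"
  proof (induction s arbitrary: t)
    case (El a) then show ?case by (cases t) (auto simp: J)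
  next
    case (Gn b z) then show ?case by (cases t) (auto simp: J)
  next
    case Zr then show ?case by (cases t) (auto simp: J)
  next
    case On then show ?case by (cases t) (auto simp: J)
  next
    case (Ad s1 s2) then show ?case by (cases t) (auto simp: J)
  next
    case (Sm c s) then show ?case by (cases t) (auto simp: J)
  next
    case (Ml i j s1 s2) then show ?case
      by (cases t) (auto simp: J prod_encode_eq dest: injD[OF inj_int_encode])
  qed
qed

text \<open>The value of a term in degree \<open>n\<close>, from the values \<open>u\<close> of elements and a choice \<open>G\<close> for the
  generators, which may depend on the value of the boundary.\<close>

primrec eval_tm :: "('k, 'b) dga \<Rightarrow> ('a \<Rightarrow> 'k) \<Rightarrow> (int \<Rightarrow> 'a \<Rightarrow> 'b) \<Rightarrow> (int \<Rightarrow> 'a \<Rightarrow> 'a tm \<Rightarrow> 'b \<Rightarrow> 'b) \<Rightarrow>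
    'a tm \<Rightarrow> int \<Rightarrow> 'b" where
  "eval_tm E \<kappa> u G (El a) = (\<lambda>n. u n a)"
| "eval_tm E \<kappa> u G (Gn b z) = (\<lambda>n. G n b z (eval_tm E \<kappa> u G z (n - 1)))"
| "eval_tm E \<kappa> u G Zr = (\<lambda>n. \<zero>\<^bsub>piece E n\<^esub>)"
| "eval_tm E \<kappa> u G On = (\<lambda>n. gone E)"
| "eval_tm E \<kappa> u G (Ad s t) = (\<lambda>n. eval_tm E \<kappa> u G s n \<oplus>\<^bsub>piece E n\<^esub> eval_tm E \<kappa> u G t n)"
| "eval_tm E \<kappa> u G (Sm c t) = (\<lambda>n. \<kappa> c \<odot>\<^bsub>piece E n\<^esub> eval_tm E \<kappa> u G t n)"
| "eval_tm E \<kappa> u G (Ml i j s t) = (\<lambda>n. gmult E i j (eval_tm E \<kappa> u G s i) (eval_tm E \<kappa> u G t j))"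

text \<open>The factorization \<open>S \<rightarrow> Q \<rightarrow> A\<close> of \<open>f\<close> through an algebra obtained from \<open>S\<close> by attaching cells.\<close>

locale free_extension = f: dgalg_hom K S A f
  for K :: "'k ring" and S A :: "('k, 'a) dga" and f +
  fixes \<iota> :: "'k \<Rightarrow> 'a" and enc :: "'a tm \<Rightarrow> 'a"
  assumes inj_\<iota>: "inj_on \<iota> (carrier K)" and inj_enc: "inj enc"
begin

abbreviation \<kappa> where "\<kappa> \<equiv> inv_into (carrier K) \<iota>"

lemma \<kappa> [simp]: "c \<in> carrier K \<Longrightarrow> \<kappa> (\<iota> c) = c"
  using inj_\<iota> by simp

text \<open>The formal differential of a term, considered in a given degree.\<close>

primrec dt :: "'a tm \<Rightarrow> int \<Rightarrow> 'a tm" where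
  "dt (El a) = (\<lambda>n. El (bdry S n a))"
| "dt (Gn b z) = (\<lambda>n. z)"
| "dt Zr = (\<lambda>n. Zr)"
| "dt On = (\<lambda>n. Zr)"
| "dt (Ad s t) = (\<lambda>n. Ad (dt s n) (dt t n))"
| "dt (Sm c t) = (\<lambda>n. Sm c (dt t n))"
| "dt (Ml i j s t) = (\<lambda>n. Ad (Ml (i - 1) j (dt s i) t) (Sm (\<iota> (sign K i)) (Ml i (j - 1) s (dt t j))))"

text \<open>The map to \<open>A\<close> on terms: a generator \<open>Gn b z\<close> goes to \<open>b\<close>.\<close>

abbreviation ph :: "'a tm \<Rightarrow> int \<Rightarrow> 'a" where
  "ph \<equiv> eval_tm A \<kappa> f (\<lambda>n b z x. b)"

text \<open>The smallest partial congruence that imposes the laws of a graded algebra and the operations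
  of \<open>S\<close>. Well-formed terms of degree \<open>n\<close> are those related to themselves, so one induction handles
  typing and equality; this is necessary because a generator \<open>Gn b z\<close> exists only if \<open>z\<close> is a cycle
  modulo the relation and its image in \<open>A\<close> is the boundary of \<open>b\<close>.\<close>

inductive eqv :: "int \<Rightarrow> 'a tm \<Rightarrow> 'a tm \<Rightarrow> bool" where
  sym: "eqv n s t \<Longrightarrow> eqv n t s"
| trans: "eqv n s t \<Longrightarrow> eqv n t r \<Longrightarrow> eqv n s r"
| El: "a \<in> elts S n \<Longrightarrow> eqv n (El a) (El a)"
| Gn: "b \<in> elts A n \<Longrightarrow> eqv (n - 1) z z \<Longrightarrow> eqv (n - 2) (dt z (n - 1)) Zr \<Longrightarrow>
    bdry A n b = ph z (n - 1) \<Longrightarrow> eqv n (Gn b z) (Gn b z)"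
| Zr: "eqv n Zr Zr"
| On: "eqv 0 On On"
| Ad: "eqv n s s' \<Longrightarrow> eqv n t t' \<Longrightarrow> eqv n (Ad s t) (Ad s' t')"
| Sm: "c \<in> carrier K \<Longrightarrow> eqv n s s' \<Longrightarrow> eqv n (Sm (\<iota> c) s) (Sm (\<iota> c) s')"
| Ml: "eqv i s s' \<Longrightarrow> eqv j t t' \<Longrightarrow> i + j = n \<Longrightarrow> eqv n (Ml i j s t) (Ml i j s' t')"
| add_assoc: "eqv n s s \<Longrightarrow> eqv n t t \<Longrightarrow> eqv n r r \<Longrightarrow> eqv n (Ad (Ad s t) r) (Ad s (Ad t r))"
| add_comm: "eqv n s s \<Longrightarrow> eqv n t t \<Longrightarrow> eqv n (Ad s t) (Ad t s)"
| add_zero: "eqv n s s \<Longrightarrow> eqv n (Ad Zr s) s"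
| sm_l: "c \<in> carrier K \<Longrightarrow> d \<in> carrier K \<Longrightarrow> eqv n s s \<Longrightarrow>
    eqv n (Sm (\<iota> (c \<oplus>\<^bsub>K\<^esub> d)) s) (Ad (Sm (\<iota> c) s) (Sm (\<iota> d) s))"
| sm_r: "c \<in> carrier K \<Longrightarrow> eqv n s s \<Longrightarrow> eqv n t t \<Longrightarrow>
    eqv n (Sm (\<iota> c) (Ad s t)) (Ad (Sm (\<iota> c) s) (Sm (\<iota> c) t))"
| sm_assoc: "c \<in> carrier K \<Longrightarrow> d \<in> carrier K \<Longrightarrow> eqv n s s \<Longrightarrow>
    eqv n (Sm (\<iota> (c \<otimes>\<^bsub>K\<^esub> d)) s) (Sm (\<iota> c) (Sm (\<iota> d) s))"
| sm_one: "eqv n s s \<Longrightarrow> eqv n (Sm (\<iota> \<one>\<^bsub>K\<^esub>) s) s"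
| sm_zero: "eqv n s s \<Longrightarrow> eqv n (Sm (\<iota> \<zero>\<^bsub>K\<^esub>) s) Zr"
| ml_add_r: "eqv i s s \<Longrightarrow> eqv j t t \<Longrightarrow> eqv j r r \<Longrightarrow> i + j = n \<Longrightarrow>
    eqv n (Ml i j s (Ad t r)) (Ad (Ml i j s t) (Ml i j s r))"
| ml_add_l: "eqv i s s \<Longrightarrow> eqv i t t \<Longrightarrow> eqv j r r \<Longrightarrow> i + j = n \<Longrightarrow>
    eqv n (Ml i j (Ad s t) r) (Ad (Ml i j s r) (Ml i j t r))"
| ml_sm_r: "c \<in> carrier K \<Longrightarrow> eqv i s s \<Longrightarrow> eqv j t t \<Longrightarrow> i + j = n \<Longrightarrow>
    eqv n (Ml i j s (Sm (\<iota> c) t)) (Sm (\<iota> c) (Ml i j s t))"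
| ml_sm_l: "c \<in> carrier K \<Longrightarrow> eqv i s s \<Longrightarrow> eqv j t t \<Longrightarrow> i + j = n \<Longrightarrow>
    eqv n (Ml i j (Sm (\<iota> c) s) t) (Sm (\<iota> c) (Ml i j s t))"
| ml_assoc: "eqv i s s \<Longrightarrow> eqv j t t \<Longrightarrow> eqv l r r \<Longrightarrow> i + j = m \<Longrightarrow> j + l = k \<Longrightarrow> m + l = n \<Longrightarrow>
    eqv n (Ml m l (Ml i j s t) r) (Ml i k s (Ml j l t r))"
| one_l: "eqv n s s \<Longrightarrow> eqv n (Ml 0 n On s) s"
| one_r: "eqv n s s \<Longrightarrow> eqv n (Ml n 0 s On) s"
| El_add: "a \<in> elts S n \<Longrightarrow> b \<in> elts S n \<Longrightarrow> eqv n (El (a \<oplus>\<^bsub>piece S n\<^esub> b)) (Ad (El a) (El b))"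
| El_sm: "c \<in> carrier K \<Longrightarrow> a \<in> elts S n \<Longrightarrow> eqv n (El (c \<odot>\<^bsub>piece S n\<^esub> a)) (Sm (\<iota> c) (El a))"
| El_ml: "a \<in> elts S i \<Longrightarrow> b \<in> elts S j \<Longrightarrow> i + j = n \<Longrightarrow> eqv n (El (gmult S i j a b)) (Ml i j (El a) (El b))"
| El_one: "eqv 0 (El (gone S)) On"

lemma eqv_left: "eqv n s t \<Longrightarrow> eqv n s s" and eqv_right: "eqv n s t \<Longrightarrow> eqv n t t"
  by (blast intro: eqv.sym eqv.trans)+

lemma wf_simps [simp]:
  "a \<in> elts S n \<Longrightarrow> eqv n (El a) (El a)" "eqv n Zr Zr" "eqv 0 On On"
  "eqv n s s \<Longrightarrow> eqv n t t \<Longrightarrow> eqv n (Ad s t) (Ad s t)"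
  "c \<in> carrier K \<Longrightarrow> eqv n s s \<Longrightarrow> eqv n (Sm (\<iota> c) s) (Sm (\<iota> c) s)"
  "eqv i s s \<Longrightarrow> eqv j t t \<Longrightarrow> i + j = n \<Longrightarrow> eqv n (Ml i j s t) (Ml i j s t)"
  by (auto intro: eqv.El eqv.Zr eqv.On eqv.Ad eqv.Sm eqv.Ml)

text \<open>An equivalence class is coded by one of its terms, in order that \<open>Q\<close> has elements of type
  \<open>'a\<close>.\<close>

definition cl :: "int \<Rightarrow> 'a tm \<Rightarrow> 'a" where
  "cl n s = enc (SOME t. eqv n s t)"

abbreviation dec where "dec \<equiv> inv_into UNIV enc"

lemma cl_eq: assumes "eqv n s t" shows "cl n s = cl n t"
proof -
  have "eqv n s = eqv n t" using assms by (auto intro: eqv.sym eqv.trans)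
  then show ?thesis by (simp add: cl_def)
qed

lemma dec_cl: "eqv n s s \<Longrightarrow> eqv n s (dec (cl n s))"
  unfolding cl_def inv_f_f[OF inj_enc] by (rule someI)

lemma cl_iff: "eqv n s s \<Longrightarrow> eqv n t t \<Longrightarrow> cl n s = cl n t \<longleftrightarrow> eqv n s t"
  using cl_eq dec_cl by (metis eqv.sym eqv.trans)

definition Q :: "('k, 'a) dga" where
  "Q = \<lparr>
     piece = (\<lambda>n. \<lparr>carrier = cl n ` {s. eqv n s s}, mult = undefined, one = undefined, zero = cl n Zr,
        add = (\<lambda>x y. cl n (Ad (dec x) (dec y))), smult = (\<lambda>c x. cl n (Sm (\<iota> c) (dec x)))\<rparr>),
     bdry = (\<lambda>n x. cl (n - 1) (dt (dec x) n)),
     gmult = (\<lambda>i j x y. cl (i + j) (Ml i j (dec x) (dec y))),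
     gone = cl 0 On\<rparr>"

lemma Q_elts: "elts Q n = cl n ` {s. eqv n s s}"
  by (simp add: Q_def)

lemma cl_mem [simp]: "eqv n s s \<Longrightarrow> cl n s \<in> elts Q n"
  by (simp add: Q_elts)

lemma cl_Zr: "cl n Zr = \<zero>\<^bsub>piece Q n\<^esub>" and cl_On: "cl 0 On = gone Q"
  by (simp_all add: Q_def)

lemma cl_Ad: "eqv n s s \<Longrightarrow> eqv n t t \<Longrightarrow> cl n (Ad s t) = cl n s \<oplus>\<^bsub>piece Q n\<^esub> cl n t"
  using cl_eq[OF eqv.Ad[OF dec_cl dec_cl]] by (simp add: Q_def)

lemma cl_Sm: "c \<in> carrier K \<Longrightarrow> eqv n s s \<Longrightarrow> cl n (Sm (\<iota> c) s) = c \<odot>\<^bsub>piece Q n\<^esub> cl n s"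
  using cl_eq[OF eqv.Sm[OF _ dec_cl]] by (simp add: Q_def)

lemma cl_Ml: "eqv i s s \<Longrightarrow> eqv j t t \<Longrightarrow> i + j = n \<Longrightarrow> cl n (Ml i j s t) = gmult Q i j (cl i s) (cl j t)"
  using cl_eq[OF eqv.Ml[OF dec_cl dec_cl]] by (auto simp: Q_def)

lemmas cl_simps = cl_Zr cl_On cl_Ad cl_Sm cl_Ml

lemma Q_galg: "graded_algebra K Q"
proof -
  note e = cl_eq[symmetric]
  have mod: "module K (piece Q n)" for n
  proof (rule moduleI[OF f.A.P.R.is_cring])
    show "abelian_group (piece Q n)"
    proof (rule abelian_groupI)
      fix x y z assume "x \<in> elts Q n" "y \<in> elts Q n" "z \<in> elts Q n"
      then obtain s t r where *: "x = cl n s" "y = cl n t" "z = cl n r" "eqv n s s" "eqv n t t" "eqv n r r"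
        by (auto simp: Q_elts)
      show "x \<oplus>\<^bsub>piece Q n\<^esub> y \<oplus>\<^bsub>piece Q n\<^esub> z = x \<oplus>\<^bsub>piece Q n\<^esub> (y \<oplus>\<^bsub>piece Q n\<^esub> z)"
        using cl_eq[OF eqv.add_assoc[OF *(4-6)]] * by (simp add: cl_simps)
    next
      fix x y assume "x \<in> elts Q n" "y \<in> elts Q n"
      then obtain s t where *: "x = cl n s" "y = cl n t" "eqv n s s" "eqv n t t" by (auto simp: Q_elts)
      show "x \<oplus>\<^bsub>piece Q n\<^esub> y = y \<oplus>\<^bsub>piece Q n\<^esub> x"
        using cl_eq[OF eqv.add_comm[OF *(3,4)]] * by (simp add: cl_simps)
      show "x \<oplus>\<^bsub>piece Q n\<^esub> y \<in> elts Q n" using * by (simp flip: cl_Ad)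
    next
      fix x assume "x \<in> elts Q n"
      then obtain s where *: "x = cl n s" "eqv n s s" by (auto simp: Q_elts)
      show "\<zero>\<^bsub>piece Q n\<^esub> \<oplus>\<^bsub>piece Q n\<^esub> x = x"
        using cl_eq[OF eqv.add_zero[OF *(2)]] * by (simp add: cl_simps)
      have "cl n (Sm (\<iota> (\<ominus>\<^bsub>K\<^esub> \<one>\<^bsub>K\<^esub> \<oplus>\<^bsub>K\<^esub> \<one>\<^bsub>K\<^esub>)) s) = cl n (Sm (\<iota> (\<ominus>\<^bsub>K\<^esub> \<one>\<^bsub>K\<^esub>)) s) \<oplus>\<^bsub>piece Q n\<^esub> x"
        using cl_eq[OF eqv.sm_l[of "\<ominus>\<^bsub>K\<^esub> \<one>\<^bsub>K\<^esub>" "\<one>\<^bsub>K\<^esub>" n s]] cl_eq[OF eqv.sm_one[OF *(2)]] *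
        by (simp add: cl_Ad)
      moreover have "cl n (Sm (\<iota> (\<ominus>\<^bsub>K\<^esub> \<one>\<^bsub>K\<^esub> \<oplus>\<^bsub>K\<^esub> \<one>\<^bsub>K\<^esub>)) s) = \<zero>\<^bsub>piece Q n\<^esub>"
        using cl_eq[OF eqv.sm_zero[OF *(2)]] by (simp add: f.A.P.R.l_neg cl_Zr)
      ultimately show "\<exists>y\<in>elts Q n. y \<oplus>\<^bsub>piece Q n\<^esub> x = \<zero>\<^bsub>piece Q n\<^esub>"
        using * by (intro bexI[of _ "cl n (Sm (\<iota> (\<ominus>\<^bsub>K\<^esub> \<one>\<^bsub>K\<^esub>)) s)"]) auto
    qed (simp flip: cl_Zr)
  next
    fix c x y assume "c \<in> carrier K" "x \<in> elts Q n" "y \<in> elts Q n"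
    then obtain s t where *: "c \<in> carrier K" "x = cl n s" "y = cl n t" "eqv n s s" "eqv n t t" by (auto simp: Q_elts)
    show "c \<odot>\<^bsub>piece Q n\<^esub> (x \<oplus>\<^bsub>piece Q n\<^esub> y) = c \<odot>\<^bsub>piece Q n\<^esub> x \<oplus>\<^bsub>piece Q n\<^esub> c \<odot>\<^bsub>piece Q n\<^esub> y"
      using cl_eq[OF eqv.sm_r[OF *(1,4,5)]] * by (simp add: cl_simps)
  next
    fix c d x assume "c \<in> carrier K" "d \<in> carrier K" "x \<in> elts Q n"
    then obtain s where *: "c \<in> carrier K" "d \<in> carrier K" "x = cl n s" "eqv n s s" by (auto simp: Q_elts)
    show "(c \<oplus>\<^bsub>K\<^esub> d) \<odot>\<^bsub>piece Q n\<^esub> x = c \<odot>\<^bsub>piece Q n\<^esub> x \<oplus>\<^bsub>piece Q n\<^esub> d \<odot>\<^bsub>piece Q n\<^esub> x"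
      using cl_eq[OF eqv.sm_l[OF *(1,2,4)]] * by (simp add: cl_simps)
    show "(c \<otimes>\<^bsub>K\<^esub> d) \<odot>\<^bsub>piece Q n\<^esub> x = c \<odot>\<^bsub>piece Q n\<^esub> (d \<odot>\<^bsub>piece Q n\<^esub> x)"
      using cl_eq[OF eqv.sm_assoc[OF *(1,2,4)]] * by (simp add: cl_simps)
  next
    fix c x assume "c \<in> carrier K" "x \<in> elts Q n"
    then show "c \<odot>\<^bsub>piece Q n\<^esub> x \<in> elts Q n" by (auto simp: Q_elts simp flip: cl_Sm)
  next
    fix x assume "x \<in> elts Q n"
    then show "\<one>\<^bsub>K\<^esub> \<odot>\<^bsub>piece Q n\<^esub> x = x"
      using cl_eq[OF eqv.sm_one] by (auto simp: Q_elts simp flip: cl_Sm)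
  qed
  show ?thesis
  proof (rule graded_algebraI[OF mod])
    fix i j a b assume "a \<in> elts Q i" "b \<in> elts Q j"
    then show "gmult Q i j a b \<in> elts Q (i + j)" by (auto simp: Q_elts simp flip: cl_Ml)
  next
    fix i j a b c assume "a \<in> elts Q i" "b \<in> elts Q j" "c \<in> elts Q j"
    then obtain s t r where *: "a = cl i s" "b = cl j t" "c = cl j r" "eqv i s s" "eqv j t t" "eqv j r r"
      by (auto simp: Q_elts)
    show "gmult Q i j a (b \<oplus>\<^bsub>piece Q j\<^esub> c) = gmult Q i j a b \<oplus>\<^bsub>piece Q (i + j)\<^esub> gmult Q i j a c"
      using cl_eq[OF eqv.ml_add_r[OF *(4-6) HOL.refl]] * by (simp add: cl_simps)
  next
    fix i j a b c assume "a \<in> elts Q i" "b \<in> elts Q i" "c \<in> elts Q j"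
    then obtain s t r where *: "a = cl i s" "b = cl i t" "c = cl j r" "eqv i s s" "eqv i t t" "eqv j r r"
      by (auto simp: Q_elts)
    show "gmult Q i j (a \<oplus>\<^bsub>piece Q i\<^esub> b) c = gmult Q i j a c \<oplus>\<^bsub>piece Q (i + j)\<^esub> gmult Q i j b c"
      using cl_eq[OF eqv.ml_add_l[OF *(4-6) HOL.refl]] * by (simp add: cl_simps)
  next
    fix i j a b c assume "c \<in> carrier K" "a \<in> elts Q i" "b \<in> elts Q j"
    then obtain s t where *: "c \<in> carrier K" "a = cl i s" "b = cl j t" "eqv i s s" "eqv j t t" by (auto simp: Q_elts)
    show "gmult Q i j a (c \<odot>\<^bsub>piece Q j\<^esub> b) = c \<odot>\<^bsub>piece Q (i + j)\<^esub> gmult Q i j a b"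
      using cl_eq[OF eqv.ml_sm_r[OF *(1,4,5) HOL.refl]] * by (simp add: cl_simps)
    show "gmult Q i j (c \<odot>\<^bsub>piece Q i\<^esub> a) b = c \<odot>\<^bsub>piece Q (i + j)\<^esub> gmult Q i j a b"
      using cl_eq[OF eqv.ml_sm_l[OF *(1,4,5) HOL.refl]] * by (simp add: cl_simps)
  next
    fix i j l a b c assume "a \<in> elts Q i" "b \<in> elts Q j" "c \<in> elts Q l"
    then obtain s t r where *: "a = cl i s" "b = cl j t" "c = cl l r" "eqv i s s" "eqv j t t" "eqv l r r"
      by (auto simp: Q_elts)
    show "gmult Q (i + j) l (gmult Q i j a b) c = gmult Q i (j + l) a (gmult Q j l b c)"
      using cl_eq[OF eqv.ml_assoc[OF *(4-6) HOL.refl HOL.refl HOL.refl]] *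
      by (simp add: cl_simps add.assoc)
  next
    show "gone Q \<in> elts Q 0" by (simp flip: cl_On)
    fix i a assume "a \<in> elts Q i"
    then obtain s where *: "a = cl i s" "eqv i s s" by (auto simp: Q_elts)
    show "gmult Q 0 i (gone Q) a = a" "gmult Q i 0 a (gone Q) = a"
      using cl_eq[OF eqv.one_l[OF *(2)]] cl_eq[OF eqv.one_r[OF *(2)]] * by (simp_all add: cl_simps)
  qed
qed

sublocale Q: galg K Q
  by unfold_locales (rule Q_galg)

lemma cl_El_zero: "cl n (El \<zero>\<^bsub>piece S n\<^esub>) = \<zero>\<^bsub>piece Q n\<^esub>"
  using cl_eq[OF eqv.El_sm[of "\<zero>\<^bsub>K\<^esub>" "\<zero>\<^bsub>piece S n\<^esub>" n]] cl_eq[OF eqv.sm_zero[of n "El \<zero>\<^bsub>piece S n\<^esub>"]]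
  by (simp add: cl_Zr)

text \<open>That the differential descends to classes and squares to zero has to be proved simultaneously
  with Leibniz's rule for the classes; \<open>good\<close> is the invariant of that induction.\<close>

definition good :: "int \<Rightarrow> 'a tm \<Rightarrow> bool" where
  "good n s \<longleftrightarrow> eqv n s s \<and> eqv (n - 1) (dt s n) (dt s n) \<and> eqv (n - 2) (dt (dt s n) (n - 1)) Zr"

definition D :: "int \<Rightarrow> 'a tm \<Rightarrow> 'a" where
  "D n s = cl (n - 1) (dt s n)"

lemma goodD: "good n s \<Longrightarrow> eqv n s s" "good n s \<Longrightarrow> eqv (n - 1) (dt s n) (dt s n)"
  "good n s \<Longrightarrow> eqv (n - 2) (dt (dt s n) (n - 1)) (dt (dt s n) (n - 1))"
  "good n s \<Longrightarrow> cl (n - 2) (dt (dt s n) (n - 1)) = \<zero>\<^bsub>piece Q (n - 2)\<^esub>"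
  "good n s \<Longrightarrow> D n s \<in> elts Q (n - 1)" "good n s \<Longrightarrow> cl n s \<in> elts Q n"
  by (auto simp: good_def D_def cl_eq cl_Zr dest: eqv_left)

lemma goodI:
  assumes "eqv n s s" "eqv (n - 1) (dt s n) (dt s n)" "eqv (n - 2) (dt (dt s n) (n - 1)) (dt (dt s n) (n - 1))"
    "cl (n - 2) (dt (dt s n) (n - 1)) = \<zero>\<^bsub>piece Q (n - 2)\<^esub>"
  shows "good n s"
  using assms cl_iff[of "n - 2" "dt (dt s n) (n - 1)" Zr] by (simp add: good_def cl_Zr)

lemma good_El: "a \<in> elts S n \<Longrightarrow> good n (El a)"
  using f.A.bdry_bdry[of a n "n - 1" "n - 2"] f.A.bdry_closed[of "bdry S n a" "n - 1" "n - 2"]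
  by (intro goodI) (auto simp: cl_El_zero)

lemma good_Zr: "good n Zr" and good_On: "good 0 On"
  by (rule goodI; simp add: cl_Zr)+

lemma good_Ad: "good n s \<Longrightarrow> good n t \<Longrightarrow> good n (Ad s t)"
  by (rule goodI) (auto simp: goodD cl_simps)

lemma good_Sm: "c \<in> carrier K \<Longrightarrow> good n s \<Longrightarrow> good n (Sm (\<iota> c) s)"
  by (rule goodI) (auto simp: goodD cl_simps)

lemma D_Zr: "D n Zr = \<zero>\<^bsub>piece Q (n - 1)\<^esub>" and D_On: "D 0 On = \<zero>\<^bsub>piece Q (- 1)\<^esub>"
  by (simp_all add: D_def cl_Zr)

lemma D_Ad: "good n s \<Longrightarrow> good n t \<Longrightarrow> D n (Ad s t) = D n s \<oplus>\<^bsub>piece Q (n - 1)\<^esub> D n t"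
  by (simp add: D_def cl_simps goodD)

lemma D_Sm: "c \<in> carrier K \<Longrightarrow> good n s \<Longrightarrow> D n (Sm (\<iota> c) s) = c \<odot>\<^bsub>piece Q (n - 1)\<^esub> D n s"
  by (simp add: D_def cl_simps goodD)

lemma D_Ml: "good i s \<Longrightarrow> good j t \<Longrightarrow> i + j = n \<Longrightarrow> D n (Ml i j s t) =
   gmult Q (i - 1) j (D i s) (cl j t) \<oplus>\<^bsub>piece Q (n - 1)\<^esub>
     sign K i \<odot>\<^bsub>piece Q (n - 1)\<^esub> gmult Q i (j - 1) (cl i s) (D j t)"
  by (auto simp: D_def cl_simps goodD)

lemma good_Ml:
  assumes "good i s" "good j t" "i + j = n" shows "good n (Ml i j s t)"
proof (rule goodI)
  show "eqv n (Ml i j s t) (Ml i j s t)" "eqv (n - 1) (dt (Ml i j s t) n) (dt (Ml i j s t) n)"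
    "eqv (n - 2) (dt (dt (Ml i j s t) n) (n - 1)) (dt (dt (Ml i j s t) n) (n - 1))"
    using assms by (auto simp: goodD)
  have e: "n - 2 = i - 2 + j" "n - 2 = i - 1 + (j - 1)" "n - 2 = i + (j - 2)" using assms(3) by auto
  have "gmult Q (i - 1) (j - 1) (D i s) (D j t) \<in> elts Q (n - 2)"
    using assms by (simp add: goodD)
  then show "cl (n - 2) (dt (dt (Ml i j s t) n) (n - 1)) = \<zero>\<^bsub>piece Q (n - 2)\<^esub>"
    using assms goodD[OF assms(1)] goodD[OF assms(2)]
    by (cases "even i") (auto simp: cl_simps Q.sign_smult Q.P.abel diff_add_eq add_diff_eq simp flip: D_def)
qed

lemmas good_intros = good_El good_Zr good_On good_Ad good_Sm good_Ml
lemmas D_simps = D_Zr D_On D_Ad D_Sm D_Ml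

text \<open>The relation is compatible with the differential. The generators are no obstacle: their
  boundary is a cycle by the rule that admits them.\<close>

lemma eqv_sound: "eqv n s t \<Longrightarrow> good n s \<and> good n t \<and> D n s = D n t"
proof (induction rule: eqv.induct)
  case (Gn b n z)
  then have "good n (Gn b z)"
    using eqv.Gn[OF Gn(1-4)] by (simp add: good_def)
  then show ?case by simp
next
  case (Ml i s s' j t t' n)
  then show ?case by (simp add: good_intros D_simps cl_eq[of i s s'] cl_eq[of j t t'])
next
  case (add_assoc n s t r)
  then show ?case by (simp add: good_intros D_simps goodD Q.P.a_assoc)
next
  case (add_comm n s t)
  then show ?case by (simp add: good_intros D_simps goodD Q.P.a_comm)
next
  case (add_zero n s)
  then show ?case by (simp add: good_intros D_simps goodD)
next
  case (sm_l c d n s)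
  then show ?case by (simp add: good_intros D_simps goodD Q.P.smult_l_distr)
next
  case (sm_r c n s t)
  then show ?case by (simp add: good_intros D_simps goodD Q.P.smult_r_distr)
next
  case (sm_assoc c d n s)
  then show ?case by (simp add: good_intros D_simps goodD Q.P.smult_assoc1)
next
  case (sm_one n s)
  then show ?case by (simp add: good_intros D_simps goodD)
next
  case (sm_zero n s)
  then show ?case by (simp add: good_intros D_simps goodD)
next
  case (ml_add_r i s j t r n)
  then show ?case
    by (cases "even i") (auto simp: good_intros D_simps goodD cl_simps Q.mult_add_right Q.sign_smult Q.P.abel diff_add_eq add_diff_eq)
next
  case (ml_add_l i s t j r n)
  then show ?case
    by (cases "even i") (auto simp: good_intros D_simps goodD cl_simps Q.mult_add_left Q.sign_smult Q.P.abel diff_add_eq add_diff_eq)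
next
  case (ml_sm_r c i s j t n)
  then show ?case
    by (cases "even i") (auto simp: good_intros D_simps goodD cl_simps Q.mult_smult_right Q.sign_smult
       Q.P.smult_r_distr Q.P.smult_r_minus diff_add_eq add_diff_eq)
next
  case (ml_sm_l c i s j t n)
  then show ?case
    by (cases "even i") (auto simp: good_intros D_simps goodD cl_simps Q.mult_smult_left Q.sign_smult
       Q.P.smult_r_distr Q.P.smult_r_minus diff_add_eq add_diff_eq)
next
  case (ml_assoc i s j t l r m k n)
  have g: "good i s" "good j t" "good l r" "good m (Ml i j s t)" "good k (Ml j l t r)"
    using ml_assoc by (auto simp: good_intros)
  have "D n (Ml m l (Ml i j s t) r) = D n (Ml i k s (Ml j l t r))"
    using g ml_assoc(4-6) Q.deriv_assoc[of "cl i s" i "cl j t" j "cl l r" l "D i s" "- 1" "D j t" "D l r"]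
    by (simp add: D_Ml cl_Ml goodD)
  then show ?case using ml_assoc by (simp add: good_intros)
next
  case (one_l n s)
  then show ?case
    by (auto simp: good_intros D_simps goodD cl_simps Q.sign_smult)
next
  case (one_r n s)
  then show ?case
    by (auto simp: good_intros D_simps goodD cl_simps Q.sign_smult)
next
  case (El_add a n b)
  then show ?case
    using cl_eq[OF eqv.El_add[of "bdry S n a" "n - 1" "bdry S n b"]]
    by (simp add: good_intros) (simp add: D_def f.A.bdry_add)
next
  case (El_sm c a n)
  then show ?case
    using cl_eq[OF eqv.El_sm[of c "bdry S n a" "n - 1"]]
    by (simp add: good_intros) (simp add: D_def f.A.bdry_smult)
next
  case (El_ml a i b j n)
  then show ?case
    using cl_eq[OF eqv.El_add[of "gmult S (i - 1) j (bdry S i a) b" "n - 1"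
          "sign K i \<odot>\<^bsub>piece S (n - 1)\<^esub> gmult S i (j - 1) a (bdry S j b)"]]
      cl_eq[OF eqv.El_sm[of "sign K i" "gmult S i (j - 1) a (bdry S j b)" "n - 1"]]
      cl_eq[OF eqv.El_ml[of "bdry S i a" "i - 1" b j "n - 1"]]
      cl_eq[OF eqv.El_ml[of a i "bdry S j b" "j - 1" "n - 1"]]
    by (simp add: good_intros) (simp add: D_def f.A.leibniz cl_simps)
next
  case El_one
  then show ?case using cl_El_zero[of "- 1"] by (simp add: good_intros D_On) (simp add: D_def f.A.bdry_one)
qed (auto simp: good_intros D_simps)

lemma wf_good: "eqv n s s \<Longrightarrow> good n s"
  using eqv_sound by blast

lemma bdry_cl: "eqv n s s \<Longrightarrow> bdry Q n (cl n s) = D n s"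
  using eqv_sound[OF dec_cl] by (simp add: Q_def D_def)

lemma Q_dga: "is_dga K Q"
  unfolding is_dga_iff
proof (intro conjI Q_galg)
  show "is_complex K Q"
    unfolding is_complex_def
  proof (intro allI conjI ballI)
    fix n
    show "module K (piece Q n)" by (rule Q.P.module_axioms)
    show "linear_map K (piece Q n) (piece Q (n - 1)) (bdry Q n)"
      unfolding linear_map_def
      by (auto simp: Q_elts bdry_cl goodD wf_good D_simps simp flip: cl_Ad cl_Sm) (auto simp: D_def goodD wf_good)
    fix x assume "x \<in> elts Q n"
    then obtain s where s: "x = cl n s" "eqv n s s" by (auto simp: Q_elts)
    then have "bdry Q n x = cl (n - 1) (dt s n)" "eqv (n - 1) (dt s n) (dt s n)"
      by (simp_all add: bdry_cl D_def goodD wf_good)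
    then show "bdry Q (n - 1) (bdry Q n x) = \<zero>\<^bsub>piece Q (n - 1 - 1)\<^esub>"
      using goodD(4)[OF wf_good[OF s(2)]] by (simp add: bdry_cl D_def)
  qed
  show "\<forall>i j. \<forall>a\<in>elts Q i. \<forall>b\<in>elts Q j. bdry Q (i + j) (gmult Q i j a b) =
      gmult Q (i - 1) j (bdry Q i a) b \<oplus>\<^bsub>piece Q (i + j - 1)\<^esub>
      sign K i \<odot>\<^bsub>piece Q (i + j - 1)\<^esub> gmult Q i (j - 1) a (bdry Q j b)"
  proof (intro allI ballI)
    fix i j a b assume "a \<in> elts Q i" "b \<in> elts Q j"
    then obtain s t where *: "a = cl i s" "b = cl j t" "eqv i s s" "eqv j t t" by (auto simp: Q_elts)
    then show "bdry Q (i + j) (gmult Q i j a b) =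
      gmult Q (i - 1) j (bdry Q i a) b \<oplus>\<^bsub>piece Q (i + j - 1)\<^esub>
      sign K i \<odot>\<^bsub>piece Q (i + j - 1)\<^esub> gmult Q i (j - 1) a (bdry Q j b)"
      using bdry_cl[of "i + j" "Ml i j s t"] D_Ml[of i s j t "i + j"] by (simp add: bdry_cl wf_good cl_Ml)
  qed
qed

sublocale Q: dgalg K Q
  by unfold_locales (rule Q_dga)

end

context free_extension begin

text \<open>Evaluation of terms. A map out of \<open>Q\<close> is determined by a map on \<open>S\<close> and, recursively, a value
  \<open>G n b z x\<close> for each generator \<open>Gn b z\<close> whose boundary is the given value \<open>x\<close> of \<open>z\<close>. The relation
  \<open>R\<close> carries what the choice of that value has to know about \<open>z\<close>.\<close>

lemma eval_sound:
  fixes E :: "('k, 'b) dga"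
  assumes u: "dgalg_hom K S E u"
    and R_El: "\<And>n a. a \<in> elts S n \<Longrightarrow> R n (El a) (u n a)"
    and R_Zr: "\<And>n. R n Zr \<zero>\<^bsub>piece E n\<^esub>" and R_On: "R 0 On (gone E)"
    and R_Ad: "\<And>n s t x y. eqv n s s \<Longrightarrow> eqv n t t \<Longrightarrow> x \<in> elts E n \<Longrightarrow> y \<in> elts E n \<Longrightarrow> R n s x \<Longrightarrow> R n t y \<Longrightarrow>
      R n (Ad s t) (x \<oplus>\<^bsub>piece E n\<^esub> y)"
    and R_Sm: "\<And>n c s x. c \<in> carrier K \<Longrightarrow> eqv n s s \<Longrightarrow> x \<in> elts E n \<Longrightarrow> R n s x \<Longrightarrow>
      R n (Sm (\<iota> c) s) (c \<odot>\<^bsub>piece E n\<^esub> x)"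
    and R_Ml: "\<And>i j n s t x y. eqv i s s \<Longrightarrow> eqv j t t \<Longrightarrow> x \<in> elts E i \<Longrightarrow> y \<in> elts E j \<Longrightarrow> R i s x \<Longrightarrow> R j t y \<Longrightarrow>
      i + j = n \<Longrightarrow> R n (Ml i j s t) (gmult E i j x y)"
    and G: "\<And>n b z x. eqv n (Gn b z) (Gn b z) \<Longrightarrow> eqv (n - 1) z z \<Longrightarrow> b \<in> elts A n \<Longrightarrow> bdry A n b = ph z (n - 1) \<Longrightarrow>
      x \<in> elts E (n - 1) \<Longrightarrow> bdry E (n - 1) x = \<zero>\<^bsub>piece E (n - 2)\<^esub> \<Longrightarrow> R (n - 1) z x \<Longrightarrow>
      G n b z x \<in> elts E n \<and> bdry E n (G n b z x) = x \<and> R n (Gn b z) (G n b z x)"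
    and st: "eqv n s t"
  defines "ev \<equiv> eval_tm E \<kappa> u G"
  shows "ev s n = ev t n" "ev s n \<in> elts E n" "ev (dt s n) (n - 1) = bdry E n (ev s n)" "R n s (ev s n)"
proof -
  interpret u: dgalg_hom K S E u by fact
  define ok where "ok n s \<longleftrightarrow> eqv n s s \<and> ev s n \<in> elts E n \<and> ev (dt s n) (n - 1) = bdry E n (ev s n) \<and> R n s (ev s n)" for n s
  have ev [simp]: "ev (El a) n = u n a" "ev (Gn b z) n = G n b z (ev z (n - 1))" "ev Zr n = \<zero>\<^bsub>piece E n\<^esub>" "ev On n = gone E"
     "ev (Ad s t) n = ev s n \<oplus>\<^bsub>piece E n\<^esub> ev t n" "ev (Sm c t) n = \<kappa> c \<odot>\<^bsub>piece E n\<^esub> ev t n"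
     "ev (Ml i j s t) n = gmult E i j (ev s i) (ev t j)" for a b z s t c i j n
    by (simp_all add: ev_def)
  have okD: "eqv n s s" "ev s n \<in> elts E n" "ev (dt s n) (n - 1) = bdry E n (ev s n)" "R n s (ev s n)" if "ok n s" for n s
    using that by (simp_all add: ok_def)
  have ok_El: "ok n (El a)" if "a \<in> elts S n" for n a using that by (simp add: ok_def R_El u.hom_bdry)
  have ok_Zr: "ok n Zr" for n by (simp add: ok_def R_Zr)
  have ok_On: "ok 0 On" by (simp add: ok_def R_On u.B.bdry_one)
  have ok_Ad: "ok n (Ad s t)" if "ok n s" "ok n t" for n s t
    using okD[OF that(1)] okD[OF that(2)] by (simp add: ok_def u.B.bdry_add R_Ad)
  have ok_Sm: "ok n (Sm (\<iota> c) s)" if "c \<in> carrier K" "ok n s" for n c s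
    using okD[OF that(2)] that(1) by (simp add: ok_def u.B.bdry_smult R_Sm)
  have ok_Ml: "ok n (Ml i j s t)" if "ok i s" "ok j t" "i + j = n" for i j n s t
    using okD[OF that(1)] okD[OF that(2)] that(3) by (simp add: ok_def u.B.leibniz R_Ml)
  note ok = ok_El ok_Zr ok_On ok_Ad ok_Sm ok_Ml
  have "eqv n s t \<Longrightarrow> ok n s \<and> ok n t \<and> ev s n = ev t n" for n s t
  proof (induction rule: eqv.induct)
    case (Gn b n z)
    have x: "ev z (n - 1) \<in> elts E (n - 1)" "R (n - 1) z (ev z (n - 1))" using Gn by (auto dest: okD)
    have "bdry E (n - 1) (ev z (n - 1)) = \<zero>\<^bsub>piece E (n - 2)\<^esub>"
      using Gn okD(3)[of "n - 1" z] by simp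
    note g = G[OF eqv.Gn[OF Gn(1-4)] Gn(2,1,4) x(1) this x(2)]
    have "ok n (Gn b z)" unfolding ok_def ev using g eqv.Gn[OF Gn(1-4)] by simp
    then show ?case by simp
  next
    case (ml_assoc i s j t l r m k n)
    then show ?case by (simp add: ok okD u.B.mult_assoc)
  next
    case (El_ml a i b j n)
    then show ?case by (simp add: ok okD u.hom_mult)
  next
    case (ml_add_r i s j t r n)
    then show ?case using u.B.mult_add_right[of "ev s i" i "ev t j" j "ev r j"] by (simp add: ok okD)
  next
    case (ml_add_l i s t j r n)
    then show ?case using u.B.mult_add_left[of "ev s i" i "ev t i" "ev r j" j] by (simp add: ok okD)
  next
    case (ml_sm_r c i s j t n)
    then show ?case using u.B.mult_smult_right[of c "ev s i" i "ev t j" j] by (simp add: ok okD)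
  next
    case (ml_sm_l c i s j t n)
    then show ?case using u.B.mult_smult_left[of c "ev s i" i "ev t j" j] by (simp add: ok okD)
  qed (auto simp: ok okD u.B.P.a_ac u.B.P.smult_l_distr u.B.P.smult_r_distr u.B.P.smult_assoc1 u.hom_add u.hom_smult)
  from this[OF st] have *: "ok n s" "ev s n = ev t n" by auto
  show "ev s n = ev t n" "ev s n \<in> elts E n" "ev (dt s n) (n - 1) = bdry E n (ev s n)" "R n s (ev s n)"
    by (fact *(2), fact okD(2)[OF *(1)], fact okD(3)[OF *(1)], fact okD(4)[OF *(1)])
qed

lemma eval_hom:
  fixes E :: "('k, 'b) dga"
  assumes "dgalg K E"
    and eq: "\<And>n s t. eqv n s t \<Longrightarrow> eval_tm E \<kappa> u G s n = eval_tm E \<kappa> u G t n"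
    and mem: "\<And>n s. eqv n s s \<Longrightarrow> eval_tm E \<kappa> u G s n \<in> elts E n"
    and d: "\<And>n s. eqv n s s \<Longrightarrow> eval_tm E \<kappa> u G (dt s n) (n - 1) = bdry E n (eval_tm E \<kappa> u G s n)"
  shows "dgalg_hom K Q E (\<lambda>n x. eval_tm E \<kappa> u G (dec x) n)"
    and "\<And>n s. eqv n s s \<Longrightarrow> eval_tm E \<kappa> u G (dec (cl n s)) n = eval_tm E \<kappa> u G s n"
proof -
  interpret E: dgalg K E by fact
  show e: "\<And>n s. eqv n s s \<Longrightarrow> eval_tm E \<kappa> u G (dec (cl n s)) n = eval_tm E \<kappa> u G s n"
    using eq[OF dec_cl] by simp
  have D: "eval_tm E \<kappa> u G (dec (D n s)) (n - 1) = bdry E n (eval_tm E \<kappa> u G s n)" if "eqv n s s" for n s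
    using e[of "n - 1" "dt s n"] d[OF that] goodD(2)[OF wf_good[OF that]] by (simp add: D_def)
  have "dga_hom K Q E (\<lambda>n x. eval_tm E \<kappa> u G (dec x) n)"
    unfolding dga_hom_def complex_hom_def linear_map_def
    using e[of 0 On]
    by (auto simp: Q_elts e mem bdry_cl D cl_On simp flip: cl_Ad cl_Sm cl_Ml)
  then show "dgalg_hom K Q E (\<lambda>n x. eval_tm E \<kappa> u G (dec x) n)"
    by unfold_locales (auto simp: Q_dga E.is_dga)
qed

lemma ph_sound: "eqv n s t \<Longrightarrow> ph s n = ph t n" "eqv n s s \<Longrightarrow> ph s n \<in> elts A n"
  "eqv n s s \<Longrightarrow> ph (dt s n) (n - 1) = bdry A n (ph s n)"
proof -
  note * = eval_sound[OF f.dgalg_hom_axioms, of "\<lambda>n s x. x = ph s n" "\<lambda>n b z x. b"]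
  show "eqv n s t \<Longrightarrow> ph s n = ph t n" by (rule *(1)) auto
  show "eqv n s s \<Longrightarrow> ph s n \<in> elts A n" by (rule *(2)) auto
  show "eqv n s s \<Longrightarrow> ph (dt s n) (n - 1) = bdry A n (ph s n)" by (rule *(3)) auto
qed

definition incl :: "int \<Rightarrow> 'a \<Rightarrow> 'a" where
  "incl n a = cl n (El a)"

definition proj :: "int \<Rightarrow> 'a \<Rightarrow> 'a" where
  "proj n x = ph (dec x) n"

lemma proj_hom: "dgalg_hom K Q A proj" and proj_cl: "eqv n s s \<Longrightarrow> proj n (cl n s) = ph s n"
  using eval_hom[OF f.B.dgalg_axioms ph_sound] by (simp_all add: proj_def[abs_def])

lemma incl_hom: "dgalg_hom K S Q incl"
proof -
  have "dga_hom K S Q incl"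
    unfolding dga_hom_def complex_hom_def linear_map_def incl_def
    using cl_eq[OF eqv.El_add] cl_eq[OF eqv.El_sm] cl_eq[OF eqv.El_ml] cl_eq[OF eqv.El_one]
    by (auto simp: bdry_cl D_def cl_simps)
  then show ?thesis by unfold_locales (auto simp: Q_dga f.A.is_dga)
qed

lemma proj_incl: "a \<in> elts S n \<Longrightarrow> proj n (incl n a) = f n a"
  by (simp add: incl_def proj_cl)

lemma Gn_wf:
  assumes "eqv n z z" "D n z = \<zero>\<^bsub>piece Q (n - 1)\<^esub>" "b \<in> elts A (n + 1)" "bdry A (n + 1) b = ph z n"
  shows "eqv (n + 1) (Gn b z) (Gn b z)"
proof (rule eqv.Gn)
  have "cl (n - 1) (dt z n) = cl (n - 1) Zr" using assms(2) by (simp add: D_def cl_Zr)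
  then show "eqv (n + 1 - 2) (dt z (n + 1 - 1)) Zr"
    using cl_iff[of "n - 1" "dt z n" Zr] goodD(2)[OF wf_good[OF assms(1)]] by simp
qed (use assms in auto)

text \<open>A cycle \<open>c\<close> of \<open>Q\<close> whose image is the boundary of \<open>b\<close> is represented by a term \<open>z\<close>, and the
  generator \<open>Gn b z\<close> solves the lifting problem.\<close>

lemma proj_acyclic_fibration: "acyclic_fibration Q A proj"
  unfolding acyclic_fibration_def
proof (intro allI ballI impI)
  fix n c b assume c: "c \<in> elts Q n" "bdry Q n c = \<zero>\<^bsub>piece Q (n - 1)\<^esub>" and b: "b \<in> elts A (n + 1)" "bdry A (n + 1) b = proj n c"
  obtain z where z: "c = cl n z" "eqv n z z" using c(1) by (auto simp: Q_elts)
  have "D n z = \<zero>\<^bsub>piece Q (n - 1)\<^esub>" using bdry_cl[OF z(2)] c(2) z(1) by simp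
  then have wf: "eqv (n + 1) (Gn b z) (Gn b z)"
    using Gn_wf[OF z(2)] b z by (simp add: proj_cl)
  have "bdry Q (n + 1) (cl (n + 1) (Gn b z)) = c" using bdry_cl[OF wf] z(1) by (simp add: D_def)
  moreover have "proj (n + 1) (cl (n + 1) (Gn b z)) = b" using proj_cl[OF wf] by simp
  ultimately show "\<exists>c'\<in>elts Q (n + 1). bdry Q (n + 1) c' = c \<and> proj (n + 1) c' = b"
    using cl_mem[OF wf] by blast
qed

text \<open>On generators the lift is chosen recursively: if \<open>x\<close> is the value at \<open>z\<close>, the acyclic
  fibration provides an element with boundary \<open>x\<close> above the image of \<open>Gn b z\<close>. The relation \<open>R\<close> of
  the evaluation records that values lie above the given map \<open>v\<close>.\<close>

lemma incl_lifting:
  fixes E :: "('k, 'b) dga" and B :: "('k, 'c) dga"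
  assumes p: "dgalg_hom K E B p" "acyclic_fibration E B p"
    and u: "dgalg_hom K S E u" and v: "dgalg_hom K Q B v"
    and eq: "\<And>n a. a \<in> elts S n \<Longrightarrow> p n (u n a) = v n (incl n a)"
  shows "\<exists>h. dgalg_hom K Q E h \<and> (\<forall>n. \<forall>a\<in>elts S n. h n (incl n a) = u n a) \<and>
    (\<forall>n. \<forall>x\<in>elts Q n. p n (h n x) = v n x)"
proof -
  interpret p: dgalg_hom K E B p by fact
  interpret u: dgalg_hom K S E u by fact
  interpret v: dgalg_hom K Q B v by fact
  define G where "G n b z x = (SOME e. e \<in> elts E n \<and> bdry E n e = x \<and> p n e = v n (cl n (Gn b z)))" for n b z x
  define R where "R n s x \<longleftrightarrow> p n x = v n (cl n s)" for n s x
  have G: "G n b z x \<in> elts E n \<and> bdry E n (G n b z x) = x \<and> R n (Gn b z) (G n b z x)"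
    if wf: "eqv n (Gn b z) (Gn b z)" and x: "x \<in> elts E (n - 1)" "bdry E (n - 1) x = \<zero>\<^bsub>piece E (n - 2)\<^esub>" "R (n - 1) z x"
    for n b z x
  proof -
    have "bdry B n (v n (cl n (Gn b z))) = p (n - 1) x"
      using v.hom_bdry[OF cl_mem[OF wf], of "n - 1"] bdry_cl[OF wf] x(3) by (simp add: D_def R_def)
    then have "\<exists>e. e \<in> elts E n \<and> bdry E n e = x \<and> p n e = v n (cl n (Gn b z))"
      using acyclic_fibrationD[OF p(2) x(1), of "v n (cl n (Gn b z))"] x(2) cl_mem[OF wf] by auto
    from someI_ex[OF this] show ?thesis unfolding G_def R_def .
  qed
  have R: "R n (El a) (u n a)" if "a \<in> elts S n" for n a
    using eq[OF that] by (simp add: R_def incl_def)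
  have R0: "R n Zr \<zero>\<^bsub>piece E n\<^esub>" "R 0 On (gone E)" for n by (simp_all add: R_def cl_simps)
  have R1: "R n (Ad s t) (x \<oplus>\<^bsub>piece E n\<^esub> y)" if "eqv n s s" "eqv n t t" "x \<in> elts E n" "y \<in> elts E n" "R n s x" "R n t y" for n s t x y
    using that by (simp add: R_def cl_simps p.hom_add v.hom_add)
  have R2: "R n (Sm (\<iota> c) s) (c \<odot>\<^bsub>piece E n\<^esub> x)" if "c \<in> carrier K" "eqv n s s" "x \<in> elts E n" "R n s x" for n c s x
    using that by (simp add: R_def cl_simps p.hom_smult v.hom_smult)
  have R3: "R n (Ml i j s t) (gmult E i j x y)"
    if "eqv i s s" "eqv j t t" "x \<in> elts E i" "y \<in> elts E j" "R i s x" "R j t y" "i + j = n" for i j n s t x y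
    using that by (simp add: R_def cl_Ml p.hom_mult v.hom_mult)
  let ?e = "eval_tm E \<kappa> u G"
  have 1: "?e s n = ?e t n" if "eqv n s t" for n s t
    by (rule eval_sound(1)[where R = R and G = G, OF u]; (fact that | (rule R R0 R1 R2 R3 G; assumption)))
  have 2: "?e s n \<in> elts E n" if "eqv n s s" for n s
    by (rule eval_sound(2)[where R = R and G = G, OF u]; (fact that | (rule R R0 R1 R2 R3 G; assumption)))
  have 3: "?e (dt s n) (n - 1) = bdry E n (?e s n)" if "eqv n s s" for n s
    by (rule eval_sound(3)[where R = R and G = G, OF u]; (fact that | (rule R R0 R1 R2 R3 G; assumption)))
  have 4: "R n s (?e s n)" if "eqv n s s" for n s
    by (rule eval_sound(4)[where R = R and G = G, OF u]; (fact that | (rule R R0 R1 R2 R3 G; assumption)))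
  note h = eval_hom[OF p.A.dgalg_axioms 1 2 3]
  have "?e (dec (incl n a)) n = u n a" if "a \<in> elts S n" for n a
    using h(2)[of n "El a"] that by (simp add: incl_def)
  moreover have "p n (?e (dec x) n) = v n x" if "x \<in> elts Q n" for n x
    using that h(2) 4 by (auto simp: Q_elts R_def)
  ultimately show ?thesis using h(1) by blast
qed

end

section \<open>Polynomial paths\<close>

text \<open>The square-zero extension of a DG algebra by its shift, twisted by a derivation of degree
  zero: elements are written \<open>a + dt a'\<close>, and the differential is \<open>d a + dt (D a - d a')\<close>.\<close>

definition de_rham :: "'k ring \<Rightarrow> ('k, 'a) dga \<Rightarrow> (int \<Rightarrow> 'a \<Rightarrow> 'a) \<Rightarrow> ('k, 'a \<times> 'a) dga" where
  "de_rham K R D = \<lparr>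
     piece = (\<lambda>n. \<lparr>carrier = elts R n \<times> elts R (n + 1), mult = undefined, one = undefined,
        zero = (\<zero>\<^bsub>piece R n\<^esub>, \<zero>\<^bsub>piece R (n + 1)\<^esub>),
        add = (\<lambda>u v. (fst u \<oplus>\<^bsub>piece R n\<^esub> fst v, snd u \<oplus>\<^bsub>piece R (n + 1)\<^esub> snd v)),
        smult = (\<lambda>c u. (c \<odot>\<^bsub>piece R n\<^esub> fst u, c \<odot>\<^bsub>piece R (n + 1)\<^esub> snd u))\<rparr>),
     bdry = (\<lambda>n u. (bdry R n (fst u), D n (fst u) \<ominus>\<^bsub>piece R n\<^esub> bdry R (n + 1) (snd u))),
     gmult = (\<lambda>i j u v. (gmult R i j (fst u) (fst v),
        gmult R (i + 1) j (snd u) (fst v) \<oplus>\<^bsub>piece R (i + j + 1)\<^esub>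
          sign K i \<odot>\<^bsub>piece R (i + j + 1)\<^esub> gmult R i (j + 1) (fst u) (snd v))),
     gone = (gone R, \<zero>\<^bsub>piece R 1\<^esub>)\<rparr>"

locale derivation = dgalg K R for K :: "'k ring" and R :: "('k, 'a) dga" +
  fixes D :: "int \<Rightarrow> 'a \<Rightarrow> 'a"
  assumes D_closed [simp]: "a \<in> elts R n \<Longrightarrow> D n a \<in> elts R n"
    and D_add: "a \<in> elts R n \<Longrightarrow> b \<in> elts R n \<Longrightarrow> D n (a \<oplus>\<^bsub>piece R n\<^esub> b) = D n a \<oplus>\<^bsub>piece R n\<^esub> D n b"
    and D_smult: "c \<in> carrier K \<Longrightarrow> a \<in> elts R n \<Longrightarrow> D n (c \<odot>\<^bsub>piece R n\<^esub> a) = c \<odot>\<^bsub>piece R n\<^esub> D n a"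
    and D_bdry: "a \<in> elts R n \<Longrightarrow> D (n - 1) (bdry R n a) = bdry R n (D n a)"
    and D_mult: "a \<in> elts R i \<Longrightarrow> b \<in> elts R j \<Longrightarrow> D (i + j) (gmult R i j a b) =
       gmult R i j (D i a) b \<oplus>\<^bsub>piece R (i + j)\<^esub> gmult R i j a (D j b)"
begin

abbreviation E where "E \<equiv> de_rham K R D"

lemma E_simps [simp]:
  "elts E n = elts R n \<times> elts R (n + 1)" "\<zero>\<^bsub>piece E n\<^esub> = (\<zero>\<^bsub>piece R n\<^esub>, \<zero>\<^bsub>piece R (n + 1)\<^esub>)"
  "(a, a') \<oplus>\<^bsub>piece E n\<^esub> (b, b') = (a \<oplus>\<^bsub>piece R n\<^esub> b, a' \<oplus>\<^bsub>piece R (n + 1)\<^esub> b')"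
  "c \<odot>\<^bsub>piece E n\<^esub> (a, a') = (c \<odot>\<^bsub>piece R n\<^esub> a, c \<odot>\<^bsub>piece R (n + 1)\<^esub> a')"
  "bdry E n (a, a') = (bdry R n a, D n a \<ominus>\<^bsub>piece R n\<^esub> bdry R (n + 1) a')"
  "gmult E i j (a, a') (b, b') = (gmult R i j a b, gmult R (i + 1) j a' b \<oplus>\<^bsub>piece R (i + j + 1)\<^esub>
          sign K i \<odot>\<^bsub>piece R (i + j + 1)\<^esub> gmult R i (j + 1) a b')"
  "gone E = (gone R, \<zero>\<^bsub>piece R 1\<^esub>)"
  by (simp_all add: de_rham_def)

lemma bdry_up [simp]: "a \<in> elts R (n + 1) \<Longrightarrow> bdry R (n + 1) a \<in> elts R n"
  by simp

lemma E_galg: "graded_algebra K E"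
proof -
  have mod: "module K (piece E n)" for n
  proof (rule moduleI[OF P.R.is_cring])
    show "abelian_group (piece E n)"
    proof (rule abelian_groupI)
      fix u assume "u \<in> elts E n"
      then show "\<exists>w\<in>elts E n. w \<oplus>\<^bsub>piece E n\<^esub> u = \<zero>\<^bsub>piece E n\<^esub>"
        by (intro bexI[of _ "(\<ominus>\<^bsub>piece R n\<^esub> fst u, \<ominus>\<^bsub>piece R (n + 1)\<^esub> snd u)"]) (auto simp: P.l_neg)
    qed (auto simp: P.a_ac)
  qed (auto simp: P.smult_l_distr P.smult_r_distr P.smult_assoc1)
  have comm: "c \<odot>\<^bsub>piece R n\<^esub> (d \<odot>\<^bsub>piece R n\<^esub> x) = d \<odot>\<^bsub>piece R n\<^esub> (c \<odot>\<^bsub>piece R n\<^esub> x)"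
    if "c \<in> carrier K" "d \<in> carrier K" "x \<in> elts R n" for c d x n
    using that by (simp add: P.smult_assoc1[symmetric] P.R.m_comm)
  have ij: "i + 1 + j = i + j + 1" "i + (j + 1) = i + j + 1" for i j :: int by simp_all
  show ?thesis
  proof (rule graded_algebraI[OF mod])
    fix i j a b assume "a \<in> elts E i" "b \<in> elts E j"
    then show "gmult E i j a b \<in> elts E (i + j)" by auto
  next
    fix i j a b c assume "a \<in> elts E i" "b \<in> elts E j" "c \<in> elts E j"
    then show "gmult E i j a (b \<oplus>\<^bsub>piece E j\<^esub> c) = gmult E i j a b \<oplus>\<^bsub>piece E (i + j)\<^esub> gmult E i j a c"
      by (auto simp: mult_add_right ij P.smult_r_distr P.a_ac)
  next
    fix i j a b c assume "a \<in> elts E i" "b \<in> elts E i" "c \<in> elts E j"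
    then show "gmult E i j (a \<oplus>\<^bsub>piece E i\<^esub> b) c = gmult E i j a c \<oplus>\<^bsub>piece E (i + j)\<^esub> gmult E i j b c"
      by (auto simp: mult_add_left ij P.smult_r_distr P.a_ac)
  next
    fix i j a b c assume "c \<in> carrier K" "a \<in> elts E i" "b \<in> elts E j"
    then show "gmult E i j a (c \<odot>\<^bsub>piece E j\<^esub> b) = c \<odot>\<^bsub>piece E (i + j)\<^esub> gmult E i j a b"
      "gmult E i j (c \<odot>\<^bsub>piece E i\<^esub> a) b = c \<odot>\<^bsub>piece E (i + j)\<^esub> gmult E i j a b"
      by (auto simp: mult_smult_right mult_smult_left ij P.smult_r_distr comm)
  next
    fix i j l a b c assume "a \<in> elts E i" "b \<in> elts E j" "c \<in> elts E l"
    then obtain x x' y y' z z' where *: "a = (x, x')" "b = (y, y')" "c = (z, z')"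
      "x \<in> elts R i" "y \<in> elts R j" "z \<in> elts R l" "x' \<in> elts R (i + 1)" "y' \<in> elts R (j + 1)" "z' \<in> elts R (l + 1)" by auto
    show "gmult E (i + j) l (gmult E i j a b) c = gmult E i (j + l) a (gmult E j l b c)"
      using deriv_assoc[OF *(4-9)] mult_assoc[OF *(4-6) HOL.refl HOL.refl] unfolding *(1-3)
      by (simp add: add.assoc)
  qed (auto simp: sign_smult add.commute)
qed

lemma E_dga: "is_dga K E"
  unfolding is_dga_iff
proof (intro conjI E_galg)
  interpret E: galg K E by unfold_locales (rule E_galg)
  show "is_complex K E"
    unfolding is_complex_def
  proof (intro allI conjI ballI)
    fix n
    show "module K (piece E n)" by (rule E.P.module_axioms)
    show "linear_map K (piece E n) (piece E (n - 1)) (bdry E n)"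
      unfolding linear_map_def
      by (auto simp: bdry_add D_add bdry_smult D_smult P.smult_r_distr P.smult_r_minus P.minus_eq P.minus_add P.a_ac)
    fix x assume "x \<in> elts E n"
    then obtain a b where *: "x = (a, b)" "a \<in> elts R n" "b \<in> elts R (n + 1)" by auto
    then show "bdry E (n - 1) (bdry E n x) = \<zero>\<^bsub>piece E (n - 1 - 1)\<^esub>"
      using bdry_bdry[of a n "n - 1" "n - 2"] bdry_bdry[of b "n + 1" n "n - 1"] bdry_minus[of "D n a" n "bdry R (n + 1) b"]
      by (simp add: D_bdry)
  qed
  show "\<forall>i j. \<forall>a\<in>elts E i. \<forall>b\<in>elts E j. bdry E (i + j) (gmult E i j a b) =
      gmult E (i - 1) j (bdry E i a) b \<oplus>\<^bsub>piece E (i + j - 1)\<^esub>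
      sign K i \<odot>\<^bsub>piece E (i + j - 1)\<^esub> gmult E i (j - 1) a (bdry E j b)"
  proof (intro allI ballI)
    fix i j u v assume "u \<in> elts E i" "v \<in> elts E j"
    then obtain a a' b b' where *: "u = (a, a')" "v = (b, b')" "a \<in> elts R i" "b \<in> elts R j"
      "a' \<in> elts R (i + 1)" "b' \<in> elts R (j + 1)" by auto
    let ?n = "i + j"
    define p q r s t w where "p = gmult R i j (D i a) b" and "q = gmult R i j a (D j b)"
      and "r = gmult R i j (bdry R (i + 1) a') b" and "s = gmult R (i + 1) (j - 1) a' (bdry R j b)"
      and "t = gmult R (i - 1) (j + 1) (bdry R i a) b'" and "w = gmult R i j a (bdry R (j + 1) b')"
    have m: "p \<in> elts R ?n" "q \<in> elts R ?n" "r \<in> elts R ?n" "s \<in> elts R ?n" "t \<in> elts R ?n" "w \<in> elts R ?n"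
      using * by (simp_all add: p_def q_def r_def s_def t_def w_def)
    have "bdry R (?n + 1) (gmult R (i + 1) j a' b) = r \<oplus>\<^bsub>piece R ?n\<^esub> sign K (i + 1) \<odot>\<^bsub>piece R ?n\<^esub> s"
      using leibniz[OF *(5,4), of "?n + 1"] by (simp add: r_def s_def)
    moreover have "bdry R (?n + 1) (gmult R i (j + 1) a b') = t \<oplus>\<^bsub>piece R ?n\<^esub> sign K i \<odot>\<^bsub>piece R ?n\<^esub> w"
      using leibniz[OF *(3,6), of "?n + 1"] by (simp add: t_def w_def)
    moreover have "gmult R (i + 1) j a' b \<in> elts R (?n + 1)" "gmult R i (j + 1) a b' \<in> elts R (?n + 1)"
      using * by simp_all
    ultimately have L: "bdry E ?n (gmult E i j u v) = (bdry R ?n (gmult R i j a b), (p \<oplus>\<^bsub>piece R ?n\<^esub> q) \<ominus>\<^bsub>piece R ?n\<^esub>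
       ((r \<oplus>\<^bsub>piece R ?n\<^esub> sign K (i + 1) \<odot>\<^bsub>piece R ?n\<^esub> s) \<oplus>\<^bsub>piece R ?n\<^esub>
         sign K i \<odot>\<^bsub>piece R ?n\<^esub> (t \<oplus>\<^bsub>piece R ?n\<^esub> sign K i \<odot>\<^bsub>piece R ?n\<^esub> w)))"
      using *(3-6) D_mult[OF *(3,4)] unfolding *(1,2) by (simp add: bdry_add bdry_smult p_def q_def)
    have "gmult R i j (D i a \<ominus>\<^bsub>piece R i\<^esub> bdry R (i + 1) a') b = p \<ominus>\<^bsub>piece R ?n\<^esub> r"
      "gmult R i j a (D j b \<ominus>\<^bsub>piece R j\<^esub> bdry R (j + 1) b') = q \<ominus>\<^bsub>piece R ?n\<^esub> w"
      using *(3-6) by (simp_all add: P.minus_eq mult_add_left mult_add_right mult_neg_left mult_neg_right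
        p_def q_def r_def w_def)
    then have Rt: "gmult E (i - 1) j (bdry E i u) v = (gmult R (i - 1) j (bdry R i a) b,
        (p \<ominus>\<^bsub>piece R ?n\<^esub> r) \<oplus>\<^bsub>piece R ?n\<^esub> sign K (i - 1) \<odot>\<^bsub>piece R ?n\<^esub> t)"
      "gmult E i (j - 1) u (bdry E j v) = (gmult R i (j - 1) a (bdry R j b),
        s \<oplus>\<^bsub>piece R ?n\<^esub> sign K i \<odot>\<^bsub>piece R ?n\<^esub> (q \<ominus>\<^bsub>piece R ?n\<^esub> w))"
      unfolding *(1,2) by (simp_all add: s_def t_def diff_add_eq)
    have "(p \<oplus>\<^bsub>piece R ?n\<^esub> q) \<ominus>\<^bsub>piece R ?n\<^esub>
       ((r \<oplus>\<^bsub>piece R ?n\<^esub> sign K (i + 1) \<odot>\<^bsub>piece R ?n\<^esub> s) \<oplus>\<^bsub>piece R ?n\<^esub>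
         sign K i \<odot>\<^bsub>piece R ?n\<^esub> (t \<oplus>\<^bsub>piece R ?n\<^esub> sign K i \<odot>\<^bsub>piece R ?n\<^esub> w)) =
      ((p \<ominus>\<^bsub>piece R ?n\<^esub> r) \<oplus>\<^bsub>piece R ?n\<^esub> sign K (i - 1) \<odot>\<^bsub>piece R ?n\<^esub> t) \<oplus>\<^bsub>piece R ?n\<^esub>
       sign K i \<odot>\<^bsub>piece R ?n\<^esub> (s \<oplus>\<^bsub>piece R ?n\<^esub> sign K i \<odot>\<^bsub>piece R ?n\<^esub> (q \<ominus>\<^bsub>piece R ?n\<^esub> w))"
      using m by (cases "even i") (simp_all add: sign_smult P.minus_eq P.minus_add P.minus_minus P.a_ac)
    then show "bdry E (i + j) (gmult E i j u v) =
      gmult E (i - 1) j (bdry E i u) v \<oplus>\<^bsub>piece E (i + j - 1)\<^esub>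
      sign K i \<odot>\<^bsub>piece E (i + j - 1)\<^esub> gmult E i (j - 1) u (bdry E j v)"
      unfolding L Rt using leibniz[OF *(3,4) HOL.refl] by simp
  qed
qed

end

locale char_zero_field = field K for K :: "'k ring" +
  assumes char_zero: "\<And>n::nat. n > 0 \<Longrightarrow> [n] \<cdot>\<^bsub>K\<^esub> \<one>\<^bsub>K\<^esub> \<noteq> \<zero>\<^bsub>K\<^esub>"
begin

definition \<nu> :: "nat \<Rightarrow> 'k" where "\<nu> n = [n] \<cdot>\<^bsub>K\<^esub> \<one>\<^bsub>K\<^esub>"
definition \<nu>inv :: "nat \<Rightarrow> 'k" where "\<nu>inv n = inv\<^bsub>K\<^esub> \<nu> n"

lemma \<nu>_closed [simp]: "\<nu> n \<in> carrier K"
  by (simp add: \<nu>_def)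

lemma \<nu>_0 [simp]: "\<nu> 0 = \<zero>\<^bsub>K\<^esub>" and \<nu>_1 [simp]: "\<nu> (Suc 0) = \<one>\<^bsub>K\<^esub>"
  by (simp_all add: \<nu>_def)

lemma \<nu>_add: "\<nu> (m + n) = \<nu> m \<oplus>\<^bsub>K\<^esub> \<nu> n"
  by (simp add: \<nu>_def add.nat_pow_mult)

lemma \<nu>_nonzero: "n > 0 \<Longrightarrow> \<nu> n \<noteq> \<zero>\<^bsub>K\<^esub>"
  using char_zero by (simp add: \<nu>_def)

lemma \<nu>_unit: "n > 0 \<Longrightarrow> \<nu> n \<in> Units K"
  using \<nu>_nonzero by (simp add: field_Units)

lemma \<nu>inv_closed [simp]: "n > 0 \<Longrightarrow> \<nu>inv n \<in> carrier K"
  using Units_inv_closed[OF \<nu>_unit] by (simp add: \<nu>inv_def)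

lemma \<nu>_\<nu>inv: "n > 0 \<Longrightarrow> \<nu> n \<otimes>\<^bsub>K\<^esub> \<nu>inv n = \<one>\<^bsub>K\<^esub>" and \<nu>inv_\<nu>: "n > 0 \<Longrightarrow> \<nu>inv n \<otimes>\<^bsub>K\<^esub> \<nu> n = \<one>\<^bsub>K\<^esub>"
  using Units_r_inv[OF \<nu>_unit] Units_l_inv[OF \<nu>_unit] by (simp_all add: \<nu>inv_def)

lemma \<nu>_inj: "m < n \<Longrightarrow> \<nu> m \<noteq> \<nu> n"
  using \<nu>_add[of m "n - m"] \<nu>_nonzero[of "n - m"] add.r_cancel_one[of "\<nu> m" "\<nu> (n - m)"]
    add.l_cancel_one[of "\<nu> m" "\<nu> (n - m)"] by auto

lemma \<nu>_2_pow: "\<nu> 2 [^]\<^bsub>K\<^esub> i = \<nu> (2 ^ i)"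
proof (induction i)
  case (Suc i)
  have "\<nu> 2 = \<one>\<^bsub>K\<^esub> \<oplus>\<^bsub>K\<^esub> \<one>\<^bsub>K\<^esub>" using \<nu>_add[of 1 1] by (simp add: numeral_2_eq_2)
  then have "\<nu> 2 [^]\<^bsub>K\<^esub> Suc i = \<nu> (2 ^ i) \<oplus>\<^bsub>K\<^esub> \<nu> (2 ^ i)" using Suc by (simp add: r_distr)
  also have "\<dots> = \<nu> (2 ^ Suc i)" by (simp add: \<nu>_add[symmetric] mult_2)
  finally show ?case .
qed simp

lemma pow_diff_unit: "i < N \<Longrightarrow> \<nu> 2 [^]\<^bsub>K\<^esub> i \<ominus>\<^bsub>K\<^esub> \<nu> 2 [^]\<^bsub>K\<^esub> (N :: nat) \<in> Units K"
  using \<nu>_inj[of "2 ^ i" "2 ^ N"] add.inv_solve_right'[of "\<zero>\<^bsub>K\<^esub>" "\<nu> (2 ^ i)" "\<nu> (2 ^ N)"]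
  by (simp add: \<nu>_2_pow field_Units minus_eq)

end

text \<open>The polynomials \<open>B[t]\<close> are realized as functions on the field. This is faithful because a
  field of characteristic zero is infinite, and it makes evaluation and the algebra laws pointwise.\<close>

locale polynomials = char_zero_field K + dgalg K B for K :: "'k ring" and B :: "('k, 'a) dga"
begin

definition pmono :: "int \<Rightarrow> nat \<Rightarrow> 'k \<Rightarrow> 'a \<Rightarrow> 'k \<Rightarrow> 'a" where
  "pmono n i c b = (\<lambda>t\<in>carrier K. (c \<otimes>\<^bsub>K\<^esub> t [^]\<^bsub>K\<^esub> i) \<odot>\<^bsub>piece B n\<^esub> b)"

definition padd :: "int \<Rightarrow> ('k \<Rightarrow> 'a) \<Rightarrow> ('k \<Rightarrow> 'a) \<Rightarrow> 'k \<Rightarrow> 'a" where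
  "padd n f g = (\<lambda>t\<in>carrier K. f t \<oplus>\<^bsub>piece B n\<^esub> g t)"

definition pmul :: "int \<Rightarrow> int \<Rightarrow> ('k \<Rightarrow> 'a) \<Rightarrow> ('k \<Rightarrow> 'a) \<Rightarrow> 'k \<Rightarrow> 'a" where
  "pmul i j f g = (\<lambda>t\<in>carrier K. gmult B i j (f t) (g t))"

lemma smult_comm: "c \<in> carrier K \<Longrightarrow> d \<in> carrier K \<Longrightarrow> x \<in> elts B n \<Longrightarrow>
   c \<odot>\<^bsub>piece B n\<^esub> (d \<odot>\<^bsub>piece B n\<^esub> x) = d \<odot>\<^bsub>piece B n\<^esub> (c \<odot>\<^bsub>piece B n\<^esub> x)"
  by (simp add: P.smult_assoc1[symmetric] m_comm)

text \<open>\<open>PD n f f' F\<close>: the function \<open>f\<close> on the field is polynomial with coefficients of degree \<open>n\<close>,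
  its derivative is \<open>f'\<close>, and \<open>F\<close> is the antiderivative that vanishes at zero. One induction over
  this relation proves a closure property together with the formulas for derivative and
  antiderivative, before these are known to be well defined.\<close>

inductive PD :: "int \<Rightarrow> ('k \<Rightarrow> 'a) \<Rightarrow> ('k \<Rightarrow> 'a) \<Rightarrow> ('k \<Rightarrow> 'a) \<Rightarrow> bool" where
  mono: "b \<in> elts B n \<Longrightarrow>
    PD n (pmono n i \<one>\<^bsub>K\<^esub> b) (pmono n (i - 1) (\<nu> i) b) (pmono n (Suc i) (\<nu>inv (Suc i)) b)"
| add: "PD n f f' F \<Longrightarrow> PD n g g' G \<Longrightarrow> PD n (padd n f g) (padd n f' g') (padd n F G)"

lemma pmono_PiE [simp]: "c \<in> carrier K \<Longrightarrow> b \<in> elts B n \<Longrightarrow> pmono n i c b \<in> carrier K \<rightarrow>\<^sub>E elts B n"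
  by (auto simp: pmono_def)

lemma padd_PiE [simp]: "f \<in> carrier K \<rightarrow>\<^sub>E elts B n \<Longrightarrow> g \<in> carrier K \<rightarrow>\<^sub>E elts B n \<Longrightarrow>
    padd n f g \<in> carrier K \<rightarrow>\<^sub>E elts B n"
  by (auto simp: padd_def PiE_mem)

lemma pmono_apply [simp]: "t \<in> carrier K \<Longrightarrow> pmono n i c b t = (c \<otimes>\<^bsub>K\<^esub> t [^]\<^bsub>K\<^esub> i) \<odot>\<^bsub>piece B n\<^esub> b"
  and padd_apply [simp]: "t \<in> carrier K \<Longrightarrow> padd n f g t = f t \<oplus>\<^bsub>piece B n\<^esub> g t"
  and pmul_apply [simp]: "t \<in> carrier K \<Longrightarrow> pmul j l f g t = gmult B j l (f t) (g t)"
  by (simp_all add: pmono_def padd_def pmul_def)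

lemma PD_PiE: "PD n f f' F \<Longrightarrow>
   f \<in> carrier K \<rightarrow>\<^sub>E elts B n \<and> f' \<in> carrier K \<rightarrow>\<^sub>E elts B n \<and> F \<in> carrier K \<rightarrow>\<^sub>E elts B n"
  by (induction rule: PD.induct) simp_all

lemma PD_mem: "PD n f f' F \<Longrightarrow> t \<in> carrier K \<Longrightarrow> f t \<in> elts B n"
  "PD n f f' F \<Longrightarrow> t \<in> carrier K \<Longrightarrow> f' t \<in> elts B n"
  "PD n f f' F \<Longrightarrow> t \<in> carrier K \<Longrightarrow> F t \<in> elts B n"
  using PD_PiE PiE_mem by blast+

lemma PiE_eqI: "f \<in> carrier K \<rightarrow>\<^sub>E elts B n \<Longrightarrow> g \<in> carrier K \<rightarrow>\<^sub>E elts B n \<Longrightarrow>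
    (\<And>t. t \<in> carrier K \<Longrightarrow> f t = g t) \<Longrightarrow> f = g"
  by (rule PiE_ext)

text \<open>Coefficientwise linear maps commute with differentiation and integration; this covers both
  scalars and the boundary.\<close>

lemma PD_linear:
  assumes L: "linear_map K (piece B n) (piece B m) L" and PD: "PD n f f' F"
  shows "PD m (\<lambda>t\<in>carrier K. L (f t)) (\<lambda>t\<in>carrier K. L (f' t)) (\<lambda>t\<in>carrier K. L (F t))"
proof -
  have Lm: "L x \<in> elts B m" if "x \<in> elts B n" for x using L that by (auto simp: linear_map_def)
  have La: "L (x \<oplus>\<^bsub>piece B n\<^esub> y) = L x \<oplus>\<^bsub>piece B m\<^esub> L y" if "x \<in> elts B n" "y \<in> elts B n" for x y
    using L that by (auto simp: linear_map_def)
  have Ls: "L (c \<odot>\<^bsub>piece B n\<^esub> x) = c \<odot>\<^bsub>piece B m\<^esub> L x" if "c \<in> carrier K" "x \<in> elts B n" for c x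
    using L that by (auto simp: linear_map_def)
  have "PD p f f' F \<Longrightarrow> p = n \<Longrightarrow>
    PD m (\<lambda>t\<in>carrier K. L (f t)) (\<lambda>t\<in>carrier K. L (f' t)) (\<lambda>t\<in>carrier K. L (F t))" for p f f' F
  proof (induction rule: PD.induct)
    case (mono b p i)
    have "(\<lambda>t\<in>carrier K. L (pmono n l c b t)) = pmono m l c (L b)" if "c \<in> carrier K" for l c
      using mono that unfolding pmono_def by (intro restrict_ext) (simp add: Ls)
    then show ?case using PD.mono[OF Lm, of b i] mono by simp
  next
    case (add p f f' F g g' G)
    have e: "(\<lambda>t\<in>carrier K. L (padd n u v t)) = padd m (\<lambda>t\<in>carrier K. L (u t)) (\<lambda>t\<in>carrier K. L (v t))"
      if "u \<in> carrier K \<rightarrow>\<^sub>E elts B n" "v \<in> carrier K \<rightarrow>\<^sub>E elts B n" for u v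
      unfolding padd_def using that by (intro restrict_ext) (simp add: La PiE_mem[OF that(1)] PiE_mem[OF that(2)])
    have f: "f \<in> carrier K \<rightarrow>\<^sub>E elts B n" "f' \<in> carrier K \<rightarrow>\<^sub>E elts B n" "F \<in> carrier K \<rightarrow>\<^sub>E elts B n"
      and g: "g \<in> carrier K \<rightarrow>\<^sub>E elts B n" "g' \<in> carrier K \<rightarrow>\<^sub>E elts B n" "G \<in> carrier K \<rightarrow>\<^sub>E elts B n"
      using PD_PiE add.hyps add.prems by auto
    show ?case
      unfolding add.prems e[OF f(1) g(1)] e[OF f(2) g(2)] e[OF f(3) g(3)]
      by (rule PD.add[OF add.IH(1)[OF add.prems] add.IH(2)[OF add.prems]])
  qed
  then show ?thesis using PD by blast
qed

lemma PD_smult: "PD n f f' F \<Longrightarrow> c \<in> carrier K \<Longrightarrow>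
   PD n (\<lambda>t\<in>carrier K. c \<odot>\<^bsub>piece B n\<^esub> f t) (\<lambda>t\<in>carrier K. c \<odot>\<^bsub>piece B n\<^esub> f' t) (\<lambda>t\<in>carrier K. c \<odot>\<^bsub>piece B n\<^esub> F t)"
  by (rule PD_linear) (auto simp: linear_map_def P.smult_r_distr smult_comm)

lemma PD_bdry: "PD n f f' F \<Longrightarrow>
   PD (n - 1) (\<lambda>t\<in>carrier K. bdry B n (f t)) (\<lambda>t\<in>carrier K. bdry B n (f' t)) (\<lambda>t\<in>carrier K. bdry B n (F t))"
  by (rule PD_linear) (auto simp: linear_map_def bdry_add bdry_smult)

lemma PD_const: "b \<in> elts B n \<Longrightarrow> \<exists>F. PD n (\<lambda>t\<in>carrier K. b) (\<lambda>t\<in>carrier K. \<zero>\<^bsub>piece B n\<^esub>) F"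
proof -
  assume b: "b \<in> elts B n"
  have "pmono n 0 \<one>\<^bsub>K\<^esub> b = (\<lambda>t\<in>carrier K. b)" "pmono n (0 - 1) (\<nu> 0) b = (\<lambda>t\<in>carrier K. \<zero>\<^bsub>piece B n\<^esub>)"
    unfolding pmono_def using b by (auto intro!: restrict_ext)
  then show ?thesis using PD.mono[OF b, of 0] by metis
qed

lemma PD_antiderivative_zero: "PD n f f' F \<Longrightarrow> F \<zero>\<^bsub>K\<^esub> = \<zero>\<^bsub>piece B n\<^esub>"
  by (induction rule: PD.induct) auto

subsection \<open>Coefficients\<close>

text \<open>The sum of \<open>w i c i\<close> for \<open>i < N\<close>. For the three components of \<open>PD\<close> the weights \<open>w\<close> differ, but
  the coefficients \<open>c\<close> are the same.\<close>

primrec psum :: "int \<Rightarrow> nat \<Rightarrow> (nat \<Rightarrow> 'k) \<Rightarrow> (nat \<Rightarrow> 'a) \<Rightarrow> 'a" where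
  "psum n 0 w c = \<zero>\<^bsub>piece B n\<^esub>"
| "psum n (Suc N) w c = psum n N w c \<oplus>\<^bsub>piece B n\<^esub> w N \<odot>\<^bsub>piece B n\<^esub> c N"

lemma psum_closed [simp]: "(\<And>i. w i \<in> carrier K) \<Longrightarrow> (\<And>i. c i \<in> elts B n) \<Longrightarrow> psum n N w c \<in> elts B n"
  by (induction N) auto

lemma psum_cong: "(\<And>i. i < N \<Longrightarrow> w i = w' i) \<Longrightarrow> (\<And>i. i < N \<Longrightarrow> c i = c' i) \<Longrightarrow> psum n N w c = psum n N w' c'"
  by (induction N) auto

lemma psum_zero: "(\<And>i. w i \<in> carrier K) \<Longrightarrow> (\<And>i. i < N \<Longrightarrow> c i = \<zero>\<^bsub>piece B n\<^esub>) \<Longrightarrow> psum n N w c = \<zero>\<^bsub>piece B n\<^esub>"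
  by (induction N) auto

lemma psum_add: "(\<And>i. w i \<in> carrier K) \<Longrightarrow> (\<And>i. c i \<in> elts B n) \<Longrightarrow> (\<And>i. d i \<in> elts B n) \<Longrightarrow>
   psum n N w (\<lambda>i. c i \<oplus>\<^bsub>piece B n\<^esub> d i) = psum n N w c \<oplus>\<^bsub>piece B n\<^esub> psum n N w d"
  by (induction N) (auto simp: P.smult_r_distr P.a_ac)

lemma psum_extend: "(\<And>i. w i \<in> carrier K) \<Longrightarrow> (\<And>i. c i \<in> elts B n) \<Longrightarrow>
   psum n (N + M) w (\<lambda>i. if i < N then c i else \<zero>\<^bsub>piece B n\<^esub>) = psum n N w c"
proof (induction M)
  case 0
  then show ?case by (auto intro!: psum_cong)
qed auto

lemma PD_coefficients:
  "PD n f f' F \<Longrightarrow> \<exists>N c. (\<forall>i. c i \<in> elts B n) \<and> (\<forall>t\<in>carrier K.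
     f t = psum n N (\<lambda>i. t [^]\<^bsub>K\<^esub> i) c \<and> f' t = psum n N (\<lambda>i. \<nu> i \<otimes>\<^bsub>K\<^esub> t [^]\<^bsub>K\<^esub> (i - 1)) c \<and>
     F t = psum n N (\<lambda>i. \<nu>inv (Suc i) \<otimes>\<^bsub>K\<^esub> t [^]\<^bsub>K\<^esub> (Suc i)) c)"
proof (induction rule: PD.induct)
  case (mono b n i)
  let ?c = "\<lambda>j. if j = i then b else \<zero>\<^bsub>piece B n\<^esub>"
  have "psum n (Suc i) w ?c = w i \<odot>\<^bsub>piece B n\<^esub> b" if "\<And>j. w j \<in> carrier K" for w
    using that psum_zero[of w i ?c n] mono by simp
  then show ?case using mono by (intro exI[of _ "Suc i"] exI[of _ ?c]) (auto simp del: psum.simps)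
next
  case (add n f f' F g g' G)
  obtain N c where c: "\<And>i. c i \<in> elts B n" and fc: "\<And>t. t\<in>carrier K \<Longrightarrow>
     f t = psum n N (\<lambda>i. t [^]\<^bsub>K\<^esub> i) c \<and> f' t = psum n N (\<lambda>i. \<nu> i \<otimes>\<^bsub>K\<^esub> t [^]\<^bsub>K\<^esub> (i - 1)) c \<and>
     F t = psum n N (\<lambda>i. \<nu>inv (Suc i) \<otimes>\<^bsub>K\<^esub> t [^]\<^bsub>K\<^esub> (Suc i)) c" using add.IH(1) by blast
  obtain M d where d: "\<And>i. d i \<in> elts B n" and gd: "\<And>t. t\<in>carrier K \<Longrightarrow>
     g t = psum n M (\<lambda>i. t [^]\<^bsub>K\<^esub> i) d \<and> g' t = psum n M (\<lambda>i. \<nu> i \<otimes>\<^bsub>K\<^esub> t [^]\<^bsub>K\<^esub> (i - 1)) d \<and>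
     G t = psum n M (\<lambda>i. \<nu>inv (Suc i) \<otimes>\<^bsub>K\<^esub> t [^]\<^bsub>K\<^esub> (Suc i)) d" using add.IH(2) by blast
  let ?c = "\<lambda>i. if i < N then c i else \<zero>\<^bsub>piece B n\<^esub>" and ?d = "\<lambda>i. if i < M then d i else \<zero>\<^bsub>piece B n\<^esub>"
  have sum: "psum n (N + M) w (\<lambda>i. ?c i \<oplus>\<^bsub>piece B n\<^esub> ?d i) = psum n N w c \<oplus>\<^bsub>piece B n\<^esub> psum n M w d"
    if w: "\<And>j. w j \<in> carrier K" for w
    using psum_add[of w ?c n ?d "N + M"] psum_extend[of w c n N M] psum_extend[of w d n M N] c d w
    by (simp add: add.commute)
  show ?case
    by (rule exI[of _ "N + M"], rule exI[of _ "\<lambda>i. ?c i \<oplus>\<^bsub>piece B n\<^esub> ?d i"])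
       (use c d fc gd in \<open>auto simp: sum\<close>)
qed

lemma psum_scale_diff:
  assumes "\<And>i. c i \<in> elts B n" "t \<in> carrier K" "a \<in> carrier K" "e \<in> carrier K"
  shows "psum n N (\<lambda>i. t [^]\<^bsub>K\<^esub> i) (\<lambda>i. (a [^]\<^bsub>K\<^esub> i \<ominus>\<^bsub>K\<^esub> e) \<odot>\<^bsub>piece B n\<^esub> c i) =
    psum n N (\<lambda>i. (a \<otimes>\<^bsub>K\<^esub> t) [^]\<^bsub>K\<^esub> i) c \<ominus>\<^bsub>piece B n\<^esub> e \<odot>\<^bsub>piece B n\<^esub> psum n N (\<lambda>i. t [^]\<^bsub>K\<^esub> i) c"
proof (induction N)
  case 0
  then show ?case using assms by simp
next
  case (Suc N)
  have "t [^]\<^bsub>K\<^esub> N \<odot>\<^bsub>piece B n\<^esub> ((a [^]\<^bsub>K\<^esub> N \<ominus>\<^bsub>K\<^esub> e) \<odot>\<^bsub>piece B n\<^esub> c N) =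
     (a \<otimes>\<^bsub>K\<^esub> t) [^]\<^bsub>K\<^esub> N \<odot>\<^bsub>piece B n\<^esub> c N \<ominus>\<^bsub>piece B n\<^esub> e \<odot>\<^bsub>piece B n\<^esub> (t [^]\<^bsub>K\<^esub> N \<odot>\<^bsub>piece B n\<^esub> c N)"
    using assms by (simp add: minus_eq P.minus_eq P.smult_l_distr P.smult_r_distr P.smult_l_minus P.smult_r_minus
        nat_pow_distrib P.smult_assoc1 smult_comm[of "t [^]\<^bsub>K\<^esub> N"])
  then show ?case using assms Suc by (simp add: P.smult_r_distr P.abel)
qed

text \<open>A polynomial function that vanishes identically has no coefficients: compare \<open>f (2 t)\<close> with
  \<open>2\<^sup>N f t\<close> to remove the leading term. In characteristic zero the differences \<open>2\<^sup>i - 2\<^sup>N\<close> that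
  appear as factors are invertible.\<close>

lemma coefficients_vanish:
  assumes "\<And>i. c i \<in> elts B n" "\<And>t. t \<in> carrier K \<Longrightarrow> psum n N (\<lambda>i. t [^]\<^bsub>K\<^esub> i) c = \<zero>\<^bsub>piece B n\<^esub>" "i < N"
  shows "c i = \<zero>\<^bsub>piece B n\<^esub>"
  using assms
proof (induction N arbitrary: c i)
  case 0
  then show ?case by simp
next
  case (Suc N)
  note c = Suc.prems(1)
  define e where "e i = \<nu> 2 [^]\<^bsub>K\<^esub> i \<ominus>\<^bsub>K\<^esub> \<nu> 2 [^]\<^bsub>K\<^esub> N" for i :: nat
  have ec: "e i \<in> carrier K" for i by (simp add: e_def)
  have "psum n N (\<lambda>i. t [^]\<^bsub>K\<^esub> i) (\<lambda>i. e i \<odot>\<^bsub>piece B n\<^esub> c i) = \<zero>\<^bsub>piece B n\<^esub>" if t: "t \<in> carrier K" for t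
  proof -
    have 2: "\<nu> 2 \<in> carrier K" by simp
    have p: "psum n N (\<lambda>i. (\<nu> 2 \<otimes>\<^bsub>K\<^esub> t) [^]\<^bsub>K\<^esub> i) c = \<ominus>\<^bsub>piece B n\<^esub> ((\<nu> 2 \<otimes>\<^bsub>K\<^esub> t) [^]\<^bsub>K\<^esub> N \<odot>\<^bsub>piece B n\<^esub> c N)"
      using Suc.prems(2)[of "\<nu> 2 \<otimes>\<^bsub>K\<^esub> t"] t c by (intro P.minus_equality[symmetric]) auto
    have q: "psum n N (\<lambda>i. t [^]\<^bsub>K\<^esub> i) c = \<ominus>\<^bsub>piece B n\<^esub> (t [^]\<^bsub>K\<^esub> N \<odot>\<^bsub>piece B n\<^esub> c N)"
      using Suc.prems(2)[of t] t c by (intro P.minus_equality[symmetric]) auto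
    have "psum n N (\<lambda>i. t [^]\<^bsub>K\<^esub> i) (\<lambda>i. e i \<odot>\<^bsub>piece B n\<^esub> c i) =
       \<ominus>\<^bsub>piece B n\<^esub> ((\<nu> 2 \<otimes>\<^bsub>K\<^esub> t) [^]\<^bsub>K\<^esub> N \<odot>\<^bsub>piece B n\<^esub> c N) \<ominus>\<^bsub>piece B n\<^esub>
         \<nu> 2 [^]\<^bsub>K\<^esub> N \<odot>\<^bsub>piece B n\<^esub> (\<ominus>\<^bsub>piece B n\<^esub> (t [^]\<^bsub>K\<^esub> N \<odot>\<^bsub>piece B n\<^esub> c N))"
      using psum_scale_diff[OF c t 2, of "\<nu> 2 [^]\<^bsub>K\<^esub> N"] by (simp add: e_def p q)
    also have "\<dots> = \<zero>\<^bsub>piece B n\<^esub>"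
      using t c by (simp add: P.smult_r_minus nat_pow_distrib P.smult_assoc1 P.abel)
    finally show ?thesis .
  qed
  note vanish = this
  have low: "c i = \<zero>\<^bsub>piece B n\<^esub>" if "i < N" for i
  proof -
    have z: "e i \<odot>\<^bsub>piece B n\<^esub> c i = \<zero>\<^bsub>piece B n\<^esub>"
      using Suc.IH[of "\<lambda>i. e i \<odot>\<^bsub>piece B n\<^esub> c i" i] vanish c ec that by simp
    have u: "e i \<in> Units K" using pow_diff_unit[OF that] by (simp add: e_def)
    have "c i = (inv\<^bsub>K\<^esub> (e i) \<otimes>\<^bsub>K\<^esub> e i) \<odot>\<^bsub>piece B n\<^esub> c i" using u c by simp
    also have "\<dots> = inv\<^bsub>K\<^esub> (e i) \<odot>\<^bsub>piece B n\<^esub> (e i \<odot>\<^bsub>piece B n\<^esub> c i)"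
      using P.smult_assoc1[of "inv\<^bsub>K\<^esub> (e i)" "e i" "c i" n] Units_inv_closed[OF u] c ec by simp
    also have "\<dots> = \<zero>\<^bsub>piece B n\<^esub>" using Units_inv_closed[OF u] by (simp add: z)
    finally show ?thesis .
  qed
  have "psum n N (\<lambda>i. \<one>\<^bsub>K\<^esub> [^]\<^bsub>K\<^esub> i) c = \<zero>\<^bsub>piece B n\<^esub>" using low by (intro psum_zero) auto
  then have "c N = \<zero>\<^bsub>piece B n\<^esub>" using Suc.prems(2)[of "\<one>\<^bsub>K\<^esub>"] c by simp
  then show ?case using low Suc.prems(3) by (cases "i = N") auto
qed

text \<open>The coefficients of a difference of two presentations of \<open>f\<close> vanish, and they determine the
  differences of the derivatives and of the antiderivatives.\<close>

lemma PD_unique: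
  assumes f: "PD n f f' F" and g: "PD n f g' G" shows "f' = g'" "F = G"
proof -
  let ?m = "\<ominus>\<^bsub>K\<^esub> \<one>\<^bsub>K\<^esub>"
  note d = PD.add[OF f PD_smult[OF g, of ?m]]
  obtain N c where c: "\<And>i. c i \<in> elts B n" and fc: "\<And>t. t\<in>carrier K \<Longrightarrow>
     padd n f (\<lambda>t\<in>carrier K. ?m \<odot>\<^bsub>piece B n\<^esub> f t) t = psum n N (\<lambda>i. t [^]\<^bsub>K\<^esub> i) c \<and>
     padd n f' (\<lambda>t\<in>carrier K. ?m \<odot>\<^bsub>piece B n\<^esub> g' t) t = psum n N (\<lambda>i. \<nu> i \<otimes>\<^bsub>K\<^esub> t [^]\<^bsub>K\<^esub> (i - 1)) c \<and>
     padd n F (\<lambda>t\<in>carrier K. ?m \<odot>\<^bsub>piece B n\<^esub> G t) t = psum n N (\<lambda>i. \<nu>inv (Suc i) \<otimes>\<^bsub>K\<^esub> t [^]\<^bsub>K\<^esub> (Suc i)) c"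
    using PD_coefficients[OF d] by auto
  have "psum n N (\<lambda>i. t [^]\<^bsub>K\<^esub> i) c = \<zero>\<^bsub>piece B n\<^esub>" if "t \<in> carrier K" for t
    using fc[OF that] that PD_mem(1)[OF f that] by (simp add: P.smult_l_minus P.r_neg)
  then have z: "c i = \<zero>\<^bsub>piece B n\<^esub>" if "i < N" for i
    using coefficients_vanish[of c n N i] c that by blast
  have eq: "u t = v t" if "u t \<oplus>\<^bsub>piece B n\<^esub> ?m \<odot>\<^bsub>piece B n\<^esub> v t = \<zero>\<^bsub>piece B n\<^esub>" "u t \<in> elts B n" "v t \<in> elts B n" for u v t
  proof -
    have "u t \<oplus>\<^bsub>piece B n\<^esub> \<ominus>\<^bsub>piece B n\<^esub> v t = \<zero>\<^bsub>piece B n\<^esub>" using that by (simp add: P.smult_l_minus)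
    from P.minus_equality[OF this] show ?thesis using that by simp
  qed
  have "f' t = g' t" "F t = G t" if t: "t \<in> carrier K" for t
    using eq[of f' t g'] eq[of F t G] fc[OF t] t psum_zero[of _ N c n] z
      PD_mem(2,3)[OF f t] PD_mem(2,3)[OF g t] by auto
  then show "f' = g'" "F = G"
    using PiE_eqI PD_PiE[OF f] PD_PiE[OF g] by blast+
qed

text \<open>The fundamental theorem of calculus, in both directions.\<close>

lemma PD_deriv:
  "PD n f f' F \<Longrightarrow> (\<exists>f''. PD n f' f'' (\<lambda>t\<in>carrier K. f t \<ominus>\<^bsub>piece B n\<^esub> f \<zero>\<^bsub>K\<^esub>)) \<and> (\<exists>G. PD n F f G)"
proof (induction rule: PD.induct)
  case (mono b n i)
  have "pmono n (i - 1) (\<nu> i) b = pmono n (i - 1) \<one>\<^bsub>K\<^esub> (\<nu> i \<odot>\<^bsub>piece B n\<^esub> b)"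
    unfolding pmono_def using mono
    by (intro restrict_ext) (simp add: P.smult_assoc1[symmetric] m_comm)
  moreover have "pmono n (Suc (i - 1)) (\<nu>inv (Suc (i - 1))) (\<nu> i \<odot>\<^bsub>piece B n\<^esub> b) =
     (\<lambda>t\<in>carrier K. pmono n i \<one>\<^bsub>K\<^esub> b t \<ominus>\<^bsub>piece B n\<^esub> pmono n i \<one>\<^bsub>K\<^esub> b \<zero>\<^bsub>K\<^esub>)"
  proof (cases i)
    case 0
    then show ?thesis unfolding pmono_def[of n "Suc (i - 1)"] using mono by (intro restrict_ext) simp
  next
    case (Suc k)
    have "(\<nu>inv (Suc k) \<otimes>\<^bsub>K\<^esub> t [^]\<^bsub>K\<^esub> Suc k) \<odot>\<^bsub>piece B n\<^esub> (\<nu> (Suc k) \<odot>\<^bsub>piece B n\<^esub> b) = t [^]\<^bsub>K\<^esub> Suc k \<odot>\<^bsub>piece B n\<^esub> b"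
      if t: "t \<in> carrier K" for t
    proof -
      have "\<nu>inv (Suc k) \<otimes>\<^bsub>K\<^esub> t [^]\<^bsub>K\<^esub> Suc k \<otimes>\<^bsub>K\<^esub> \<nu> (Suc k) = (\<nu>inv (Suc k) \<otimes>\<^bsub>K\<^esub> \<nu> (Suc k)) \<otimes>\<^bsub>K\<^esub> t [^]\<^bsub>K\<^esub> Suc k"
        using t \<nu>inv_closed[of "Suc k"] by (simp add: m_ac del: nat_pow_Suc)
      also have "\<dots> = t [^]\<^bsub>K\<^esub> Suc k" using t \<nu>inv_\<nu>[of "Suc k"] by (simp del: nat_pow_Suc)
      finally show ?thesis using t mono \<nu>inv_closed[of "Suc k"]
        by (simp add: P.smult_assoc1[symmetric] del: nat_pow_Suc)
    qed
    then show ?thesis unfolding pmono_def[of n "Suc (i - 1)"] using mono Suc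
      by (intro restrict_ext) (simp del: nat_pow_Suc add: nat_pow_zero)
  qed
  ultimately have 1: "\<exists>f''. PD n (pmono n (i - 1) (\<nu> i) b) f''
     (\<lambda>t\<in>carrier K. pmono n i \<one>\<^bsub>K\<^esub> b t \<ominus>\<^bsub>piece B n\<^esub> pmono n i \<one>\<^bsub>K\<^esub> b \<zero>\<^bsub>K\<^esub>)"
    using PD.mono[of "\<nu> i \<odot>\<^bsub>piece B n\<^esub> b" n "i - 1"] mono by (metis \<nu>_closed P.smult_closed)
  have q: "\<nu>inv (Suc i) \<in> carrier K" by simp
  have "pmono n (Suc i) (\<nu>inv (Suc i)) b = pmono n (Suc i) \<one>\<^bsub>K\<^esub> (\<nu>inv (Suc i) \<odot>\<^bsub>piece B n\<^esub> b)"
    unfolding pmono_def using mono q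
    by (intro restrict_ext) (simp add: P.smult_assoc1[symmetric] m_comm del: nat_pow_Suc)
  moreover have "pmono n (Suc i - 1) (\<nu> (Suc i)) (\<nu>inv (Suc i) \<odot>\<^bsub>piece B n\<^esub> b) = pmono n i \<one>\<^bsub>K\<^esub> b"
    unfolding pmono_def
  proof (rule restrict_ext)
    fix t assume t: "t \<in> carrier K"
    have "\<nu> (Suc i) \<otimes>\<^bsub>K\<^esub> t [^]\<^bsub>K\<^esub> i \<otimes>\<^bsub>K\<^esub> \<nu>inv (Suc i) = (\<nu> (Suc i) \<otimes>\<^bsub>K\<^esub> \<nu>inv (Suc i)) \<otimes>\<^bsub>K\<^esub> t [^]\<^bsub>K\<^esub> i"
      using t q by (simp add: m_ac)
    then show "(\<nu> (Suc i) \<otimes>\<^bsub>K\<^esub> t [^]\<^bsub>K\<^esub> (Suc i - 1)) \<odot>\<^bsub>piece B n\<^esub> (\<nu>inv (Suc i) \<odot>\<^bsub>piece B n\<^esub> b) =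
        (\<one>\<^bsub>K\<^esub> \<otimes>\<^bsub>K\<^esub> t [^]\<^bsub>K\<^esub> i) \<odot>\<^bsub>piece B n\<^esub> b"
      using t q mono \<nu>_\<nu>inv[of "Suc i"] by (simp add: P.smult_assoc1[symmetric])
  qed
  ultimately have 2: "\<exists>G. PD n (pmono n (Suc i) (\<nu>inv (Suc i)) b) (pmono n i \<one>\<^bsub>K\<^esub> b) G"
    using PD.mono[of "\<nu>inv (Suc i) \<odot>\<^bsub>piece B n\<^esub> b" n "Suc i"] mono q by (metis P.smult_closed)
  show ?case using 1 2 by blast
next
  case (add n f f' F g g' G)
  obtain u v where u: "PD n f' u (\<lambda>t\<in>carrier K. f t \<ominus>\<^bsub>piece B n\<^esub> f \<zero>\<^bsub>K\<^esub>)" "PD n F f v" using add.IH(1) by blast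
  obtain u' v' where u': "PD n g' u' (\<lambda>t\<in>carrier K. g t \<ominus>\<^bsub>piece B n\<^esub> g \<zero>\<^bsub>K\<^esub>)" "PD n G g v'" using add.IH(2) by blast
  have e: "padd n (\<lambda>t\<in>carrier K. f t \<ominus>\<^bsub>piece B n\<^esub> f \<zero>\<^bsub>K\<^esub>) (\<lambda>t\<in>carrier K. g t \<ominus>\<^bsub>piece B n\<^esub> g \<zero>\<^bsub>K\<^esub>) =
    (\<lambda>t\<in>carrier K. padd n f g t \<ominus>\<^bsub>piece B n\<^esub> padd n f g \<zero>\<^bsub>K\<^esub>)"
    unfolding padd_def[of n "\<lambda>t\<in>carrier K. f t \<ominus>\<^bsub>piece B n\<^esub> f \<zero>\<^bsub>K\<^esub>"]
    using PD_mem(1)[OF add(1)] PD_mem(1)[OF add(2)]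
    by (intro restrict_ext) (simp add: P.minus_eq P.minus_add P.a_ac)
  show ?case using PD.add[OF u(1) u'(1)] PD.add[OF u(2) u'(2)] unfolding e by blast
qed

end

context polynomials begin

lemma K_one: "\<one>\<^bsub>K\<^esub> \<in> carrier K"
  by simp

lemma pmul_pmono: "a \<in> elts B i \<Longrightarrow> b \<in> elts B j \<Longrightarrow> c \<in> carrier K \<Longrightarrow> d \<in> carrier K \<Longrightarrow> t \<in> carrier K \<Longrightarrow>
   gmult B i j (pmono i k c a t) (pmono j l d b t) =
     (c \<otimes>\<^bsub>K\<^esub> d \<otimes>\<^bsub>K\<^esub> t [^]\<^bsub>K\<^esub> (k + l)) \<odot>\<^bsub>piece B (i + j)\<^esub> gmult B i j a b"
  by (simp add: mult_smult_left mult_smult_right P.smult_assoc1[symmetric] nat_pow_mult[symmetric] m_ac)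

lemma pmono_product:
  assumes "a \<in> elts B i" "b \<in> elts B j"
  shows "pmul i j (pmono i k \<one>\<^bsub>K\<^esub> a) (pmono j l \<one>\<^bsub>K\<^esub> b) = pmono (i + j) (k + l) \<one>\<^bsub>K\<^esub> (gmult B i j a b)"
    and "padd (i + j) (pmul i j (pmono i (k - 1) (\<nu> k) a) (pmono j l \<one>\<^bsub>K\<^esub> b))
        (pmul i j (pmono i k \<one>\<^bsub>K\<^esub> a) (pmono j (l - 1) (\<nu> l) b)) =
      pmono (i + j) (k + l - 1) (\<nu> (k + l)) (gmult B i j a b)"
proof -
  show "pmul i j (pmono i k \<one>\<^bsub>K\<^esub> a) (pmono j l \<one>\<^bsub>K\<^esub> b) = pmono (i + j) (k + l) \<one>\<^bsub>K\<^esub> (gmult B i j a b)"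
    unfolding pmul_def pmono_def[of "i + j"]
    by (intro restrict_ext) (simp only: pmul_pmono[OF assms K_one K_one], simp)
  have "\<nu> k \<otimes>\<^bsub>K\<^esub> t [^]\<^bsub>K\<^esub> (k - 1 + l) = \<nu> k \<otimes>\<^bsub>K\<^esub> t [^]\<^bsub>K\<^esub> (k + l - 1)"
    "\<nu> l \<otimes>\<^bsub>K\<^esub> t [^]\<^bsub>K\<^esub> (k + (l - 1)) = \<nu> l \<otimes>\<^bsub>K\<^esub> t [^]\<^bsub>K\<^esub> (k + l - 1)" if "t \<in> carrier K" for t
    using that by (cases k; cases l; simp)+
  note s = this
  show "padd (i + j) (pmul i j (pmono i (k - 1) (\<nu> k) a) (pmono j l \<one>\<^bsub>K\<^esub> b))
        (pmul i j (pmono i k \<one>\<^bsub>K\<^esub> a) (pmono j (l - 1) (\<nu> l) b)) =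
      pmono (i + j) (k + l - 1) (\<nu> (k + l)) (gmult B i j a b)"
    unfolding padd_def pmono_def[of "i + j"]
  proof (rule restrict_ext)
    fix t assume t: "t \<in> carrier K"
    have "pmul i j (pmono i (k - 1) (\<nu> k) a) (pmono j l \<one>\<^bsub>K\<^esub> b) t =
        (\<nu> k \<otimes>\<^bsub>K\<^esub> t [^]\<^bsub>K\<^esub> (k + l - 1)) \<odot>\<^bsub>piece B (i + j)\<^esub> gmult B i j a b"
      "pmul i j (pmono i k \<one>\<^bsub>K\<^esub> a) (pmono j (l - 1) (\<nu> l) b) t =
        (\<nu> l \<otimes>\<^bsub>K\<^esub> t [^]\<^bsub>K\<^esub> (k + l - 1)) \<odot>\<^bsub>piece B (i + j)\<^esub> gmult B i j a b"
      unfolding pmul_apply[OF t] using s[OF t]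
      by (simp_all only: pmul_pmono assms t K_one \<nu>_closed l_one r_one)
    then show "pmul i j (pmono i (k - 1) (\<nu> k) a) (pmono j l \<one>\<^bsub>K\<^esub> b) t \<oplus>\<^bsub>piece B (i + j)\<^esub>
        pmul i j (pmono i k \<one>\<^bsub>K\<^esub> a) (pmono j (l - 1) (\<nu> l) b) t =
        (\<nu> (k + l) \<otimes>\<^bsub>K\<^esub> t [^]\<^bsub>K\<^esub> (k + l - 1)) \<odot>\<^bsub>piece B (i + j)\<^esub> gmult B i j a b"
      using assms t by (simp add: \<nu>_add l_distr P.smult_l_distr)
  qed
qed

lemma pmul_padd_right: "f \<in> carrier K \<rightarrow>\<^sub>E elts B i \<Longrightarrow> g \<in> carrier K \<rightarrow>\<^sub>E elts B j \<Longrightarrow> h \<in> carrier K \<rightarrow>\<^sub>E elts B j \<Longrightarrow>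
   pmul i j f (padd j g h) = padd (i + j) (pmul i j f g) (pmul i j f h)"
  unfolding padd_def[of "i + j"] unfolding pmul_def
  by (intro restrict_ext) (simp add: mult_add_right PiE_mem[of f "carrier K" "\<lambda>_. elts B i"]
     PiE_mem[of g "carrier K" "\<lambda>_. elts B j"] PiE_mem[of h "carrier K" "\<lambda>_. elts B j"])

lemma pmul_padd_left: "f \<in> carrier K \<rightarrow>\<^sub>E elts B i \<Longrightarrow> g \<in> carrier K \<rightarrow>\<^sub>E elts B i \<Longrightarrow> h \<in> carrier K \<rightarrow>\<^sub>E elts B j \<Longrightarrow>
   pmul i j (padd i f g) h = padd (i + j) (pmul i j f h) (pmul i j g h)"
  unfolding padd_def[of "i + j"] unfolding pmul_def
  by (intro restrict_ext) (simp add: mult_add_left PiE_mem[of f "carrier K" "\<lambda>_. elts B i"]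
     PiE_mem[of g "carrier K" "\<lambda>_. elts B i"] PiE_mem[of h "carrier K" "\<lambda>_. elts B j"])

lemma pmul_PiE: "f \<in> carrier K \<rightarrow>\<^sub>E elts B i \<Longrightarrow> g \<in> carrier K \<rightarrow>\<^sub>E elts B j \<Longrightarrow> pmul i j f g \<in> carrier K \<rightarrow>\<^sub>E elts B (i + j)"
  by (auto simp: pmul_def PiE_iff)

lemma padd_swap:
  assumes "a \<in> carrier K \<rightarrow>\<^sub>E elts B n" "b \<in> carrier K \<rightarrow>\<^sub>E elts B n" "c \<in> carrier K \<rightarrow>\<^sub>E elts B n" "d \<in> carrier K \<rightarrow>\<^sub>E elts B n"
  shows "padd n (padd n a b) (padd n c d) = padd n (padd n a c) (padd n b d)"
  unfolding padd_def[of n "padd n _ _"]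
  by (intro restrict_ext) (simp add: P.a_ac PiE_mem[OF assms(1)] PiE_mem[OF assms(2)] PiE_mem[OF assms(3)] PiE_mem[OF assms(4)])

text \<open>Leibniz's rule, joined with a property of the integrals \<open>H\<close> and \<open>H'\<close> of the two products over
  the unit interval: up to commutators they differ by the sign of the exchange. For monomials \<open>a
  t\<^sup>k\<close> and \<open>b t\<^sup>l\<close> both integrals have the same factor \<open>1 / (k + l + 1)\<close>, which leaves a multiple of
  one commutator.\<close>

definition product_rule where
  "product_rule i j f f' g g' \<longleftrightarrow> (\<exists>H u H'.
     PD (i + j) (pmul i j f g) (padd (i + j) (pmul i j f' g) (pmul i j f g')) H \<and>
     PD (i + j) (pmul j i g f) u H' \<and>
     H \<one>\<^bsub>K\<^esub> \<ominus>\<^bsub>piece B (i + j)\<^esub> sign K (i * j) \<odot>\<^bsub>piece B (i + j)\<^esub> H' \<one>\<^bsub>K\<^esub> \<in> commutators K B (i + j))"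

lemma product_rule_combine:
  assumes "PD n p p' H" "PD n q u H'" "H \<one>\<^bsub>K\<^esub> \<ominus>\<^bsub>piece B n\<^esub> s \<odot>\<^bsub>piece B n\<^esub> H' \<one>\<^bsub>K\<^esub> \<in> commutators K B n"
    and "PD n p2 p2' H2" "PD n q2 u2 H2'" "H2 \<one>\<^bsub>K\<^esub> \<ominus>\<^bsub>piece B n\<^esub> s \<odot>\<^bsub>piece B n\<^esub> H2' \<one>\<^bsub>K\<^esub> \<in> commutators K B n"
    and s: "s \<in> carrier K"
  shows "\<exists>H u H'. PD n (padd n p p2) (padd n p' p2') H \<and> PD n (padd n q q2) u H' \<and>
    H \<one>\<^bsub>K\<^esub> \<ominus>\<^bsub>piece B n\<^esub> s \<odot>\<^bsub>piece B n\<^esub> H' \<one>\<^bsub>K\<^esub> \<in> commutators K B n"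
proof -
  have "padd n H H2 \<one>\<^bsub>K\<^esub> \<ominus>\<^bsub>piece B n\<^esub> s \<odot>\<^bsub>piece B n\<^esub> padd n H' H2' \<one>\<^bsub>K\<^esub> =
      (H \<one>\<^bsub>K\<^esub> \<ominus>\<^bsub>piece B n\<^esub> s \<odot>\<^bsub>piece B n\<^esub> H' \<one>\<^bsub>K\<^esub>) \<oplus>\<^bsub>piece B n\<^esub>
      (H2 \<one>\<^bsub>K\<^esub> \<ominus>\<^bsub>piece B n\<^esub> s \<odot>\<^bsub>piece B n\<^esub> H2' \<one>\<^bsub>K\<^esub>)"
    using PD_mem(3)[OF assms(1)] PD_mem(3)[OF assms(2)] PD_mem(3)[OF assms(4)] PD_mem(3)[OF assms(5)] s
    by (simp add: P.minus_eq P.minus_add P.smult_r_distr P.a_ac)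
  then show ?thesis
    using PD.add[OF assms(1,4)] PD.add[OF assms(2,5)] C.H_add[OF assms(3,6)] by metis
qed

lemma PD_mult: "PD i f f' F \<Longrightarrow> PD j g g' G \<Longrightarrow> product_rule i j f f' g g'"
proof (induction rule: PD.induct)
  case (mono a i k)
  note a = mono(1)
  show ?case using mono(2)
  proof (induction rule: PD.induct)
    case (mono b j l)
    have ab: "gmult B i j a b \<in> elts B (i + j)" "gmult B j i b a \<in> elts B (i + j)" using a mono by simp_all
    have w: "\<nu>inv (Suc (k + l)) \<in> carrier K" by simp
    have ji: "j + i = i + j" "l + k = k + l" by simp_all
    have c: "pmono (i + j) (Suc (k + l)) (\<nu>inv (Suc (k + l))) (gmult B i j a b) \<one>\<^bsub>K\<^esub> \<ominus>\<^bsub>piece B (i + j)\<^esub>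
       sign K (i * j) \<odot>\<^bsub>piece B (i + j)\<^esub> pmono (i + j) (Suc (k + l)) (\<nu>inv (Suc (k + l))) (gmult B j i b a) \<one>\<^bsub>K\<^esub> =
       \<nu>inv (Suc (k + l)) \<odot>\<^bsub>piece B (i + j)\<^esub> (gmult B i j a b \<ominus>\<^bsub>piece B (i + j)\<^esub>
         sign K (i * j) \<odot>\<^bsub>piece B (i + j)\<^esub> gmult B j i b a)"
      using ab w by (simp add: P.minus_eq P.smult_r_distr P.smult_r_minus smult_comm[of "sign K (i * j)"])
    show ?case
      unfolding product_rule_def pmono_product[OF a mono]
      using PD.mono[OF ab(1), of "k + l"] PD.mono[OF ab(2), of "k + l"] pmono_product(1)[OF mono a, of l k]
        C.smult_closed[OF w commutator_mem[OF a mono HOL.refl HOL.refl]] unfolding c[symmetric] ji by metis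
  next
    case (add j g g' G h h' H)
    let ?m = "pmono i k \<one>\<^bsub>K\<^esub> a" and ?m' = "pmono i (k - 1) (\<nu> k) a"
    have m: "?m \<in> carrier K \<rightarrow>\<^sub>E elts B i" "?m' \<in> carrier K \<rightarrow>\<^sub>E elts B i" using a by simp_all
    note g = PD_PiE[OF add(1)] and h = PD_PiE[OF add(2)]
    have e: "pmul i j ?m (padd j g h) = padd (i + j) (pmul i j ?m g) (pmul i j ?m h)"
      "pmul j i (padd j g h) ?m = padd (i + j) (pmul j i g ?m) (pmul j i h ?m)"
      "padd (i + j) (pmul i j ?m' (padd j g h)) (pmul i j ?m (padd j g' h')) =
       padd (i + j) (padd (i + j) (pmul i j ?m' g) (pmul i j ?m g')) (padd (i + j) (pmul i j ?m' h) (pmul i j ?m h'))"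
      using m g h by (simp_all add: pmul_padd_right pmul_padd_left padd_swap pmul_PiE add.commute[of j i])
    show ?case
      using add.IH unfolding product_rule_def e
      by (elim exE conjE) (rule product_rule_combine; (assumption | rule sign_closed))
  qed
next
  case (add i f f' F h h' H)
  note f = PD_PiE[OF add(1)] and h = PD_PiE[OF add(2)] and g = PD_PiE[OF add(5)]
  have e: "pmul i j (padd i f h) g = padd (i + j) (pmul i j f g) (pmul i j h g)"
      "pmul j i g (padd i f h) = padd (i + j) (pmul j i g f) (pmul j i g h)"
      "padd (i + j) (pmul i j (padd i f' h') g) (pmul i j (padd i f h) g') =
       padd (i + j) (padd (i + j) (pmul i j f' g) (pmul i j f g')) (padd (i + j) (pmul i j h' g) (pmul i j h g'))"
    using f g h by (simp_all add: pmul_padd_right pmul_padd_left padd_swap pmul_PiE add.commute[of j i])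
  show ?case
    using add.IH(1)[OF add(5)] add.IH(2)[OF add(5)] unfolding product_rule_def e
    by (elim exE conjE) (rule product_rule_combine; (assumption | rule sign_closed))
qed

subsection \<open>The algebra of polynomial functions\<close>

definition psmult :: "int \<Rightarrow> 'k \<Rightarrow> ('k \<Rightarrow> 'a) \<Rightarrow> 'k \<Rightarrow> 'a" where
  "psmult n c f = (\<lambda>t\<in>carrier K. c \<odot>\<^bsub>piece B n\<^esub> f t)"

definition pbdry :: "int \<Rightarrow> ('k \<Rightarrow> 'a) \<Rightarrow> 'k \<Rightarrow> 'a" where
  "pbdry n f = (\<lambda>t\<in>carrier K. bdry B n (f t))"

definition pconst :: "'a \<Rightarrow> 'k \<Rightarrow> 'a" where
  "pconst b = (\<lambda>t\<in>carrier K. b)"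

lemma papply [simp]:
  "t \<in> carrier K \<Longrightarrow> psmult n c f t = c \<odot>\<^bsub>piece B n\<^esub> f t"
  "t \<in> carrier K \<Longrightarrow> pbdry n f t = bdry B n (f t)"
  "t \<in> carrier K \<Longrightarrow> pconst b t = b"
  by (simp_all add: psmult_def pbdry_def pconst_def)

definition R :: "('k, 'k \<Rightarrow> 'a) dga" where
  "R = \<lparr>
     piece = (\<lambda>n. \<lparr>carrier = {f. \<exists>f' F. PD n f f' F}, mult = undefined, one = undefined,
        zero = pconst \<zero>\<^bsub>piece B n\<^esub>, add = padd n, smult = psmult n\<rparr>),
     bdry = pbdry, gmult = pmul, gone = pconst (gone B)\<rparr>"

lemma R_simps [simp]:
  "\<zero>\<^bsub>piece R n\<^esub> = pconst \<zero>\<^bsub>piece B n\<^esub>" "f \<oplus>\<^bsub>piece R n\<^esub> g = padd n f g"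
  "c \<odot>\<^bsub>piece R n\<^esub> f = psmult n c f" "bdry R n f = pbdry n f" "gmult R i j f g = pmul i j f g"
  "gone R = pconst (gone B)"
  by (simp_all add: R_def)

lemma R_elts: "f \<in> elts R n \<longleftrightarrow> (\<exists>f' F. PD n f f' F)"
  by (simp add: R_def)

lemma R_mem [simp]: "f \<in> elts R n \<Longrightarrow> t \<in> carrier K \<Longrightarrow> f t \<in> elts B n"
  using PD_mem(1) by (auto simp: R_elts)

lemma R_PiE: "f \<in> elts R n \<Longrightarrow> f \<in> carrier K \<rightarrow>\<^sub>E elts B n"
  unfolding R_elts using PD_PiE by blast

lemma R_eqI: "f \<in> elts R n \<Longrightarrow> g \<in> elts R n \<Longrightarrow> (\<And>t. t \<in> carrier K \<Longrightarrow> f t = g t) \<Longrightarrow> f = g"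
  using PiE_eqI R_PiE by blast

lemma R_padd: "f \<in> elts R n \<Longrightarrow> g \<in> elts R n \<Longrightarrow> padd n f g \<in> elts R n"
  unfolding R_elts by (elim exE) (rule exI, rule exI, erule (1) PD.add)

lemma R_psmult: "c \<in> carrier K \<Longrightarrow> f \<in> elts R n \<Longrightarrow> psmult n c f \<in> elts R n"
  unfolding R_elts psmult_def by (elim exE) (rule exI, rule exI, erule (1) PD_smult)

lemma R_pbdry: "f \<in> elts R n \<Longrightarrow> m = n - 1 \<Longrightarrow> pbdry n f \<in> elts R m"
  unfolding R_elts pbdry_def by (elim exE, simp only:) (rule exI, rule exI, erule PD_bdry)

lemma R_pconst: "b \<in> elts B n \<Longrightarrow> pconst b \<in> elts R n"
  unfolding R_elts pconst_def using PD_const[of b n] by blast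

lemma R_pmul: "f \<in> elts R i \<Longrightarrow> g \<in> elts R j \<Longrightarrow> i + j = n \<Longrightarrow> pmul i j f g \<in> elts R n"
  unfolding R_elts using PD_mult[unfolded product_rule_def, of i f _ _ j g] by blast

lemmas R_closed = R_padd R_psmult R_pbdry R_pconst R_pmul

lemma R_galg: "graded_algebra K R"
proof -
  have mod: "module K (piece R n)" for n
  proof (rule moduleI[OF is_cring])
    show "abelian_group (piece R n)"
    proof (rule abelian_groupI)
      fix f assume f: "f \<in> elts R n"
      have "psmult n (\<ominus>\<^bsub>K\<^esub> \<one>\<^bsub>K\<^esub>) f \<oplus>\<^bsub>piece R n\<^esub> f = \<zero>\<^bsub>piece R n\<^esub>"
        by (rule R_eqI[of _ n]) (use f in \<open>auto simp: R_closed P.smult_l_minus P.l_neg\<close>)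
      then show "\<exists>g\<in>elts R n. g \<oplus>\<^bsub>piece R n\<^esub> f = \<zero>\<^bsub>piece R n\<^esub>"
        using R_closed(2)[OF _ f, of "\<ominus>\<^bsub>K\<^esub> \<one>\<^bsub>K\<^esub>"] by blast
    next
      fix f g h assume "f \<in> elts R n" "g \<in> elts R n" "h \<in> elts R n"
      then show "f \<oplus>\<^bsub>piece R n\<^esub> g \<oplus>\<^bsub>piece R n\<^esub> h = f \<oplus>\<^bsub>piece R n\<^esub> (g \<oplus>\<^bsub>piece R n\<^esub> h)"
        by (intro R_eqI[of _ n]) (simp_all add: R_closed P.a_assoc)
    next
      fix f g assume "f \<in> elts R n" "g \<in> elts R n"
      then show "f \<oplus>\<^bsub>piece R n\<^esub> g = g \<oplus>\<^bsub>piece R n\<^esub> f"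
        by (intro R_eqI[of _ n]) (simp_all add: R_closed P.a_comm)
    next
      fix f assume "f \<in> elts R n"
      then show "\<zero>\<^bsub>piece R n\<^esub> \<oplus>\<^bsub>piece R n\<^esub> f = f" by (intro R_eqI[of _ n]) (simp_all add: R_closed)
    qed (simp_all add: R_closed)
  next
    fix c d f assume "c \<in> carrier K" "d \<in> carrier K" "f \<in> elts R n"
    then show "(c \<oplus>\<^bsub>K\<^esub> d) \<odot>\<^bsub>piece R n\<^esub> f = c \<odot>\<^bsub>piece R n\<^esub> f \<oplus>\<^bsub>piece R n\<^esub> d \<odot>\<^bsub>piece R n\<^esub> f"
      "(c \<otimes>\<^bsub>K\<^esub> d) \<odot>\<^bsub>piece R n\<^esub> f = c \<odot>\<^bsub>piece R n\<^esub> (d \<odot>\<^bsub>piece R n\<^esub> f)"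
      by (intro R_eqI[of _ n]; simp add: R_closed P.smult_l_distr P.smult_assoc1)+
  next
    fix c f g assume "c \<in> carrier K" "f \<in> elts R n" "g \<in> elts R n"
    then show "c \<odot>\<^bsub>piece R n\<^esub> (f \<oplus>\<^bsub>piece R n\<^esub> g) = c \<odot>\<^bsub>piece R n\<^esub> f \<oplus>\<^bsub>piece R n\<^esub> c \<odot>\<^bsub>piece R n\<^esub> g"
      by (intro R_eqI[of _ n]) (simp_all add: R_closed P.smult_r_distr)
  next
    fix f assume "f \<in> elts R n"
    then show "\<one>\<^bsub>K\<^esub> \<odot>\<^bsub>piece R n\<^esub> f = f" by (intro R_eqI[of _ n]) (simp_all add: R_closed)
  qed (simp add: R_closed)
  show ?thesis
  proof (rule graded_algebraI[OF mod])
    fix i j f g h assume "f \<in> elts R i" "g \<in> elts R j" "h \<in> elts R j"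
    then show "gmult R i j f (g \<oplus>\<^bsub>piece R j\<^esub> h) = gmult R i j f g \<oplus>\<^bsub>piece R (i + j)\<^esub> gmult R i j f h"
      by (intro R_eqI[of _ "i + j"]) (simp_all add: R_closed mult_add_right)
  next
    fix i j f g h assume "f \<in> elts R i" "g \<in> elts R i" "h \<in> elts R j"
    then show "gmult R i j (f \<oplus>\<^bsub>piece R i\<^esub> g) h = gmult R i j f h \<oplus>\<^bsub>piece R (i + j)\<^esub> gmult R i j g h"
      by (intro R_eqI[of _ "i + j"]) (simp_all add: R_closed mult_add_left)
  next
    fix i j f g c assume "c \<in> carrier K" "f \<in> elts R i" "g \<in> elts R j"
    then show "gmult R i j f (c \<odot>\<^bsub>piece R j\<^esub> g) = c \<odot>\<^bsub>piece R (i + j)\<^esub> gmult R i j f g"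
      "gmult R i j (c \<odot>\<^bsub>piece R i\<^esub> f) g = c \<odot>\<^bsub>piece R (i + j)\<^esub> gmult R i j f g"
      by (intro R_eqI[of _ "i + j"]; simp add: R_closed mult_smult_left mult_smult_right)+
  next
    fix i j l f g h assume "f \<in> elts R i" "g \<in> elts R j" "h \<in> elts R l"
    then show "gmult R (i + j) l (gmult R i j f g) h = gmult R i (j + l) f (gmult R j l g h)"
      by (intro R_eqI[of _ "i + j + l"]) (simp_all add: R_closed mult_assoc)
  next
    fix i f assume "f \<in> elts R i"
    then show "gmult R 0 i (gone R) f = f" "gmult R i 0 f (gone R) = f"
      by (intro R_eqI[of _ i]; simp add: R_closed)+
  qed (simp_all add: R_closed)
qed

lemma R_dga: "is_dga K R"
  unfolding is_dga_iff
proof (intro conjI R_galg)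
  interpret R: galg K R by unfold_locales (rule R_galg)
  show "is_complex K R"
    unfolding is_complex_def linear_map_def
  proof (intro allI conjI ballI)
    fix n
    show "module K (piece R n)" by (rule R.P.module_axioms)
    show "bdry R n \<in> elts R n \<rightarrow> elts R (n - 1)" by (simp add: R_closed)
    fix f assume f: "f \<in> elts R n"
    then show "bdry R (n - 1) (bdry R n f) = \<zero>\<^bsub>piece R (n - 1 - 1)\<^esub>"
      using bdry_bdry[of _ n "n - 1" "n - 2"] by (intro R_eqI[of _ "n - 2"]) (simp_all add: R_closed)
    show "bdry R n (f \<oplus>\<^bsub>piece R n\<^esub> g) = bdry R n f \<oplus>\<^bsub>piece R (n - 1)\<^esub> bdry R n g" if "g \<in> elts R n" for g
      using f that by (intro R_eqI[of _ "n - 1"]) (simp_all add: R_closed bdry_add)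
    show "bdry R n (c \<odot>\<^bsub>piece R n\<^esub> f) = c \<odot>\<^bsub>piece R (n - 1)\<^esub> bdry R n f" if "c \<in> carrier K" for c
      using f that by (intro R_eqI[of _ "n - 1"]) (simp_all add: R_closed bdry_smult)
  qed
  show "\<forall>i j. \<forall>f\<in>elts R i. \<forall>g\<in>elts R j. bdry R (i + j) (gmult R i j f g) =
      gmult R (i - 1) j (bdry R i f) g \<oplus>\<^bsub>piece R (i + j - 1)\<^esub>
      sign K i \<odot>\<^bsub>piece R (i + j - 1)\<^esub> gmult R i (j - 1) f (bdry R j g)"
  proof (intro allI ballI)
    fix i j f g assume "f \<in> elts R i" "g \<in> elts R j"
    then show "bdry R (i + j) (gmult R i j f g) =
      gmult R (i - 1) j (bdry R i f) g \<oplus>\<^bsub>piece R (i + j - 1)\<^esub>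
      sign K i \<odot>\<^bsub>piece R (i + j - 1)\<^esub> gmult R i (j - 1) f (bdry R j g)"
      by (intro R_eqI[of _ "i + j - 1"]) (simp_all add: R_closed leibniz)
  qed
qed

definition Dp :: "int \<Rightarrow> ('k \<Rightarrow> 'a) \<Rightarrow> 'k \<Rightarrow> 'a" where
  "Dp n f = (THE f'. \<exists>F. PD n f f' F)"

definition Ip :: "int \<Rightarrow> ('k \<Rightarrow> 'a) \<Rightarrow> 'k \<Rightarrow> 'a" where
  "Ip n f = (THE F. \<exists>f'. PD n f f' F)"

lemma PD_D: "PD n f f' F \<Longrightarrow> Dp n f = f'" and PD_I: "PD n f f' F \<Longrightarrow> Ip n f = F"
  unfolding Dp_def Ip_def using PD_unique by blast+

lemma PD_ops: "f \<in> elts R n \<Longrightarrow> PD n f (Dp n f) (Ip n f)"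
  using PD_D PD_I by (auto simp: R_elts)

end

context polynomials begin

lemma Dp_closed: "f \<in> elts R n \<Longrightarrow> Dp n f \<in> elts R n"
  and Ip_closed: "f \<in> elts R n \<Longrightarrow> Ip n f \<in> elts R n"
  and Dp_Ip: "f \<in> elts R n \<Longrightarrow> Dp n (Ip n f) = f"
  and Ip_Dp: "f \<in> elts R n \<Longrightarrow> t \<in> carrier K \<Longrightarrow> Ip n (Dp n f) t = f t \<ominus>\<^bsub>piece B n\<^esub> f \<zero>\<^bsub>K\<^esub>"
  and Ip_zero: "f \<in> elts R n \<Longrightarrow> Ip n f \<zero>\<^bsub>K\<^esub> = \<zero>\<^bsub>piece B n\<^esub>"
proof -
  assume f: "f \<in> elts R n"
  note o = PD_ops[OF f]
  obtain f'' G where d: "PD n (Dp n f) f'' (\<lambda>t\<in>carrier K. f t \<ominus>\<^bsub>piece B n\<^esub> f \<zero>\<^bsub>K\<^esub>)" "PD n (Ip n f) f G"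
    using PD_deriv[OF o] by blast
  show "Dp n f \<in> elts R n" "Ip n f \<in> elts R n" using d by (auto simp: R_elts)
  show "Dp n (Ip n f) = f" using PD_D[OF d(2)] .
  show "t \<in> carrier K \<Longrightarrow> Ip n (Dp n f) t = f t \<ominus>\<^bsub>piece B n\<^esub> f \<zero>\<^bsub>K\<^esub>" using PD_I[OF d(1)] by simp
  show "Ip n f \<zero>\<^bsub>K\<^esub> = \<zero>\<^bsub>piece B n\<^esub>" using PD_antiderivative_zero[OF o] .
qed

lemma DI_padd: "f \<in> elts R n \<Longrightarrow> g \<in> elts R n \<Longrightarrow> Dp n (padd n f g) = padd n (Dp n f) (Dp n g)"
  "f \<in> elts R n \<Longrightarrow> g \<in> elts R n \<Longrightarrow> Ip n (padd n f g) = padd n (Ip n f) (Ip n g)"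
  using PD.add[OF PD_ops PD_ops] PD_D PD_I by blast+

lemma DI_psmult: "c \<in> carrier K \<Longrightarrow> f \<in> elts R n \<Longrightarrow> Dp n (psmult n c f) = psmult n c (Dp n f)"
  "c \<in> carrier K \<Longrightarrow> f \<in> elts R n \<Longrightarrow> Ip n (psmult n c f) = psmult n c (Ip n f)"
  using PD_smult[OF PD_ops] PD_D PD_I unfolding psmult_def by blast+

lemma DI_pbdry: "f \<in> elts R n \<Longrightarrow> Dp (n - 1) (pbdry n f) = pbdry n (Dp n f)"
  "f \<in> elts R n \<Longrightarrow> Ip (n - 1) (pbdry n f) = pbdry n (Ip n f)"
  using PD_bdry[OF PD_ops] PD_D PD_I unfolding pbdry_def by blast+

sublocale W: derivation K R Dp
proof
  show "is_dga K R" by (rule R_dga)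
  fix i j f g assume f: "f \<in> elts R i" "g \<in> elts R j"
  have "product_rule i j f (Dp i f) g (Dp j g)" using PD_mult[OF PD_ops PD_ops] f by blast
  then show "Dp (i + j) (gmult R i j f g) = gmult R i j (Dp i f) g \<oplus>\<^bsub>piece R (i + j)\<^esub> gmult R i j f (Dp j g)"
    unfolding product_rule_def R_simps using PD_D by blast
qed (simp_all add: Dp_closed DI_padd DI_psmult DI_pbdry)

sublocale PE: dgalg K W.E
  by unfold_locales (rule W.E_dga)

lemma evaluation: 
  assumes t: "t \<in> carrier K" shows "dgalg_hom K W.E B (\<lambda>n u. fst u t)"
proof -
  have "dga_hom K W.E B (\<lambda>n u. fst u t)"
    unfolding dga_hom_def complex_hom_def linear_map_def using t by auto
  then show ?thesis by unfold_locales (auto simp: W.E_dga is_dga)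
qed

text \<open>If \<open>f + dt g\<close> is a cycle, the derivative of \<open>f\<close> is the boundary of \<open>g\<close>. So \<open>f + dt g\<close> is the
  boundary of \<open>b\<close> plus the integral of \<open>g\<close> from zero, for any \<open>b\<close> whose boundary is the value of \<open>f\<close>
  at zero.\<close>

lemma evaluation_acyclic_fibration: "acyclic_fibration W.E B (\<lambda>n u. fst u \<zero>\<^bsub>K\<^esub>)"
  unfolding acyclic_fibration_def
proof (intro allI ballI impI)
  fix n u b assume u: "u \<in> elts W.E n" "bdry W.E n u = \<zero>\<^bsub>piece W.E (n - 1)\<^esub>"
    and b: "b \<in> elts B (n + 1)" "bdry B (n + 1) b = fst u \<zero>\<^bsub>K\<^esub>"
  obtain f g where fg: "u = (f, g)" "f \<in> elts R n" "g \<in> elts R (n + 1)" using u(1) by auto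
  have eq: "Dp n f \<ominus>\<^bsub>piece R n\<^esub> bdry R (n + 1) g = \<zero>\<^bsub>piece R n\<^esub>" using u(2) unfolding fg(1) by simp
  have m: "Dp n f \<in> elts R n" "bdry R (n + 1) g \<in> elts R n" using Dp_closed[OF fg(2)] W.bdry_up[OF fg(3)] by auto
  have "Dp n f \<oplus>\<^bsub>piece R n\<^esub> \<ominus>\<^bsub>piece R n\<^esub> bdry R (n + 1) g = \<zero>\<^bsub>piece R n\<^esub>"
    using eq m by (simp add: W.P.minus_eq del: R_simps)
  from W.P.minus_equality[OF this] m have "Dp n f = bdry R (n + 1) g" by (simp add: W.P.minus_minus del: R_simps)
  then have Dg: "Dp n f = pbdry (n + 1) g" by simp
  define h where "h = padd (n + 1) (pconst b) (Ip (n + 1) g)"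
  have h: "h \<in> elts R (n + 1)" using b(1) Ip_closed[OF fg(3)] by (simp add: h_def R_closed)
  have cst: "Dp (n + 1) (pconst b) = pconst \<zero>\<^bsub>piece B (n + 1)\<^esub>"
    using PD_const[OF b(1)] PD_D unfolding pconst_def by blast
  have gI: "Ip (n + 1) g \<in> elts R (n + 1)" by (rule Ip_closed[OF fg(3)])
  have "Dp (n + 1) h = g"
  proof -
    have "Dp (n + 1) h = padd (n + 1) (pconst \<zero>\<^bsub>piece B (n + 1)\<^esub>) g"
      using DI_padd(1)[OF R_pconst[OF b(1)] gI] cst Dp_Ip[OF fg(3)] by (simp add: h_def)
    also have "\<dots> = g" by (rule R_eqI[of _ "n + 1"]) (use fg(3) in \<open>simp_all add: R_closed\<close>)
    finally show ?thesis .
  qed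
  moreover have "pbdry (n + 1) h = f"
  proof (rule R_eqI[of _ n])
    show "pbdry (n + 1) h \<in> elts R n" using R_pbdry[OF h, of n] by simp
    show "f \<in> elts R n" by fact
    fix t assume t: "t \<in> carrier K"
    have "bdry B (n + 1) (Ip (n + 1) g t) = f t \<ominus>\<^bsub>piece B n\<^esub> f \<zero>\<^bsub>K\<^esub>"
      using DI_pbdry(2)[OF fg(3)] Ip_Dp[OF fg(2) t] Dg papply(2)[OF t, of "n + 1" "Ip (n + 1) g"] by simp
    then show "pbdry (n + 1) h t = f t"
      using t b fg gI by (simp add: h_def bdry_add P.abel)
  qed
  moreover have "padd (n + 1) g (psmult (n + 1) (\<ominus>\<^bsub>K\<^esub> \<one>\<^bsub>K\<^esub>) (pconst \<zero>\<^bsub>piece B (n + 1)\<^esub>)) = g"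
    by (rule R_eqI[of _ "n + 1"]) (use fg(3) in \<open>simp_all add: R_closed\<close>)
  moreover have z: "pconst \<zero>\<^bsub>piece B (n + 2)\<^esub> \<in> elts R (n + 2)" by (simp add: R_closed)
  moreover have "g \<ominus>\<^bsub>piece R (n + 1)\<^esub> bdry R (n + 2) (pconst \<zero>\<^bsub>piece B (n + 2)\<^esub>) = g"
    using W.bdry_zero[of "n + 2"] fg(3) W.P.minus_zero[of g "n + 1"]
    by (simp add: add.commute[of n 1] del: R_simps(4))
  ultimately have "bdry W.E (n + 1) (h, pconst \<zero>\<^bsub>piece B (n + 2)\<^esub>) = u" using fg(1) by (simp add: add.assoc)
  moreover have "fst (h, pconst \<zero>\<^bsub>piece B (n + 2)\<^esub>) \<zero>\<^bsub>K\<^esub> = b"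
    using b(1) Ip_zero[OF fg(3)] by (simp add: h_def)
  moreover have "(h, pconst \<zero>\<^bsub>piece B (n + 2)\<^esub>) \<in> elts W.E (n + 1)" using h z by (simp add: add.assoc)
  ultimately show "\<exists>w\<in>elts W.E (n + 1). bdry W.E (n + 1) w = u \<and> fst w \<zero>\<^bsub>K\<^esub> = b" by blast
qed

definition unit_integral :: "int \<Rightarrow> ('k \<Rightarrow> 'a) \<Rightarrow> 'a" where
  "unit_integral n f = Ip n f \<one>\<^bsub>K\<^esub>"

lemma unit_integral_closed [simp]: "f \<in> elts R n \<Longrightarrow> unit_integral n f \<in> elts B n"
  using Ip_closed by (simp add: unit_integral_def)

lemma unit_integral_padd: "f \<in> elts R n \<Longrightarrow> g \<in> elts R n \<Longrightarrow> unit_integral n (padd n f g) = unit_integral n f \<oplus>\<^bsub>piece B n\<^esub> unit_integral n g"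
  and unit_integral_psmult: "c \<in> carrier K \<Longrightarrow> f \<in> elts R n \<Longrightarrow> unit_integral n (psmult n c f) = c \<odot>\<^bsub>piece B n\<^esub> unit_integral n f"
  and unit_integral_pbdry: "f \<in> elts R n \<Longrightarrow> unit_integral (n - 1) (pbdry n f) = bdry B n (unit_integral n f)"
  and unit_integral_Dp: "f \<in> elts R n \<Longrightarrow> unit_integral n (Dp n f) = f \<one>\<^bsub>K\<^esub> \<ominus>\<^bsub>piece B n\<^esub> f \<zero>\<^bsub>K\<^esub>"
  by (simp_all add: unit_integral_def DI_padd DI_psmult DI_pbdry Ip_Dp)

lemma unit_integral_minus: "f \<in> elts R n \<Longrightarrow> g \<in> elts R n \<Longrightarrow> unit_integral n (f \<ominus>\<^bsub>piece R n\<^esub> g) = unit_integral n f \<ominus>\<^bsub>piece B n\<^esub> unit_integral n g"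
proof -
  assume fg: "f \<in> elts R n" "g \<in> elts R n"
  have "f \<ominus>\<^bsub>piece R n\<^esub> g = padd n f (psmult n (\<ominus>\<^bsub>K\<^esub> \<one>\<^bsub>K\<^esub>) g)"
    using W.P.smult_l_minus[of "\<one>\<^bsub>K\<^esub>" g n] W.P.smult_one[of g n] fg by (simp add: W.P.minus_eq)
  then show ?thesis using fg by (simp add: unit_integral_padd unit_integral_psmult R_closed P.smult_l_minus P.minus_eq)
qed

lemma unit_integral_trace:
  assumes "f \<in> elts R i" "g \<in> elts R j" "i + j = n" "s = sign K (i * j)"
  shows "unit_integral n (pmul i j f g) \<ominus>\<^bsub>piece B n\<^esub> s \<odot>\<^bsub>piece B n\<^esub> unit_integral n (pmul j i g f) \<in> commutators K B n"
  using PD_mult[OF PD_ops[OF assms(1)] PD_ops[OF assms(2)]] assms(3,4) PD_I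
  unfolding product_rule_def unit_integral_def by blast

text \<open>Stokes's formula on the unit interval: the integral of the \<open>dt\<close> part is a chain homotopy
  between the two ends of a path.\<close>

lemma path_homotopy:
  assumes u: "u \<in> elts W.E n"
  shows "unit_integral n (snd (bdry W.E n u)) = (fst u \<one>\<^bsub>K\<^esub> \<ominus>\<^bsub>piece B n\<^esub> fst u \<zero>\<^bsub>K\<^esub>) \<ominus>\<^bsub>piece B n\<^esub> bdry B (n + 1) (unit_integral (n + 1) (snd u))"
proof -
  obtain f g where fg: "u = (f, g)" "f \<in> elts R n" "g \<in> elts R (n + 1)" using u by auto
  have b: "pbdry (n + 1) g \<in> elts R n" using R_pbdry[OF fg(3), of n] by simp
  show ?thesis
    using unit_integral_minus[OF Dp_closed[OF fg(2)] b] unit_integral_Dp[OF fg(2)] unit_integral_pbdry[OF fg(3)] unfolding fg(1) by simp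
qed

lemma evaluations_homologous: "homologous W.E B (\<lambda>n u. fst u \<zero>\<^bsub>K\<^esub>) (\<lambda>n u. fst u \<one>\<^bsub>K\<^esub>)"
  unfolding homologous_def
proof (intro allI ballI impI)
  fix n u assume u: "u \<in> elts W.E n" "bdry W.E n u = \<zero>\<^bsub>piece W.E (n - 1)\<^esub>"
  have f: "fst u \<in> elts R n" and g: "snd u \<in> elts R (n + 1)" using u(1) by auto
  have d: "bdry B (n + 1) (unit_integral (n + 1) (snd u)) \<in> elts B n" using bdry_closed[OF unit_integral_closed[OF g], of n] by simp
  have "unit_integral n (pconst \<zero>\<^bsub>piece B n\<^esub>) = \<zero>\<^bsub>piece B n\<^esub>"
    using unit_integral_minus[of "pconst \<zero>\<^bsub>piece B n\<^esub>" n "pconst \<zero>\<^bsub>piece B n\<^esub>"] W.P.minus_self[of "pconst \<zero>\<^bsub>piece B n\<^esub>" n]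
    by (simp add: R_closed)
  then have z: "(fst u \<one>\<^bsub>K\<^esub> \<ominus>\<^bsub>piece B n\<^esub> fst u \<zero>\<^bsub>K\<^esub>) \<ominus>\<^bsub>piece B n\<^esub> bdry B (n + 1) (unit_integral (n + 1) (snd u)) = \<zero>\<^bsub>piece B n\<^esub>"
    using path_homotopy[OF u(1)] unfolding u(2) by simp
  have "fst u \<zero>\<^bsub>K\<^esub> \<ominus>\<^bsub>piece B n\<^esub> fst u \<one>\<^bsub>K\<^esub> = \<ominus>\<^bsub>piece B n\<^esub> bdry B (n + 1) (unit_integral (n + 1) (snd u))"
  proof -
    have "fst u \<zero>\<^bsub>K\<^esub> \<ominus>\<^bsub>piece B n\<^esub> fst u \<one>\<^bsub>K\<^esub> = \<ominus>\<^bsub>piece B n\<^esub> ((fst u \<one>\<^bsub>K\<^esub> \<ominus>\<^bsub>piece B n\<^esub> fst u \<zero>\<^bsub>K\<^esub>) \<ominus>\<^bsub>piece B n\<^esub>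
       bdry B (n + 1) (unit_integral (n + 1) (snd u))) \<ominus>\<^bsub>piece B n\<^esub> bdry B (n + 1) (unit_integral (n + 1) (snd u))"
      using f d by (simp add: P.abel)
    then show ?thesis unfolding z using d by (simp add: P.minus_eq)
  qed
  then show "fst u \<zero>\<^bsub>K\<^esub> \<ominus>\<^bsub>piece B n\<^esub> fst u \<one>\<^bsub>K\<^esub> \<in> boundaries B n"
    using boundaries_neg[OF boundariesI[OF unit_integral_closed[OF g]]] by simp
qed

text \<open>The chain homotopy descends to commutator quotients. In the \<open>dt\<close> part of \<open>[H a, H b]\<close> the
  terms pair off into two products of a polynomial with a \<open>dt\<close> part and the same products in the
  other order; the signs are those of their exchange.\<close>

lemma homotopy_commutators:
  assumes H: "dgalg_hom K A W.E H" and x: "x \<in> commutators K A n"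
  shows "unit_integral (n + 1) (snd (H n x)) \<in> commutators K B (n + 1)"
proof -
  interpret H: dgalg_hom K A W.E H by fact
  have Hm: "fst (H i a) \<in> elts R i" "snd (H i a) \<in> elts R (i + 1)" if "a \<in> elts A i" for a i
    using H.hom_closed[OF that] by auto
  have lin: "linear_map K (piece A n) (piece B (n + 1)) (\<lambda>x. unit_integral (n + 1) (snd (H n x)))"
  proof -
    have "snd (u \<oplus>\<^bsub>piece W.E n\<^esub> v) = padd (n + 1) (snd u) (snd v)" "snd (c \<odot>\<^bsub>piece W.E n\<^esub> u) = psmult (n + 1) c (snd u)" for c u v
      by (cases u; cases v; simp)+
    then show ?thesis
      unfolding linear_map_def using Hm by (auto simp: H.hom_add H.hom_smult unit_integral_padd unit_integral_psmult)
  qed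
  show ?thesis
  proof (rule commutators_image[OF H.A.galg_axioms commutators_quotient lin _ x])
    fix i j a b assume ab: "a \<in> elts A i" "b \<in> elts A j" "i + j = n"
    obtain f g where fg: "H i a = (f, g)" "f \<in> elts R i" "g \<in> elts R (i + 1)" using H.hom_closed[OF ab(1)] by auto
    obtain f' g' where fg': "H j b = (f', g')" "f' \<in> elts R j" "g' \<in> elts R (j + 1)" using H.hom_closed[OF ab(2)] by auto
    let ?s = "sign K (i * j)"
    have ji: "j + i = n" "i + 1 + j = n + 1" "i + (j + 1) = n + 1" "j + 1 + i = n + 1" "j + (i + 1) = n + 1" using ab(3) by auto
    let ?p = "unit_integral (n + 1) (pmul (i + 1) j g f')" and ?q = "unit_integral (n + 1) (pmul i (j + 1) f g')"
      and ?p' = "unit_integral (n + 1) (pmul j (i + 1) f' g)" and ?q' = "unit_integral (n + 1) (pmul (j + 1) i g' f)"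
    have m: "pmul (i + 1) j g f' \<in> elts R (n + 1)" "pmul i (j + 1) f g' \<in> elts R (n + 1)"
      "pmul j (i + 1) f' g \<in> elts R (n + 1)" "pmul (j + 1) i g' f \<in> elts R (n + 1)"
      using fg fg' ji by (simp_all add: R_closed)
    have L: "(\<lambda>x. unit_integral (n + 1) (snd (H n x))) (gmult A i j a b \<ominus>\<^bsub>piece A n\<^esub> ?s \<odot>\<^bsub>piece A n\<^esub> gmult A j i b a) =
      unit_integral (n + 1) (snd (H n (gmult A i j a b))) \<ominus>\<^bsub>piece B (n + 1)\<^esub> ?s \<odot>\<^bsub>piece B (n + 1)\<^esub> unit_integral (n + 1) (snd (H n (gmult A j i b a)))"
    proof -
      have c: "gmult A i j a b \<in> elts A n" "gmult A j i b a \<in> elts A n" using ab ji by auto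
      have "f (x \<ominus>\<^bsub>piece A n\<^esub> c \<odot>\<^bsub>piece A n\<^esub> y) = f x \<ominus>\<^bsub>piece B (n + 1)\<^esub> c \<odot>\<^bsub>piece B (n + 1)\<^esub> f y"
        if "linear_map K (piece A n) (piece B (n + 1)) f" "x \<in> elts A n" "y \<in> elts A n" "c \<in> carrier K" for f x y c
      proof -
        have "x \<ominus>\<^bsub>piece A n\<^esub> c \<odot>\<^bsub>piece A n\<^esub> y = x \<oplus>\<^bsub>piece A n\<^esub> (\<ominus>\<^bsub>K\<^esub> c) \<odot>\<^bsub>piece A n\<^esub> y"
          using that by (simp add: H.A.P.minus_eq H.A.P.smult_l_minus)
        moreover have "f x \<in> elts B (n + 1)" "f y \<in> elts B (n + 1)" using that by (auto simp: linear_map_def)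
        ultimately show ?thesis using that by (simp add: linear_map_def P.minus_eq P.smult_l_minus)
      qed
      from this[OF lin c, of ?s] show ?thesis by simp
    qed
    have ab1: "unit_integral (n + 1) (snd (H n (gmult A i j a b))) = ?p \<oplus>\<^bsub>piece B (n + 1)\<^esub> sign K i \<odot>\<^bsub>piece B (n + 1)\<^esub> ?q"
      using H.hom_mult[OF ab(1,2), of n] ab(3) m unfolding fg(1) fg'(1) by (simp add: unit_integral_padd unit_integral_psmult R_closed)
    have ba1: "unit_integral (n + 1) (snd (H n (gmult A j i b a))) = ?q' \<oplus>\<^bsub>piece B (n + 1)\<^esub> sign K j \<odot>\<^bsub>piece B (n + 1)\<^esub> ?p'"
      using H.hom_mult[OF ab(2,1), of n] ji m unfolding fg(1) fg'(1) by (simp add: unit_integral_padd unit_integral_psmult R_closed)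
    have "?p \<ominus>\<^bsub>piece B (n + 1)\<^esub> sign K ((i + 1) * j) \<odot>\<^bsub>piece B (n + 1)\<^esub> ?p' \<in> commutators K B (n + 1)"
      using unit_integral_trace[OF fg(3) fg'(2) ji(2) HOL.refl] .
    moreover have "sign K i \<odot>\<^bsub>piece B (n + 1)\<^esub> (?q \<ominus>\<^bsub>piece B (n + 1)\<^esub> sign K (i * (j + 1)) \<odot>\<^bsub>piece B (n + 1)\<^esub> ?q')
        \<in> commutators K B (n + 1)"
      using unit_integral_trace[OF fg(2) fg'(3) ji(3) HOL.refl] by (intro C.smult_closed) simp_all
    moreover have "(?p \<oplus>\<^bsub>piece B (n + 1)\<^esub> sign K i \<odot>\<^bsub>piece B (n + 1)\<^esub> ?q) \<ominus>\<^bsub>piece B (n + 1)\<^esub>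
        ?s \<odot>\<^bsub>piece B (n + 1)\<^esub> (?q' \<oplus>\<^bsub>piece B (n + 1)\<^esub> sign K j \<odot>\<^bsub>piece B (n + 1)\<^esub> ?p') =
      (?p \<ominus>\<^bsub>piece B (n + 1)\<^esub> sign K ((i + 1) * j) \<odot>\<^bsub>piece B (n + 1)\<^esub> ?p') \<oplus>\<^bsub>piece B (n + 1)\<^esub>
      sign K i \<odot>\<^bsub>piece B (n + 1)\<^esub> (?q \<ominus>\<^bsub>piece B (n + 1)\<^esub> sign K (i * (j + 1)) \<odot>\<^bsub>piece B (n + 1)\<^esub> ?q')"
      using m by (cases "even i"; cases "even j")
        (simp_all add: sign_smult P.minus_eq P.minus_add P.minus_minus P.a_ac)
    ultimately show "unit_integral (n + 1) (snd (H n (gmult A i j a b \<ominus>\<^bsub>piece A n\<^esub> ?s \<odot>\<^bsub>piece A n\<^esub> gmult A j i b a)))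
        \<in> commutators K B (n + 1)"
      using C.H_add unfolding L[simplified] ab1 ba1 by simp
  qed
qed

text \<open>A cycle of the commutator quotient is represented by an \<open>a\<close> whose boundary is a sum of
  commutators. In the homotopy formula for \<open>a\<close> the term with that boundary vanishes modulo
  commutators.\<close>

lemma homotopy_natural:
  assumes H: "dgalg_hom K A W.E H"
  shows "homologous (natural K A) (natural K B) (nmap K A B (\<lambda>n a. fst (H n a) \<zero>\<^bsub>K\<^esub>)) (nmap K A B (\<lambda>n a. fst (H n a) \<one>\<^bsub>K\<^esub>))"
proof -
  interpret H: dgalg_hom K A W.E H by fact
  interpret f0: dgalg_hom K A B "\<lambda>n a. fst (H n a) \<zero>\<^bsub>K\<^esub>" by (rule dga_hom_comp[OF H evaluation]) simp
  interpret f1: dgalg_hom K A B "\<lambda>n a. fst (H n a) \<one>\<^bsub>K\<^esub>" by (rule dga_hom_comp[OF H evaluation]) simp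
  show ?thesis
    unfolding homologous_def
  proof (intro allI ballI impI)
    fix n U assume U: "U \<in> elts (natural K A) n" "bdry (natural K A) n U = \<zero>\<^bsub>piece (natural K A) (n - 1)\<^esub>"
    obtain a where a: "U = H.A.cls n a" "a \<in> elts A n" using U(1) by (auto simp: H.A.natural_elts)
    have "H.A.cls (n - 1) (bdry A n a) = H.A.cls (n - 1) \<zero>\<^bsub>piece A (n - 1)\<^esub>" using U(2) a by simp
    then have "bdry A n a \<in> commutators K A (n - 1)"
      using H.A.C.coset_eq[of "bdry A n a" "n - 1" "\<zero>\<^bsub>piece A (n - 1)\<^esub>"] a(2) by simp
    from homotopy_commutators[OF H this]
    have c: "unit_integral n (snd (H (n - 1) (bdry A n a))) \<in> commutators K B n" by simp
    define f s where "f = fst (H n a)" and "s = unit_integral (n + 1) (snd (H n a))"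
    have Ha: "H n a \<in> elts W.E n" using a(2) by (rule H.hom_closed)
    have f: "f \<in> elts R n" and s: "s \<in> elts B (n + 1)" using Ha by (auto simp: f_def s_def)
    have ds: "bdry B (n + 1) s \<in> elts B n" using bdry_closed[OF s, of n] by simp
    have "unit_integral n (snd (H (n - 1) (bdry A n a))) = (f \<one>\<^bsub>K\<^esub> \<ominus>\<^bsub>piece B n\<^esub> f \<zero>\<^bsub>K\<^esub>) \<ominus>\<^bsub>piece B n\<^esub> bdry B (n + 1) s"
      using path_homotopy[OF Ha] H.hom_bdry[OF a(2), of "n - 1"] by (simp add: f_def s_def)
    then have "\<ominus>\<^bsub>piece B n\<^esub> ((f \<one>\<^bsub>K\<^esub> \<ominus>\<^bsub>piece B n\<^esub> f \<zero>\<^bsub>K\<^esub>) \<ominus>\<^bsub>piece B n\<^esub> bdry B (n + 1) s) \<in> commutators K B n"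
      using C.H_neg c by simp
    moreover have "\<ominus>\<^bsub>piece B n\<^esub> ((f \<one>\<^bsub>K\<^esub> \<ominus>\<^bsub>piece B n\<^esub> f \<zero>\<^bsub>K\<^esub>) \<ominus>\<^bsub>piece B n\<^esub> bdry B (n + 1) s) =
        (f \<zero>\<^bsub>K\<^esub> \<ominus>\<^bsub>piece B n\<^esub> f \<one>\<^bsub>K\<^esub>) \<ominus>\<^bsub>piece B n\<^esub> bdry B (n + 1) (\<ominus>\<^bsub>piece B (n + 1)\<^esub> s)"
      using f s ds by (simp add: bdry_neg P.abel)
    ultimately have "cls n (f \<zero>\<^bsub>K\<^esub> \<ominus>\<^bsub>piece B n\<^esub> f \<one>\<^bsub>K\<^esub>) = cls n (bdry B (n + 1) (\<ominus>\<^bsub>piece B (n + 1)\<^esub> s))"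
      using f s ds bdry_neg[OF s] by (subst C.coset_eq) simp_all
    also have "\<dots> = bdry (natural K B) (n + 1) (cls (n + 1) (\<ominus>\<^bsub>piece B (n + 1)\<^esub> s))" using s by simp
    also have "\<dots> \<in> boundaries (natural K B) n"
      using s by (intro N.boundariesI) (auto simp: natural_elts)
    finally show "nmap K A B (\<lambda>n a. fst (H n a) \<zero>\<^bsub>K\<^esub>) n U \<ominus>\<^bsub>piece (natural K B) n\<^esub>
        nmap K A B (\<lambda>n a. fst (H n a) \<one>\<^bsub>K\<^esub>) n U \<in> boundaries (natural K B) n"
      using a f natural_minus[of "f \<zero>\<^bsub>K\<^esub>" n "f \<one>\<^bsub>K\<^esub>"] by (simp add: f_def)
  qed
qed

end

section \<open>Lifting and factorization for DG algebras\<close>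

lemma dga_hom_iff: "dgalg_hom K A B f \<longleftrightarrow> is_dga K A \<and> is_dga K B \<and> dga_hom K A B f"
  by (auto simp: dgalg_hom_def dgalg_def dgalg_hom_axioms_def)

lemma DGA_HomD:
  assumes "u \<in> Hom (DGA K) A B" shows "dgalg_hom K A B (lab u)" "src u = A" "tgt u = B"
  using assms DGA_ArD[of u K] by (auto simp: Hom_def DGA_simps(3,4))

text \<open>Arrows of the category are restricted functions; this makes an arrow of any map of DG
  algebras.\<close>

definition dga_arrow :: "('k, 'a) dga \<Rightarrow> ('k, 'a) dga \<Rightarrow> (int \<Rightarrow> 'a \<Rightarrow> 'a) \<Rightarrow> ('k, 'a) dga_arrow" where
  "dga_arrow A B f = \<lparr>src = A, lab = (\<lambda>n. restrict (f n) (elts A n)), tgt = B\<rparr>"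

lemma dga_arrow_simps [simp]:
  "src (dga_arrow A B f) = A" "tgt (dga_arrow A B f) = B"
  "x \<in> elts A n \<Longrightarrow> lab (dga_arrow A B f) n x = f n x"
  by (simp_all add: dga_arrow_def)

lemma dga_arrow_Hom: "dgalg_hom K A B f \<Longrightarrow> dga_arrow A B f \<in> Hom (DGA K) A B"
  using dga_hom_restrict[of K A B f]
  by (auto simp: dga_hom_iff Hom_def DGA_simps(2-4) dga_map_iff dga_arrow_def)

lemma arrow_eqI:
  assumes "u \<in> Hom (DGA K) A B" "v \<in> Hom (DGA K) A B" "\<And>n x. x \<in> elts A n \<Longrightarrow> lab u n x = lab v n x"
  shows "u = v"
proof -
  have "lab u n = lab v n" for n
    by (rule extensionalityI[of _ "elts A n"]) (use assms in \<open>auto simp: Hom_def DGA_simps(2-4) dga_map_iff\<close>)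
  then show ?thesis using assms(1,2) by (cases u; cases v) (auto simp: Hom_def DGA_simps(3,4))
qed

lemma weq_iff: "u \<in> Hom (DGA K) A B \<Longrightarrow> u \<in> weq (DGA K) \<longleftrightarrow> quasi_iso A B (lab u)"
  by (auto simp: Hom_def DGA_simps(3,4,7))


lemma arrow_acyclic_iff:
  assumes "u \<in> Hom (DGA K) A B"
  shows "u \<in> weq (DGA K) \<inter> fib (DGA K) \<longleftrightarrow> acyclic_fibration A B (lab u)"
proof -
  interpret dgalg_hom K A B "lab u" by (rule DGA_HomD(1)[OF assms])
  show ?thesis using assms acyclic_fibration_iff by (auto simp: Hom_def DGA_simps(3,4,7,8))
qed

lemma cof_DGA:
  fixes K :: "'k ring" and i :: "('k, 'a) dga_arrow"
  shows "i \<in> cof (DGA K) \<longleftrightarrow> i \<in> Ar (DGA K) \<and> has_llp (DGA K) i (weq (DGA K) \<inter> fib (DGA K))"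
proof -
  define C :: "(('k, 'a) dga, ('k, 'a) dga_arrow) category" where "C = graded_category {A. is_dga K A} (dga_map K)"
  define W where "W = {u \<in> Ar C. quasi_iso (src u) (tgt u) (lab u)}"
  define F where "F = {u \<in> Ar C. \<forall>n. lab u n ` elts (src u) n = elts (tgt u) n}"
  have D: "DGA K = relcat.extend (category.extend C (relcat.fields W))
      (model.fields F {i \<in> Ar C. has_llp C i (W \<inter> F)})"
    by (simp add: DGA_def Let_def C_def W_def F_def)
  have e: "Ar (DGA K) = Ar C" "Dom (DGA K) = Dom C" "Cod (DGA K) = Cod C" "Cmp (DGA K) = Cmp C"
      "weq (DGA K) = W" "fib (DGA K) = F" "cof (DGA K) = {i \<in> Ar C. has_llp C i (W \<inter> F)}"
    unfolding D by (simp_all add: category.extend_def relcat.extend_def relcat.fields_def model.fields_def)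
  have "has_llp (DGA K) i P = has_llp C i P" for P
    unfolding has_llp_def Hom_def e(1-4) ..
  then show ?thesis unfolding e(1,5-7) by simp
qed

lemma acyclic_fibration_cong:
  assumes "dgalg_hom K A B f" "\<And>n x. x \<in> elts A n \<Longrightarrow> f n x = g n x"
  shows "acyclic_fibration A B f \<longleftrightarrow> acyclic_fibration A B g"
  using assms(2) by (simp add: acyclic_fibration_def cong: conj_cong)

text \<open>An infinite type contains a copy of the natural numbers and of its own square, hence codes for
  all finite trees labelled by its elements.\<close>

lemma encoding_exists:
  assumes "infinite (UNIV :: 'a set)"
  obtains enc :: "'a tm \<Rightarrow> 'a" where "inj enc"
proof -
  have "(card_of (UNIV \<times> UNIV :: ('a \<times> 'a) set), card_of (UNIV :: 'a set)) \<in> ordLeq"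
    using card_of_Times_same_infinite[OF assms] ordIso_imp_ordLeq by blast
  then obtain p :: "'a \<times> 'a \<Rightarrow> 'a" where p: "inj p" unfolding card_of_ordLeq[symmetric] by auto
  obtain e :: "nat \<Rightarrow> 'a" where e: "inj e" using infinite_countable_subset[OF assms] by blast
  have "inj (\<lambda>(n, ab). p (e n, p ab))"
    by (rule injI) (auto simp: inj_eq[OF p] inj_eq[OF e])
  then show ?thesis using that[OF inj_encode_tm] by blast
qed

locale dga_universe = char_zero_field K for K :: "'k ring" +
  fixes \<iota> :: "'k \<Rightarrow> 'a" and enc :: "'a tm \<Rightarrow> 'a"
  assumes inj_\<iota>: "inj_on \<iota> (carrier K)" and inj_enc: "inj enc"
begin

lemma enc_eq [simp]: "enc s = enc t \<longleftrightarrow> s = t"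
  using inj_enc by (simp add: inj_eq)

lemma DGA_factor:
  fixes X Y :: "('k, 'a) dga"
  assumes f: "f \<in> Hom (DGA K) X Y"
  shows "\<exists>Z. \<exists>i\<in>Hom (DGA K) X Z. \<exists>p\<in>Hom (DGA K) Z Y.
      i \<in> cof (DGA K) \<and> p \<in> weq (DGA K) \<and> p \<in> fib (DGA K) \<and> Cmp (DGA K) p i = f"
proof -
  interpret C: rel_category "DGA K :: (('k, 'a) dga, ('k, 'a) dga_arrow) model" by (rule DGA_category)
  interpret f: dgalg_hom K X Y "lab f" by (rule DGA_HomD(1)[OF f])
  interpret Q: free_extension K X Y "lab f" \<iota> enc by unfold_locales (fact inj_\<iota>, fact inj_enc)
  let ?i = "dga_arrow X Q.Q Q.incl" and ?p = "dga_arrow Q.Q Y Q.proj"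
  interpret i: dgalg_hom K X Q.Q Q.incl by (rule Q.incl_hom)
  have i: "?i \<in> Hom (DGA K) X Q.Q" and p: "?p \<in> Hom (DGA K) Q.Q Y"
    using dga_arrow_Hom Q.incl_hom Q.proj_hom by blast+
  have pa: "?p \<in> weq (DGA K) \<inter> fib (DGA K)"
    unfolding arrow_acyclic_iff[OF p]
    using Q.proj_acyclic_fibration acyclic_fibration_cong[OF Q.proj_hom, of "lab ?p"] by simp
  have "Cmp (DGA K) ?p ?i = f"
    by (rule arrow_eqI[OF C.Cmp_Hom[OF i p] f]) (simp add: DGA_Cmp_lab[OF i p] Q.proj_incl)
  moreover have "?i \<in> cof (DGA K)"
    unfolding cof_DGA has_llp_def
  proof (intro conjI ballI impI)
    show "?i \<in> Ar (DGA K)" using i by (simp add: Hom_def)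
    fix q u v assume q: "q \<in> weq (DGA K) \<inter> fib (DGA K)"
      and "u \<in> Hom (DGA K) (Dom (DGA K) ?i) (Dom (DGA K) q)" "v \<in> Hom (DGA K) (Cod (DGA K) ?i) (Cod (DGA K) q)"
      and eq: "Cmp (DGA K) q u = Cmp (DGA K) v ?i"
    then have u: "u \<in> Hom (DGA K) X (src q)" and v: "v \<in> Hom (DGA K) Q.Q (tgt q)" by (simp_all add: DGA_simps(3,4))
    have qH: "q \<in> Hom (DGA K) (src q) (tgt q)" using q by (auto simp: Hom_def DGA_simps(3,4,7))
    have e: "lab q n (lab u n a) = lab v n (Q.incl n a)" if "a \<in> elts X n" for n a
      using DGA_Cmp_lab[OF u qH that] DGA_Cmp_lab[OF i v that] that eq by simp
    obtain h where h: "dgalg_hom K Q.Q (src q) h" "\<forall>n. \<forall>a\<in>elts X n. h n (Q.incl n a) = lab u n a"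
      "\<forall>n. \<forall>x\<in>elts Q.Q n. lab q n (h n x) = lab v n x"
      using Q.incl_lifting[OF DGA_HomD(1)[OF qH] q[unfolded arrow_acyclic_iff[OF qH]] DGA_HomD(1)[OF u] DGA_HomD(1)[OF v] e]
      by blast
    note hH = dga_arrow_Hom[OF h(1)]
    have "Cmp (DGA K) (dga_arrow Q.Q (src q) h) ?i = u"
      by (rule arrow_eqI[OF C.Cmp_Hom[OF i hH] u]) (simp add: DGA_Cmp_lab[OF i hH] h(2))
    moreover have "Cmp (DGA K) q (dga_arrow Q.Q (src q) h) = v"
      by (rule arrow_eqI[OF C.Cmp_Hom[OF hH qH] v]) (simp add: DGA_Cmp_lab[OF hH qH] h(3))
    ultimately show "\<exists>h\<in>Hom (DGA K) (Cod (DGA K) ?i) (Dom (DGA K) q). Cmp (DGA K) h ?i = u \<and> Cmp (DGA K) q h = v"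
      using hH by (auto simp: DGA_simps(3,4))
  qed
  ultimately show ?thesis using i p pa by blast
qed

text \<open>The kernel pair is the fibre product of \<open>p\<close> with itself, with pairs coded as elements of the
  universe. The first projection is an acyclic fibration by base change. The second has the same
  composite with \<open>p\<close> and is a quasi-isomorphism by two-out-of-three.\<close>

lemma DGA_kernel_pair:
  fixes E B :: "('k, 'a) dga"
  assumes p: "p \<in> Hom (DGA K) E B" "p \<in> weq (DGA K)" "p \<in> fib (DGA K)"
  shows "\<exists>P. \<exists>a\<in>Hom (DGA K) P E. \<exists>b\<in>Hom (DGA K) P E. a \<in> weq (DGA K) \<and> b \<in> weq (DGA K) \<and>
      Cmp (DGA K) p a = Cmp (DGA K) p b \<and>
        (\<forall>Z. \<forall>u\<in>Hom (DGA K) Z E. \<forall>v\<in>Hom (DGA K) Z E. Cmp (DGA K) p u = Cmp (DGA K) p v \<longrightarrow>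
          (\<exists>!h. h \<in> Hom (DGA K) Z P \<and> Cmp (DGA K) a h = u \<and> Cmp (DGA K) b h = v))"
proof -
  interpret C: rel_category "DGA K :: (('k, 'a) dga, ('k, 'a) dga_arrow) model" by (rule DGA_category)
  interpret p: dgalg_hom K E B "lab p" by (rule DGA_HomD(1)[OF p(1)])
  interpret S: cospan K E E B "lab p" "lab p" ..
  define j where "j n z = enc (Ad (El (fst z)) (El (snd z)))" for n :: int and z
  interpret T: transported K S.FP j
    by unfold_locales (auto simp: S.FP_dga j_def inj_on_def)
  define a where "a n x = fst (T.unT n x)" for n x
  define b where "b n x = snd (T.unT n x)" for n x
  have ah: "dgalg_hom K T.T E a" and bh: "dgalg_hom K T.T E b"
    unfolding a_def b_def using dga_hom_comp[OF T.from_T S.FP_fst] dga_hom_comp[OF T.from_T S.FP_snd] by simp_all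
  interpret a: dgalg_hom K T.T E a by (rule ah)
  interpret b: dgalg_hom K T.T E b by (rule bh)
  have pab: "lab p n (a n x) = lab p n (b n x)" if "x \<in> elts T.T n" for n x
    using that by (auto simp: a_def b_def)
  have paf: "acyclic_fibration E B (lab p)" using arrow_acyclic_iff[OF p(1)] p(2,3) by blast
  have pq: "quasi_iso E B (lab p)" using p(2) weq_iff[OF p(1)] by simp
  have aq: "quasi_iso T.T E a"
  proof -
    have "acyclic_fibration T.T E a"
      unfolding acyclic_fibration_def
    proof (intro allI ballI impI)
      fix n c x assume c: "c \<in> elts T.T n" "bdry T.T n c = \<zero>\<^bsub>piece T.T (n - 1)\<^esub>"
        and x: "x \<in> elts E (n + 1)" "bdry E (n + 1) x = a n c"
      interpret uT: dgalg_hom K T.T S.FP T.unT by (rule T.from_T)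
      have "T.unT n c \<in> elts S.FP n" using uT.hom_closed[OF c(1)] .
      moreover have "bdry S.FP n (T.unT n c) = \<zero>\<^bsub>piece S.FP (n - 1)\<^esub>"
        using uT.hom_bdry[OF c(1), of "n - 1"] c(2) uT.hom_zero[of "n - 1"] by (simp del: T.T_simps S.FP_simps)
      ultimately obtain w where w: "w \<in> elts S.FP (n + 1)" "bdry S.FP (n + 1) w = T.unT n c" "fst w = x"
        using acyclic_fibrationD[OF S.FP_fst_acyclic_fibration[OF paf]] x unfolding a_def by blast
      have "bdry T.T (n + 1) (j (n + 1) w) = c" using w(1,2) T.to_from[OF c(1)] by simp
      moreover have "a (n + 1) (j (n + 1) w) = x" using T.unT[OF w(1)] w(3) by (simp add: a_def)
      ultimately show "\<exists>c'\<in>elts T.T (n + 1). bdry T.T (n + 1) c' = c \<and> a (n + 1) c' = x"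
        using w(1) by (intro bexI[of _ "j (n + 1) w"]) auto
    qed
    then show ?thesis unfolding a.acyclic_fibration_iff by blast
  qed
  have bq: "quasi_iso T.T E b"
  proof (rule quasi_iso_cancel[OF b.cplx_hom_axioms p.cplx_hom_axioms pq])
    have "quasi_iso T.T B (\<lambda>n x. lab p n (a n x))"
      by (rule quasi_iso_comp[OF a.cplx_hom_axioms p.cplx_hom_axioms aq pq])
    then show "quasi_iso T.T B (\<lambda>n x. lab p n (b n x))"
      using quasi_iso_cong[OF complex_hom_comp[OF a.cplx_hom_axioms p.cplx_hom_axioms]
          complex_hom_comp[OF b.cplx_hom_axioms p.cplx_hom_axioms] pab] by simp
  qed
  let ?a = "dga_arrow T.T E a" and ?b = "dga_arrow T.T E b"
  note aH = dga_arrow_Hom[OF ah] and bH = dga_arrow_Hom[OF bh]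
  have weq: "dga_arrow T.T E f \<in> weq (DGA K)" if f: "dgalg_hom K T.T E f" "quasi_iso T.T E f" for f
  proof -
    interpret f: dgalg_hom K T.T E f by fact
    interpret f': dgalg_hom K T.T E "lab (dga_arrow T.T E f)" by (rule DGA_HomD(1)[OF dga_arrow_Hom[OF f(1)]])
    show ?thesis unfolding weq_iff[OF dga_arrow_Hom[OF f(1)]]
      using quasi_iso_cong[OF f'.cplx_hom_axioms f.cplx_hom_axioms] f(2) by simp
  qed
  have univ: "\<exists>!h. h \<in> Hom (DGA K) Z T.T \<and> Cmp (DGA K) ?a h = u \<and> Cmp (DGA K) ?b h = v"
    if u: "u \<in> Hom (DGA K) Z E" and v: "v \<in> Hom (DGA K) Z E" and eq: "Cmp (DGA K) p u = Cmp (DGA K) p v" for Z u v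
  proof (rule ex_ex1I)
    interpret u: dgalg_hom K Z E "lab u" by (rule DGA_HomD(1)[OF u])
    interpret v: dgalg_hom K Z E "lab v" by (rule DGA_HomD(1)[OF v])
    have e: "lab p n (lab u n z) = lab p n (lab v n z)" if "z \<in> elts Z n" for n z
      using DGA_Cmp_lab[OF u p(1) that] DGA_Cmp_lab[OF v p(1) that] eq by simp
    note hh = dga_hom_comp[OF S.FP_universal[OF DGA_HomD(1)[OF u] DGA_HomD(1)[OF v] e] T.to_T]
    let ?h = "dga_arrow Z T.T (\<lambda>n z. j n (lab u n z, lab v n z))"
    have h: "?h \<in> Hom (DGA K) Z T.T" using dga_arrow_Hom[OF hh] .
    have m: "(lab u n z, lab v n z) \<in> elts S.FP n" if "z \<in> elts Z n" for n z using that e by simp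
    have "Cmp (DGA K) ?a ?h = u"
      by (rule arrow_eqI[OF C.Cmp_Hom[OF h aH] u]) (use m T.unT[OF m] in \<open>simp add: DGA_Cmp_lab[OF h aH] a_def\<close>)
    moreover have "Cmp (DGA K) ?b ?h = v"
      by (rule arrow_eqI[OF C.Cmp_Hom[OF h bH] v]) (use m T.unT[OF m] in \<open>simp add: DGA_Cmp_lab[OF h bH] b_def\<close>)
    ultimately show "\<exists>h. h \<in> Hom (DGA K) Z T.T \<and> Cmp (DGA K) ?a h = u \<and> Cmp (DGA K) ?b h = v" using h by blast
  next
    fix h h' assume *: "h \<in> Hom (DGA K) Z T.T \<and> Cmp (DGA K) ?a h = u \<and> Cmp (DGA K) ?b h = v"
      "h' \<in> Hom (DGA K) Z T.T \<and> Cmp (DGA K) ?a h' = u \<and> Cmp (DGA K) ?b h' = v"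
    show "h = h'"
    proof (rule arrow_eqI)
      show h: "h \<in> Hom (DGA K) Z T.T" "h' \<in> Hom (DGA K) Z T.T" using * by simp_all
      fix n z assume z: "z \<in> elts Z n"
      interpret h: dgalg_hom K Z T.T "lab h" by (rule DGA_HomD(1)[OF h(1)])
      interpret h': dgalg_hom K Z T.T "lab h'" by (rule DGA_HomD(1)[OF h(2)])
      have l: "lab h n z \<in> elts T.T n" "lab h' n z \<in> elts T.T n" using h.hom_closed[OF z] h'.hom_closed[OF z] .
      have "a n (lab h n z) = lab u n z" "a n (lab h' n z) = lab u n z"
        using DGA_Cmp_lab[OF h(1) aH z] DGA_Cmp_lab[OF h(2) aH z] l * by (simp_all del: T.T_simps)
      moreover have "b n (lab h n z) = lab v n z" "b n (lab h' n z) = lab v n z"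
        using DGA_Cmp_lab[OF h(1) bH z] DGA_Cmp_lab[OF h(2) bH z] l * by (simp_all del: T.T_simps)
      ultimately have "T.unT n (lab h n z) = T.unT n (lab h' n z)"
        unfolding a_def b_def by (simp add: prod_eq_iff del: T.T_simps)
      then have "j n (T.unT n (lab h n z)) = j n (T.unT n (lab h' n z))" by (rule arg_cong)
      then show "lab h n z = lab h' n z" unfolding T.to_from[OF l(1)] T.to_from[OF l(2)] .
    qed
  qed
  have "Cmp (DGA K) p ?a = Cmp (DGA K) p ?b"
    by (rule arrow_eqI[OF C.Cmp_Hom[OF aH p(1)] C.Cmp_Hom[OF bH p(1)]])
       (simp add: DGA_Cmp_lab[OF aH p(1)] DGA_Cmp_lab[OF bH p(1)] pab del: T.T_simps)
  then show ?thesis using aH bH weq[OF ah aq] weq[OF bh bq] univ by blast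
qed

lemma DGA_initial: "\<exists>I :: ('k, 'a) dga. initial_object (DGA K) I"
proof -
  interpret G: dgalg K "ground K" by unfold_locales (rule ground_dga[OF is_cring])
  interpret T: transported K "ground K" "\<lambda>n. \<iota>"
    by unfold_locales (use inj_\<iota> in \<open>auto simp: inj_on_def\<close>)
  have "initial_object (DGA K) T.T"
    unfolding initial_object_def
  proof (intro conjI ballI)
    show "T.T \<in> Ob (DGA K)" using T.T_dga by (simp add: DGA_simps(1))
    fix A :: "('k, 'a) dga" assume "A \<in> Ob (DGA K)"
    then interpret A: dgalg K A by unfold_locales (simp add: DGA_simps(1))
    show "\<exists>!f. f \<in> Hom (DGA K) T.T A"
    proof (rule ex_ex1I)
      show "\<exists>f. f \<in> Hom (DGA K) T.T A"
        using dga_arrow_Hom[OF dga_hom_comp[OF T.from_T A.from_ground]] by blast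
      fix f g assume f: "f \<in> Hom (DGA K) T.T A" and g: "g \<in> Hom (DGA K) T.T A"
      show "f = g"
      proof (rule arrow_eqI[OF f g])
        fix n x assume x: "x \<in> elts T.T n"
        interpret uT: dgalg_hom K T.T "ground K" T.unT by (rule T.from_T)
        have "lab f n (\<iota> (T.unT n x)) = lab g n (\<iota> (T.unT n x))"
          using A.hom_from_ground[OF dga_hom_comp[OF T.to_T DGA_HomD(1)[OF f]] uT.hom_closed[OF x]]
            A.hom_from_ground[OF dga_hom_comp[OF T.to_T DGA_HomD(1)[OF g]] uT.hom_closed[OF x]] by simp
        then show "lab f n x = lab g n x" using T.to_from[OF x] by simp
      qed
    qed
  qed
  then show ?thesis by blast
qed

lemma DGA_resolution_model: "resolution_model (DGA K :: (('k, 'a) dga, ('k, 'a) dga_arrow) model)"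
proof -
  interpret C: rel_category "DGA K :: (('k, 'a) dga, ('k, 'a) dga_arrow) model" by (rule DGA_category)
  have lab_Cmp: "quasi_iso X Z (lab (Cmp (DGA K) g f)) \<longleftrightarrow> quasi_iso X Z (\<lambda>n x. lab g n (lab f n x))"
    if f: "f \<in> Hom (DGA K) X Y" and g: "g \<in> Hom (DGA K) Y Z" for X Y Z :: "('k, 'a) dga" and f g
  proof -
    interpret f: dgalg_hom K X Y "lab f" by (rule DGA_HomD(1)[OF f])
    interpret g: dgalg_hom K Y Z "lab g" by (rule DGA_HomD(1)[OF g])
    interpret gf: dgalg_hom K X Z "lab (Cmp (DGA K) g f)" by (rule DGA_HomD(1)[OF C.Cmp_Hom[OF f g]])
    show ?thesis
      by (rule quasi_iso_cong[OF gf.cplx_hom_axioms complex_hom_comp[OF f.cplx_hom_axioms g.cplx_hom_axioms]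
         DGA_Cmp_lab[OF f g]])
  qed
  show ?thesis
  proof
    show "weq (DGA K) \<subseteq> Ar (DGA K)" by (auto simp: DGA_simps(7))
  next
    fix i :: "('k, 'a) dga_arrow"
    show "(i \<in> cof (DGA K)) = (i \<in> Ar (DGA K) \<and> has_llp (DGA K) i (weq (DGA K) \<inter> fib (DGA K)))" by (rule cof_DGA)
  next
    fix f g and X Y Z :: "('k, 'a) dga"
    assume f: "f \<in> Hom (DGA K) X Y" and g: "g \<in> Hom (DGA K) Y Z"
    interpret f: dgalg_hom K X Y "lab f" by (rule DGA_HomD(1)[OF f])
    interpret g: dgalg_hom K Y Z "lab g" by (rule DGA_HomD(1)[OF g])
    note w = weq_iff[OF f] weq_iff[OF g] weq_iff[OF C.Cmp_Hom[OF f g]] lab_Cmp[OF f g]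
    show "f \<in> weq (DGA K) \<Longrightarrow> g \<in> weq (DGA K) \<Longrightarrow> Cmp (DGA K) g f \<in> weq (DGA K)"
      unfolding w by (rule quasi_iso_comp[OF f.cplx_hom_axioms g.cplx_hom_axioms])
    show "g \<in> weq (DGA K) \<Longrightarrow> Cmp (DGA K) g f \<in> weq (DGA K) \<Longrightarrow> f \<in> weq (DGA K)"
      unfolding w by (rule quasi_iso_cancel[OF f.cplx_hom_axioms g.cplx_hom_axioms])
  qed (use DGA_factor DGA_kernel_pair DGA_initial in blast)+
qed

end

section \<open>Quasi-isomorphisms of cofibrant DG algebras\<close>

text \<open>Cofibrancy in the form of a lifting property against acyclic fibrations of algebras over the
  type of \<open>X\<close>. The next lemma extends it to all algebras that embed into this type degreewise.\<close>

definition lifts :: "'k ring \<Rightarrow> ('k, 'a) dga \<Rightarrow> bool" where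
  "lifts K X \<longleftrightarrow> (\<forall>(E :: ('k, 'a) dga) (Y :: ('k, 'a) dga) p v.
     dgalg_hom K E Y p \<longrightarrow> acyclic_fibration E Y p \<longrightarrow> dgalg_hom K X Y v \<longrightarrow>
       (\<exists>h. dgalg_hom K X E h \<and> (\<forall>n. \<forall>x\<in>elts X n. p n (h n x) = v n x)))"

lemma lifts_transported:
  fixes E :: "('k, 'b) dga" and X Y :: "('k, 'a) dga" and j :: "int \<Rightarrow> 'b \<Rightarrow> 'a"
  assumes X: "lifts K X" and j: "\<And>n. inj_on (j n) (elts E n)"
    and p: "dgalg_hom K E Y p" "acyclic_fibration E Y p" and v: "dgalg_hom K X Y v"
  shows "\<exists>h. dgalg_hom K X E h \<and> (\<forall>n. \<forall>x\<in>elts X n. p n (h n x) = v n x)"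
proof -
  interpret p: dgalg_hom K E Y p by fact
  interpret T: transported K E j by unfold_locales (rule j)
  interpret uT: dgalg_hom K T.T E T.unT by (rule T.from_T)
  have "acyclic_fibration T.T Y (\<lambda>n x. p n (T.unT n x))"
    unfolding acyclic_fibration_def
  proof (intro allI ballI impI)
    fix n c b assume c: "c \<in> elts T.T n" "bdry T.T n c = \<zero>\<^bsub>piece T.T (n - 1)\<^esub>"
      and b: "b \<in> elts Y (n + 1)" "bdry Y (n + 1) b = p n (T.unT n c)"
    have "bdry E n (T.unT n c) = \<zero>\<^bsub>piece E (n - 1)\<^esub>"
      using uT.hom_bdry[OF c(1), of "n - 1"] c(2) uT.hom_zero[of "n - 1"] by (simp del: T.T_simps)
    then obtain w where w: "w \<in> elts E (n + 1)" "bdry E (n + 1) w = T.unT n c" "p (n + 1) w = b"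
      using acyclic_fibrationD[OF p(2) uT.hom_closed[OF c(1)] b(1) _ b(2)] by blast
    have "bdry T.T (n + 1) (j (n + 1) w) = c" using w(1,2) T.to_from[OF c(1)] by simp
    then show "\<exists>c'\<in>elts T.T (n + 1). bdry T.T (n + 1) c' = c \<and> p (n + 1) (T.unT (n + 1) c') = b"
      using w(1,3) by (intro bexI[of _ "j (n + 1) w"]) auto
  qed
  then obtain h where h: "dgalg_hom K X T.T h" "\<And>n x. x \<in> elts X n \<Longrightarrow> p n (T.unT n (h n x)) = v n x"
    using X dga_hom_comp[OF T.from_T p(1)] v unfolding lifts_def by blast
  show ?thesis using dga_hom_comp[OF h(1) T.from_T] h(2) by blast
qed


primrec list_tm :: "'a list \<Rightarrow> 'a tm" where
  "list_tm [] = Zr"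
| "list_tm (x # xs) = Ad (El x) (list_tm xs)"

lemma inj_list_tm: "list_tm xs = list_tm ys \<Longrightarrow> xs = ys"
proof (induction xs arbitrary: ys)
  case Nil then show ?case by (cases ys) simp_all
next
  case (Cons x xs) then show ?case by (cases ys) auto
qed

text \<open>A polynomial is determined by the list of its coefficients, so path algebras can be coded in
  the type of their coefficients.\<close>

lemma (in polynomials) polynomials_inject:
  "\<exists>r :: ('k \<Rightarrow> 'a) \<Rightarrow> 'a list. inj_on r (elts R n)"
proof -
  define P where "P f xs \<longleftrightarrow> (\<forall>t\<in>carrier K. f t = psum n (length xs) (\<lambda>i. t [^]\<^bsub>K\<^esub> i) ((!) xs))" for f xs
  have ex: "\<exists>xs. P f xs" if f: "f \<in> elts R n" for f
  proof -
    obtain f' F where "PD n f f' F" using f by (auto simp: R_elts)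
    then obtain N c where c: "\<forall>t\<in>carrier K. f t = psum n N (\<lambda>i. t [^]\<^bsub>K\<^esub> i) c"
      using PD_coefficients by blast
    have "psum n N (\<lambda>i. t [^]\<^bsub>K\<^esub> i) c = psum n (length (map c [0..<N])) (\<lambda>i. t [^]\<^bsub>K\<^esub> i) ((!) (map c [0..<N]))" for t
      by (simp only: length_map length_upt diff_zero, rule psum_cong) simp_all
    then have "P f (map c [0..<N])" unfolding P_def using c by metis
    then show ?thesis by blast
  qed
  define r where "r f = (SOME xs. P f xs)" for f
  have r: "P f (r f)" if "f \<in> elts R n" for f unfolding r_def using someI_ex[OF ex[OF that]] .
  have "inj_on r (elts R n)"
  proof (rule inj_onI)
    fix f g assume f: "f \<in> elts R n" and g: "g \<in> elts R n" and e: "r f = r g"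
    show "f = g" by (rule R_eqI[OF f g]) (use r[OF f] r[OF g] e in \<open>simp add: P_def\<close>)
  qed
  then show ?thesis by blast
qed

context dga_universe begin

lemma cofibrant_lifts:
  fixes X :: "('k, 'a) dga"
  assumes X: "cofibrant (DGA K) X" shows "lifts K X"
  unfolding lifts_def
proof (intro allI impI)
  fix E Y :: "('k, 'a) dga" and p v
  assume p: "dgalg_hom K E Y p" "acyclic_fibration E Y p" and v: "dgalg_hom K X Y v"
  interpret M: resolution_model "DGA K :: (('k, 'a) dga, ('k, 'a) dga_arrow) model" by (rule DGA_resolution_model)
  note pH = dga_arrow_Hom[OF p(1)] and vH = dga_arrow_Hom[OF v]
  have "dga_arrow E Y p \<in> weq (DGA K) \<inter> fib (DGA K)"
    unfolding arrow_acyclic_iff[OF pH] using p acyclic_fibration_cong[OF p(1), of "lab (dga_arrow E Y p)"] by simp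
  then obtain h where h: "h \<in> Hom (DGA K) X E" "Cmp (DGA K) (dga_arrow E Y p) h = dga_arrow X Y v"
    using M.cofibrant_lift[OF X _ pH vH] by blast
  interpret h: dgalg_hom K X E "lab h" by (rule DGA_HomD(1)[OF h(1)])
  have "p n (lab h n x) = v n x" if "x \<in> elts X n" for n x
    using DGA_Cmp_lab[OF h(1) pH that] h(2) that by simp
  then show "\<exists>h. dgalg_hom K X E h \<and> (\<forall>n. \<forall>x\<in>elts X n. p n (h n x) = v n x)"
    using h.dgalg_hom_axioms by blast
qed

text \<open>The fibre product of \<open>w\<close> and the evaluation at zero consists of elements of \<open>A\<close> with a path in
  \<open>B\<close> that starts at their image. The endpoint of the path defines an acyclic fibration \<open>\<pi>\<close> to \<open>B\<close>:
  it is surjective, and on homology it agrees with \<open>w\<close> after the projection to \<open>A\<close>. A section of \<open>\<pi>\<close>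
  exists because \<open>B\<close> is cofibrant; its components are the right inverse \<open>g\<close> and the homotopy.\<close>

lemma right_homotopy_inverse:
  fixes A B :: "('k, 'a) dga"
  assumes w: "dgalg_hom K A B w" "quasi_iso A B w" and B: "lifts K B"
  shows "\<exists>g. dgalg_hom K B A g \<and> homologous B B (\<lambda>n y. w n (g n y)) (\<lambda>n y. y) \<and>
    homologous (natural K B) (natural K B) (\<lambda>n y. nmap K A B w n (nmap K B A g n y)) (\<lambda>n y. y)"
proof -
  interpret w: dgalg_hom K A B w by fact
  interpret P: polynomials K B ..
  have z: "\<zero>\<^bsub>K\<^esub> \<in> carrier K" and o: "\<one>\<^bsub>K\<^esub> \<in> carrier K" by simp_all
  interpret e0: dgalg_hom K P.W.E B "\<lambda>n u. fst u \<zero>\<^bsub>K\<^esub>" by (rule P.evaluation[OF z])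
  interpret e1: dgalg_hom K P.W.E B "\<lambda>n u. fst u \<one>\<^bsub>K\<^esub>" by (rule P.evaluation[OF o])
  interpret S: cospan K A P.W.E B w "\<lambda>n u. fst u \<zero>\<^bsub>K\<^esub>" ..
  interpret a: dgalg_hom K S.FP A "\<lambda>n. fst" by (rule S.FP_fst)
  interpret b: dgalg_hom K S.FP P.W.E "\<lambda>n. snd" by (rule S.FP_snd)
  define \<pi> where "\<pi> n u = fst (snd u) \<one>\<^bsub>K\<^esub>" for n :: int and u :: "'a \<times> ('k \<Rightarrow> 'a) \<times> ('k \<Rightarrow> 'a)"
  have \<pi>: "dgalg_hom K S.FP B \<pi>"
    using dga_hom_comp[OF S.FP_snd P.evaluation[OF o]] by (simp add: \<pi>_def[abs_def])
  interpret \<pi>: dgalg_hom K S.FP B \<pi> by (rule \<pi>)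
  interpret wa: cplx_hom K S.FP B "\<lambda>n u. w n (fst u)"
    by (rule complex_hom_comp[OF a.cplx_hom_axioms w.cplx_hom_axioms])
  have "quasi_iso S.FP A (\<lambda>n. fst)"
    using S.FP_fst_acyclic_fibration[OF P.evaluation_acyclic_fibration] unfolding a.acyclic_fibration_iff by blast
  then have wq: "quasi_iso S.FP B (\<lambda>n u. w n (fst u))"
    using quasi_iso_comp[OF a.cplx_hom_axioms w.cplx_hom_axioms _ w(2)] by simp
  have "homologous S.FP B (\<lambda>n u. w n (fst u)) \<pi>"
    unfolding homologous_def
  proof (intro allI ballI impI)
    fix n u assume u: "u \<in> elts S.FP n" "bdry S.FP n u = \<zero>\<^bsub>piece S.FP (n - 1)\<^esub>"
    have "fst (snd u) \<zero>\<^bsub>K\<^esub> \<ominus>\<^bsub>piece B n\<^esub> fst (snd u) \<one>\<^bsub>K\<^esub> \<in> boundaries B n"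
      using P.evaluations_homologous u unfolding homologous_def S.FP_simps by blast
    then show "w n (fst u) \<ominus>\<^bsub>piece B n\<^esub> \<pi> n u \<in> boundaries B n" using u(1) by (simp add: \<pi>_def)
  qed
  then have "quasi_iso S.FP B \<pi>"
    using wa.quasi_iso_homologous[OF \<pi>.cplx_hom_axioms wq] by simp
  moreover have "\<pi> n ` elts S.FP n = elts B n" for n
  proof (intro equalityI subsetI)
    fix y assume y: "y \<in> elts B n"
    \<comment> \<open>the path \<open>t y\<close> leads from zero to \<open>y\<close>\<close>
    let ?f = "P.pmono n 1 \<one>\<^bsub>K\<^esub> y" and ?g = "P.pconst \<zero>\<^bsub>piece B (n + 1)\<^esub>"
    have "?f \<in> elts P.R n" using P.PD.mono[OF y, of 1] by (auto simp: P.R_elts)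
    then have m: "(\<zero>\<^bsub>piece A n\<^esub>, ?f, ?g) \<in> elts S.FP n"
      using y by (simp add: P.R_closed P.pmono_def)
    have e: "\<pi> n (\<zero>\<^bsub>piece A n\<^esub>, ?f, ?g) = y" using y by (simp add: \<pi>_def P.pmono_def)
    show "y \<in> \<pi> n ` elts S.FP n" using imageI[OF m, of "\<pi> n"] unfolding e .
  qed (use \<pi>.hom_closed in blast)
  ultimately have af: "acyclic_fibration S.FP B \<pi>" unfolding \<pi>.acyclic_fibration_iff by blast
  have "\<forall>n. \<exists>r :: ('k \<Rightarrow> 'a) \<Rightarrow> 'a list. inj_on r (elts P.R n)" using P.polynomials_inject by blast
  then obtain r :: "int \<Rightarrow> ('k \<Rightarrow> 'a) \<Rightarrow> 'a list" where r: "\<And>n. inj_on (r n) (elts P.R n)" by metis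
  define j where "j n u = enc (Ad (El (fst u)) (Ad (list_tm (r n (fst (snd u)))) (list_tm (r (n + 1) (snd (snd u))))))"
    for n and u :: "'a \<times> ('k \<Rightarrow> 'a) \<times> ('k \<Rightarrow> 'a)"
  have j: "inj_on (j n) (elts S.FP n)" for n
  proof (rule inj_onI)
    fix u v assume "u \<in> elts S.FP n" "v \<in> elts S.FP n" "j n u = j n v"
    then have "fst u = fst v" "fst (snd u) = fst (snd v)" "snd (snd u) = snd (snd v)"
      using inj_onD[OF r[of n]] inj_onD[OF r[of "n + 1"]] by (auto simp: j_def dest!: inj_list_tm)
    then show "u = v" by (simp add: prod_eq_iff)
  qed
  have idB: "dgalg_hom K B B (\<lambda>n y. y)" using dga_hom_id w.B.is_dga by (auto simp: dga_hom_iff)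
  obtain s where s: "dgalg_hom K B S.FP s" "\<And>n y. y \<in> elts B n \<Longrightarrow> \<pi> n (s n y) = y"
    using lifts_transported[OF B j \<pi> af idB] by blast
  interpret s: dgalg_hom K B S.FP s by (rule s(1))
  define g where "g n y = fst (s n y)" for n y
  define H where "H n y = snd (s n y)" for n y
  have g: "dgalg_hom K B A g" and H: "dgalg_hom K B P.W.E H"
    using dga_hom_comp[OF s(1) S.FP_fst] dga_hom_comp[OF s(1) S.FP_snd] by (simp_all add: g_def[abs_def] H_def[abs_def])
  interpret H: dgalg_hom K B P.W.E H by (rule H)
  have H0: "fst (H n y) \<zero>\<^bsub>K\<^esub> = w n (g n y)" and H1: "fst (H n y) \<one>\<^bsub>K\<^esub> = y" if "y \<in> elts B n" for n y
    using s.hom_closed[OF that] s(2)[OF that] by (simp_all add: g_def H_def \<pi>_def)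
  have "homologous B B (\<lambda>n y. w n (g n y)) (\<lambda>n y. y)"
    unfolding homologous_def
  proof (intro allI ballI impI)
    fix n y assume y: "y \<in> elts B n" "bdry B n y = \<zero>\<^bsub>piece B (n - 1)\<^esub>"
    then have "H n y \<in> elts P.W.E n" "bdry P.W.E n (H n y) = \<zero>\<^bsub>piece P.W.E (n - 1)\<^esub>"
      using H.hom_cycle[of y n] by blast+
    then have "fst (H n y) \<zero>\<^bsub>K\<^esub> \<ominus>\<^bsub>piece B n\<^esub> fst (H n y) \<one>\<^bsub>K\<^esub> \<in> boundaries B n"
      using P.evaluations_homologous unfolding homologous_def by blast
    then show "w n (g n y) \<ominus>\<^bsub>piece B n\<^esub> y \<in> boundaries B n" unfolding H0[OF y(1)] H1[OF y(1)] .
  qed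
  moreover have "homologous (natural K B) (natural K B) (\<lambda>n y. nmap K A B w n (nmap K B A g n y)) (\<lambda>n y. y)"
  proof -
    have H0': "nmap K B B (\<lambda>n y. fst (H n y) \<zero>\<^bsub>K\<^esub>) = nmap K B B (\<lambda>n y. w n (g n y))"
      by (rule nmap_cong[OF w.B.dgalg_axioms H0])
    have H1': "nmap K B B (\<lambda>n y. fst (H n y) \<one>\<^bsub>K\<^esub>) = nmap K B B (\<lambda>n y. y)"
      by (rule nmap_cong[OF w.B.dgalg_axioms H1])
    show ?thesis
      unfolding homologous_def
    proof (intro allI ballI impI)
      fix n y assume y: "y \<in> elts (natural K B) n" "bdry (natural K B) n y = \<zero>\<^bsub>piece (natural K B) (n - 1)\<^esub>"
      have "nmap K B B (\<lambda>n y. w n (g n y)) n y \<ominus>\<^bsub>piece (natural K B) n\<^esub> nmap K B B (\<lambda>n y. y) n y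
          \<in> boundaries (natural K B) n"
        using P.homotopy_natural[OF H] y unfolding homologous_def H0' H1' by blast
      then show "nmap K A B w n (nmap K B A g n y) \<ominus>\<^bsub>piece (natural K B) n\<^esub> y \<in> boundaries (natural K B) n"
        unfolding nmap_comp[OF g w(1) y(1)] nmap_id[OF w.B.dgalg_axioms y(1)] .
    qed
  qed
  ultimately show ?thesis using g by blast
qed

text \<open>Apply the preceding lemma to \<open>w\<close>, and again to the right inverse \<open>g\<close> of \<open>w\<close> so obtained, which
  is a quasi-isomorphism because \<open>w\<close> is.\<close>

lemma natural_quasi_iso:
  fixes A B :: "('k, 'a) dga"
  assumes w: "dgalg_hom K A B w" "quasi_iso A B w" and A: "lifts K A" and B: "lifts K B"
  shows "quasi_iso (natural K A) (natural K B) (nmap K A B w)"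
proof -
  interpret w: dgalg_hom K A B w by fact
  obtain g where g: "dgalg_hom K B A g" "homologous B B (\<lambda>n y. w n (g n y)) (\<lambda>n y. y)"
    "homologous (natural K B) (natural K B) (\<lambda>n y. nmap K A B w n (nmap K B A g n y)) (\<lambda>n y. y)"
    using right_homotopy_inverse[OF w B] by blast
  interpret g: dgalg_hom K B A g by (rule g(1))
  have id: "cplx_hom K B B (\<lambda>n y. y)"
    by unfold_locales (simp add: complex_hom_id w.B.is_complex)
  interpret wg: cplx_hom K B B "\<lambda>n y. w n (g n y)"
    by (rule complex_hom_comp[OF g.cplx_hom_axioms w.cplx_hom_axioms])
  have "homologous B B (\<lambda>n y. y) (\<lambda>n y. w n (g n y))"
    unfolding homologous_def
  proof (intro allI ballI impI)
    fix n y assume y: "y \<in> elts B n" "bdry B n y = \<zero>\<^bsub>piece B (n - 1)\<^esub>"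
    have "w n (g n y) \<ominus>\<^bsub>piece B n\<^esub> y \<in> boundaries B n" using g(2) y unfolding homologous_def by blast
    then show "y \<ominus>\<^bsub>piece B n\<^esub> w n (g n y) \<in> boundaries B n"
      using w.B.boundaries_sym[OF wg.hom_closed[OF y(1)] y(1)] by blast
  qed
  moreover have "quasi_iso B B (\<lambda>n y. y)"
  proof (rule cplx_hom.quasi_isoI[OF id])
    fix n y assume "w.B.cycle n y"
    moreover from this have "y \<ominus>\<^bsub>piece B n\<^esub> y \<in> boundaries B n"
      using w.B.P.minus_self[of y n] w.B.boundaries_zero[of n] by simp
    ultimately show "\<exists>x. w.B.cycle n x \<and> x \<ominus>\<^bsub>piece B n\<^esub> y \<in> boundaries B n" by blast
  qed
  ultimately have "quasi_iso B B (\<lambda>n y. w n (g n y))"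
    using cplx_hom.quasi_iso_homologous[OF id wg.cplx_hom_axioms] by blast
  then have "quasi_iso B A g"
    by (rule quasi_iso_cancel[OF g.cplx_hom_axioms w.cplx_hom_axioms w(2)])
  then obtain h where h: "dgalg_hom K A B h"
    "homologous (natural K A) (natural K A) (\<lambda>n y. nmap K B A g n (nmap K A B h n y)) (\<lambda>n y. y)"
    using right_homotopy_inverse[OF g(1) _ A] by blast
  show ?thesis
    using quasi_iso_from_inverses[OF w.nmap_hom g.nmap_hom dgalg_hom.nmap_hom[OF h(1)] g(3) h(2)] .
qed

end

theorem theorem3p2:
  fixes K :: "'k ring"
    and DGA_k :: "(('k, 'a) dga, ('k, 'a) dga_arrow) model"
  assumes "field K"
    and char_zero: "\<And>n::nat. n > 0 \<Longrightarrow> [n] \<cdot>\<^bsub>K\<^esub> \<one>\<^bsub>K\<^esub> \<noteq> \<zero>\<^bsub>K\<^esub>"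
    and universe: "infinite (UNIV :: 'a set)" "carrier K \<lesssim> (UNIV :: 'a set)"
    and DGA_k: "DGA_k = DGA K"
  shows "\<exists>LC t.
    total_left_derived (Mor DGA_k) (Com K) (cone_functor K) LC t \<and>
    (\<forall>f \<in> Ar DGA_k.
      (\<exists>p. cofibrant_resolution DGA_k (Dom DGA_k f) p) \<and>
      (\<forall>p. cofibrant_resolution DGA_k (Dom DGA_k f) p \<longrightarrow>
        (\<exists>q. cofibrant_resolution (under_model DGA_k (Dom DGA_k p)) (Cmp DGA_k f p) q) \<and>
        (\<forall>q. cofibrant_resolution (under_model DGA_k (Dom DGA_k p)) (Cmp DGA_k f p) q \<longrightarrow>
          (\<exists>\<phi> \<in> Hom (Ho (Com K)) (FOb LC f) (natural_cone K (src q)).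
            is_isomorphism (Ho (Com K)) \<phi> \<and>
            Cmp (Ho (Com K)) \<phi>
              (FAr LC (FAr (loc (Mor DGA_k)) \<lparr>src = src q, lab = (p, lab q), tgt = f\<rparr>))
              = t (src q)))))"
proof -
  obtain enc :: "'a tm \<Rightarrow> 'a" where enc: "inj enc" using encoding_exists[OF universe(1)] .
  obtain \<iota> :: "'k \<Rightarrow> 'a" where \<iota>: "inj_on \<iota> (carrier K)" using universe(2) unfolding lepoll_def by blast
  interpret field K by fact
  interpret U: dga_universe K \<iota> enc by unfold_locales (fact char_zero, fact \<iota>, fact enc)
  interpret M: resolution_model "DGA K :: (('k, 'a) dga, ('k, 'a) dga_arrow) model" by (rule U.DGA_resolution_model)
  have "FAr (cone_functor K) w \<in> weq (Com K)"
    if w: "w \<in> Hom (Mor (DGA K)) i j" "w \<in> weq (Mor (DGA K))" and ij: "i \<in> M.Mor_cofs" "j \<in> M.Mor_cofs"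
    for w and i j :: "('k, 'a) dga_arrow"
  proof (rule cone_functor_weq[OF w(1)])
    obtain a b where ab: "w = square i a b j" "a \<in> Hom (DGA K) (src i) (src j)" "b \<in> Hom (DGA K) (tgt i) (tgt j)"
      using w(1) unfolding Mor_Hom by (auto simp: DGA_simps(3,4))
    have weq: "a \<in> weq (DGA K)" "b \<in> weq (DGA K)" using Mor_weq w ab(1) by metis+
    have cof: "lifts K (src u)" "lifts K (tgt u)" if "u \<in> M.Mor_cofs" for u :: "('k, 'a) dga_arrow"
      using that M.cofibrant_cod[of "src u" u "tgt u"] U.cofibrant_lifts
      by (auto simp: M.Mor_cofs_def Hom_def DGA_simps(3,4))
    show "quasi_iso (natural K (src i)) (natural K (src j)) (natural_map K (fst (lab w)))"
      using U.natural_quasi_iso[OF DGA_HomD(1)[OF ab(2)] _ cof(1)[OF ij(1)] cof(1)[OF ij(2)]] weq(1) weq_iff[OF ab(2)]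
        DGA_HomD(2,3)[OF ab(2)] by (simp add: ab(1) natural_map_nmap)
    show "quasi_iso (natural K (tgt i)) (natural K (tgt j)) (natural_map K (snd (lab w)))"
      using U.natural_quasi_iso[OF DGA_HomD(1)[OF ab(3)] _ cof(2)[OF ij(1)] cof(2)[OF ij(2)]] weq(2) weq_iff[OF ab(3)]
        DGA_HomD(2,3)[OF ab(3)] by (simp add: ab(1) natural_map_nmap)
  qed
  from M.derived_on_arrows[OF Com_category cone_functor this]
  show ?thesis unfolding DGA_k cone_functor_Ob .
qed

end
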